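(* Assume: (1) $k(x,x)\le\kappa^2$ for all $x\in X$; (2) $dq_X=\beta\,dp_X$ with $\beta:X\to[0,\infty)$ and $\beta(x)\le b$ for all $x\in X$, for some constant $b>0$; (3) there is $M'>0$ with $\|y\|_Y\le M'$ for $p$-almost every $(x,y)$; (4) (general source condition) $f^*=C_*\phi(\cdot)$ with $C_*=C_o\,\varphi(C_X)$ for some $C_o\in\mathcal S_2(\mathcal H,Y)$ and an index function $\varphi$; (5) $C_X$ has strictly positive eigenvalues $(\mu_i)_{i\in\mathbb N}$ whose eigenfunctions $(f_i)_{i\in\mathbb N}$ form an orthonormal basis of $\mathcal H$, and for some $\mathbf b>1$ one has $i^{-\mathbf b}\lesssim\mu_i\lesssim i^{-\mathbf b}$ for all $i\in\mathbb N$ (inequalities up to positive constants not depending on $i$). Let $\delta\in(0,1)$, let $\Psi(t)=t^{\frac12+\frac1{2\mathbf b}}\varphi(t)$, and assume that $\lambda\in(0,1]$ satisfies $\lambda=\Psi^{-1}(n^{-1/2})$. (i) If the qualification $\nu$ of the regularization family covers the index function $\varphi$, then with probability at least $1-\delta$, $$\big\|f^*-\widehat f_{\mathbf z,\lambda}\big\|_{\mathcal G}\le c_1\,\varphi\big(\Psi^{-1}(n^{-1/2})\big)\log\left(\frac2\delta\right),$$ for some positive constant $c_1$. (ii) If the qualification $\nu$ of the regularization family covers the index function $t\mapsto\varphi(t)\sqrt t$, then with probability at least $1-\delta$, $$\big\|f^*-\widehat f_{\mathbf z,\lambda}\big\|_{L_2(q_X,Y)}\le c_2\,\big(\Psi^{-1}(n^{-1/2})\big)^{1/2}\varphi\big(\Psi^{-1}(n^{-1/2})\big)\log\left(\frac2\delta\right),$$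 for some positive constant $c_2$.
   Context: Spaces. $X$ is a second-countable locally compact Hausdorff space and $Y$ an infinite-dimensional real separable Hilbert space. $k:X\times X\to\mathbb R$ is the reproducing kernel of a scalar RKHS $\mathcal H$, with feature map $\phi(x)=k(x,\cdot)\in\mathcal H$. $\mathcal S_2(\mathcal H,Y)$ is the space of Hilbert–Schmidt operators $\mathcal H\to Y$; $a\otimes a'$ denotes the operator $v\mapsto\langle v,a'\rangle a$. (Note: $\phi$ is the feature map, $\varphi$ an index function.) $\mathcal G$ is the vector-valued RKHS of functions $X\to Y$ with operator-valued kernel $K(x,t)=k(x,t)\,Id_Y$; equivalently $\mathcal G=\{C\phi(\cdot):C\in\mathcal S_2(\mathcal H,Y)\}$ with $\|C\phi(\cdot)\|_{\mathcal G}=\|C\|_{\mathcal S_2(\mathcal H,Y)}$. Data (covariate shift). $p$ and $q$ are probability distributions on $X\times Y$ with the same conditional distribution $p(y|x)$ and marginals $p_X,q_X$ on $X$, i.e. $p(x,y)=p(y|x)p_X(x)$, $q(x,y)=p(y|x)q_X(x)$. The common regression function is $f^*(x)=\int_Y y\,dp(y|x)$. The sample $\mathbf z=\{(x_i,y_i)\}_{i=1}^n$ is i.i.d. from $p$; probabilities refer to this sample. The weight function $\beta=dq_X/dp_X$ is known exactly. $L_2(q_X,Y)$ is the Bochner space of $q_X$-square-integrable $Y$-valued functions. Operators. $C_X=\mathbb E_{x\sim q_X}[\phi(x)\otimes\phi(x)]=\mathbb E_{x\sim p_X}[\beta(x)\,\phi(x)\otimes\phi(x)]$ on $\mathcal H$;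 $\widehat C_X^\beta=\frac1n\sum_{i=1}^n\beta(x_i)\phi(x_i)\otimes\phi(x_i)$; $\widehat C_{YX}^\beta=\frac1n\sum_{i=1}^n\beta(x_i)\,y_i\otimes\phi(x_i)$. Regularization family. A family of functions $g_\lambda:[0,s]\to\mathbb R$, $0<\lambda\le s$ (with $[0,s]$ containing the spectrum of $\widehat C_X^\beta$, so that $g_\lambda(\widehat C_X^\beta)$ is defined by functional calculus), with constants $B,D,\gamma>0$ such that $\sup_{\sigma\in(0,s]}|\sigma g_\lambda(\sigma)|\le D$, $\sup_{\sigma\in(0,s]}|g_\lambda(\sigma)|\le B/\lambda$, $\sup_{\sigma\in(0,s]}|1-\sigma g_\lambda(\sigma)|\le\gamma$. Its qualification is the largest $\nu>0$ for which $\sup_{\sigma\in(0,s]}|1-\sigma g_\lambda(\sigma)|\sigma^\nu\le\gamma_\nu\lambda^\nu$ with $\gamma_\nu$ independent of $\lambda$. Index function: a continuous strictly increasing $\varphi:[0,\infty)\to[0,\infty)$ with $\varphi(0)=0$. The qualification $\nu$ covers an index function $\psi$ if there is $c>0$ with $c\,\frac{t^\nu}{\psi(t)}\le\inf_{t\le\sigma\le s}\frac{\sigma^\nu}{\psi(\sigma)}$ for all $0<t\le s$. Estimator: $\widehat f_{\mathbf z,\lambda}(x)=\widehat C_\lambda^\beta\phi(x)$ with $\widehat C_\lambda^\beta=\widehat C_{YX}^\beta\,g_\lambda(\widehat C_X^\beta)$. *)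

theory Defs
  imports "HOL-Probability.Probability"
begin

text \<open>
  A reproducing kernel Hilbert space is given by a Hilbert space type together with its evaluation
  map \<open>evl\<close>: injectivity of \<open>evl\<close> identifies the elements of the type with functions on \<open>'x\<close>.
\<close>

definition scalar_rkhs ::
  "('x \<Rightarrow> 'x \<Rightarrow> real) \<Rightarrow> ('h::{real_inner, banach} \<Rightarrow> 'x \<Rightarrow> real) \<Rightarrow> ('x \<Rightarrow> 'h) \<Rightarrow> bool" where
  "scalar_rkhs k evl feat \<longleftrightarrow>
     (\<forall>x. linear (\<lambda>f. evl f x)) \<and> inj evl \<and>
     (\<forall>x. evl (feat x) = k x) \<and>
     (\<forall>f x. evl f x = f \<bullet> feat x)"

definition vector_rkhs ::
  "('x \<Rightarrow> 'x \<Rightarrow> 'y::real_inner \<Rightarrow> 'y) \<Rightarrow> ('g::{real_inner, banach} \<Rightarrow> 'x \<Rightarrow> 'y) \<Rightarrow> bool" where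
  "vector_rkhs K evl \<longleftrightarrow>
     (\<forall>x. linear (\<lambda>f. evl f x)) \<and> inj evl \<and>
     (\<forall>x y. \<exists>Kxy. (\<forall>t. evl Kxy t = K t x y) \<and> (\<forall>f. evl f x \<bullet> y = f \<bullet> Kxy))"

text \<open>Only meaningful for \<open>f \<in> range evl\<close>.\<close>

definition rkhs_norm :: "('g::real_normed_vector \<Rightarrow> 'x \<Rightarrow> 'y) \<Rightarrow> ('x \<Rightarrow> 'y) \<Rightarrow> real" where
  "rkhs_norm evl f = norm (the_inv evl f)"

definition L2_functions :: "'x measure \<Rightarrow> ('x \<Rightarrow> 'y::real_normed_vector) set" where
  "L2_functions M = {f. f \<in> borel_measurable M \<and> integrable M (\<lambda>x. (norm (f x))\<^sup>2)}"

definition L2_norm :: "'x measure \<Rightarrow> ('x \<Rightarrow> 'y::real_normed_vector) \<Rightarrow> real" where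
  "L2_norm M f = sqrt (\<integral>x. (norm (f x))\<^sup>2 \<partial>M)"

definition orthonormal_basis :: "'h::real_inner set \<Rightarrow> bool" where
  "orthonormal_basis E \<longleftrightarrow>
     (\<forall>e\<in>E. norm e = 1) \<and> pairwise orthogonal E \<and> closure (span E) = UNIV"

definition hilbert_schmidt :: "('h::real_inner \<Rightarrow> 'y::real_inner) \<Rightarrow> bool" where
  "hilbert_schmidt A \<longleftrightarrow>
     bounded_linear A \<and> (\<exists>E. orthonormal_basis E \<and> (\<lambda>e. (norm (A e))\<^sup>2) summable_on E)"

definition tensor_op :: "'y::real_vector \<Rightarrow> 'h::real_inner \<Rightarrow> 'h \<Rightarrow> 'y" where
  "tensor_op a a' = (\<lambda>v. (v \<bullet> a') *\<^sub>R a)"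

definition spectrum :: "('h::real_normed_vector \<Rightarrow> 'h) \<Rightarrow> real set" where
  "spectrum A = {\<sigma>. \<not> (\<exists>R. bounded_linear R \<and>
     (\<forall>v. R (A v - \<sigma> *\<^sub>R v) = v) \<and> (\<forall>v. A (R v) - \<sigma> *\<^sub>R R v = v))}"

definition eigenspace :: "('h::real_vector \<Rightarrow> 'h) \<Rightarrow> real \<Rightarrow> 'h set" where
  "eigenspace A \<sigma> = {v. A v = \<sigma> *\<^sub>R v}"

definition orth_proj :: "'h::real_inner set \<Rightarrow> 'h \<Rightarrow> 'h" where
  "orth_proj S v = (THE p. p \<in> S \<and> (\<forall>w\<in>S. orthogonal (v - p) w))"

text \<open>
  Functional calculus through the spectral resolution \<open>g(A) = \<Sum>\<^sub>\<sigma> g(\<sigma>) P\<^sub>\<sigma>\<close>, where \<open>\<sigma>\<close> runs over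
  the eigenvalues (including \<open>0\<close>, if it is one) and \<open>P\<^sub>\<sigma>\<close> is the orthogonal projection onto the
  eigenspace. This is the functional calculus for compact self-adjoint operators, which is the only
  case needed: covariance operators and their (finite-rank) empirical versions.
\<close>

definition fun_calc :: "(real \<Rightarrow> real) \<Rightarrow> ('h::real_inner \<Rightarrow> 'h) \<Rightarrow> 'h \<Rightarrow> 'h" where
  "fun_calc g A v = (\<Sum>\<^sub>\<infinity>\<sigma>\<in>{\<sigma>. eigenspace A \<sigma> \<noteq> {0}}. g \<sigma> *\<^sub>R orth_proj (eigenspace A \<sigma>) v)"

definition joint_law ::
  "'x::topological_space measure \<Rightarrow> ('x \<Rightarrow> 'y::topological_space measure) \<Rightarrow> ('x \<times> 'y) measure" where
  "joint_law M P = M \<bind> (\<lambda>x. P x \<bind> (\<lambda>y. return (borel \<Otimes>\<^sub>M borel) (x, y)))"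

definition regression_fun ::
  "('x \<Rightarrow> 'y measure) \<Rightarrow> 'x \<Rightarrow> 'y::{banach, second_countable_topology}" where
  "regression_fun P x = (\<integral>y. y \<partial>P x)"

text \<open>
  The expectation of \<open>\<phi>(x) \<otimes> \<phi>(x)\<close> is taken pointwise, as a Bochner integral in the Hilbert space.
\<close>

definition cov_op ::
  "'x measure \<Rightarrow> ('x \<Rightarrow> 'h) \<Rightarrow> 'h \<Rightarrow> 'h::{real_inner, banach, second_countable_topology}" where
  "cov_op M feat v = (\<integral>x. tensor_op (feat x) (feat x) v \<partial>M)"

definition emp_cov ::
  "('x \<Rightarrow> real) \<Rightarrow> ('x \<Rightarrow> 'h::real_inner) \<Rightarrow> nat \<Rightarrow> (nat \<Rightarrow> 'x \<times> 'y) \<Rightarrow> 'h \<Rightarrow> 'h" where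
  "emp_cov \<beta> feat n z v = (1 / real n) *\<^sub>R
     (\<Sum>i<n. \<beta> (fst (z i)) *\<^sub>R tensor_op (feat (fst (z i))) (feat (fst (z i))) v)"

definition emp_cross_cov ::
  "('x \<Rightarrow> real) \<Rightarrow> ('x \<Rightarrow> 'h::real_inner) \<Rightarrow> nat \<Rightarrow> (nat \<Rightarrow> 'x \<times> 'y::real_vector) \<Rightarrow> 'h \<Rightarrow> 'y" where
  "emp_cross_cov \<beta> feat n z v = (1 / real n) *\<^sub>R
     (\<Sum>i<n. \<beta> (fst (z i)) *\<^sub>R tensor_op (snd (z i)) (feat (fst (z i))) v)"

definition estimator ::
  "('x \<Rightarrow> real) \<Rightarrow> ('x \<Rightarrow> 'h::real_inner) \<Rightarrow> (real \<Rightarrow> real \<Rightarrow> real) \<Rightarrow> nat \<Rightarrow>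
    (nat \<Rightarrow> 'x \<times> 'y::real_vector) \<Rightarrow> real \<Rightarrow> 'x \<Rightarrow> 'y" where
  "estimator \<beta> feat g n z lam x =
     emp_cross_cov \<beta> feat n z (fun_calc (g lam) (emp_cov \<beta> feat n z) (feat x))"

definition regularization_family ::
  "real \<Rightarrow> (real \<Rightarrow> real \<Rightarrow> real) \<Rightarrow> real \<Rightarrow> real \<Rightarrow> real \<Rightarrow> bool" where
  "regularization_family s g B D \<gamma> \<longleftrightarrow>
     0 < B \<and> 0 < D \<and> 0 < \<gamma> \<and>
     (\<forall>lam\<in>{0<..s}. \<forall>\<sigma>\<in>{0<..s}.
        \<bar>\<sigma> * g lam \<sigma>\<bar> \<le> D \<and> \<bar>g lam \<sigma>\<bar> \<le> B / lam \<and> \<bar>1 - \<sigma> * g lam \<sigma>\<bar> \<le> \<gamma>)"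

definition qualification_at_least :: "real \<Rightarrow> (real \<Rightarrow> real \<Rightarrow> real) \<Rightarrow> real \<Rightarrow> bool" where
  "qualification_at_least s g \<nu> \<longleftrightarrow>
     0 < \<nu> \<and> (\<exists>\<gamma>\<nu>. \<forall>lam\<in>{0<..s}. \<forall>\<sigma>\<in>{0<..s}.
        \<bar>1 - \<sigma> * g lam \<sigma>\<bar> * \<sigma> powr \<nu> \<le> \<gamma>\<nu> * lam powr \<nu>)"

definition qualification :: "real \<Rightarrow> (real \<Rightarrow> real \<Rightarrow> real) \<Rightarrow> real \<Rightarrow> bool" where
  "qualification s g \<nu> \<longleftrightarrow>
     qualification_at_least s g \<nu> \<and> (\<forall>\<nu>'. qualification_at_least s g \<nu>' \<longrightarrow> \<nu>' \<le> \<nu>)"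

definition index_function :: "(real \<Rightarrow> real) \<Rightarrow> bool" where
  "index_function \<phi> \<longleftrightarrow> continuous_on {0..} \<phi> \<and> strict_mono_on {0..} \<phi> \<and> \<phi> 0 = 0"

definition covers :: "real \<Rightarrow> real \<Rightarrow> (real \<Rightarrow> real) \<Rightarrow> bool" where
  "covers s \<nu> \<psi> \<longleftrightarrow>
     (\<exists>c>0. \<forall>t\<in>{0<..s}. c * (t powr \<nu> / \<psi> t) \<le> (INF \<sigma>\<in>{t..s}. \<sigma> powr \<nu> / \<psi> \<sigma>))"

definition Psi :: "real \<Rightarrow> (real \<Rightarrow> real) \<Rightarrow> real \<Rightarrow> real" where
  "Psi bb \<phi> t = t powr (1 / 2 + 1 / (2 * bb)) * \<phi> t"

definition Psi_inv :: "real \<Rightarrow> (real \<Rightarrow> real) \<Rightarrow> real \<Rightarrow> real" where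
  "Psi_inv bb \<phi> = the_inv_into {0..} (Psi bb \<phi>)"

end

theory Submission
  imports Defs
begin

text \<open>
  Write \<open>C\<close> for the covariance operator, \<open>\<hat>C\<close> for its weighted empirical version, \<open>r(s) = 1 - s g\<^sub>\<lambda>(s)\<close>,
  \<open>\<epsilon>\<^sub>i = y\<^sub>i - f\<^sup>*(x\<^sub>i)\<close> and \<open>L = ln (2 / \<delta>)\<close>. The error is the difference of a bias operator
  \<open>C\<^sub>o \<phi>(C) r(\<hat>C)\<close> and a noise operator \<open>1/n \<Sum>\<^sub>i \<beta>(x\<^sub>i) \<epsilon>\<^sub>i \<otimes> g\<^sub>\<lambda>(\<hat>C) feat(x\<^sub>i)\<close>.

  Two events of total probability at least \<open>1 - \<delta>\<close> suffice, and neither depends on \<open>g\<close>, which need not be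
  measurable. On the first, \<open>\<hat>C - C\<close> is small relative to \<open>(C + \<lambda> + L/n)\<^sup>1\<^sup>/\<^sup>2\<close>; it comes from the bound
  \<open>E cosh \<parallel>S\<^sub>n\<parallel> \<le> exp (\<dots>)\<close> for sums of independent centered vectors. On the second,
  \<open>n\<^sup>-\<^sup>2 \<Sum>\<^sub>i\<^sub>l \<beta>\<^sub>i \<beta>\<^sub>l \<langle>\<epsilon>\<^sub>i, \<epsilon>\<^sub>l\<rangle> \<langle>feat(x\<^sub>i), (\<hat>C + \<lambda>)\<^sup>-\<^sup>1 feat(x\<^sub>l)\<rangle>\<close> is of order \<open>\<lambda> \<phi>(\<lambda>)\<^sup>2 L\<close>; conditionally on the
  inputs this is a Hoeffding bound with the empirical effective dimension as variance, after the few
  inputs with a large component outside the leading eigenspaces are removed.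

  No operator monotonicity of \<open>\<phi>\<close> is available. Instead the covering condition gives
  \<open>\<phi>(\<mu>) \<le> K \<phi>(\<lambda>) max 1 (\<mu>/\<lambda>)\<^sup>\<nu>\<close>, the qualification gives \<open>r(s) \<le> \<Gamma> min 1 (\<lambda>/s)\<^sup>\<nu>\<close>, and the two are matched
  across \<open>C\<close> and \<open>\<hat>C\<close> by a dyadic sum of powers of resolvents, for which the perturbation is controlled.
\<close>

section \<open>Scalar inequalities\<close>

text \<open>The bound is linear in L for every \<delta>, with no condition tying L to n, and this
  shapes two choices. The population operator is shifted by \<open>\<lambda> + L/n\<close> instead
  of \<lambda>, so that the sup-norm term of the Bernstein bound, of order
  \<open>L / (n * sqrt (\<lambda> + L/n))\<close>, never exceeds \<open>sqrt (L/n)\<close>. The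
  constant comparing the two shifted operators is then of order
  \<open>1 + \<phi>(\<lambda>) * sqrt L\<close> and may be large; in the L2 bound it is paired with
  a sharp bias estimate when \<open>\<phi>(\<lambda>) * sqrt L\<close> is at most 1, and with a
  crude one otherwise. The choice of \<lambda> enters only as
  \<open>1/n = \<lambda> powr (1 + 1/bb) * \<phi>(\<lambda>)\<^sup>2\<close>, which balances the
  effective dimension divided by n against \<open>\<lambda> * \<phi>(\<lambda>)\<^sup>2\<close>. The
  space of Hilbert-Schmidt operators is never built. Such operators appear as elements of the
  vector-valued space, generated by rank-one tensors, and scalar inequalities between Gram matrices
  are lifted to vector outputs by the Schur product theorem.\<close>

lemma convex_power_nonneg:
  fixes n :: nat
  shows "convex_on {0::real..} (\<lambda>x. x ^ n)"
  using convex_power_even[of n] convex_power_odd[of n] convex_on_subset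
  by (cases "even n") (auto intro: convex_on_subset)

text \<open>As a power series in u with nonnegative coefficients, \<open>cosh (sqrt u)\<close> is
  convex on the half line; the series form lets convexity be used termwise.\<close>

lemma cosh_sqrt_sums:
  assumes "0 \<le> (u::real)"
  shows "(\<lambda>n. if even n then u ^ (n div 2) / fact n else 0) sums cosh (sqrt u)"
proof -
  have "(\<lambda>n. if even n then sqrt u ^ n /\<^sub>R fact n else 0) sums cosh (sqrt u)"
    by (rule cosh_converges)
  moreover have "(if even n then sqrt u ^ n /\<^sub>R fact n else 0) =
      (if even n then u ^ (n div 2) / fact n else 0)" for n
    using assms by (auto elim!: evenE simp: power_mult divide_simps)
  ultimately show ?thesis by simp
qed

text \<open>Both arguments lie between \<open>(a - b)\<^sup>2\<close> and
  \<open>(a + b)\<^sup>2\<close> and have the same sum as these endpoints. The sum of a convex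
  function is then largest at the endpoints, where the addition formulas give
  \<open>2 * cosh a * cosh b\<close>.\<close>

lemma cosh_sqrt_convex_sum:
  fixes a b t :: real
  assumes "0 \<le> a" "0 \<le> b" and t: "\<bar>t\<bar> \<le> a * b"
  shows "cosh (sqrt (a\<^sup>2 + 2 * t + b\<^sup>2)) + cosh (sqrt (a\<^sup>2 - 2 * t + b\<^sup>2)) \<le> 2 * cosh a * cosh b"
proof -
  define E1 where "E1 = (a + b)\<^sup>2"
  define E2 where "E2 = (a - b)\<^sup>2"
  define p where "p = a\<^sup>2 + 2 * t + b\<^sup>2"
  define q where "q = a\<^sup>2 - 2 * t + b\<^sup>2"
  have pq: "E2 \<le> p" "p \<le> E1" "E2 \<le> q" "q \<le> E1" and s: "p + q = E1 + E2"
    using t by (auto simp: p_def q_def E1_def E2_def power2_eq_square algebra_simps)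
  have nn: "0 \<le> E1" "0 \<le> E2" "0 \<le> p" "0 \<le> q"
    using pq by (auto simp: E1_def E2_def intro: order_trans[of 0 "(a - b)\<^sup>2"])
  have pow: "p ^ k + q ^ k \<le> E1 ^ k + E2 ^ k" for k
  proof (cases "E1 = E2")
    case True
    then have "p = E1" "q = E2" using pq s by auto
    then show ?thesis by simp
  next
    case False
    \<comment> \<open>Barycentric coordinate of p between E2 and E1; q has the mirrored coordinate
      because the sums agree.\<close>
    define \<theta> where "\<theta> = (p - E2) / (E1 - E2)"
    have th: "0 \<le> \<theta>" "\<theta> \<le> 1" using pq False by (auto simp: \<theta>_def divide_simps)
    have pe: "p = (1 - \<theta>) * E2 + \<theta> * E1"
    proof -
      have "\<theta> * (E1 - E2) = p - E2" using False by (simp add: \<theta>_def)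
      then show ?thesis by (simp add: algebra_simps)
    qed
    have qe: "q = (1 - \<theta>) * E1 + \<theta> * E2" using s pe by (simp add: algebra_simps)
    have cv: "((1 - \<theta>) * x + \<theta> * y) ^ k \<le> (1 - \<theta>) * x ^ k + \<theta> * y ^ k" if "0 \<le> x" "0 \<le> y" for x y
      using convex_onD[OF convex_power_nonneg[of k], of \<theta> x y] th that by simp
    show ?thesis using cv[of E2 E1] cv[of E1 E2] nn unfolding pe qe by (simp add: algebra_simps)
  qed
  have "cosh (sqrt p) + cosh (sqrt q) \<le> cosh (sqrt E1) + cosh (sqrt E2)"
  proof (rule sums_le)
    show "(\<lambda>n. (if even n then p ^ (n div 2) / fact n else 0) + (if even n then q ^ (n div 2) / fact n else 0))
        sums (cosh (sqrt p) + cosh (sqrt q))"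
      by (intro sums_add cosh_sqrt_sums nn)
    show "(\<lambda>n. (if even n then E1 ^ (n div 2) / fact n else 0) + (if even n then E2 ^ (n div 2) / fact n else 0))
        sums (cosh (sqrt E1) + cosh (sqrt E2))"
      by (intro sums_add cosh_sqrt_sums nn)
  qed (use pow in \<open>auto simp: add_divide_distrib[symmetric] divide_right_mono\<close>)
  also have "\<dots> = 2 * cosh a * cosh b"
    using assms by (simp add: E1_def E2_def cosh_add cosh_diff real_sqrt_abs)
  finally show ?thesis by (simp add: p_def q_def)
qed

lemma cosh_ge_tangent: "cosh x + sinh x * (y - x) \<le> cosh (y::real)"
proof -
  have "exp x * (1 + (y - x)) \<le> exp x * exp (y - x)" by (intro mult_left_mono exp_ge_add_one_self) auto
  moreover have "exp (-x) * (1 + (x - y)) \<le> exp (-x) * exp (x - y)" by (intro mult_left_mono exp_ge_add_one_self) auto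
  ultimately show ?thesis
    by (simp add: cosh_field_def sinh_field_def exp_add[symmetric] field_simps)
qed

text \<open>
  The replacement for Pinelis' martingale argument: with \<open>a\<close> the norm of a partial sum, \<open>b\<close> the norm
  of the next summand and \<open>t\<close> their inner product, the term linear in \<open>t\<close> averages out.
\<close>

lemma cosh_sqrt_step:
  fixes a b t :: real
  assumes a: "0 \<le> a" and b: "0 \<le> b" and t: "\<bar>t\<bar> \<le> a * b"
  shows "cosh (sqrt (a\<^sup>2 + 2 * t + b\<^sup>2)) \<le> cosh a * (2 * cosh b - 1) + sinh a / a * t"
proof -
  \<comment> \<open>The summand with \<open>- t\<close> is bounded below by the tangent of cosh at
    a, which is linear in t. At \<open>a = 0\<close> the quotient is 0 by the division convention,
    and t vanishes as well.\<close>
  have "cosh a - sinh a / a * t \<le> cosh (sqrt (a\<^sup>2 - 2 * t + b\<^sup>2))"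
  proof (cases "a = 0")
    case True
    then show ?thesis using t by (auto simp: cosh_real_ge_1)
  next
    case False
    have "t\<^sup>2 \<le> (a * b)\<^sup>2" using t by (metis abs_ge_zero power2_abs power_mono)
    then have "(t / a)\<^sup>2 \<le> b\<^sup>2" using False by (simp add: power_divide power_mult_distrib divide_simps mult.commute)
    then have "(a - t / a)\<^sup>2 \<le> a\<^sup>2 - 2 * t + b\<^sup>2" using False by (simp add: power2_diff)
    then have le: "\<bar>a - t / a\<bar> \<le> sqrt (a\<^sup>2 - 2 * t + b\<^sup>2)" by (rule real_le_rsqrt[of "\<bar>a - t / a\<bar>", simplified power2_abs])
    have "cosh a - sinh a / a * t \<le> cosh (a - t / a)"
      using cosh_ge_tangent[of a "a - t / a"] by simp
    also have "\<dots> = cosh \<bar>a - t / a\<bar>" by simp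
    also have "\<dots> \<le> cosh (sqrt (a\<^sup>2 - 2 * t + b\<^sup>2))" using le abs_ge_zero[of "a - t / a"] order_trans by (intro cosh_real_nonneg_le_iff[THEN iffD2]) blast+
    finally show ?thesis .
  qed
  with cosh_sqrt_convex_sum[OF assms] show ?thesis by (simp add: algebra_simps)
qed

text \<open>Coefficientwise comparison of two series in \<open>x\<^sup>2\<close>, by
  \<open>2 ^ k * fact k \<le> fact (2 * k)\<close>.\<close>

lemma cosh_le_exp_half_square: "cosh (x::real) \<le> exp (x\<^sup>2 / 2)"
proof -
  have pr: "(2::real) ^ k * fact k \<le> fact (2 * k)" for k
  proof (induction k)
    case (Suc k)
    have "(2::real) ^ Suc k * fact (Suc k) = (2 * (real k + 1)) * (2 ^ k * fact k)" by (simp add: algebra_simps)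
    also have "\<dots> \<le> (2 * (real k + 1)) * fact (2 * k)" using Suc by (intro mult_left_mono) auto
    also have "\<dots> \<le> (2 * (real k + 1)) * ((2 * real k + 1) * fact (2 * k))"
      by (intro mult_left_mono) (auto simp: algebra_simps)
    also have "\<dots> = fact (2 * Suc k)" by (simp add: algebra_simps)
    finally show ?case .
  qed simp
  have "(\<lambda>n. if even n then x\<^sup>2 ^ (n div 2) / fact n else 0) sums cosh \<bar>x\<bar>"
    using cosh_sqrt_sums[of "x\<^sup>2"] by (simp add: real_sqrt_abs)
  moreover have "(if even n then x\<^sup>2 ^ (n div 2) / fact n else 0) = 0" if "n \<notin> range (\<lambda>k. 2 * k)" for n :: nat
    using that by (auto simp: image_iff dvd_def)
  ultimately have "(\<lambda>k. (if even (2 * k) then x\<^sup>2 ^ (2 * k div 2) / fact (2 * k) else 0)) sums cosh \<bar>x\<bar>"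
    using sums_mono_reindex[of "\<lambda>k. 2 * k" "\<lambda>n. if even n then x\<^sup>2 ^ (n div 2) / fact n else 0" "cosh \<bar>x\<bar>"]
    using strict_monoI[of "\<lambda>k::nat. 2 * k"] by auto
  then have 1: "(\<lambda>k. x\<^sup>2 ^ k / fact (2 * k)) sums cosh \<bar>x\<bar>" by simp
  have "(\<lambda>k. y ^ k / fact k) sums exp y" for y :: real
    using exp_converges[of y] unfolding real_scaleR_def divide_inverse_commute .
  then have 2: "(\<lambda>k. (x\<^sup>2 / 2) ^ k / fact k) sums exp (x\<^sup>2 / 2)" .
  have "cosh \<bar>x\<bar> \<le> exp (x\<^sup>2 / 2)"
  proof (rule sums_le[OF _ 1 2])
    fix k
    show "x\<^sup>2 ^ k / fact (2 * k) \<le> (x\<^sup>2 / 2) ^ k / fact k"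
      using pr[of k] by (auto simp: power_divide intro!: divide_left_mono)
  qed
  then show ?thesis by simp
qed

text \<open>Follows from \<open>(exp (x\<^sup>2 / 2) - 1)\<^sup>2 \<ge> 0\<close>. The left side is
  the growth factor of \<open>cosh_sqrt_step\<close>; the exponential form serves bounded
  increments, as in Hoeffding's inequality.\<close>

lemma two_cosh_minus_one_le_exp: "2 * cosh x - 1 \<le> exp (x\<^sup>2 :: real)"
proof -
  have "0 \<le> (exp (x\<^sup>2 / 2) - 1)\<^sup>2" by simp
  also have "\<dots> = exp (x\<^sup>2) - 2 * exp (x\<^sup>2 / 2) + 1"
    by (simp add: power2_diff power2_eq_square[of "exp _"] exp_add[symmetric])
  finally show ?thesis using cosh_le_exp_half_square[of x] by linarith
qed

text \<open>Linear in the square, so that after integration the second moment of the increment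
  appears, as in Bernstein's inequality.\<close>

lemma cosh_le_one_plus_square:
  assumes "\<bar>x\<bar> \<le> (1::real)"
  shows "cosh x \<le> 1 + x\<^sup>2"
proof -
  have "2 * cosh x - 1 \<le> exp (x\<^sup>2)" by (rule two_cosh_minus_one_le_exp)
  also have "x\<^sup>2 \<le> 1" using assms by (simp add: abs_square_le_1)
  then have "exp (x\<^sup>2) \<le> 1 + x\<^sup>2 + (x\<^sup>2)\<^sup>2" by (intro exp_bound) auto
  also have "\<dots> \<le> 1 + 2 * x\<^sup>2"
    using mult_left_le[OF \<open>x\<^sup>2 \<le> 1\<close> zero_le_power2[of x]] by (simp only: power2_eq_square[of "x\<^sup>2"])
  finally show ?thesis by simp
qed

lemma exp_le_two_cosh: "exp x \<le> 2 * cosh (x::real)"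
  by (simp add: cosh_field_def)

section \<open>Orthonormal families and Schur products\<close>

definition orthonormal :: "'a::real_inner set \<Rightarrow> bool" where
  "orthonormal E \<longleftrightarrow> (\<forall>e\<in>E. norm e = 1) \<and> pairwise orthogonal E"

lemma orthonormal_inner:
  "orthonormal E \<Longrightarrow> e \<in> E \<Longrightarrow> e' \<in> E \<Longrightarrow> e \<bullet> e' = (if e = e' then 1 else 0)"
  by (auto simp: orthonormal_def pairwise_def orthogonal_def norm_eq_1)

lemma orthonormal_basis_orthonormal: "orthonormal_basis E \<Longrightarrow> orthonormal E"
  by (simp add: orthonormal_basis_def orthonormal_def)

context
  fixes E F :: "'a::real_inner set"
  assumes E: "orthonormal E" and F: "finite F" "F \<subseteq> E"
begin

lemma orthonormal_sum_inner:
  "e' \<in> E \<Longrightarrow> (\<Sum>e\<in>F. c e *\<^sub>R e) \<bullet> e' = (if e' \<in> F then c e' else 0)"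
  using F by (auto simp: inner_sum_left orthonormal_inner[OF E] subset_iff if_distrib cong: if_cong sum.cong)

lemma orthonormal_sum_norm: "(norm (\<Sum>e\<in>F. c e *\<^sub>R e))\<^sup>2 = (\<Sum>e\<in>F. (c e)\<^sup>2)"
proof -
  have "(norm (\<Sum>e\<in>F. c e *\<^sub>R e))\<^sup>2 = (\<Sum>e'\<in>F. c e' * ((\<Sum>e\<in>F. c e *\<^sub>R e) \<bullet> e'))"
    by (simp only: power2_norm_eq_inner inner_sum_right inner_scaleR_right)
  also have "\<dots> = (\<Sum>e\<in>F. (c e)\<^sup>2)"
    using F by (intro sum.cong refl) (auto simp: orthonormal_sum_inner power2_eq_square)
  finally show ?thesis .
qed

lemma bessel_eq: "(norm (v - (\<Sum>e\<in>F. (v \<bullet> e) *\<^sub>R e)))\<^sup>2 = (norm v)\<^sup>2 - (\<Sum>e\<in>F. (v \<bullet> e)\<^sup>2)"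
proof -
  have "v \<bullet> (\<Sum>e\<in>F. (v \<bullet> e) *\<^sub>R e) = (\<Sum>e\<in>F. (v \<bullet> e)\<^sup>2)"
    by (simp add: inner_sum_right power2_eq_square)
  then show ?thesis
    using orthonormal_sum_norm[of "\<lambda>e. v \<bullet> e"]
    by (simp add: power2_norm_eq_inner inner_diff_left inner_diff_right inner_commute algebra_simps)
qed

lemma bessel: "(\<Sum>e\<in>F. (v \<bullet> e)\<^sup>2) \<le> (norm v)\<^sup>2"
  using bessel_eq[of v] by (metis diff_ge_0_iff_ge zero_le_power2)

lemma orthonormal_span_expand: "v \<in> span F \<Longrightarrow> (\<Sum>e\<in>F. (v \<bullet> e) *\<^sub>R e) = v"
proof (induction rule: span_induct_alt)
  case (step c x y)
  have "(\<Sum>e\<in>F. (x \<bullet> e) *\<^sub>R e) = (\<Sum>e\<in>F. if e = x then x else 0)"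
    using step F by (intro sum.cong refl) (auto simp: orthonormal_inner[OF E] subset_iff)
  also have "\<dots> = x" using step F by simp
  finally show ?case using step
    by (simp add: inner_add_left scaleR_add_left sum.distrib flip: scaleR_scaleR scaleR_sum_right)
qed simp

text \<open>The residual of v equals that of \<open>v - w\<close>, because w is reproduced by its
  coefficients; a residual is never longer than its vector.\<close>

lemma orthonormal_best_approx:
  assumes "w \<in> span F"
  shows "norm (v - (\<Sum>e\<in>F. (v \<bullet> e) *\<^sub>R e)) \<le> norm (v - w)"
proof -
  have "(v - w) - (\<Sum>e\<in>F. ((v - w) \<bullet> e) *\<^sub>R e) = v - (\<Sum>e\<in>F. (v \<bullet> e) *\<^sub>R e)"
    using orthonormal_span_expand[OF assms]
    by (simp add: inner_diff_left scaleR_diff_left sum_subtractf)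
  then have "(norm (v - (\<Sum>e\<in>F. (v \<bullet> e) *\<^sub>R e)))\<^sup>2 \<le> (norm (v - w))\<^sup>2"
    using bessel_eq[of "v - w"] sum_nonneg[of F "\<lambda>e. ((v - w) \<bullet> e)\<^sup>2"] by (simp only:) simp
  then show ?thesis by (rule power2_le_imp_le) simp
qed

end

text \<open>Gram-Schmidt: each new vector adds its normalized residual, and nothing when the
  residual is zero.\<close>

lemma finite_orthonormal_span:
  fixes S :: "'a::real_inner set"
  assumes "finite S"
  shows "\<exists>E. finite E \<and> orthonormal E \<and> S \<subseteq> span E"
  using assms
proof (induction)
  case empty
  then show ?case by (intro exI[of _ "{}"]) (auto simp: orthonormal_def)
next
  case (insert a S)
  then obtain E where E: "finite E" "orthonormal E" "S \<subseteq> span E" by blast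
  define b where "b = a - (\<Sum>e\<in>E. (a \<bullet> e) *\<^sub>R e)"
  have a: "a = b + (\<Sum>e\<in>E. (a \<bullet> e) *\<^sub>R e)" by (simp add: b_def)
  have sE: "(\<Sum>e\<in>E. (a \<bullet> e) *\<^sub>R e) \<in> span E" by (intro span_sum span_scale span_base)
  show ?case
  proof (cases "b = 0")
    case True
    then show ?thesis using E a sE by auto
  next
    case False
    have orth: "b \<bullet> e = 0" if "e \<in> E" for e
      using that orthonormal_sum_inner[OF E(2,1) subset_refl that]
      by (simp add: b_def inner_diff_left)
    define u where "u = (1 / norm b) *\<^sub>R b"
    have u: "norm u = 1" "b = norm b *\<^sub>R u" using False by (auto simp: u_def)
    have "orthonormal (insert u E)"
      using E(2) u orth unfolding orthonormal_def pairwise_insert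
      by (auto simp: orthogonal_def u_def inner_commute)
    moreover have "a \<in> span (insert u E)"
    proof -
      have "b \<in> span (insert u E)" by (subst u(2)) (intro span_scale span_base, simp)
      moreover have "(\<Sum>e\<in>E. (a \<bullet> e) *\<^sub>R e) \<in> span (insert u E)"
        using sE span_mono[of E "insert u E"] by blast
      ultimately show ?thesis using a span_add by metis
    qed
    moreover have "S \<subseteq> span (insert u E)" using E(3) span_mono[of E "insert u E"] by blast
    ultimately show ?thesis using E(1) by (intro exI[of _ "insert u E"]) auto
  qed
qed

text \<open>Schur product theorem. Writing each \<open>y i \<bullet> y l\<close> in coordinates of a
  finite orthonormal family turns the double sum into a sum over e of scalar quadratic forms with
  coefficients \<open>y i \<bullet> e\<close>. The space of outputs may be infinite-dimensional,
  since only the span of the given vectors is expanded.\<close>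

lemma schur_nonneg:
  fixes y :: "'i \<Rightarrow> 'y::real_inner"
  assumes "finite I" and D: "\<And>c. 0 \<le> (\<Sum>i\<in>I. \<Sum>l\<in>I. c i * c l * D i l)"
  shows "0 \<le> (\<Sum>i\<in>I. \<Sum>l\<in>I. (y i \<bullet> y l) * D i l)"
proof -
  obtain E where E: "finite E" "orthonormal E" "y ` I \<subseteq> span E"
    using finite_orthonormal_span[of "y ` I"] assms(1) by auto
  have yy: "y i \<bullet> y l = (\<Sum>e\<in>E. (y i \<bullet> e) * (y l \<bullet> e))" if "i \<in> I" "l \<in> I" for i l
  proof -
    have "y i = (\<Sum>e\<in>E. (y i \<bullet> e) *\<^sub>R e)"
      using orthonormal_span_expand[OF E(2,1) subset_refl, of "y i"] E(3) that by auto
    then have "y i \<bullet> y l = (\<Sum>e\<in>E. (y i \<bullet> e) *\<^sub>R e) \<bullet> y l" by simp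
    then show ?thesis by (simp only: inner_sum_left inner_scaleR_left) (simp add: inner_commute)
  qed
  have "(\<Sum>i\<in>I. \<Sum>l\<in>I. (y i \<bullet> y l) * D i l) = (\<Sum>i\<in>I. \<Sum>l\<in>I. \<Sum>e\<in>E. (y i \<bullet> e) * (y l \<bullet> e) * D i l)"
    by (intro sum.cong refl) (simp add: yy sum_distrib_right)
  also have "\<dots> = (\<Sum>i\<in>I. \<Sum>e\<in>E. \<Sum>l\<in>I. (y i \<bullet> e) * (y l \<bullet> e) * D i l)"
    by (intro sum.cong refl sum.swap)
  also have "\<dots> = (\<Sum>e\<in>E. \<Sum>i\<in>I. \<Sum>l\<in>I. (y i \<bullet> e) * (y l \<bullet> e) * D i l)"
    by (rule sum.swap)
  also have "\<dots> \<ge> 0" by (intro sum_nonneg D)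
  finally show ?thesis .
qed

text \<open>The basis may be uncountable. A finite combination near v fixes a finite set, and by
  best approximation every larger finite set does at least as well.\<close>

lemma orthonormal_basis_has_sum:
  assumes "orthonormal_basis E"
  shows "((\<lambda>e. (v \<bullet> e) *\<^sub>R e) has_sum v) E"
  unfolding has_sum_def tendsto_iff eventually_finite_subsets_at_top
proof (intro allI impI)
  fix \<epsilon> :: real assume \<epsilon>: "\<epsilon> > 0"
  have on: "orthonormal E" using assms by (rule orthonormal_basis_orthonormal)
  have "v \<in> closure (span E)" using assms by (simp add: orthonormal_basis_def)
  then obtain w where w: "w \<in> span E" "dist w v < \<epsilon>" using \<epsilon> by (auto simp: closure_approachable)
  from w(1) obtain X r where X: "finite X" "X \<subseteq> E" and wr: "w = (\<Sum>a\<in>X. r a *\<^sub>R a)"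
    unfolding span_explicit by blast
  have wX: "w \<in> span X" unfolding wr by (intro span_sum span_scale span_base)
  show "\<exists>X. finite X \<and> X \<subseteq> E \<and> (\<forall>Y. finite Y \<and> X \<subseteq> Y \<and> Y \<subseteq> E \<longrightarrow> dist (\<Sum>e\<in>Y. (v \<bullet> e) *\<^sub>R e) v < \<epsilon>)"
  proof (intro exI[of _ X] conjI allI impI X)
    fix Y assume Y: "finite Y \<and> X \<subseteq> Y \<and> Y \<subseteq> E"
    then have "w \<in> span Y" using wX span_mono by blast
    then have "norm (v - (\<Sum>e\<in>Y. (v \<bullet> e) *\<^sub>R e)) \<le> norm (v - w)"
      using orthonormal_best_approx[OF on] Y by blast
    then show "dist (\<Sum>e\<in>Y. (v \<bullet> e) *\<^sub>R e) v < \<epsilon>"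
      using w(2) by (simp add: dist_norm norm_minus_commute)
  qed
qed

text \<open>A minimizing sequence is Cauchy by the parallelogram law, since midpoints stay in S and
  cannot beat the infimum d; its limit is the foot of the perpendicular.\<close>

lemma closed_subspace_nearest:
  fixes S :: "'a::{real_inner,banach} set"
  assumes S: "subspace S" "closed S"
  shows "\<exists>w\<in>S. \<forall>u\<in>S. (v - w) \<bullet> u = 0"
proof -
  define d where "d = (INF w\<in>S. (norm (v - w))\<^sup>2)"
  have ne: "S \<noteq> {}" using S subspace_0 by blast
  have bdd: "bdd_below ((\<lambda>w. (norm (v - w))\<^sup>2) ` S)" by (rule bdd_belowI2[of _ 0]) simp
  have d_le: "d \<le> (norm (v - w))\<^sup>2" if "w \<in> S" for w
    unfolding d_def by (rule cINF_lower[OF bdd that])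
  have "\<exists>w\<in>S. (norm (v - w))\<^sup>2 < d + inverse (real (Suc n))" for n
    using cINF_less_iff[OF ne bdd, of "d + inverse (real (Suc n))"] by (simp add: d_def)
  then obtain w where w: "\<And>n. w n \<in> S" "\<And>n. (norm (v - w n))\<^sup>2 < d + inverse (real (Suc n))" by metis
  have par: "(norm (w m - w n))\<^sup>2 \<le> 2 * inverse (real (Suc m)) + 2 * inverse (real (Suc n))" for m n
  proof -
    have "(1/2) *\<^sub>R (w m + w n) \<in> S" using S w subspace_add subspace_scale by blast
    then have "d \<le> (norm (v - (1/2) *\<^sub>R (w m + w n)))\<^sup>2" by (rule d_le)
    moreover have "(norm (w m - w n))\<^sup>2 = 2 * (norm (v - w m))\<^sup>2 + 2 * (norm (v - w n))\<^sup>2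
        - 4 * (norm (v - (1/2) *\<^sub>R (w m + w n)))\<^sup>2"
      by (simp add: power2_norm_eq_inner inner_diff_left inner_diff_right inner_add_left inner_add_right
          inner_commute algebra_simps)
    ultimately show ?thesis using w(2)[of m] w(2)[of n] by linarith
  qed
  have "Cauchy w"
  proof (rule metric_CauchyI)
    fix e :: real assume "e > 0"
    then obtain N where N: "inverse (real (Suc N)) < e\<^sup>2 / 4" using reals_Archimedean[of "e\<^sup>2 / 4"] by auto
    show "\<exists>M. \<forall>m\<ge>M. \<forall>n\<ge>M. dist (w m) (w n) < e"
    proof (intro exI[of _ N] allI impI)
      fix m n assume mn: "N \<le> m" "N \<le> n"
      have "inverse (real (Suc m)) \<le> inverse (real (Suc N))" "inverse (real (Suc n)) \<le> inverse (real (Suc N))"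
        using mn by (auto intro!: le_imp_inverse_le)
      then have "(norm (w m - w n))\<^sup>2 < e\<^sup>2" using par[of m n] N by linarith
      then show "dist (w m) (w n) < e" using \<open>e > 0\<close>
        by (simp add: dist_norm power2_less_imp_less)
    qed
  qed
  then obtain l where l: "w \<longlonglongrightarrow> l" using Cauchy_convergent_iff convergent_def by blast
  have lS: "l \<in> S" using closed_sequentially[OF S(2)] w(1) l by blast
  have lim_d: "(\<lambda>n. d + inverse (real (Suc n))) \<longlonglongrightarrow> d + 0"
    by (intro tendsto_intros LIMSEQ_inverse_real_of_nat)
  have "(\<lambda>n. (norm (v - w n))\<^sup>2) \<longlonglongrightarrow> (norm (v - l))\<^sup>2" by (intro tendsto_intros l)
  from this lim_d have "(norm (v - l))\<^sup>2 \<le> d + 0"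
    by (rule LIMSEQ_le) (use w(2) less_imp_le in blast)
  then have min: "(norm (v - l))\<^sup>2 \<le> d" by simp
  have "(v - l) \<bullet> u = 0" if u: "u \<in> S" for u
  proof (rule ccontr)
    assume ne: "(v - l) \<bullet> u \<noteq> 0"
    then have u0: "u \<bullet> u > 0" by (metis inner_gt_zero_iff inner_zero_right)
    \<comment> \<open>The optimal correction of l along u; unless the inner product vanishes it
      would lower the squared distance below d.\<close>
    define c where "c = ((v - l) \<bullet> u) / (u \<bullet> u)"
    have "l + c *\<^sub>R u \<in> S" using S lS u subspace_add subspace_scale by blast
    then have "(norm (v - l))\<^sup>2 \<le> (norm (v - (l + c *\<^sub>R u)))\<^sup>2" using min d_le order_trans by blast
    also have "\<dots> = (norm (v - l))\<^sup>2 - 2 * c * ((v - l) \<bullet> u) + c\<^sup>2 * (u \<bullet> u)"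
      unfolding power2_norm_eq_inner
      by (simp add: inner_diff_left inner_diff_right inner_add_left inner_add_right
          inner_commute algebra_simps power2_eq_square)
    also have "\<dots> = (norm (v - l))\<^sup>2 - ((v - l) \<bullet> u)\<^sup>2 / (u \<bullet> u)"
      using u0 by (simp add: c_def power2_eq_square field_simps)
    finally have "((v - l) \<bullet> u)\<^sup>2 / (u \<bullet> u) \<le> 0" by simp
    then show False using u0 ne by (simp add: divide_le_0_iff)
  qed
  with lS show ?thesis by blast
qed

lemma subspace_closure_subspace:
  fixes S :: "'a::real_normed_vector set"
  assumes "subspace S"
  shows "subspace (closure S)"
proof (rule subspaceI)
  show "0 \<in> closure S" using assms closure_subset subspace_0 by blast
  show "x + y \<in> closure S" if xy: "x \<in> closure S" "y \<in> closure S" for x y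
  proof -
    obtain a b where "\<And>n. a n \<in> S" "a \<longlonglongrightarrow> x" "\<And>n. b n \<in> S" "b \<longlonglongrightarrow> y"
      using xy unfolding closure_sequential by blast
    then show ?thesis using subspace_add[OF assms] tendsto_add[of a x _ b y]
      unfolding closure_sequential by (intro exI[of _ "\<lambda>n. a n + b n"]) auto
  qed
  show "c *\<^sub>R x \<in> closure S" if x: "x \<in> closure S" for c x
  proof -
    obtain a where "\<And>n. a n \<in> S" "a \<longlonglongrightarrow> x" using x unfolding closure_sequential by blast
    then show ?thesis using subspace_scale[OF assms] tendsto_scaleR[OF tendsto_const, of a x _ c]
      unfolding closure_sequential by (intro exI[of _ "\<lambda>n. c *\<^sub>R a n"]) auto
  qed
qed

text \<open>The residual of v at the closed span is orthogonal to S, hence zero. For a feature map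
  the hypothesis is injectivity of evaluation.\<close>

lemma dense_span_if_orthogonal_trivial:
  fixes S :: "'a::{real_inner,banach} set"
  assumes "\<And>v. (\<And>s. s \<in> S \<Longrightarrow> v \<bullet> s = 0) \<Longrightarrow> v = 0"
  shows "closure (span S) = UNIV"
proof -
  have "v \<in> closure (span S)" for v
  proof -
    have "subspace (closure (span S))" by (rule subspace_closure_subspace) simp
    then obtain w where w: "w \<in> closure (span S)" "\<forall>u\<in>closure (span S). (v - w) \<bullet> u = 0"
      using closed_subspace_nearest[of "closure (span S)" v] by auto
    then have "v - w = 0" using assms[of "v - w"] closure_subset[of "span S"] span_superset[of S] by blast
    then show ?thesis using w by simp
  qed
  then show ?thesis by auto
qed

section \<open>Spectral calculus\<close>

text \<open>A summable majorant for the squared norms of finite sums replaces orthogonality: tails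
  of b control tails of x, so the net of finite sums is Cauchy. The argument runs over finite
  subsets, so E may be uncountable.\<close>

lemma summable_on_norm_square_bound:
  fixes x :: "'i \<Rightarrow> 'a::banach" and b :: "'i \<Rightarrow> real"
  assumes b: "b summable_on E"
    and bound: "\<And>F. finite F \<Longrightarrow> F \<subseteq> E \<Longrightarrow> (norm (\<Sum>i\<in>F. x i))\<^sup>2 \<le> (\<Sum>i\<in>F. b i)"
  shows "x summable_on E"
proof -
  obtain s where s: "(b has_sum s) E" using b by (auto simp: summable_on_def)
  have b0: "0 \<le> b i" if "i \<in> E" for i
    using bound[of "{i}"] that order_trans[OF zero_le_power2] by fastforce
  have "cauchy_filter (filtermap (sum x) (finite_subsets_at_top E))"
    unfolding cauchy_filter_metric_filtermap
  proof (intro allI impI)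
    fix \<epsilon> :: real assume \<epsilon>: "\<epsilon> > 0"
    \<comment> \<open>Two sums of b within \<open>\<epsilon>\<^sup>2 / 8\<close> of s differ by less
      than \<open>\<epsilon>\<^sup>2 / 4\<close>, the square of the half \<epsilon> used in the
      triangle inequality.\<close>
    then have "eventually (\<lambda>F. dist (sum b F) s < \<epsilon>\<^sup>2 / 8) (finite_subsets_at_top E)"
      using s unfolding has_sum_def tendsto_iff by (metis divide_pos_pos zero_less_numeral zero_less_power)
    then have "\<exists>F0. finite F0 \<and> F0 \<subseteq> E \<and>
        (\<forall>F. finite F \<and> F0 \<subseteq> F \<and> F \<subseteq> E \<longrightarrow> dist (sum b F) s < \<epsilon>\<^sup>2 / 8)"
      by (simp only: eventually_finite_subsets_at_top)
    then obtain F0 where F0: "finite F0" "F0 \<subseteq> E"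
      "\<And>F. finite F \<Longrightarrow> F0 \<subseteq> F \<Longrightarrow> F \<subseteq> E \<Longrightarrow> dist (sum b F) s < \<epsilon>\<^sup>2 / 8"
      by auto
    have near: "dist (sum x F) (sum x F0) < \<epsilon> / 2" if F: "finite F" "F0 \<subseteq> F" "F \<subseteq> E" for F
    proof -
      have "sum x F - sum x F0 = sum x (F - F0)" using F by (simp add: sum_diff)
      then have "(norm (sum x F - sum x F0))\<^sup>2 \<le> sum b (F - F0)" using bound[of "F - F0"] F by auto
      also have "\<dots> = sum b F - sum b F0" using F by (simp add: sum_diff)
      also have "\<dots> < \<epsilon>\<^sup>2 / 4"
        using F0(3)[OF F] F0(3)[of F0] F0(1,2) by (auto simp: dist_real_def abs_if split: if_splits)
      also have "\<dots> = (\<epsilon> / 2)\<^sup>2" by (simp add: power_divide)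
      finally show ?thesis using \<epsilon> power_less_imp_less_base[of "norm (sum x F - sum x F0)" 2 "\<epsilon> / 2"] by (simp add: dist_norm)
    qed
    show "\<exists>P. eventually P (finite_subsets_at_top E) \<and> (\<forall>F F'. P F \<and> P F' \<longrightarrow> dist (sum x F) (sum x F') < \<epsilon>)"
    proof (intro exI[of _ "\<lambda>F. finite F \<and> F0 \<subseteq> F \<and> F \<subseteq> E"] conjI allI impI)
      show "eventually (\<lambda>F. finite F \<and> F0 \<subseteq> F \<and> F \<subseteq> E) (finite_subsets_at_top E)"
        using F0 unfolding eventually_finite_subsets_at_top by blast
      show "dist (sum x F) (sum x F') < \<epsilon>"
        if "(finite F \<and> F0 \<subseteq> F \<and> F \<subseteq> E) \<and> (finite F' \<and> F0 \<subseteq> F' \<and> F' \<subseteq> E)" for F F'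
        using near[of F] near[of F'] that dist_triangle_half_l[of "sum x F" "sum x F0" \<epsilon> "sum x F'"]
        by (auto simp: dist_commute)
    qed
  qed
  moreover have "uniform_space_class.complete (UNIV :: 'a set)"
    by (meson Cauchy_convergent UNIV_I complete_def convergent_def)
  ultimately obtain l where "filtermap (sum x) (finite_subsets_at_top E) \<le> nhds l"
    using cauchy_filter_complete_converges[of "filtermap (sum x) (finite_subsets_at_top E)" UNIV]
    by (auto simp: filtermap_bot_iff)
  then show ?thesis by (auto simp: summable_on_def has_sum_def filterlim_def)
qed

section \<open>Spectral theorem for finite-rank nonnegative operators\<close>

lemma compact_box_span:
  fixes E :: "'a::real_normed_vector set"
  assumes "finite E"
  shows "compact {\<Sum>e\<in>E. c e *\<^sub>R e | c. \<forall>e\<in>E. \<bar>c e\<bar> \<le> (1::real)}"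
  using assms
proof (induction)
  case (insert a E)
  define K where "K = {\<Sum>e\<in>E. c e *\<^sub>R e | c. \<forall>e\<in>E. \<bar>c e\<bar> \<le> (1::real)}"
  have "{\<Sum>e\<in>insert a E. c e *\<^sub>R e | c. \<forall>e\<in>insert a E. \<bar>c e\<bar> \<le> (1::real)}
      = (\<lambda>(t, x). t *\<^sub>R a + x) ` ({-1..1} \<times> K)" (is "?L = ?R")
  proof (intro set_eqI iffI)
    fix v assume "v \<in> ?L"
    then obtain c where c: "v = (\<Sum>e\<in>insert a E. c e *\<^sub>R e)" "\<forall>e\<in>insert a E. \<bar>c e\<bar> \<le> (1::real)" by blast
    then have "v = (\<lambda>(t, x). t *\<^sub>R a + x) (c a, \<Sum>e\<in>E. c e *\<^sub>R e)" using insert by simp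
    moreover have "(c a, \<Sum>e\<in>E. c e *\<^sub>R e) \<in> {-1..1} \<times> K" using c(2) by (auto simp: K_def abs_le_iff)
    ultimately show "v \<in> ?R" by (rule image_eqI)
  next
    fix v assume "v \<in> ?R"
    then obtain t c where v: "v = t *\<^sub>R a + (\<Sum>e\<in>E. c e *\<^sub>R e)" "\<bar>t\<bar> \<le> 1" "\<forall>e\<in>E. \<bar>c e\<bar> \<le> 1"
      unfolding K_def by (auto simp: abs_le_iff)
    have "(\<Sum>e\<in>E. (c(a := t)) e *\<^sub>R e) = (\<Sum>e\<in>E. c e *\<^sub>R e)"
      using insert by (intro sum.cong) auto
    then have "v = (\<Sum>e\<in>insert a E. (c(a := t)) e *\<^sub>R e)" using insert v by simp
    moreover have "\<forall>e\<in>insert a E. \<bar>(c(a := t)) e\<bar> \<le> 1" using v by auto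
    ultimately show "v \<in> ?L" by blast
  qed
  moreover have "compact ?R" using insert.IH
    unfolding K_def by (intro compact_continuous_image compact_Times compact_Icc)
      (auto intro!: continuous_intros simp: split_beta)
  ultimately show ?case by simp
qed simp

text \<open>The ambient space may be infinite-dimensional; compactness comes from seeing the sphere
  as a closed part of the image of a coordinate box.\<close>

lemma compact_sphere_span:
  fixes E :: "'a::real_inner set"
  assumes E: "finite E" "orthonormal E"
  shows "compact {x \<in> span E. norm x = 1}"
proof -
  define K where "K = {\<Sum>e\<in>E. c e *\<^sub>R e | c. \<forall>e\<in>E. \<bar>c e\<bar> \<le> (1::real)}"
  have "{x \<in> span E. norm x = 1} = K \<inter> {x. norm x = 1}"
  proof (intro set_eqI iffI)
    fix x assume x: "x \<in> {x \<in> span E. norm x = 1}"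
    then have "x = (\<Sum>e\<in>E. (x \<bullet> e) *\<^sub>R e)"
      using orthonormal_span_expand[OF E(2,1) subset_refl] by simp
    moreover have "\<bar>x \<bullet> e\<bar> \<le> 1" if "e \<in> E" for e
      using Cauchy_Schwarz_ineq2[of x e] x that E by (auto simp: orthonormal_def)
    ultimately show "x \<in> K \<inter> {x. norm x = 1}" using x unfolding K_def by auto
  next
    fix x assume "x \<in> K \<inter> {x. norm x = 1}"
    then show "x \<in> {x \<in> span E. norm x = 1}"
      unfolding K_def by (auto intro!: span_sum span_scale intro: span_base)
  qed
  then show ?thesis using compact_box_span[OF E(1)] by (auto simp: K_def intro!: compact_Int_closed closed_Collect_eq continuous_intros)
qed

lemma nonneg_quadratic_imp_zero:
  fixes b c :: real
  assumes "\<And>t. 0 \<le> 2 * t * b + t\<^sup>2 * c"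
  shows "b = 0"
proof (rule ccontr)
  assume b: "b \<noteq> 0"
  define K where "K = \<bar>c\<bar> + 1"
  have K: "K > 0" "c \<le> K" by (auto simp: K_def)
  have "0 \<le> 2 * (- b / K) * b + (- b / K)\<^sup>2 * c" by (rule assms)
  also have "\<dots> \<le> 2 * (- b / K) * b + (- b / K)\<^sup>2 * K" using K by (intro add_left_mono mult_left_mono) auto
  also have "\<dots> = - (b\<^sup>2 / K)" using K by (simp add: power2_eq_square field_simps)
  finally show False using b K by (simp add: divide_le_0_iff not_less zero_le_divide_iff)
qed

text \<open>Functional calculus of an operator with eigenvectors U and eigenvalues \<sigma>. On the
  orthogonal complement of U, where such an operator vanishes, the function acts by its value at 0.
  Equal eigenvalues are not grouped, so every rule is a computation with finite sums.\<close>

definition spec_fun :: "'a::real_inner set \<Rightarrow> ('a \<Rightarrow> real) \<Rightarrow> (real \<Rightarrow> real) \<Rightarrow> 'a \<Rightarrow> 'a" where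
  "spec_fun U \<sigma> h v = (\<Sum>u\<in>U. (h (\<sigma> u) * (v \<bullet> u)) *\<^sub>R u) + h 0 *\<^sub>R (v - (\<Sum>u\<in>U. (v \<bullet> u) *\<^sub>R u))"

definition spectral_rep :: "('a \<Rightarrow> 'a::real_inner) \<Rightarrow> 'a set \<Rightarrow> ('a \<Rightarrow> real) \<Rightarrow> bool" where
  "spectral_rep A U \<sigma> \<longleftrightarrow> finite U \<and> orthonormal U \<and> (\<forall>u\<in>U. 0 < \<sigma> u) \<and>
     (\<forall>v. A v = (\<Sum>u\<in>U. (\<sigma> u * (v \<bullet> u)) *\<^sub>R u))"

text \<open>Take an orthonormal family of eigenvectors with positive eigenvalues, of largest
  cardinality inside the finite-dimensional \<open>span E\<close>. If the operator A' left after
  removing its contribution were nonzero there, a maximizer of its Rayleigh quotient would be one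
  more eigenvector.\<close>

lemma finite_rank_spectral_rep:
  fixes a :: "'i \<Rightarrow> 'a::real_inner"
  assumes I: "finite I" and c: "\<And>i. i \<in> I \<Longrightarrow> 0 \<le> c i"
    and A: "\<And>v. A v = (\<Sum>i\<in>I. (c i * (v \<bullet> a i)) *\<^sub>R a i)"
  shows "\<exists>U \<sigma>. spectral_rep A U \<sigma>"
proof -
  obtain E where E: "finite E" "orthonormal E" "a ` I \<subseteq> span E"
    using finite_orthonormal_span[of "a ` I"] I by auto
  have A_span: "A v \<in> span E" for v unfolding A using E(3) by (intro span_sum span_scale) auto
  have A_sym: "A v \<bullet> w = v \<bullet> A w" for v w
    unfolding A by (simp add: inner_sum_left inner_sum_right inner_commute mult.commute mult.left_commute)
  have A_add: "A (v + w) = A v + A w" for v w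
    unfolding A by (simp add: inner_add_left algebra_simps sum.distrib)
  have A_scale: "A (r *\<^sub>R v) = r *\<^sub>R A v" for r v
    unfolding A by (simp add: scaleR_sum_right mult.left_commute)
  have A_psd: "0 \<le> A v \<bullet> v" for v
  proof -
    have "A v \<bullet> v = (\<Sum>i\<in>I. c i * (v \<bullet> a i)\<^sup>2)"
      unfolding A inner_sum_left by (simp add: inner_commute power2_eq_square mult.assoc)
    then show ?thesis using c by (auto intro!: sum_nonneg mult_nonneg_nonneg)
  qed
  define P where "P U \<sigma> \<longleftrightarrow> finite U \<and> orthonormal U \<and> U \<subseteq> span E \<and> (\<forall>u\<in>U. 0 < \<sigma> u \<and> A u = \<sigma> u *\<^sub>R u)"
    for U and \<sigma> :: "'a \<Rightarrow> real"
  have card_le: "card U \<le> card E" if "P U \<sigma>" for U \<sigma>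
  proof -
    have "independent U"
      using that by (intro pairwise_orthogonal_independent) (auto simp: P_def orthonormal_def)
    then show ?thesis using independent_span_bound[OF E(1)] that by (auto simp: P_def)
  qed
  have "P {} (\<lambda>_. 1)" by (auto simp: P_def orthonormal_def)
  moreover have "\<forall>p. P (fst p) (snd p) \<longrightarrow> card (fst p) < Suc (card E)"
    using card_le by (simp add: less_Suc_eq_le)
  ultimately have "\<exists>p. P (fst p) (snd p) \<and> (\<forall>q. P (fst q) (snd q) \<longrightarrow> card (fst q) \<le> card (fst p))"
    by (intro ex_has_greatest_nat[of _ "({}, \<lambda>_. 1)" _ "Suc (card E)"]) simp_all
  then obtain p where p: "P (fst p) (snd p)" and max: "\<And>q. P (fst q) (snd q) \<Longrightarrow> card (fst q) \<le> card (fst p)"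
    by blast
  define U \<sigma> where "U = fst p" and "\<sigma> = snd p"
  have U: "finite U" "orthonormal U" "U \<subseteq> span E" "\<And>u. u \<in> U \<Longrightarrow> 0 < \<sigma> u" "\<And>u. u \<in> U \<Longrightarrow> A u = \<sigma> u *\<^sub>R u"
    using p by (auto simp: P_def U_def \<sigma>_def)
  define A' where "A' v = A v - (\<Sum>u\<in>U. (\<sigma> u * (v \<bullet> u)) *\<^sub>R u)" for v
  have A'_span: "A' v \<in> span E" for v
    unfolding A'_def using U(3) A_span by (intro span_diff span_sum span_scale) auto
  have A'_sym: "A' v \<bullet> w = v \<bullet> A' w" for v w
    unfolding A'_def using A_sym[of v w] by (simp add: inner_diff_left inner_diff_right inner_sum_left inner_sum_right
        inner_commute mult.commute mult.left_commute)
  have A'_add: "A' (v + w) = A' v + A' w" for v w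
    unfolding A'_def A_add by (simp add: inner_add_left algebra_simps sum.distrib)
  have A'_scale: "A' (r *\<^sub>R v) = r *\<^sub>R A' v" for r v
    unfolding A'_def A_scale by (simp add: scaleR_sum_right mult.left_commute algebra_simps)
  have A'_U: "A' u = 0" if "u \<in> U" for u
  proof -
    have "(\<Sum>u'\<in>U. (\<sigma> u' * (u \<bullet> u')) *\<^sub>R u') = (\<Sum>u'\<in>U. if u' = u then \<sigma> u *\<^sub>R u else 0)"
      using that by (intro sum.cong refl) (auto simp: orthonormal_inner[OF U(2)])
    then show ?thesis using that U by (simp add: A'_def)
  qed
  \<comment> \<open>Removing the U-components of v leaves the form of A' unchanged, and on vectors
    orthogonal to U it agrees with the form of A.\<close>
  have A'_psd: "0 \<le> A' v \<bullet> v" for v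
  proof -
    define w where "w = v - (\<Sum>u\<in>U. (v \<bullet> u) *\<^sub>R u)"
    have "A' (\<Sum>u\<in>V. (v \<bullet> u) *\<^sub>R u) = 0" if "V \<subseteq> U" "finite V" for V
      using that(2,1) by (induction V) (auto simp: A'_add A'_scale A'_U A'_scale[of 0 0, simplified])
    then have s0: "A' (\<Sum>u\<in>U. (v \<bullet> u) *\<^sub>R u) = 0" using U(1) by auto
    have v: "v = w + (\<Sum>u\<in>U. (v \<bullet> u) *\<^sub>R u)" by (simp add: w_def)
    have "A' v = A' w" by (subst v) (simp add: A'_add s0)
    then have "A' v \<bullet> v = w \<bullet> A' v" by (metis A'_sym)
    also have "\<dots> = A' w \<bullet> w" using \<open>A' v = A' w\<close> by (simp add: inner_commute)
    also have "A' w = A w"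
    proof -
      have "w \<bullet> u = 0" if "u \<in> U" for u
        using orthonormal_sum_inner[OF U(2,1) subset_refl that] that by (simp add: w_def inner_diff_left)
      then show ?thesis by (simp add: A'_def)
    qed
    finally show ?thesis using A_psd by simp
  qed
  have "A' v = 0" if "v \<in> span E" for v
  proof (rule ccontr)
    assume v: "A' v \<noteq> 0"
    define S where "S = {x \<in> span E. norm x = 1}"
    have "compact S" unfolding S_def by (rule compact_sphere_span[OF E(1,2)])
    moreover have v0: "v \<noteq> 0" using v A'_scale[of 0 0] by auto
    then have "(1 / norm v) *\<^sub>R v \<in> S" using that by (auto simp: S_def span_scale)
    then have "S \<noteq> {}" by blast
    moreover have "continuous_on S (\<lambda>x. A' x \<bullet> x)"
      unfolding A'_def A by (intro continuous_intros)
    ultimately obtain x where x: "x \<in> S" and xmax: "\<And>y. y \<in> S \<Longrightarrow> A' y \<bullet> y \<le> A' x \<bullet> x"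
      using continuous_attains_sup[of S "\<lambda>x. A' x \<bullet> x"] by blast
    define M where "M = A' x \<bullet> x"
    have xE: "x \<in> span E" and x1: "norm x = 1" using x by (auto simp: S_def)
    have le: "A' y \<bullet> y \<le> M * (y \<bullet> y)" if y: "y \<in> span E" for y
    proof (cases "y = 0")
      case False
      then have "(1 / norm y) *\<^sub>R y \<in> S" using y by (auto simp: S_def span_scale)
      moreover have "A' ((1 / norm y) *\<^sub>R y) \<bullet> ((1 / norm y) *\<^sub>R y) = A' y \<bullet> y / (norm y)\<^sup>2"
        unfolding A'_scale inner_scaleR_left inner_scaleR_right power2_eq_square by simp
      ultimately have "A' y \<bullet> y / (norm y)\<^sup>2 \<le> M"
        using xmax M_def by metis
      then show ?thesis using False by (simp add: divide_le_eq power2_norm_eq_inner)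
    qed simp
    \<comment> \<open>First-order condition at the maximizer x: the form of \<open>M - A'\<close> is
      nonnegative on \<open>span E\<close> and vanishes at x, so its linear term in every direction
      y is zero.\<close>
    have eig: "(M *\<^sub>R x - A' x) \<bullet> y = 0" if y: "y \<in> span E" for y
    proof (rule nonneg_quadratic_imp_zero)
      fix t
      have "x + t *\<^sub>R y \<in> span E" using xE y by (intro span_add span_scale)
      from le[OF this] have "0 \<le> M * ((x + t *\<^sub>R y) \<bullet> (x + t *\<^sub>R y)) - A' (x + t *\<^sub>R y) \<bullet> (x + t *\<^sub>R y)" by simp
      also have "\<dots> = 2 * t * ((M *\<^sub>R x - A' x) \<bullet> y) + t\<^sup>2 * (M * (y \<bullet> y) - A' y \<bullet> y)"
      proof -
        have xx: "x \<bullet> x = 1" using x1 by (simp add: norm_eq_1)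
        have yx: "A' y \<bullet> x = A' x \<bullet> y" by (metis A'_sym inner_commute)
        have "(x + t *\<^sub>R y) \<bullet> (x + t *\<^sub>R y) = 1 + 2 * t * (x \<bullet> y) + t\<^sup>2 * (y \<bullet> y)"
          by (simp add: inner_add_left inner_add_right xx inner_commute[of y x] power2_eq_square algebra_simps)
        moreover have "A' (x + t *\<^sub>R y) \<bullet> (x + t *\<^sub>R y) = M + 2 * t * (A' x \<bullet> y) + t\<^sup>2 * (A' y \<bullet> y)"
          by (simp add: A'_add A'_scale inner_add_left inner_add_right yx M_def power2_eq_square algebra_simps)
        ultimately show ?thesis by (simp only: inner_diff_left inner_scaleR_left) (simp add: algebra_simps)
      qed
      finally show "0 \<le> 2 * t * ((M *\<^sub>R x - A' x) \<bullet> y) + t\<^sup>2 * (M * (y \<bullet> y) - A' y \<bullet> y)" .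
    qed
    have "M *\<^sub>R x - A' x \<in> span E" using xE A'_span by (intro span_diff span_scale)
    then have A'x: "A' x = M *\<^sub>R x" using eig by (metis inner_eq_zero_iff right_minus_eq)
    \<comment> \<open>With M nonpositive the form of A' vanishes on \<open>span E\<close>; varying v
      along \<open>A' v\<close> then forces \<open>A' v = 0\<close>.\<close>
    have "M > 0"
    proof (rule ccontr)
      assume "\<not> M > 0"
      then have q0: "A' y \<bullet> y = 0" if "y \<in> span E" for y
        using le[OF that] A'_psd[of y] mult_nonpos_nonneg[of M "y \<bullet> y"] by simp
      have "A' v \<bullet> A' v = 0"
      proof (rule nonneg_quadratic_imp_zero[of _ 0])
        fix t
        have "0 = A' (v + t *\<^sub>R A' v) \<bullet> (v + t *\<^sub>R A' v)"
          using q0[of "v + t *\<^sub>R A' v"] that A'_span by (simp add: span_add span_scale)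
        also have "\<dots> = 2 * t * (A' v \<bullet> A' v)"
          using q0[OF that] q0[OF A'_span[of v]] A'_sym[of "A' v" v]
          by (simp add: A'_add A'_scale inner_add_left inner_add_right)
        finally show "0 \<le> 2 * t * (A' v \<bullet> A' v) + t\<^sup>2 * 0" by auto
      qed
      then show False using v by simp
    qed
    have xU: "x \<bullet> u = 0" if "u \<in> U" for u
    proof -
      have "M * (x \<bullet> u) = A' x \<bullet> u" by (simp add: A'x)
      also have "\<dots> = 0" using A'_sym[of x u] A'_U[OF that] by simp
      finally show ?thesis using \<open>M > 0\<close> by simp
    qed
    have xnU: "x \<notin> U" using xU[of x] x1 by (auto simp: norm_eq_1)
    have "A x = M *\<^sub>R x" using A'x xU by (simp add: A'_def)
    then have "P (insert x U) (\<sigma>(x := M))"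
      using U xE x1 xU xnU \<open>M > 0\<close>
      by (auto simp: P_def orthonormal_def pairwise_insert orthogonal_def inner_commute)
    then have "card (insert x U) \<le> card U" using max[of "(insert x U, \<sigma>(x := M))"] by (simp add: U_def)
    then show False using U(1) xnU by simp
  qed note A'_zero = this
  \<comment> \<open>The component q of v orthogonal to \<open>span E\<close> is killed by A and
    orthogonal to U, so the identity on \<open>span E\<close> carries over to all v.\<close>
  have "A v = (\<Sum>u\<in>U. (\<sigma> u * (v \<bullet> u)) *\<^sub>R u)" for v
  proof -
    define q where "q = v - (\<Sum>e\<in>E. (v \<bullet> e) *\<^sub>R e)"
    have q: "q \<bullet> y = 0" if "y \<in> span E" for y
    proof -
      have qe: "q \<bullet> e = 0" if "e \<in> E" for e
        using orthonormal_sum_inner[OF E(2,1) subset_refl that] that by (simp add: q_def inner_diff_left)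
      show ?thesis using that
        by (induction rule: span_induct_alt) (simp_all add: inner_add_right qe)
    qed
    have "q \<bullet> a i = 0" if "i \<in> I" for i using q E(3) that by blast
    moreover have "q \<bullet> u = 0" if "u \<in> U" for u using q U(3) that by blast
    ultimately have "A' q = 0" by (simp add: A'_def A)
    moreover have "A' (\<Sum>e\<in>E. (v \<bullet> e) *\<^sub>R e) = 0" by (intro A'_zero span_sum span_scale span_base)
    moreover have "A' v = A' q + A' (\<Sum>e\<in>E. (v \<bullet> e) *\<^sub>R e)"
      unfolding A'_add[symmetric] by (simp add: q_def)
    ultimately have "A' v = 0" by simp
    then show ?thesis by (simp add: A'_def)
  qed
  then show ?thesis using U unfolding spectral_rep_def by blast
qed

section \<open>Rules of the functional calculus\<close>

lemma spectral_repD: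
  assumes "spectral_rep A U \<sigma>"
  shows "finite U" "orthonormal U" "\<And>u. u \<in> U \<Longrightarrow> 0 < \<sigma> u"
    "\<And>v. A v = (\<Sum>u\<in>U. (\<sigma> u * (v \<bullet> u)) *\<^sub>R u)"
  using assms by (auto simp: spectral_rep_def)

text \<open>The labels \<sigma> are arbitrary real numbers and no operator is attached, so the rules
  can be applied to any assignment of values to a finite orthonormal family.\<close>

locale orthonormal_family =
  fixes U :: "'a::real_inner set" and \<sigma> :: "'a \<Rightarrow> real"
  assumes finite_U: "finite U" and orthonormal_U: "orthonormal U"
begin

abbreviation F where "F \<equiv> spec_fun U \<sigma>"

lemma spec_fun_add: "F h (v + w) = F h v + F h w"
  by (simp add: spec_fun_def inner_add_left algebra_simps sum.distrib)

lemma spec_fun_scale: "F h (r *\<^sub>R v) = r *\<^sub>R F h v"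
  by (simp add: spec_fun_def scaleR_sum_right algebra_simps)

lemma spec_fun_zero [simp]: "F h 0 = 0"
  using spec_fun_scale[of h 0 0] by simp

lemma spec_fun_minus: "F h (v - w) = F h v - F h w"
  using spec_fun_add[of h v "-w"] spec_fun_scale[of h "-1" w] by simp

lemma spec_fun_inner: "F h v \<bullet> w = (\<Sum>u\<in>U. h (\<sigma> u) * (v \<bullet> u) * (w \<bullet> u))
    + h 0 * (v \<bullet> w - (\<Sum>u\<in>U. (v \<bullet> u) * (w \<bullet> u)))"
  unfolding spec_fun_def inner_add_left inner_sum_left inner_diff_left inner_scaleR_left
  by (simp add: inner_commute)

lemma spec_fun_sym: "F h v \<bullet> w = v \<bullet> F h w"
  unfolding inner_commute[of v] spec_fun_inner by (simp add: inner_commute mult.commute mult.left_commute)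

lemma spec_fun_inner_U:
  assumes "u \<in> U"
  shows "F h v \<bullet> u = h (\<sigma> u) * (v \<bullet> u)"
proof -
  have "(\<Sum>u'\<in>U. h (\<sigma> u') * (v \<bullet> u') * (u \<bullet> u')) = (\<Sum>u'\<in>U. if u' = u then h (\<sigma> u) * (v \<bullet> u) else 0)"
    using assms by (intro sum.cong refl) (auto simp: orthonormal_inner[OF orthonormal_U])
  moreover have "(\<Sum>u'\<in>U. (v \<bullet> u') * (u \<bullet> u')) = (\<Sum>u'\<in>U. if u' = u then (v \<bullet> u) else 0)"
    using assms by (intro sum.cong refl) (auto simp: orthonormal_inner[OF orthonormal_U])
  ultimately show ?thesis using assms finite_U by (simp add: spec_fun_inner)
qed

lemma spec_fun_mult: "F h (F g v) = F (\<lambda>s. h s * g s) v"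
proof -
  have "F g v - (\<Sum>u\<in>U. (F g v \<bullet> u) *\<^sub>R u) = g 0 *\<^sub>R (v - (\<Sum>u\<in>U. (v \<bullet> u) *\<^sub>R u))"
    by (simp add: spec_fun_inner_U) (simp add: spec_fun_def)
  then show ?thesis
    by (subst (1) spec_fun_def) (simp add: spec_fun_inner_U, simp add: spec_fun_def mult.assoc)
qed

lemma spec_fun_one: "F (\<lambda>s. 1) v = v"
  by (simp add: spec_fun_def)

lemma spec_fun_plus_fun: "F (\<lambda>s. h s + g s) v = F h v + F g v"
  by (simp add: spec_fun_def algebra_simps sum.distrib)

lemma spec_fun_scale_fun: "F (\<lambda>s. c * h s) v = c *\<^sub>R F h v"
  by (simp add: spec_fun_def algebra_simps scaleR_sum_right)

lemma spec_fun_diff_fun: "F (\<lambda>s. h s - g s) v = F h v - F g v"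
  using spec_fun_plus_fun[of h "\<lambda>s. - g s"] spec_fun_scale_fun[of "-1" g v] by simp

lemma spec_fun_cong:
  assumes "\<And>u. u \<in> U \<Longrightarrow> h (\<sigma> u) = g (\<sigma> u)" "h 0 = g 0"
  shows "F h v = F g v"
  using assms by (simp add: spec_fun_def cong: sum.cong)

text \<open>The complement of U carries \<open>v \<bullet> v\<close> minus the squared coefficients,
  nonnegative by Bessel; pointwise inequalities at 0 and at the labels therefore suffice.\<close>

lemma spec_fun_mono:
  assumes "\<And>u. u \<in> U \<Longrightarrow> h (\<sigma> u) \<le> g (\<sigma> u)" "h 0 \<le> g 0"
  shows "F h v \<bullet> v \<le> F g v \<bullet> v"
proof -
  have "(\<Sum>u\<in>U. (v \<bullet> u) * (v \<bullet> u)) \<le> v \<bullet> v"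
    using bessel[OF orthonormal_U finite_U subset_refl, of v] by (simp add: power2_norm_eq_inner flip: power2_eq_square)
  then show ?thesis
    unfolding spec_fun_inner mult.assoc using assms
    by (intro add_mono sum_mono mult_right_mono) (auto simp flip: power2_eq_square)
qed

lemma spec_fun_nonneg:
  assumes "\<And>u. u \<in> U \<Longrightarrow> 0 \<le> h (\<sigma> u)" "0 \<le> h 0"
  shows "0 \<le> F h v \<bullet> v"
  using spec_fun_mono[of "\<lambda>_. 0" h v] assms by (simp add: spec_fun_def)

lemma spec_fun_norm: "(norm (F h v))\<^sup>2 = F (\<lambda>s. (h s)\<^sup>2) v \<bullet> v"
proof -
  have "(norm (F h v))\<^sup>2 = F h (F h v) \<bullet> v"
    using spec_fun_sym[of h "F h v" v] by (simp add: power2_norm_eq_inner inner_commute)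
  then show ?thesis by (simp add: spec_fun_mult power2_eq_square)
qed

lemma spec_fun_norm_le:
  assumes "\<And>u. u \<in> U \<Longrightarrow> \<bar>h (\<sigma> u)\<bar> \<le> c" "\<bar>h 0\<bar> \<le> c"
  shows "norm (F h v) \<le> c * norm v"
proof -
  have c: "0 \<le> c" using assms(2) by linarith
  have sq: "x\<^sup>2 \<le> c\<^sup>2" if "\<bar>x\<bar> \<le> c" for x using that by (metis abs_ge_zero power2_abs power_mono)
  have "(norm (F h v))\<^sup>2 \<le> F (\<lambda>s. c\<^sup>2) v \<bullet> v"
    unfolding spec_fun_norm using assms sq by (intro spec_fun_mono) auto
  also have "\<dots> = (c * norm v)\<^sup>2"
    using spec_fun_scale_fun[of "c\<^sup>2" "\<lambda>_. 1" v] by (simp add: spec_fun_one power_mult_distrib power2_norm_eq_inner)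
  finally show ?thesis by (rule power2_le_imp_le) (use c in auto)
qed

end

lemma spectral_rep_family: "spectral_rep A U \<sigma> \<Longrightarrow> orthonormal_family U"
  by unfold_locales (auto simp: spectral_rep_def)

lemma spectral_rep_spec_fun: "spectral_rep A U \<sigma> \<Longrightarrow> A v = spec_fun U \<sigma> (\<lambda>s. s) v"
  by (simp add: spectral_rep_def spec_fun_def)

section \<open>Agreement with the calculus by eigenprojections\<close>

lemma orth_proj_eqI:
  assumes "subspace S" "p \<in> S" "\<And>w. w \<in> S \<Longrightarrow> (v - p) \<bullet> w = 0"
  shows "orth_proj S v = p"
  unfolding orth_proj_def
proof (rule the_equality)
  show "p \<in> S \<and> (\<forall>w\<in>S. orthogonal (v - p) w)" using assms by (auto simp: orthogonal_def)
  fix p' assume p': "p' \<in> S \<and> (\<forall>w\<in>S. orthogonal (v - p') w)"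
  have d: "p' - p \<in> S" using p' assms subspace_diff by blast
  have "(p' - p) \<bullet> (p' - p) = (v - p) \<bullet> (p' - p) - (v - p') \<bullet> (p' - p)"
    by (simp add: inner_diff_left)
  also have "\<dots> = 0" using d p' assms(3) by (auto simp: orthogonal_def)
  finally show "p' = p" by simp
qed

text \<open>The defining sum uses projections onto whole eigenspaces. It is supported on 0 and the
  values of \<sigma>; at a nonzero value the projection collects all u sharing it, and at 0 it is
  the projection onto the complement of U.\<close>

lemma fun_calc_spectral_rep:
  assumes "spectral_rep A U \<sigma>"
  shows "fun_calc g A v = spec_fun U \<sigma> g v"
proof -
  note R = spectral_repD[OF assms]
  interpret orthonormal_family U \<sigma> using assms by (rule spectral_rep_family)
  have A_U: "A w \<bullet> u = \<sigma> u * (w \<bullet> u)" if "u \<in> U" for u w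
    using spec_fun_inner_U[OF that, of "\<lambda>s. s" w] spectral_rep_spec_fun[OF assms, of w] by simp
  have A_add: "A (x + y) = A x + A y" and A_scale: "A (c *\<^sub>R x) = c *\<^sub>R A x" for x y c
    by (auto simp: spectral_rep_spec_fun[OF assms] spec_fun_add spec_fun_scale)
  have sub: "subspace (eigenspace A s)" for s
    using A_scale[of 0 0] by (intro subspaceI) (auto simp: eigenspace_def A_add A_scale algebra_simps)
  define Us where "Us s = {u \<in> U. \<sigma> u = s}" for s
  have Us: "finite (Us s)" "Us s \<subseteq> U" for s using finite_U by (auto simp: Us_def)
  have sum_A: "A (\<Sum>u\<in>Us s. c u *\<^sub>R u) = s *\<^sub>R (\<Sum>u\<in>Us s. c u *\<^sub>R u)" for s c
  proof -
    have "A (\<Sum>u\<in>Us s. c u *\<^sub>R u) = (\<Sum>u\<in>U. (\<sigma> u * (if u \<in> Us s then c u else 0)) *\<^sub>R u)"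
      unfolding R(4) by (intro sum.cong refl) (simp add: orthonormal_sum_inner[OF orthonormal_U Us])
    also have "\<dots> = (\<Sum>u\<in>Us s. (s * c u) *\<^sub>R u)"
      using finite_U by (intro sum.mono_neutral_cong_right) (auto simp: Us_def)
    finally show ?thesis by (simp add: scaleR_sum_right)
  qed
  have eig: "w \<bullet> u = 0" if "w \<in> eigenspace A s" "u \<in> U" "\<sigma> u \<noteq> s" for w s u
    using A_U[OF that(2), of w] that by (auto simp: eigenspace_def)
  have perp: "(v - (\<Sum>u\<in>Us s. (v \<bullet> u) *\<^sub>R u)) \<bullet> w = 0" if w: "w \<in> eigenspace A s" and s: "s \<noteq> 0" for w s
  proof -
    have "s *\<^sub>R w = (\<Sum>u\<in>U. (\<sigma> u * (w \<bullet> u)) *\<^sub>R u)" using w R(4) by (simp add: eigenspace_def)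
    also have "\<dots> = (\<Sum>u\<in>Us s. (s * (w \<bullet> u)) *\<^sub>R u)"
      using finite_U eig[OF w] by (intro sum.mono_neutral_cong_right) (auto simp: Us_def)
    also have "\<dots> = s *\<^sub>R (\<Sum>u\<in>Us s. (w \<bullet> u) *\<^sub>R u)" by (simp add: scaleR_sum_right)
    finally have we: "w = (\<Sum>u\<in>Us s. (w \<bullet> u) *\<^sub>R u)" using s by simp
    have "(v - (\<Sum>u\<in>Us s. (v \<bullet> u) *\<^sub>R u)) \<bullet> u = 0" if "u \<in> Us s" for u
    proof -
      have "u \<in> U" using that Us by blast
      from orthonormal_sum_inner[OF orthonormal_U Us this, of "\<lambda>u. v \<bullet> u" s] that
      show ?thesis by (simp add: inner_diff_left)
    qed
    then show ?thesis by (subst we) (simp add: inner_sum_right)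
  qed
  have proj: "orth_proj (eigenspace A s) v = (\<Sum>u\<in>Us s. (v \<bullet> u) *\<^sub>R u)" if "s \<noteq> 0" for s
    by (rule orth_proj_eqI[OF sub]) (use that perp sum_A in \<open>auto simp: eigenspace_def\<close>)
  have proj0: "orth_proj (eigenspace A 0) v = v - (\<Sum>u\<in>U. (v \<bullet> u) *\<^sub>R u)"
  proof (rule orth_proj_eqI[OF sub])
    have "(v - (\<Sum>u\<in>U. (v \<bullet> u) *\<^sub>R u)) \<bullet> u = 0" if "u \<in> U" for u
      using that orthonormal_sum_inner[OF orthonormal_U finite_U subset_refl, of u] by (simp add: inner_diff_left)
    then show "v - (\<Sum>u\<in>U. (v \<bullet> u) *\<^sub>R u) \<in> eigenspace A 0" by (simp add: eigenspace_def R(4))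
    fix w assume w: "w \<in> eigenspace A 0"
    have "u \<bullet> w = 0" if "u \<in> U" for u using eig[OF w that] R(3)[OF that] by (simp add: inner_commute)
    then show "(v - (v - (\<Sum>u\<in>U. (v \<bullet> u) *\<^sub>R u))) \<bullet> w = 0" by (simp add: inner_sum_left)
  qed
  have triv: "orth_proj {0} v = 0" by (rule orth_proj_eqI) (auto simp: subspace_def)
  have ev: "s \<in> insert 0 (\<sigma> ` U)" if "eigenspace A s \<noteq> {0}" for s
  proof (rule ccontr)
    assume s: "s \<notin> insert 0 (\<sigma> ` U)"
    have "0 \<in> eigenspace A s" by (rule subspace_0[OF sub])
    with that have "\<not> eigenspace A s \<subseteq> {0}" by (metis empty_subsetI insert_subset subset_antisym)
    then obtain w where w: "w \<in> eigenspace A s" "w \<noteq> 0" by (auto simp: subset_iff)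
    then have "s *\<^sub>R w = (\<Sum>u\<in>U. (\<sigma> u * (w \<bullet> u)) *\<^sub>R u)" using R(4) by (simp add: eigenspace_def)
    also have "\<dots> = 0" using eig[OF w(1)] s by (intro sum.neutral) auto
    finally have "s = 0 \<or> w = 0" by (simp only: scaleR_eq_0_iff)
    then show False using w(2) s by simp
  qed
  \<comment> \<open>The value 0 is included even when the kernel is trivial; the projection onto the
    zero space contributes nothing.\<close>
  have "fun_calc g A v = (\<Sum>\<^sub>\<infinity>s\<in>insert 0 (\<sigma> ` U). g s *\<^sub>R orth_proj (eigenspace A s) v)"
    unfolding fun_calc_def by (rule infsum_cong_neutral) (use ev triv in auto)
  also have "\<dots> = (\<Sum>s\<in>insert 0 (\<sigma> ` U). g s *\<^sub>R orth_proj (eigenspace A s) v)"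
    using finite_U by simp
  also have "\<dots> = g 0 *\<^sub>R (v - (\<Sum>u\<in>U. (v \<bullet> u) *\<^sub>R u)) + (\<Sum>s\<in>\<sigma> ` U. g s *\<^sub>R orth_proj (eigenspace A s) v)"
    using finite_U R(3) by (subst sum.insert) (force simp: proj0 image_iff)+
  also have "(\<Sum>s\<in>\<sigma> ` U. g s *\<^sub>R orth_proj (eigenspace A s) v)
      = (\<Sum>s\<in>\<sigma> ` U. \<Sum>u\<in>{u \<in> U. \<sigma> u = s}. (g (\<sigma> u) * (v \<bullet> u)) *\<^sub>R u)"
  proof (intro sum.cong refl)
    fix s assume "s \<in> \<sigma> ` U"
    then have "s \<noteq> 0" using R(3) by force
    then show "g s *\<^sub>R orth_proj (eigenspace A s) v = (\<Sum>u\<in>{u \<in> U. \<sigma> u = s}. (g (\<sigma> u) * (v \<bullet> u)) *\<^sub>R u)"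
      by (simp add: proj Us_def scaleR_sum_right)
  qed
  also have "\<dots> = (\<Sum>u\<in>U. (g (\<sigma> u) * (v \<bullet> u)) *\<^sub>R u)"
    by (rule sum.image_gen[OF finite_U, symmetric])
  finally show ?thesis by (simp add: spec_fun_def)
qed

lemma spectral_rep_in_spectrum:
  assumes "spectral_rep A U \<sigma>" "u \<in> U"
  shows "\<sigma> u \<in> spectrum A"
proof -
  interpret orthonormal_family U \<sigma> using assms by (intro spectral_rep_family)
  have "u \<bullet> u = 1" using orthonormal_inner[OF orthonormal_U assms(2) assms(2)] by simp
  then have u0: "u \<noteq> 0" by auto
  have "A u = (\<Sum>u'\<in>U. if u' = u then \<sigma> u *\<^sub>R u else 0)"
    unfolding spectral_repD(4)[OF assms(1)] using assms(2)
    by (intro sum.cong refl) (auto simp: orthonormal_inner[OF orthonormal_U])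
  then have Au: "A u - \<sigma> u *\<^sub>R u = 0" using assms(2) finite_U by simp
  show ?thesis unfolding spectrum_def
  proof (safe)
    fix R assume R: "bounded_linear R" "\<forall>v. R (A v - \<sigma> u *\<^sub>R v) = v"
    have "R 0 = u" using R(2) Au by metis
    then show False using linear_0[OF bounded_linear.linear[OF R(1)]] u0 by simp
  qed
qed

text \<open>Eigenvalues may repeat, while the defining sum runs over distinct ones, so the expansion
  in f is regrouped along the fibres of \<mu>. Boundedness of h on the eigenvalues makes the
  expansion summable.\<close>

lemma fun_calc_diagonal:
  fixes A :: "'a::{real_inner,banach} \<Rightarrow> 'a" and f :: "nat \<Rightarrow> 'a"
  assumes f: "inj f" "orthonormal_basis (range f)"
    and A: "\<And>w j. A w \<bullet> f j = \<mu> j * (w \<bullet> f j)"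
    and h: "\<And>j. \<bar>h (\<mu> j)\<bar> \<le> c"
  shows "fun_calc h A v \<bullet> f k = h (\<mu> k) * (v \<bullet> f k)"
proof -
  have on: "orthonormal (range f)" using f(2) by (rule orthonormal_basis_orthonormal)
  have ff: "f i \<bullet> f j = (if i = j then 1 else 0)" for i j
    using orthonormal_inner[OF on, of "f i" "f j"] f(1) by (auto simp: inj_eq)
  have c: "0 \<le> c" using h[of 0] by linarith
  have expand: "((\<lambda>j. (w \<bullet> f j) *\<^sub>R f j) has_sum w) UNIV" for w
    using orthonormal_basis_has_sum[OF f(2), of w] has_sum_reindex[OF f(1), of "\<lambda>e. (w \<bullet> e) *\<^sub>R e" w]
    by (simp add: o_def)
  have eqI: "w = w'" if "\<And>j. w \<bullet> f j = w' \<bullet> f j" for w w'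
    using expand[of w] expand[of w'] that has_sum_unique by fastforce
  have eig: "eigenspace A s = {w. \<forall>j. \<mu> j \<noteq> s \<longrightarrow> w \<bullet> f j = 0}" for s
  proof (intro set_eqI iffI)
    fix w assume "w \<in> eigenspace A s"
    then have "s * (w \<bullet> f j) = \<mu> j * (w \<bullet> f j)" for j using A[of w j] by (simp add: eigenspace_def)
    then show "w \<in> {w. \<forall>j. \<mu> j \<noteq> s \<longrightarrow> w \<bullet> f j = 0}" by auto
  next
    fix w assume w: "w \<in> {w. \<forall>j. \<mu> j \<noteq> s \<longrightarrow> w \<bullet> f j = 0}"
    have "A w = s *\<^sub>R w" by (rule eqI) (use A w in auto)
    then show "w \<in> eigenspace A s" by (simp add: eigenspace_def)
  qed
  have sub: "subspace (eigenspace A s)" for s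
    unfolding eig by (intro subspaceI) (auto simp: inner_add_left)
  have summ: "(\<lambda>j. (d j * (v \<bullet> f j)) *\<^sub>R f j) summable_on B" if d: "\<And>j. \<bar>d j\<bar> \<le> c'" for d :: "nat \<Rightarrow> real" and c' B
  proof -
    have c': "0 \<le> c'" using d[of 0] by linarith
    have "(\<lambda>j. c'\<^sup>2 * (v \<bullet> f j)\<^sup>2) summable_on UNIV"
    proof (rule nonneg_bounded_partial_sums_imp_summable_on)
      show "\<forall>\<^sub>F F in finite_subsets_at_top UNIV. (\<Sum>j\<in>F. c'\<^sup>2 * (v \<bullet> f j)\<^sup>2) \<le> c'\<^sup>2 * (norm v)\<^sup>2"
      proof (rule eventually_finite_subsets_at_top_weakI)
        fix F :: "nat set" assume F: "finite F"
        have "(\<Sum>j\<in>F. (v \<bullet> f j)\<^sup>2) = (\<Sum>e\<in>f ` F. (v \<bullet> e)\<^sup>2)"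
          using f(1) by (subst sum.reindex) (auto simp: inj_on_def inj_def)
        also have "\<dots> \<le> (norm v)\<^sup>2" using F by (intro bessel[OF on]) auto
        finally show "(\<Sum>j\<in>F. c'\<^sup>2 * (v \<bullet> f j)\<^sup>2) \<le> c'\<^sup>2 * (norm v)\<^sup>2"
          by (simp add: sum_distrib_left[symmetric] mult_left_mono)
      qed
    qed simp
    then have "(\<lambda>j. (d j * (v \<bullet> f j)) *\<^sub>R f j) summable_on UNIV"
    proof (rule summable_on_norm_square_bound)
      fix F :: "nat set" assume F: "finite F"
      have "(\<Sum>j\<in>F. (d j * (v \<bullet> f j)) *\<^sub>R f j) = (\<Sum>e\<in>f ` F. (d (inv f e) * (v \<bullet> e)) *\<^sub>R e)"
        using f(1) by (subst sum.reindex) (auto simp: inj_on_def inj_def inv_f_f[OF f(1)])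
      then have "(norm (\<Sum>j\<in>F. (d j * (v \<bullet> f j)) *\<^sub>R f j))\<^sup>2 = (\<Sum>e\<in>f ` F. (d (inv f e) * (v \<bullet> e))\<^sup>2)"
        using F orthonormal_sum_norm[OF on, of "f ` F" "\<lambda>e. d (inv f e) * (v \<bullet> e)"] by auto
      also have "\<dots> = (\<Sum>j\<in>F. (d j * (v \<bullet> f j))\<^sup>2)"
        using f(1) by (subst sum.reindex) (auto simp: inj_on_def inj_def inv_f_f[OF f(1)])
      also have "\<dots> \<le> (\<Sum>j\<in>F. c'\<^sup>2 * (v \<bullet> f j)\<^sup>2)"
        unfolding power_mult_distrib using d c'
        by (intro sum_mono mult_right_mono) (auto simp: abs_le_square_iff[symmetric])
      finally show "(norm (\<Sum>j\<in>F. (d j * (v \<bullet> f j)) *\<^sub>R f j))\<^sup>2 \<le> (\<Sum>j\<in>F. c'\<^sup>2 * (v \<bullet> f j)\<^sup>2)" .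
    qed
    then show ?thesis by (rule summable_on_subset_banach) simp
  qed
  have inner_sum: "(\<Sum>\<^sub>\<infinity>j\<in>B. (d j * (v \<bullet> f j)) *\<^sub>R f j) \<bullet> f k = (if k \<in> B then d k * (v \<bullet> f k) else 0)"
    if d: "\<And>j. \<bar>d j\<bar> \<le> c'" for d :: "nat \<Rightarrow> real" and c' B k
  proof -
    have "((\<lambda>j. ((d j * (v \<bullet> f j)) *\<^sub>R f j) \<bullet> f k) has_sum (\<Sum>\<^sub>\<infinity>j\<in>B. (d j * (v \<bullet> f j)) *\<^sub>R f j) \<bullet> f k) B"
      by (intro has_sum_bounded_linear[OF bounded_linear_inner_left] has_sum_infsum summ[of d c'] d)
    moreover have "((\<lambda>j. ((d j * (v \<bullet> f j)) *\<^sub>R f j) \<bullet> f k) has_sum (\<Sum>j\<in>B \<inter> {k}. d j * (v \<bullet> f j))) B"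
      by (rule has_sum_finite_neutralI[where B = "B \<inter> {k}"]) (auto simp: ff)
    ultimately show ?thesis using has_sum_unique by (cases "k \<in> B") fastforce+
  qed
  define Bs where "Bs s = {j. \<mu> j = s}" for s
  have proj: "orth_proj (eigenspace A s) v = (\<Sum>\<^sub>\<infinity>j\<in>Bs s. (v \<bullet> f j) *\<^sub>R f j)" for s
  proof (rule orth_proj_eqI[OF sub])
    have ip: "(\<Sum>\<^sub>\<infinity>j\<in>Bs s. (v \<bullet> f j) *\<^sub>R f j) \<bullet> f k = (if k \<in> Bs s then v \<bullet> f k else 0)" for k
      using inner_sum[of "\<lambda>_. 1" 1 "Bs s" k] by simp
    then show "(\<Sum>\<^sub>\<infinity>j\<in>Bs s. (v \<bullet> f j) *\<^sub>R f j) \<in> eigenspace A s" by (auto simp: eig Bs_def)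
    fix w assume w: "w \<in> eigenspace A s"
    let ?x = "v - (\<Sum>\<^sub>\<infinity>j\<in>Bs s. (v \<bullet> f j) *\<^sub>R f j)"
    have "((\<lambda>j. ?x \<bullet> ((w \<bullet> f j) *\<^sub>R f j)) has_sum ?x \<bullet> w) UNIV"
      by (intro has_sum_bounded_linear[OF bounded_linear_inner_right] expand)
    moreover have "?x \<bullet> ((w \<bullet> f j) *\<^sub>R f j) = 0" for j
      using w ip[of j] by (auto simp: eig Bs_def inner_diff_left)
    ultimately show "?x \<bullet> w = 0" using has_sum_0 has_sum_unique by (metis (no_types, lifting))
  qed
  have ev: "{s. eigenspace A s \<noteq> {0}} = range \<mu>"
  proof (intro set_eqI iffI)
    fix s assume s: "s \<in> {s. eigenspace A s \<noteq> {0}}"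
    show "s \<in> range \<mu>"
    proof (rule ccontr)
      assume "s \<notin> range \<mu>"
      then have "w = 0" if "w \<in> eigenspace A s" for w using that by (intro eqI) (auto simp: eig)
      then show False using s subspace_0[OF sub[of s]] by blast
    qed
  next
    fix s assume "s \<in> range \<mu>"
    then obtain j where j: "s = \<mu> j" by blast
    have "f j \<in> eigenspace A s" by (simp add: eig j ff)
    moreover have "f j \<noteq> 0" using ff[of j j] by (metis inner_zero_left zero_neq_one)
    ultimately show "s \<in> {s. eigenspace A s \<noteq> {0}}" by auto
  qed
  let ?g = "\<lambda>j. (h (\<mu> j) * (v \<bullet> f j)) *\<^sub>R f j"
  \<comment> \<open>Pairs of an eigenvalue and an index in its fibre correspond to indices, which
    identifies the iterated sum with the plain one.\<close>
  have bij: "bij_betw snd (Sigma (range \<mu>) Bs) UNIV"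
    by (rule bij_betwI[of _ _ _ "\<lambda>j. (\<mu> j, j)"]) (auto simp: Bs_def)
  have "((\<lambda>x. ?g (snd x)) has_sum infsum ?g UNIV) (Sigma (range \<mu>) Bs)"
    using has_sum_infsum[OF summ[of "\<lambda>j. h (\<mu> j)" c UNIV]] h has_sum_reindex_bij_betw[OF bij, of ?g] by simp
  moreover have "((\<lambda>y. ?g (snd (s, y))) has_sum h s *\<^sub>R orth_proj (eigenspace A s) v) (Bs s)" for s
  proof -
    have "((\<lambda>j. h s *\<^sub>R ((v \<bullet> f j) *\<^sub>R f j)) has_sum h s *\<^sub>R (\<Sum>\<^sub>\<infinity>j\<in>Bs s. (v \<bullet> f j) *\<^sub>R f j)) (Bs s)"
      using has_sum_infsum[OF summ[of "\<lambda>_. 1" 1 "Bs s"]]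
      by (intro has_sum_bounded_linear[OF bounded_linear_scaleR_right]) auto
    then show ?thesis unfolding proj by (rule has_sum_cong[THEN iffD1, rotated]) (auto simp: Bs_def)
  qed
  ultimately have "((\<lambda>s. h s *\<^sub>R orth_proj (eigenspace A s) v) has_sum infsum ?g UNIV) (range \<mu>)"
    by (intro has_sum_Sigma[OF isUCont_plus, where f = "\<lambda>x. ?g (snd x)" and B = Bs]) auto
  then have "fun_calc h A v = infsum ?g UNIV"
    unfolding fun_calc_def ev by (rule infsumI)
  then show ?thesis using inner_sum[of "\<lambda>j. h (\<mu> j)" c UNIV k] h by simp
qed

section \<open>Tensors in a vector-valued reproducing kernel space\<close>

text \<open>States that g is the tensor of y and a. The second clause, testing g against every
  element of rank-one form, survives linear combinations in a and limits, so existence can be proved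
  by density before tensors have a name.\<close>

definition represents ::
  "('g::real_inner \<Rightarrow> 'x \<Rightarrow> 'y::real_inner) \<Rightarrow> ('x \<Rightarrow> 'h::real_inner) \<Rightarrow> 'g \<Rightarrow> 'y \<Rightarrow> 'h \<Rightarrow> bool" where
  "represents evl feat g y a \<longleftrightarrow> (\<forall>x. evl g x = (a \<bullet> feat x) *\<^sub>R y) \<and>
     (\<forall>g0 y0 a0. (\<forall>x. evl g0 x = (a0 \<bullet> feat x) *\<^sub>R y0) \<longrightarrow> g0 \<bullet> g = (y0 \<bullet> y) * (a0 \<bullet> a))"

text \<open>Stands for the operator sending v to \<open>(v \<bullet> a) *\<^sub>R y\<close>,
  realized through its function as an element of the vector-valued space.\<close>

definition rkhs_tensor :: "('g \<Rightarrow> 'x \<Rightarrow> 'y::real_inner) \<Rightarrow> ('x \<Rightarrow> 'h::real_inner) \<Rightarrow> 'y \<Rightarrow> 'h \<Rightarrow> 'g" where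
  "rkhs_tensor evl feat y a = the_inv evl (\<lambda>x. (a \<bullet> feat x) *\<^sub>R y)"

locale tensor_rkhs =
  fixes evl :: "'g::{real_inner,banach} \<Rightarrow> 'x \<Rightarrow> 'y::real_inner"
    and feat :: "'x \<Rightarrow> 'h::{real_inner,banach}"
  assumes tensor_G: "vector_rkhs (\<lambda>x t y. (feat x \<bullet> feat t) *\<^sub>R y) evl"
    and total: "\<And>v. (\<And>x. v \<bullet> feat x = 0) \<Longrightarrow> v = 0"
begin

lemma ev_linear: "linear (\<lambda>g. evl g x)"
  using tensor_G by (simp add: vector_rkhs_def)

lemma ev_inj: "inj evl"
  using tensor_G by (simp add: vector_rkhs_def)

lemma ev_section: "\<exists>s. (\<forall>t. evl s t = (feat x \<bullet> feat t) *\<^sub>R y) \<and> (\<forall>g. evl g x \<bullet> y = g \<bullet> s)"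
proof -
  have "\<exists>s. (\<forall>t. evl s t = (feat t \<bullet> feat x) *\<^sub>R y) \<and> (\<forall>g. evl g x \<bullet> y = g \<bullet> s)"
    using tensor_G unfolding vector_rkhs_def by blast
  then show ?thesis by (simp add: inner_commute)
qed

text \<open>The kernel section at x in the direction \<open>evl g x\<close> has norm
  \<open>norm (feat x) * norm (evl g x)\<close>; Cauchy-Schwarz against it bounds the square of the
  value.\<close>

lemma ev_norm_le: "norm (evl g x) \<le> norm (feat x) * norm g"
proof -
  obtain s where s: "\<forall>t. evl s t = (feat x \<bullet> feat t) *\<^sub>R evl g x" "\<forall>g'. evl g' x \<bullet> evl g x = g' \<bullet> s"
    using ev_section by blast
  have "(norm s)\<^sup>2 = evl s x \<bullet> evl g x" using s(2) by (simp add: power2_norm_eq_inner)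
  also have "\<dots> = (norm (feat x) * norm (evl g x))\<^sup>2"
    using s(1) by (simp add: power2_norm_eq_inner power_mult_distrib)
  finally have ns: "norm s = norm (feat x) * norm (evl g x)" by (rule power2_eq_imp_eq) auto
  have "norm (evl g x) * norm (evl g x) = g \<bullet> s" using s(2) by (simp add: power2_norm_eq_inner flip: power2_eq_square)
  also have "\<dots> \<le> norm g * (norm (feat x) * norm (evl g x))" using norm_cauchy_schwarz[of g s] ns by simp
  finally show ?thesis by (cases "norm (evl g x) = 0") (auto simp: mult_ac)
qed

lemma ev_bounded_linear: "bounded_linear (\<lambda>g. evl g x)"
  using linear_add[OF ev_linear[of x]] linear_scale[OF ev_linear[of x]] ev_norm_le[of _ x]
  by (intro bounded_linear_intro[where K = "norm (feat x)"]) (auto simp: mult.commute)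

text \<open>For a in the span of the features, combinations of kernel sections do it. Passing from a
  to its element scales distances by \<open>norm y\<close>, so the construction extends to limits,
  and the span of the features is dense.\<close>

lemma represents_exists: "\<exists>g. represents evl feat g y a"
proof -
  have sp: "\<exists>g. represents evl feat g y a" if "a \<in> span (range feat)" for a
    using that
  proof (induction rule: span_induct_alt)
    case base
    have "evl 0 x = 0" for x using linear_0[OF ev_linear] .
    then show ?case by (intro exI[of _ 0]) (simp add: represents_def)
  next
    case (step c v w)
    then obtain x g where x: "v = feat x" and g: "represents evl feat g y w" by blast
    obtain s where s: "\<forall>t. evl s t = (feat x \<bullet> feat t) *\<^sub>R y" "\<forall>g. evl g x \<bullet> y = g \<bullet> s"
      using ev_section by blast
    have "represents evl feat (c *\<^sub>R s + g) y (c *\<^sub>R v + w)"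
      unfolding represents_def
    proof (intro conjI allI impI)
      fix t show "evl (c *\<^sub>R s + g) t = ((c *\<^sub>R v + w) \<bullet> feat t) *\<^sub>R y"
        using s(1) g linear_add[OF ev_linear[of t]] linear_scale[OF ev_linear[of t]]
        by (simp add: represents_def x inner_add_left algebra_simps)
      fix g0 y0 a0 assume g0: "\<forall>x. evl g0 x = (a0 \<bullet> feat x) *\<^sub>R y0"
      have "g0 \<bullet> s = evl g0 x \<bullet> y" using s(2) by simp
      also have "\<dots> = (y0 \<bullet> y) * (a0 \<bullet> v)" using g0 by (simp add: x mult.commute)
      finally show "g0 \<bullet> (c *\<^sub>R s + g) = (y0 \<bullet> y) * (a0 \<bullet> (c *\<^sub>R v + w))"
        using g g0 by (simp add: represents_def inner_add_right algebra_simps)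
    qed
    then show ?case by blast
  qed
  have "closure (span (range feat)) = UNIV"
    by (rule dense_span_if_orthogonal_trivial) (use total in blast)
  then have "a \<in> closure (span (range feat))" by simp
  then obtain A where A: "\<And>n. A n \<in> span (range feat)" "A \<longlonglongrightarrow> a"
    unfolding closure_sequential by blast
  define g where "g n = (SOME g. represents evl feat g y (A n))" for n
  have g: "represents evl feat (g n) y (A n)" for n unfolding g_def by (rule someI_ex) (rule sp[OF A(1)])
  have dif: "norm (g m - g n) = norm (A m - A n) * norm y" for m n
  proof -
    have e: "evl (g m - g n) x = ((A m - A n) \<bullet> feat x) *\<^sub>R y" for x
      using g[of m] g[of n] linear_diff[OF ev_linear[of x]]
      by (simp add: represents_def inner_diff_left scaleR_diff_left)
    \<comment> \<open>The difference has rank-one form with the same y, so the second clause of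
      \<open>represents\<close> evaluates both inner products.\<close>
    have "(norm (g m - g n))\<^sup>2 = (g m - g n) \<bullet> g m - (g m - g n) \<bullet> g n"
      by (simp add: power2_norm_eq_inner inner_diff_right)
    also have "(g m - g n) \<bullet> g m = (y \<bullet> y) * ((A m - A n) \<bullet> A m)"
      using g[of m] e unfolding represents_def by blast
    also have "(g m - g n) \<bullet> g n = (y \<bullet> y) * ((A m - A n) \<bullet> A n)"
      using g[of n] e unfolding represents_def by blast
    also have "(y \<bullet> y) * ((A m - A n) \<bullet> A m) - (y \<bullet> y) * ((A m - A n) \<bullet> A n) = (norm (A m - A n) * norm y)\<^sup>2"
      by (simp add: power_mult_distrib power2_norm_eq_inner inner_diff_right algebra_simps)
    finally show ?thesis by (rule power2_eq_imp_eq) auto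
  qed
  have "Cauchy g"
  proof (rule metric_CauchyI)
    fix e :: real assume e: "e > 0"
    have "Cauchy A" using A(2) LIMSEQ_imp_Cauchy by blast
    then obtain M where M: "\<And>m n. m \<ge> M \<Longrightarrow> n \<ge> M \<Longrightarrow> dist (A m) (A n) < e / (norm y + 1)"
      using metric_CauchyD[of A "e / (norm y + 1)"] e by (metis add_nonneg_pos divide_pos_pos norm_ge_zero zero_less_one)
    show "\<exists>M. \<forall>m\<ge>M. \<forall>n\<ge>M. dist (g m) (g n) < e"
    proof (intro exI[of _ M] allI impI)
      fix m n assume "M \<le> m" "M \<le> n"
      then have "norm (A m - A n) < e / (norm y + 1)" using M by (simp add: dist_norm)
      then have "norm (A m - A n) * (norm y + 1) < e"
        by (simp add: pos_less_divide_eq add_nonneg_pos)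
      then show "dist (g m) (g n) < e"
        using norm_ge_zero[of "A m - A n"] unfolding dist_norm dif by (simp only: distrib_left)
    qed
  qed
  then obtain l where l: "g \<longlonglongrightarrow> l" using Cauchy_convergent_iff convergent_def by blast
  have "represents evl feat l y a"
    unfolding represents_def
  proof (intro conjI allI impI)
    fix x
    have "(\<lambda>n. evl (g n) x) \<longlonglongrightarrow> evl l x" by (rule bounded_linear.tendsto[OF ev_bounded_linear l])
    moreover have "(\<lambda>n. evl (g n) x) = (\<lambda>n. (A n \<bullet> feat x) *\<^sub>R y)" using g by (simp add: represents_def)
    moreover have "(\<lambda>n. (A n \<bullet> feat x) *\<^sub>R y) \<longlonglongrightarrow> (a \<bullet> feat x) *\<^sub>R y" by (intro tendsto_intros A)
    ultimately show "evl l x = (a \<bullet> feat x) *\<^sub>R y" using LIMSEQ_unique by metis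
    fix g0 y0 a0 assume g0: "\<forall>x. evl g0 x = (a0 \<bullet> feat x) *\<^sub>R y0"
    have "(\<lambda>n. g0 \<bullet> g n) \<longlonglongrightarrow> g0 \<bullet> l" by (intro tendsto_intros l)
    moreover have "g0 \<bullet> g n = (y0 \<bullet> y) * (a0 \<bullet> A n)" for n
      using g[of n] g0 unfolding represents_def by blast
    moreover have "(\<lambda>n. (y0 \<bullet> y) * (a0 \<bullet> A n)) \<longlonglongrightarrow> (y0 \<bullet> y) * (a0 \<bullet> a)" by (intro tendsto_intros A)
    ultimately show "g0 \<bullet> l = (y0 \<bullet> y) * (a0 \<bullet> a)" by (simp add: LIMSEQ_unique)
  qed
  then show ?thesis by blast
qed

abbreviation T where "T \<equiv> rkhs_tensor evl feat"

lemma tensor_represents: "represents evl feat (T y a) y a"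
proof -
  obtain g where g: "represents evl feat g y a" using represents_exists by blast
  then have "evl g = (\<lambda>x. (a \<bullet> feat x) *\<^sub>R y)" by (auto simp: represents_def)
  then have "T y a = g" using the_inv_f_f[OF ev_inj, of g] by (simp add: rkhs_tensor_def)
  then show ?thesis using g by simp
qed

lemma ev_tensor: "evl (T y a) x = (a \<bullet> feat x) *\<^sub>R y"
  using tensor_represents by (simp add: represents_def)

lemma tensor_inner: "T y a \<bullet> T y' a' = (y \<bullet> y') * (a \<bullet> a')"
  using tensor_represents[of y' a'] ev_tensor by (simp add: represents_def)

lemma ev_sum: "evl (\<Sum>i\<in>I. g i) x = (\<Sum>i\<in>I. evl (g i) x)"
  using linear_sum[OF bounded_linear.linear[OF ev_bounded_linear]] .

lemma ev_diff: "evl (g - g') x = evl g x - evl g' x"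
  using linear_diff[OF bounded_linear.linear[OF ev_bounded_linear]] .

lemma tensor_sum_norm: "(norm (\<Sum>i\<in>I. T (y i) (a i)))\<^sup>2 = (\<Sum>i\<in>I. \<Sum>l\<in>I. (y i \<bullet> y l) * (a i \<bullet> a l))"
  by (simp add: power2_norm_eq_inner inner_sum_left inner_sum_right tensor_inner) (rule sum.swap)

end

section \<open>Residuals of an operator close to a diagonal one\<close>

locale diagonal_op =
  fixes f :: "nat \<Rightarrow> 'a::{real_inner,banach}" and \<mu> :: "nat \<Rightarrow> real" and C :: "'a \<Rightarrow> 'a"
  assumes inj_f: "inj f" and basis_f: "orthonormal_basis (range f)"
    and \<mu>_pos: "\<And>j. 0 < \<mu> j"
    and C_f: "\<And>w j. C w \<bullet> f j = \<mu> j * (w \<bullet> f j)"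
begin

lemma f_inner: "f i \<bullet> f j = (if i = j then 1 else 0)"
  using orthonormal_inner[OF orthonormal_basis_orthonormal[OF basis_f], of "f i" "f j"] inj_f
  by (auto simp: inj_eq)

lemma f_expand: "((\<lambda>j. (w \<bullet> f j) *\<^sub>R f j) has_sum w) UNIV"
  using orthonormal_basis_has_sum[OF basis_f, of w] has_sum_reindex[OF inj_f, of "\<lambda>e. (w \<bullet> e) *\<^sub>R e" w]
  by (simp add: o_def)

lemma f_eqI:
  assumes "\<And>j. w \<bullet> f j = w' \<bullet> f j"
  shows "w = w'"
  using f_expand[of w] f_expand[of w'] assms has_sum_unique by fastforce

lemma parseval_inner: "((\<lambda>j. (v \<bullet> f j) * (w \<bullet> f j)) has_sum v \<bullet> w) UNIV"
  using has_sum_bounded_linear[OF bounded_linear_inner_right[of v] f_expand[of w]]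
  by (simp add: mult.commute)

lemma parseval: "((\<lambda>j. (v \<bullet> f j)\<^sup>2) has_sum (norm v)\<^sup>2) UNIV"
  using parseval_inner[of v v] by (simp add: power2_eq_square power2_norm_eq_inner flip: power2_eq_square)

lemma C_quadratic: "((\<lambda>j. \<mu> j * (v \<bullet> f j)\<^sup>2) has_sum v \<bullet> C v) UNIV"
  using parseval_inner[of v "C v"] by (simp add: C_f power2_eq_square mult_ac)

lemma C_psd: "0 \<le> v \<bullet> C v"
  using C_quadratic by (rule has_sum_nonneg) (simp add: less_imp_le[OF \<mu>_pos])

lemma C_add: "C (v + w) = C v + C w"
  by (rule f_eqI) (simp add: C_f inner_add_left distrib_left)

lemma C_scale: "C (c *\<^sub>R v) = c *\<^sub>R C v"
  by (rule f_eqI) (simp add: C_f)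

lemma diag_f:
  assumes "\<And>j. \<bar>h (\<mu> j)\<bar> \<le> c"
  shows "fun_calc h C v \<bullet> f j = h (\<mu> j) * (v \<bullet> f j)"
  by (rule fun_calc_diagonal[where A = C and \<mu> = \<mu> and f = f and h = h and c = c, OF inj_f basis_f C_f assms])

lemma diag_norm_le:
  assumes "\<And>j. \<bar>h (\<mu> j)\<bar> \<le> c"
  shows "norm (fun_calc h C v) \<le> c * norm v"
proof -
  have c: "0 \<le> c" using assms[of 0] by linarith
  have "(norm (fun_calc h C v))\<^sup>2 \<le> c\<^sup>2 * (norm v)\<^sup>2"
  proof (rule has_sum_mono[OF parseval has_sum_cmult_right[OF parseval]])
    fix j
    have "(h (\<mu> j))\<^sup>2 \<le> c\<^sup>2" using assms[of j] by (metis abs_ge_zero power2_abs power_mono)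
    then show "(fun_calc h C v \<bullet> f j)\<^sup>2 \<le> c\<^sup>2 * (v \<bullet> f j)\<^sup>2"
      by (simp add: diag_f[of h c, OF assms] power_mult_distrib mult_right_mono)
  qed
  then show ?thesis using c by (simp add: power_mult_distrib[symmetric] power_mono_iff)
qed

lemma diag_sym:
  assumes "\<And>j. \<bar>h (\<mu> j)\<bar> \<le> c"
  shows "fun_calc h C v \<bullet> w = v \<bullet> fun_calc h C w"
  using parseval_inner[of "fun_calc h C v" w] parseval_inner[of v "fun_calc h C w"] has_sum_unique
  by (fastforce simp: diag_f[of h c, OF assms] mult_ac)

lemma diag_linear:
  assumes "\<And>j. \<bar>h (\<mu> j)\<bar> \<le> c"
  shows "fun_calc h C (v + w) = fun_calc h C v + fun_calc h C w"
    and "fun_calc h C (r *\<^sub>R v) = r *\<^sub>R fun_calc h C v"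
  by (rule f_eqI, simp add: diag_f[of h c, OF assms] inner_add_left distrib_left)+

end

section \<open>Dyadic resolvent weights\<close>

text \<open>Sum over the scales \<open>t = lam * 2 ^ k\<close> of the squared N-th power of the
  Tikhonov factor \<open>t / (s + t)\<close>, weighted by \<open>t / lam\<close> to the power
  \<open>- 2 * \<nu>\<close>. It is comparable to the square of
  \<open>min 1 ((lam / s) powr \<nu>)\<close>, yet each summand is a power of a resolvent and can be
  moved from one operator to another.\<close>

definition dyadic_weight :: "real \<Rightarrow> real \<Rightarrow> nat \<Rightarrow> nat \<Rightarrow> real \<Rightarrow> real" where
  "dyadic_weight \<nu> lam N K s =
     (\<Sum>k\<le>K. 4 powr (- real k * \<nu>) * (lam * 2 ^ k / (s + lam * 2 ^ k)) ^ (2 * N))"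

lemma sum_four_powr_le:
  assumes "0 < \<nu>"
  shows "(\<Sum>k\<le>K. 4 powr (- real k * \<nu>)) \<le> 1 / (1 - 4 powr (- \<nu>))"
proof -
  define q where "q = 4 powr (- \<nu>)"
  have q: "0 < q" "q < 1" using assms by (auto simp: q_def powr_less_one)
  have "4 powr (- real k * \<nu>) = q ^ k" for k
    by (simp add: q_def powr_powr[symmetric] powr_realpow[symmetric] mult.commute powr_powr)
  then have "(\<Sum>k\<le>K. 4 powr (- real k * \<nu>)) = (1 - q ^ Suc K) / (1 - q)"
    using q sum_gp0[of q K] by simp
  also have "\<dots> \<le> 1 / (1 - q)" using q by (intro divide_right_mono) auto
  finally show ?thesis by (simp add: q_def)
qed

text \<open>At the first scale t above s the Tikhonov factor is at least 1/2, which costs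
  \<open>4 ^ N\<close>, and for positive k the number s exceeds half of t, which costs
  \<open>4 powr \<nu>\<close>. For k = 0 the left side is at most 1.\<close>

lemma dyadic_weight_lower:
  assumes lam: "0 < lam" and \<nu>: "0 < \<nu>" and s: "0 < s" "s \<le> lam * 2 ^ K"
  shows "(min 1 ((lam / s) powr \<nu>))\<^sup>2 \<le> 4 powr (\<nu> + real N) * dyadic_weight \<nu> lam N K s"
proof -
  define k where "k = (LEAST k. s \<le> lam * 2 ^ k)"
  have k: "s \<le> lam * 2 ^ k" "k \<le> K"
    unfolding k_def using s(2) by (auto intro: LeastI Least_le)
  define t where "t = lam * 2 ^ k"
  have t: "0 < t" "s \<le> t" using lam k by (auto simp: t_def)
  have "(1/2)^(2*N) \<le> (t / (s + t)) ^ (2 * N)"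
    using t s by (intro power_mono) (auto simp: divide_simps)
  moreover have "(4::real) ^ N = (2 ^ N)\<^sup>2" by (simp add: power2_eq_square power_mult_distrib[symmetric])
  ultimately have a: "1 \<le> 4 ^ N * (t / (s + t)) ^ (2 * N)"
    by (simp add: power_mult power_divide power_one_over field_simps)
  have b: "(min 1 ((lam / s) powr \<nu>))\<^sup>2 \<le> 4 powr \<nu> * 4 powr (- real k * \<nu>)"
  proof (cases "k = 0")
    case True
    have "(min 1 ((lam / s) powr \<nu>))\<^sup>2 \<le> 1" by (simp add: abs_square_le_1 min_def)
    also have "\<dots> \<le> 4 powr \<nu> * 4 powr (- real k * \<nu>)" using True \<nu> by (simp add: ge_one_powr_ge_zero)
    finally show ?thesis .
  next
    case False
    then have "\<not> s \<le> lam * 2 ^ (k - 1)" using not_less_Least[of "k - 1" "\<lambda>k. s \<le> lam * 2 ^ k"] by (simp add: k_def)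
    then have "lam * 2 ^ k < 2 * s" using False by (cases k) auto
    then have "lam / s \<le> 2 / 2 ^ k" using s by (simp add: field_simps)
    also have "2 / 2 ^ k = 2 powr (1 - real k)" by (simp add: powr_diff powr_realpow)
    finally have "(lam / s) powr \<nu> \<le> (2 powr (1 - real k)) powr \<nu>"
      using lam s \<nu> by (intro powr_mono2) auto
    then have "(min 1 ((lam / s) powr \<nu>))\<^sup>2 \<le> (2 powr ((1 - real k) * \<nu>))\<^sup>2"
      by (intro power_mono) (auto simp: powr_powr min_le_iff_disj)
    also have "\<dots> = 4 powr ((1 - real k) * \<nu>)"
      using powr_mult[of 2 2 "(1 - real k) * \<nu>"] by (simp add: power2_eq_square)
    also have "\<dots> = 4 powr \<nu> * 4 powr (- real k * \<nu>)"
      by (simp add: powr_add[symmetric] algebra_simps)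
    finally show ?thesis .
  qed
  have "(min 1 ((lam / s) powr \<nu>))\<^sup>2 \<le> 4 powr \<nu> * 4 powr (- real k * \<nu>) * (4 ^ N * (t / (s + t)) ^ (2 * N))"
  proof -
    have "4 powr \<nu> * 4 powr (- real k * \<nu>) * 1
        \<le> 4 powr \<nu> * 4 powr (- real k * \<nu>) * (4 ^ N * (t / (s + t)) ^ (2 * N))"
      by (rule mult_left_mono[OF a]) simp
    with b show ?thesis by linarith
  qed
  also have "\<dots> = 4 powr (\<nu> + real N) * (4 powr (- real k * \<nu>) * (t / (s + t)) ^ (2 * N))"
    by (simp add: powr_add powr_realpow)
  also have "\<dots> \<le> 4 powr (\<nu> + real N) * dyadic_weight \<nu> lam N K s"
    unfolding dyadic_weight_def t_def using lam s k
    by (intro mult_left_mono member_le_sum[of k "{..K}" "\<lambda>k. 4 powr (- real k * \<nu>) * (lam * 2 ^ k / (s + lam * 2 ^ k)) ^ (2 * N)"])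
       auto
  finally show ?thesis .
qed

text \<open>
  In terms of \<open>q = s / (lam 2^k)\<close>, each summand times \<open>(s / lam)\<^sup>2\<^sup>\<nu>\<close> is at most a multiple of
  \<open>\<Theta>(q) - \<Theta>(q / 2)\<close> with \<open>\<Theta>(q) = q\<^sup>2\<^sup>\<nu> / (1 + q\<^sup>2\<^sup>\<nu>)\<close>, so that the sum telescopes.
\<close>

lemma dyadic_weight_upper:
  assumes lam: "0 < lam" and \<nu>: "0 < \<nu>" and s: "0 < s" and N: "2 * \<nu> \<le> real N"
  shows "dyadic_weight \<nu> lam N K s * (max 1 ((s / lam) powr \<nu>))\<^sup>2 \<le> 4 / (1 - 4 powr (- \<nu>))"
proof -
  define p where "p = 4 powr (- \<nu>)"
  have p: "0 < p" "p < 1" using \<nu> by (auto simp: p_def powr_less_one)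
  have one: "dyadic_weight \<nu> lam N K s \<le> 4 / (1 - p)"
  proof -
    have "0 < s + lam * 2 ^ k" for k :: nat using lam s by (simp add: add_pos_pos)
    then have "dyadic_weight \<nu> lam N K s \<le> (\<Sum>k\<le>K. 4 powr (- real k * \<nu>))"
      unfolding dyadic_weight_def using lam s
      by (intro sum_mono mult_left_le power_le_one) (auto simp: less_imp_le)
    also have "\<dots> \<le> 1 / (1 - p)" using sum_four_powr_le[OF \<nu>] by (simp add: p_def)
    also have "\<dots> \<le> 4 / (1 - p)" using p by (intro divide_right_mono) auto
    finally show ?thesis .
  qed
  define \<Theta> where "\<Theta> x = x / (1 + x)" for x :: real
  define x where "x k = (s / (lam * 2 ^ k)) powr (2 * \<nu>)" for k :: nat
  have x0: "0 < x k" for k using s lam by (simp add: x_def)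
  have xS: "x (Suc k) = p * x k" for k
  proof -
    have "x (Suc k) = (s / (lam * 2 ^ k) * (1/2)) powr (2 * \<nu>)" by (simp add: x_def field_simps)
    also have "\<dots> = x k * (1/2) powr (2 * \<nu>)" using s lam unfolding x_def by (intro powr_mult)
    also have "(1/2::real) powr (2 * \<nu>) = p"
      unfolding p_def by (simp add: powr_minus powr_divide powr_powr[symmetric] inverse_eq_divide)
    finally show ?thesis by simp
  qed
  have term_le: "4 powr (- real k * \<nu>) * (lam * 2 ^ k / (s + lam * 2 ^ k)) ^ (2 * N) * ((s / lam) powr \<nu>)\<^sup>2
      \<le> 4 / (1 - p) * (\<Theta> (x k) - \<Theta> (x (Suc k)))" for k
  proof -
    define t where "t = lam * 2 ^ k"
    define q where "q = s / t"
    have t: "0 < t" using lam by (simp add: t_def)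
    have q: "0 < q" using s t by (simp add: q_def)
    have xk: "x k = q powr (2 * \<nu>)" by (simp add: x_def q_def t_def)
    have f1: "4 powr (- real k * \<nu>) * ((s / lam) powr \<nu>)\<^sup>2 = x k"
    proof -
      have sl: "s / lam = q * 2 ^ k" using lam by (simp add: q_def t_def)
      have "((s / lam) powr \<nu>)\<^sup>2 = (q * 2 ^ k) powr (2 * \<nu>)"
        unfolding sl[symmetric] using powr_add[of "s / lam" \<nu> \<nu>] by (simp add: power2_eq_square)
      also have "(q * 2 ^ k) powr (2 * \<nu>) = q powr (2 * \<nu>) * (2 ^ k) powr (2 * \<nu>)" using q by (intro powr_mult)
      also have "((2::real) ^ k) powr (2 * \<nu>) = 4 powr (real k * \<nu>)"
      proof -
        have "((2::real) ^ k) powr (2 * \<nu>) = (2 powr real k) powr (2 * \<nu>)" by (simp add: powr_realpow)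
        also have "\<dots> = (2 powr 2) powr (real k * \<nu>)" by (simp only: powr_powr) (simp add: mult_ac)
        finally show ?thesis by simp
      qed
      finally have e: "((s / lam) powr \<nu>)\<^sup>2 = q powr (2 * \<nu>) * 4 powr (real k * \<nu>)" .
      have "4 powr (- real k * \<nu>) * 4 powr (real k * \<nu>) = (1::real)"
        by (simp add: powr_add[symmetric])
      then show ?thesis unfolding xk e by (simp add: mult_ac)
    qed
    have f2: "(t / (s + t)) = 1 / (1 + q)" using t s by (simp add: q_def field_simps)
    \<comment> \<open>Where the size of N enters: the square of
      \<open>1 + q powr (2 * \<nu>)\<close> grows with exponent \<open>4 * \<nu>\<close>, and
      \<open>2 * N\<close> has to dominate it.\<close>
    have "(1 + x k)\<^sup>2 \<le> 4 * (1 + q) powr (4 * \<nu>)"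
    proof -
      have "q powr (2 * \<nu>) \<le> (1 + q) powr (2 * \<nu>)" using q \<nu> by (intro powr_mono2) auto
      moreover have "1 \<le> (1 + q) powr (2 * \<nu>)" using q \<nu> by (intro ge_one_powr_ge_zero) auto
      ultimately have "1 + x k \<le> 2 * (1 + q) powr (2 * \<nu>)" unfolding xk by linarith
      then have "(1 + x k)\<^sup>2 \<le> (2 * (1 + q) powr (2 * \<nu>))\<^sup>2" using x0[of k] by (intro power_mono) auto
      also have "\<dots> = 4 * (1 + q) powr (4 * \<nu>)"
        using powr_add[of "1 + q" "2 * \<nu>" "2 * \<nu>"] by (simp add: power_mult_distrib power2_eq_square)
      finally show ?thesis .
    qed
    also have "\<dots> \<le> 4 * (1 + q) powr (real (2 * N))"
      using q N by (intro mult_left_mono powr_mono) auto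
    also have "\<dots> = 4 * (1 + q) ^ (2 * N)" using q by (subst powr_realpow) auto
    finally have "(1 + x k)\<^sup>2 \<le> 4 * (1 + q) ^ (2 * N)" .
    then have f3: "1 / (1 + q) ^ (2 * N) \<le> 4 / (1 + x k)\<^sup>2"
      using q x0[of k] by (simp add: divide_simps)
    have "x k * (1 / (1 + q) ^ (2 * N)) \<le> x k * (4 / (1 + x k)\<^sup>2)"
      using x0[of k] by (intro mult_left_mono f3) auto
    also have "\<dots> = 4 / (1 - p) * ((1 - p) * x k / (1 + x k)\<^sup>2)" using p by simp
    also have "\<dots> \<le> 4 / (1 - p) * ((1 - p) * x k / ((1 + x k) * (1 + p * x k)))"
    proof -
      have "(1 + x k) * (1 + p * x k) \<le> (1 + x k)\<^sup>2"
        using p x0[of k] by (simp add: power2_eq_square mult_left_mono mult_le_cancel_right1)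
      then show ?thesis using p x0[of k] by (intro mult_left_mono divide_left_mono) (auto intro!: mult_pos_pos add_pos_pos)
    qed
    also have "(1 - p) * x k / ((1 + x k) * (1 + p * x k)) = \<Theta> (x k) - \<Theta> (x (Suc k))"
    proof -
      have "1 + x k \<noteq> 0" "1 + p * x k \<noteq> 0" using x0[of k] p mult_pos_pos[of p "x k"] by linarith+
      then show ?thesis unfolding \<Theta>_def xS by (simp add: field_simps)
    qed
    finally show ?thesis
      using f1 unfolding t_def[symmetric] f2 by (simp add: power_one_over mult_ac)
  qed
  have "dyadic_weight \<nu> lam N K s * ((s / lam) powr \<nu>)\<^sup>2 \<le> (\<Sum>k\<le>K. 4 / (1 - p) * (\<Theta> (x k) - \<Theta> (x (Suc k))))"
    unfolding dyadic_weight_def sum_distrib_right by (intro sum_mono term_le)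
  also have "\<dots> = 4 / (1 - p) * (\<Theta> (x 0) - \<Theta> (x (Suc K)))"
    unfolding sum_distrib_left[symmetric] using sum_telescope[of "\<lambda>k. \<Theta> (x k)" K] by simp
  also have "\<dots> \<le> 4 / (1 - p) * 1"
  proof -
    have "\<Theta> (x 0) \<le> 1" "0 \<le> \<Theta> (x (Suc K))" using x0[of 0] x0[of "Suc K"] by (auto simp: \<Theta>_def)
    then show ?thesis using p by (intro mult_left_mono) auto
  qed
  finally have two: "dyadic_weight \<nu> lam N K s * ((s / lam) powr \<nu>)\<^sup>2 \<le> 4 / (1 - p)" by simp
  show ?thesis using one two by (auto simp: max_def p_def)
qed

text \<open>Under the root stand the constant of \<open>dyadic_weight_lower\<close>, a 2 from
  squaring a sum of two terms, and the constant of \<open>dyadic_weight_upper\<close>. The number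
  \<open>nat \<lceil>2 * \<nu>\<rceil>\<close> is the least power N admissible there; N resolvents
  are exchanged, whence the factor N + 1.\<close>

definition bias_const :: "real \<Rightarrow> real" where
  "bias_const \<nu> = sqrt (4 powr (\<nu> + real (nat \<lceil>2 * \<nu>\<rceil>)) * 2 * (4 / (1 - 4 powr (- \<nu>)))) * (real (nat \<lceil>2 * \<nu>\<rceil>) + 1)"

section \<open>Transfer between a diagonal and a finite-rank operator\<close>

lemma has_sum_finite_sum:
  fixes g :: "'i \<Rightarrow> 'b \<Rightarrow> 'c::topological_comm_monoid_add"
  assumes "finite I" "\<And>i. i \<in> I \<Longrightarrow> (g i has_sum S i) A"
  shows "((\<lambda>x. \<Sum>i\<in>I. g i x) has_sum (\<Sum>i\<in>I. S i)) A"
  using assms by (induction) (auto intro: has_sum_add)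

lemma power2_sum_le: "(a + b)\<^sup>2 \<le> 2 * a\<^sup>2 + 2 * (b::real)\<^sup>2"
  using sum_squares_bound[of a b] by (simp add: power2_sum)

lemma resolvent_factor_le_one:
  assumes "0 \<le> m" "0 < (t::real)"
  shows "\<bar>t / (m + t)\<bar> \<le> 1" "\<bar>(t / (m + t)) ^ N\<bar> \<le> 1"
proof -
  have 0: "0 \<le> t / (m + t)" and 1: "t / (m + t) \<le> 1" using assms by auto
  show "\<bar>t / (m + t)\<bar> \<le> 1" unfolding abs_of_nonneg[OF 0] by (rule 1)
  show "\<bar>(t / (m + t)) ^ N\<bar> \<le> 1" unfolding abs_of_nonneg[OF zero_le_power[OF 0]] by (rule power_le_one[OF 0 1])
qed

text \<open>The deterministic situation for one sample: C is diagonal in the basis f, and Ch is the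
  finite-rank operator given by U and \<sigma>. The deviation is measured relative to
  \<open>C + lam'\<close>, and \<open>compare\<close> says that \<open>C + lam'\<close> is at most
  \<open>w\<^sup>2 * (Ch + lam)\<close> as a quadratic form.\<close>

locale two_ops = diagonal_op f \<mu> C + orthonormal_family U \<sigma>
  for f :: "nat \<Rightarrow> 'a::{real_inner,banach}" and \<mu> C and U :: "'a set" and \<sigma> +
  fixes Ch :: "'a \<Rightarrow> 'a" and lam lam' B w :: real
  assumes Ch: "\<And>v. Ch v = F (\<lambda>s. s) v"
    and \<sigma>_pos: "\<And>u. u \<in> U \<Longrightarrow> 0 < \<sigma> u"
    and lam: "0 < lam" and B: "0 \<le> B" and w: "0 \<le> w"
    and dev: "\<And>a x. \<bar>a \<bullet> (Ch x - C x)\<bar> \<le> B * sqrt (a \<bullet> C a + lam' * (norm a)\<^sup>2) * norm x"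
    and compare: "\<And>a. a \<bullet> C a + lam' * (norm a)\<^sup>2 \<le> w\<^sup>2 * (a \<bullet> Ch a + lam * (norm a)\<^sup>2)"
begin

lemma Ch_psd: "0 \<le> v \<bullet> Ch v"
  using spec_fun_nonneg[of "\<lambda>s. s" v] \<sigma>_pos by (simp add: Ch inner_commute less_imp_le)

text \<open>The difference d of the two scaled resolvents at h solves
  \<open>(Ch + t) d = (C - Ch) R\<close>. Testing with d, the bounds \<open>dev\<close> and
  \<open>compare\<close> give \<open>q * q \<le> w * B * norm h * q\<close> for the energy norm q of
  d, and \<open>sqrt t * norm d \<le> q\<close>.\<close>

lemma resolvent_diff:
  assumes t: "lam \<le> t"
  shows "norm (F (\<lambda>s. t / (s + t)) h - fun_calc (\<lambda>s. t / (s + t)) C h) \<le> w * B / sqrt t * norm h"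
proof -
  have t0: "0 < t" using lam t by simp
  define R where "R = fun_calc (\<lambda>s. t / (s + t)) C h"
  define d where "d = F (\<lambda>s. t / (s + t)) h - R"
  have bd: "\<bar>t / (\<mu> j + t)\<bar> \<le> 1" for j using resolvent_factor_le_one(1) \<mu>_pos[of j] t0 less_imp_le by blast
  have nR: "norm R \<le> norm h" using diag_norm_le[of "\<lambda>s. t / (s + t)" 1 h] bd by (simp add: R_def)
  have e1: "Ch (F (\<lambda>s. t / (s + t)) h) + t *\<^sub>R F (\<lambda>s. t / (s + t)) h = t *\<^sub>R h"
  proof -
    have "Ch (F (\<lambda>s. t / (s + t)) h) + t *\<^sub>R F (\<lambda>s. t / (s + t)) h = F (\<lambda>s. s * (t / (s + t)) + t * (t / (s + t))) h"
      unfolding Ch spec_fun_mult by (simp only: spec_fun_plus_fun spec_fun_scale_fun)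
    also have "\<dots> = F (\<lambda>s. t * 1) h"
    proof (rule spec_fun_cong)
      fix u assume "u \<in> U"
      then have "\<sigma> u + t \<noteq> 0" using \<sigma>_pos t0 by (metis add_pos_pos less_irrefl)
      then show "\<sigma> u * (t / (\<sigma> u + t)) + t * (t / (\<sigma> u + t)) = t * 1"
        unfolding distrib_right[symmetric] by simp
    qed (use t0 in simp)
    finally show ?thesis by (simp only: spec_fun_scale_fun spec_fun_one)
  qed
  have e2: "C R + t *\<^sub>R R = t *\<^sub>R h"
  proof (rule f_eqI)
    fix j
    have nz: "\<mu> j + t \<noteq> 0" using \<mu>_pos[of j] t0 by simp
    have Rf: "R \<bullet> f j = t / (\<mu> j + t) * (h \<bullet> f j)" unfolding R_def by (rule diag_f[of _ 1]) (rule bd)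
    have "(C R + t *\<^sub>R R) \<bullet> f j = (\<mu> j + t) * (R \<bullet> f j)" by (simp add: inner_add_left C_f algebra_simps)
    then show "(C R + t *\<^sub>R R) \<bullet> f j = (t *\<^sub>R h) \<bullet> f j" using nz by (simp add: Rf)
  qed
  have "Ch d + t *\<^sub>R d = C R - Ch R"
  proof -
    have "Ch d = Ch (F (\<lambda>s. t / (s + t)) h) - Ch R" unfolding d_def Ch by (rule spec_fun_minus)
    then have "Ch d + t *\<^sub>R d = (Ch (F (\<lambda>s. t / (s + t)) h) + t *\<^sub>R F (\<lambda>s. t / (s + t)) h) - (Ch R + t *\<^sub>R R)"
      by (simp add: d_def scaleR_diff_right)
    also have "\<dots> = C R - Ch R" unfolding e1 e2[symmetric] by simp
    finally show ?thesis .
  qed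
  then have "d \<bullet> Ch d + t * (norm d)\<^sup>2 = - (d \<bullet> (Ch R - C R))"
    by (metis inner_add_right inner_minus_right inner_scaleR_right minus_diff_eq power2_norm_eq_inner)
  also have "\<dots> \<le> B * sqrt (d \<bullet> C d + lam' * (norm d)\<^sup>2) * norm R"
    using dev[of d R] by linarith
  also have "\<dots> \<le> B * sqrt (w\<^sup>2 * (d \<bullet> Ch d + t * (norm d)\<^sup>2)) * norm h"
  proof -
    have "d \<bullet> C d + lam' * (norm d)\<^sup>2 \<le> w\<^sup>2 * (d \<bullet> Ch d + lam * (norm d)\<^sup>2)" by (rule compare)
    also have "\<dots> \<le> w\<^sup>2 * (d \<bullet> Ch d + t * (norm d)\<^sup>2)" using t by (intro mult_left_mono add_left_mono mult_right_mono) auto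
    finally have "B * sqrt (d \<bullet> C d + lam' * (norm d)\<^sup>2) \<le> B * sqrt (w\<^sup>2 * (d \<bullet> Ch d + t * (norm d)\<^sup>2))"
      using B by (intro mult_left_mono real_sqrt_le_mono)
    moreover have "0 \<le> d \<bullet> Ch d + t * (norm d)\<^sup>2" using Ch_psd[of d] t0 by simp
    ultimately show ?thesis using B nR
      by (intro mult_mono[of "B * sqrt (d \<bullet> C d + lam' * (norm d)\<^sup>2)"]) simp_all
  qed
  also have "\<dots> = (w * B * norm h) * sqrt (d \<bullet> Ch d + t * (norm d)\<^sup>2)"
    using w by (simp add: real_sqrt_mult)
  finally have main: "d \<bullet> Ch d + t * (norm d)\<^sup>2 \<le> (w * B * norm h) * sqrt (d \<bullet> Ch d + t * (norm d)\<^sup>2)" .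
  define q where "q = sqrt (d \<bullet> Ch d + t * (norm d)\<^sup>2)"
  have q0: "0 \<le> q" and qq: "q * q = d \<bullet> Ch d + t * (norm d)\<^sup>2"
    using Ch_psd[of d] t0 by (auto simp: q_def)
  have "q \<le> w * B * norm h"
  proof (cases "q = 0")
    case False
    have "q * q \<le> (w * B * norm h) * q" using main unfolding q_def[symmetric] by (simp only: qq)
    then show ?thesis using False q0 by (simp only: mult_le_cancel_right)
  qed (use w B in simp)
  moreover have "sqrt t * norm d \<le> q"
  proof -
    have "sqrt t * norm d = sqrt (t * (norm d)\<^sup>2)" by (simp add: real_sqrt_mult)
    also have "\<dots> \<le> q" unfolding q_def using Ch_psd[of d] by simp
    finally show ?thesis .
  qed
  ultimately have "sqrt t * norm d \<le> w * B * norm h" by simp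
  then have "norm d \<le> w * B / sqrt t * norm h" using t0 by (simp add: field_simps)
  then show ?thesis by (simp add: d_def R_def)
qed

text \<open>One factor is exchanged at a time while all others are contractions, so N exchanges cost
  N times a single one.\<close>

lemma resolvent_power_diff:
  assumes t: "lam \<le> t"
  shows "norm (F (\<lambda>s. (t / (s + t)) ^ N) h)
    \<le> norm (fun_calc (\<lambda>s. (t / (s + t)) ^ N) C h) + real N * (w * B / sqrt t) * norm h"
proof (induction N arbitrary: h)
  case 0
  have "fun_calc (\<lambda>s. (t / (s + t)) ^ 0) C h = h"
    by (rule f_eqI) (subst diag_f[of _ 1], auto)
  then show ?case by (simp add: spec_fun_one)
next
  case (Suc N)
  have t0: "0 < t" using lam t by simp
  have bd: "\<bar>(t / (\<mu> j + t)) ^ M\<bar> \<le> 1" for j M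
    using resolvent_factor_le_one(2) \<mu>_pos[of j] t0 less_imp_le by blast
  define e where "e = w * B / sqrt t"
  have e0: "0 \<le> e" using w B t0 by (simp add: e_def)
  define R where "R = fun_calc (\<lambda>s. t / (s + t)) C h"
  have nR: "norm R \<le> norm h" using diag_norm_le[of "\<lambda>s. t / (s + t)" 1 h] bd[of _ 1] by (simp add: R_def)
  define d where "d = F (\<lambda>s. t / (s + t)) h - R"
  have "F (\<lambda>s. (t / (s + t)) ^ Suc N) h = F (\<lambda>s. (t / (s + t)) ^ N) (F (\<lambda>s. t / (s + t)) h)"
    unfolding spec_fun_mult by (simp add: mult.commute)
  also have "\<dots> = F (\<lambda>s. (t / (s + t)) ^ N) d + F (\<lambda>s. (t / (s + t)) ^ N) R"
    unfolding spec_fun_add[symmetric] d_def by simp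
  finally have "norm (F (\<lambda>s. (t / (s + t)) ^ Suc N) h)
      \<le> norm (F (\<lambda>s. (t / (s + t)) ^ N) d) + norm (F (\<lambda>s. (t / (s + t)) ^ N) R)"
    by (simp add: norm_triangle_ineq)
  moreover have "norm (F (\<lambda>s. (t / (s + t)) ^ N) d) \<le> 1 * norm d"
    using \<sigma>_pos t0 by (intro spec_fun_norm_le resolvent_factor_le_one(2)) (auto intro: less_imp_le)
  moreover have "norm d \<le> e * norm h"
    using resolvent_diff[OF t, of h] by (simp add: d_def R_def e_def)
  moreover have "norm (F (\<lambda>s. (t / (s + t)) ^ N) R)
      \<le> norm (fun_calc (\<lambda>s. (t / (s + t)) ^ N) C R) + real N * e * norm R"
    using Suc.IH[of R] by (simp add: e_def)
  moreover have "real N * e * norm R \<le> real N * e * norm h" using nR e0 by (intro mult_left_mono) auto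
  moreover have "fun_calc (\<lambda>s. (t / (s + t)) ^ N) C R = fun_calc (\<lambda>s. (t / (s + t)) ^ Suc N) C h"
  proof (rule f_eqI)
    fix j
    have Rf: "R \<bullet> f j = t / (\<mu> j + t) * (h \<bullet> f j)"
      unfolding R_def by (rule diag_f[of _ 1]) (use bd[of _ 1] in simp)
    have "fun_calc (\<lambda>s. (t / (s + t)) ^ N) C R \<bullet> f j = (t / (\<mu> j + t)) ^ N * (R \<bullet> f j)"
      by (rule diag_f[of _ 1]) (rule bd)
    moreover have "fun_calc (\<lambda>s. (t / (s + t)) ^ Suc N) C h \<bullet> f j = (t / (\<mu> j + t)) ^ Suc N * (h \<bullet> f j)"
      by (rule diag_f[of _ 1]) (rule bd)
    ultimately show "fun_calc (\<lambda>s. (t / (s + t)) ^ N) C R \<bullet> f j = fun_calc (\<lambda>s. (t / (s + t)) ^ Suc N) C h \<bullet> f j"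
      unfolding Rf by simp
  qed
  moreover have "real (Suc N) * e * norm h = e * norm h + real N * e * norm h" by (simp add: algebra_simps)
  ultimately show ?case unfolding e_def[symmetric] by simp
qed

text \<open>\<open>dyadic_weight_lower\<close> bounds the residual by resolvent powers of Ch,
  \<open>resolvent_power_diff\<close> moves them to C, and there, coordinate by coordinate,
  \<open>dyadic_weight_upper\<close> cancels the growth of \<phi>. The exchange error multiplies the
  full size H of \<phi> on the eigenvalues.\<close>

lemma bias_bound:
  assumes \<nu>: "0 < \<nu>" and P: "0 \<le> P" and \<Gamma>: "0 \<le> \<Gamma>"
    and \<phi>P: "\<And>j. \<bar>\<phi> (\<mu> j)\<bar> \<le> P * max 1 ((\<mu> j / lam) powr \<nu>)"
    and \<phi>H: "\<And>j. \<bar>\<phi> (\<mu> j)\<bar> \<le> H"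
    and r: "\<And>u. u \<in> U \<Longrightarrow> \<bar>r (\<sigma> u)\<bar> \<le> \<Gamma> * min 1 ((lam / \<sigma> u) powr \<nu>)" and r0: "\<bar>r 0\<bar> \<le> \<Gamma>"
  shows "norm (F r (fun_calc \<phi> C v)) \<le> \<Gamma> * bias_const \<nu> * (P + w * B / sqrt lam * H) * norm v"
proof -
  define N where "N = nat \<lceil>2 * \<nu>\<rceil>"
  have N: "2 * \<nu> \<le> real N" using \<nu> by (simp add: N_def)
  define c4 where "c4 = 4 / (1 - 4 powr (- \<nu>))"
  have c4: "0 < c4" using \<nu> by (simp add: c4_def powr_less_one)
  define h where "h = fun_calc \<phi> C v"
  have H0: "0 \<le> H" using \<phi>H[of 0] by linarith
  have hn: "norm h \<le> H * norm v" unfolding h_def by (rule diag_norm_le[where h = \<phi>]) (rule \<phi>H)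
  \<comment> \<open>Enough scales to pass the largest eigenvalue of Ch. Their number stays out of
    the constants because the weights are summable.\<close>
  obtain K where K: "\<And>u. u \<in> U \<Longrightarrow> \<sigma> u \<le> lam * 2 ^ K"
  proof -
    obtain K where "(\<Sum>u\<in>U. \<sigma> u) / lam < 2 ^ K" using real_arch_pow[of 2] by auto
    then have "(\<Sum>u\<in>U. \<sigma> u) \<le> lam * 2 ^ K" using lam by (simp add: field_simps)
    moreover have "\<sigma> u \<le> (\<Sum>u\<in>U. \<sigma> u)" if "u \<in> U" for u
      using that finite_U \<sigma>_pos by (intro member_le_sum) (auto intro: less_imp_le)
    ultimately show ?thesis using that by (meson order_trans)
  qed
  define t where "t k = lam * 2 ^ k" for k :: nat
  have t: "lam \<le> t k" "0 < t k" for k using lam by (auto simp: t_def)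
  define S where "S = dyadic_weight \<nu> lam N K"
  have S0: "1 \<le> S 0"
  proof -
    have "1 \<le> (\<Sum>k\<le>K. 4 powr (- real k * \<nu>))"
      using member_le_sum[of 0 "{..K}" "\<lambda>k. 4 powr (- real k * \<nu>)"] by simp
    also have "\<dots> = S 0" using lam by (simp add: S_def dyadic_weight_def)
    finally show ?thesis .
  qed
  define G where "G = \<Gamma>\<^sup>2 * 4 powr (\<nu> + real N)"
  have G0: "0 \<le> G" by (simp add: G_def)
  have "(norm (F r h))\<^sup>2 \<le> F (\<lambda>s. G * S s) h \<bullet> h"
    unfolding spec_fun_norm
  proof (rule spec_fun_mono)
    fix u assume u: "u \<in> U"
    have "(r (\<sigma> u))\<^sup>2 \<le> (\<Gamma> * min 1 ((lam / \<sigma> u) powr \<nu>))\<^sup>2"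
      using r[OF u] by (metis abs_ge_zero power2_abs power_mono)
    also have "\<dots> \<le> \<Gamma>\<^sup>2 * (4 powr (\<nu> + real N) * S (\<sigma> u))"
      unfolding power_mult_distrib S_def
      by (intro mult_left_mono dyadic_weight_lower lam \<nu> \<sigma>_pos u K) auto
    finally show "(r (\<sigma> u))\<^sup>2 \<le> G * S (\<sigma> u)" by (simp add: G_def)
  next
    \<comment> \<open>On the kernel of Ch the residual is bounded by \<Gamma> only; there all
      Tikhonov factors are 1, and S is at least its first weight.\<close>
    have "(r 0)\<^sup>2 \<le> \<Gamma>\<^sup>2" using r0 by (metis abs_ge_zero power2_abs power_mono)
    also have "\<dots> \<le> \<Gamma>\<^sup>2 * (4 powr (\<nu> + real N) * S 0)"
      using S0 \<nu> ge_one_powr_ge_zero[of 4 "\<nu> + real N"] mult_mono[of 1 "4 powr (\<nu> + real N)" 1 "S 0"]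
      by (intro mult_le_cancel_left1[THEN iffD2]) auto
    finally show "(r 0)\<^sup>2 \<le> G * S 0" by (simp add: G_def)
  qed
  also have "\<dots> = G * (\<Sum>k\<le>K. 4 powr (- real k * \<nu>) * (norm (F (\<lambda>s. (t k / (s + t k)) ^ N) h))\<^sup>2)"
  proof -
    have sumF: "F (\<lambda>s. \<Sum>k\<in>I. c k * q k s) h = (\<Sum>k\<in>I. c k *\<^sub>R F (q k) h)" if "finite I" for I :: "nat set" and c q
      using that
      by induction (simp_all add: spec_fun_plus_fun spec_fun_scale_fun, simp add: spec_fun_def)
    have "F (\<lambda>s. G * S s) h = G *\<^sub>R (\<Sum>k\<le>K. 4 powr (- real k * \<nu>) *\<^sub>R F (\<lambda>s. (t k / (s + t k)) ^ (2 * N)) h)"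
      unfolding spec_fun_scale_fun S_def dyadic_weight_def t_def[symmetric] by (subst sumF) auto
    then show ?thesis
      by (simp add: inner_sum_left spec_fun_norm power_mult[symmetric] mult.commute)
  qed
  also have "\<dots> \<le> G * (2 * c4 * (P\<^sup>2 + (real N)\<^sup>2 * (w * B / sqrt lam)\<^sup>2 * H\<^sup>2) * (norm v)\<^sup>2)"
  proof (rule mult_left_mono[OF _ G0])
    let ?D = "\<lambda>k. fun_calc (\<lambda>s. (t k / (s + t k)) ^ N) C h"
    have each: "(norm (F (\<lambda>s. (t k / (s + t k)) ^ N) h))\<^sup>2
        \<le> 2 * (norm (?D k))\<^sup>2 + 2 * ((real N)\<^sup>2 * (w * B / sqrt lam)\<^sup>2 * H\<^sup>2 * (norm v)\<^sup>2)" for k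
    proof -
      have "real N * (w * B / sqrt (t k)) * norm h \<le> real N * (w * B / sqrt lam) * (H * norm v)"
        using t[of k] lam w B hn
        by (intro mult_mono mult_left_mono divide_left_mono) (auto intro!: divide_nonneg_nonneg mult_pos_pos simp: less_imp_le)
      then have "norm (F (\<lambda>s. (t k / (s + t k)) ^ N) h) \<le> norm (?D k) + real N * (w * B / sqrt lam) * (H * norm v)"
        using resolvent_power_diff[OF t(1)[of k], of N h] by linarith
      then have "(norm (F (\<lambda>s. (t k / (s + t k)) ^ N) h))\<^sup>2 \<le> (norm (?D k) + real N * (w * B / sqrt lam) * (H * norm v))\<^sup>2"
        by (intro power_mono) auto
      also have "\<dots> \<le> 2 * (norm (?D k))\<^sup>2 + 2 * (real N * (w * B / sqrt lam) * (H * norm v))\<^sup>2"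
        by (rule power2_sum_le)
      also have "(real N * (w * B / sqrt lam) * (H * norm v))\<^sup>2 = (real N)\<^sup>2 * (w * B / sqrt lam)\<^sup>2 * H\<^sup>2 * (norm v)\<^sup>2"
        by (simp only: power_mult_distrib mult.assoc)
      finally show ?thesis .
    qed
    have sumD: "(\<Sum>k\<le>K. 4 powr (- real k * \<nu>) * (norm (?D k))\<^sup>2) \<le> c4 * P\<^sup>2 * (norm v)\<^sup>2"
    proof (rule has_sum_mono)
      have bd: "\<bar>(t k / (\<mu> j + t k)) ^ N\<bar> \<le> 1" for j k
        using resolvent_factor_le_one(2) \<mu>_pos[of j] t(2)[of k] less_imp_le by blast
      have "((\<lambda>j. (?D k \<bullet> f j)\<^sup>2) has_sum (norm (?D k))\<^sup>2) UNIV" for k by (rule parseval)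
      then show "((\<lambda>j. \<Sum>k\<le>K. 4 powr (- real k * \<nu>) * (?D k \<bullet> f j)\<^sup>2) has_sum (\<Sum>k\<le>K. 4 powr (- real k * \<nu>) * (norm (?D k))\<^sup>2)) UNIV"
        by (intro has_sum_finite_sum has_sum_cmult_right) auto
      show "((\<lambda>j. c4 * P\<^sup>2 * (v \<bullet> f j)\<^sup>2) has_sum c4 * P\<^sup>2 * (norm v)\<^sup>2) UNIV"
        by (intro has_sum_cmult_right parseval)
      fix j
      have D: "?D k \<bullet> f j = (t k / (\<mu> j + t k)) ^ N * (\<phi> (\<mu> j) * (v \<bullet> f j))" for k
        by (simp add: diag_f[of "\<lambda>s. (t k / (s + t k)) ^ N" 1, OF bd] h_def diag_f[of \<phi> H, OF \<phi>H])
      have "(\<Sum>k\<le>K. 4 powr (- real k * \<nu>) * (?D k \<bullet> f j)\<^sup>2) = S (\<mu> j) * ((\<phi> (\<mu> j))\<^sup>2 * (v \<bullet> f j)\<^sup>2)"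
        unfolding D S_def dyadic_weight_def t_def[symmetric] sum_distrib_right
      proof (intro sum.cong refl)
        fix k
        have e: "x ^ (2 * N) = (x ^ N)\<^sup>2" for x :: real by (metis mult.commute power_mult)
        show "4 powr (- real k * \<nu>) * ((t k / (\<mu> j + t k)) ^ N * (\<phi> (\<mu> j) * (v \<bullet> f j)))\<^sup>2
          = 4 powr (- real k * \<nu>) * (t k / (\<mu> j + t k)) ^ (2 * N) * ((\<phi> (\<mu> j))\<^sup>2 * (v \<bullet> f j)\<^sup>2)"
          unfolding e power_mult_distrib by (simp only: mult.assoc)
      qed
      also have "\<dots> \<le> S (\<mu> j) * ((P * max 1 ((\<mu> j / lam) powr \<nu>))\<^sup>2 * (v \<bullet> f j)\<^sup>2)"
      proof -
        have "(\<phi> (\<mu> j))\<^sup>2 \<le> (P * max 1 ((\<mu> j / lam) powr \<nu>))\<^sup>2"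
          using \<phi>P[of j] by (metis abs_ge_zero power2_abs power_mono)
        moreover have "0 \<le> S (\<mu> j)"
          unfolding S_def dyadic_weight_def using less_imp_le[OF \<mu>_pos[of j]] less_imp_le[OF lam]
          by (intro sum_nonneg mult_nonneg_nonneg zero_le_power divide_nonneg_nonneg add_nonneg_nonneg) auto
        ultimately show ?thesis by (intro mult_left_mono mult_right_mono) auto
      qed
      also have "\<dots> = (S (\<mu> j) * (max 1 ((\<mu> j / lam) powr \<nu>))\<^sup>2) * (P\<^sup>2 * (v \<bullet> f j)\<^sup>2)"
        by (simp add: power_mult_distrib mult_ac)
      also have "\<dots> \<le> c4 * (P\<^sup>2 * (v \<bullet> f j)\<^sup>2)"
        unfolding S_def c4_def by (intro mult_right_mono dyadic_weight_upper lam \<nu> \<mu>_pos N) auto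
      finally show "(\<Sum>k\<le>K. 4 powr (- real k * \<nu>) * (?D k \<bullet> f j)\<^sup>2) \<le> c4 * P\<^sup>2 * (v \<bullet> f j)\<^sup>2"
        by (simp add: mult_ac)
    qed
    have pw: "(\<Sum>k\<le>K. 4 powr (- real k * \<nu>)) \<le> c4"
      using sum_four_powr_le[OF \<nu>, of K] c4 unfolding c4_def
      by (auto elim!: order_trans intro!: divide_right_mono simp: zero_less_divide_iff)
    define Z where "Z = (real N)\<^sup>2 * (w * B / sqrt lam)\<^sup>2 * H\<^sup>2 * (norm v)\<^sup>2"
    have "(\<Sum>k\<le>K. 4 powr (- real k * \<nu>) * (norm (F (\<lambda>s. (t k / (s + t k)) ^ N) h))\<^sup>2)
        \<le> (\<Sum>k\<le>K. 4 powr (- real k * \<nu>) * (2 * (norm (?D k))\<^sup>2 + 2 * Z))"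
      using each by (intro sum_mono mult_left_mono) (auto simp: Z_def)
    also have "\<dots> = 2 * (\<Sum>k\<le>K. 4 powr (- real k * \<nu>) * (norm (?D k))\<^sup>2) + 2 * ((\<Sum>k\<le>K. 4 powr (- real k * \<nu>)) * Z)"
      by (simp add: sum_distrib_left sum_distrib_right sum.distrib algebra_simps)
    also have "\<dots> \<le> 2 * (c4 * P\<^sup>2 * (norm v)\<^sup>2) + 2 * (c4 * Z)"
      using sumD mult_right_mono[OF pw, of Z] by (auto simp: Z_def)
    finally show "(\<Sum>k\<le>K. 4 powr (- real k * \<nu>) * (norm (F (\<lambda>s. (t k / (s + t k)) ^ N) h))\<^sup>2)
        \<le> 2 * c4 * (P\<^sup>2 + (real N)\<^sup>2 * (w * B / sqrt lam)\<^sup>2 * H\<^sup>2) * (norm v)\<^sup>2"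
      by (simp add: Z_def algebra_simps)
  qed
  also have "\<dots> \<le> G * (2 * c4 * ((real N + 1)\<^sup>2 * (P + w * B / sqrt lam * H)\<^sup>2) * (norm v)\<^sup>2)"
  proof -
    define x where "x = w * B / sqrt lam * H"
    have x: "0 \<le> x" using w B lam H0 by (simp add: x_def)
    have "P\<^sup>2 + (real N)\<^sup>2 * x\<^sup>2 \<le> (real N + 1)\<^sup>2 * P\<^sup>2 + (real N + 1)\<^sup>2 * x\<^sup>2"
      by (intro add_mono mult_right_mono mult_le_cancel_right1[THEN iffD2] power_mono) (auto simp: power2_eq_square algebra_simps)
    also have "\<dots> \<le> (real N + 1)\<^sup>2 * (P + x)\<^sup>2"
      using P x by (simp add: distrib_left[symmetric] mult_left_mono power2_sum)
    finally have le: "P\<^sup>2 + (real N)\<^sup>2 * x\<^sup>2 \<le> (real N + 1)\<^sup>2 * (P + x)\<^sup>2" .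
    have e: "P\<^sup>2 + (real N)\<^sup>2 * (w * B / sqrt lam)\<^sup>2 * H\<^sup>2 = P\<^sup>2 + (real N)\<^sup>2 * x\<^sup>2"
      by (simp only: x_def power_mult_distrib mult.assoc)
    show ?thesis unfolding e unfolding x_def[symmetric] using G0 c4 le
      by (intro mult_left_mono mult_right_mono) auto
  qed
  also have "\<dots> = (\<Gamma> * bias_const \<nu> * (P + w * B / sqrt lam * H) * norm v)\<^sup>2"
  proof -
    have bc: "bias_const \<nu> = sqrt (4 powr (\<nu> + real N) * 2 * c4) * (real N + 1)"
      by (simp only: bias_const_def N_def c4_def)
    show ?thesis unfolding bc using c4 by (simp add: G_def power_mult_distrib mult_ac)
  qed
  finally have "(norm (F r h))\<^sup>2 \<le> (\<Gamma> * bias_const \<nu> * (P + w * B / sqrt lam * H) * norm v)\<^sup>2" .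
  moreover have "0 \<le> \<Gamma> * bias_const \<nu> * (P + w * B / sqrt lam * H) * norm v"
    using \<Gamma> P w B lam H0 c4 by (auto simp: bias_const_def c4_def intro!: mult_nonneg_nonneg add_nonneg_nonneg)
  ultimately show ?thesis unfolding h_def by (rule power2_le_imp_le)
qed

end

section \<open>Bias and noise in the population norms\<close>

lemma schur_mono:
  fixes y :: "'i \<Rightarrow> 'y::real_inner"
  assumes "finite I" and D: "\<And>c. (\<Sum>i\<in>I. \<Sum>l\<in>I. c i * c l * D i l) \<le> (\<Sum>i\<in>I. \<Sum>l\<in>I. c i * c l * D' i l)"
  shows "(\<Sum>i\<in>I. \<Sum>l\<in>I. (y i \<bullet> y l) * D i l) \<le> (\<Sum>i\<in>I. \<Sum>l\<in>I. (y i \<bullet> y l) * D' i l)"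
  using schur_nonneg[OF assms(1), of "\<lambda>i l. D' i l - D i l" y] D
  by (simp add: right_diff_distrib sum_subtractf)

lemma double_sum_bilinear:
  fixes b :: "'a::real_vector \<Rightarrow> 'a \<Rightarrow> real" and a :: "'i \<Rightarrow> 'a"
  assumes "\<And>v. linear (b v)" "\<And>w. linear (\<lambda>v. b v w)"
  shows "(\<Sum>i\<in>I. \<Sum>l\<in>I. c i * c l * b (a i) (a l)) = b (\<Sum>i\<in>I. c i *\<^sub>R a i) (\<Sum>l\<in>I. c l *\<^sub>R a l)"
proof -
  have 1: "b (\<Sum>i\<in>I. c i *\<^sub>R a i) w = (\<Sum>i\<in>I. c i * b (a i) w)" for w
    using linear_sum[OF assms(2)[of w], of "\<lambda>i. c i *\<^sub>R a i" I] linear_scale[OF assms(2)[of w]] by simp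
  have 2: "b v (\<Sum>l\<in>I. c l *\<^sub>R a l) = (\<Sum>l\<in>I. c l * b v (a l))" for v
    using linear_sum[OF assms(1)[of v], of "\<lambda>i. c i *\<^sub>R a i" I] linear_scale[OF assms(1)[of v]] by simp
  show ?thesis unfolding 1 unfolding 2 by (simp add: sum_distrib_left mult.assoc)
qed

lemma linear_inner_comp:
  assumes "linear A"
  shows "linear (\<lambda>w. v \<bullet> A w)" "linear (\<lambda>w. A w \<bullet> v)"
  using assms by (auto simp: linear_iff inner_add_left inner_add_right)

section \<open>Population covariance and elements of the vector-valued space\<close>

locale rkhs_population = tensor_rkhs evl feat
  for evl :: "'g::{real_inner,banach} \<Rightarrow> 'x::topological_space \<Rightarrow> 'y::{real_inner,banach,second_countable_topology}"
    and feat :: "'x \<Rightarrow> 'h::{real_inner,banach,second_countable_topology}" +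
  fixes qX :: "'x measure" and \<kappa> :: real
  assumes qX: "prob_space qX" "sets qX = sets borel"
    and feat_measurable: "feat \<in> borel_measurable borel"
    and feat_bound: "\<And>x. norm (feat x) \<le> \<kappa>"
begin

abbreviation C where "C \<equiv> cov_op qX feat"

lemma measurable_qX: "f \<in> borel_measurable borel \<Longrightarrow> f \<in> borel_measurable qX"
  using measurable_cong_sets[OF qX(2) refl] by blast

lemma \<kappa>_nonneg: "0 \<le> \<kappa>"
  using order_trans[OF norm_ge_zero feat_bound] .

lemma integrable_bounded_qX:
  fixes h :: "'x \<Rightarrow> 'b::{banach,second_countable_topology}"
  assumes "h \<in> borel_measurable borel" "\<And>x. norm (h x) \<le> c"
  shows "integrable qX h"
proof -
  interpret prob_space qX by (rule qX(1))
  show ?thesis using assms by (intro integrable_const_bound[of _ c] measurable_qX) auto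
qed

lemma abs_inner_feat: "\<bar>a \<bullet> feat x\<bar> \<le> norm a * \<kappa>"
  using Cauchy_Schwarz_ineq2[of a "feat x"] mult_left_mono[OF feat_bound norm_ge_zero, of a x] by (meson order_trans)

lemma feat_inner_measurable [measurable]: "(\<lambda>x. a \<bullet> feat x) \<in> borel_measurable borel"
  using feat_measurable by measurable

lemma cov_op_inner: "a \<bullet> C v = (\<integral>x. (a \<bullet> feat x) * (v \<bullet> feat x) \<partial>qX)"
proof -
  have "integrable qX (\<lambda>x. (v \<bullet> feat x) *\<^sub>R feat x)"
  proof (rule integrable_bounded_qX[where c = "norm v * \<kappa> * \<kappa>"])
    show "(\<lambda>x. (v \<bullet> feat x) *\<^sub>R feat x) \<in> borel_measurable borel"
      using feat_measurable by measurable
    show "norm ((v \<bullet> feat x) *\<^sub>R feat x) \<le> norm v * \<kappa> * \<kappa>" for x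
      using mult_mono[OF abs_inner_feat[of v x] feat_bound[of x]] \<kappa>_nonneg by simp
  qed
  then show ?thesis unfolding cov_op_def tensor_op_def
    by (subst integral_inner_right[symmetric]) (auto simp: mult.commute)
qed

lemma cov_op_sym: "a \<bullet> C v = C a \<bullet> v"
  unfolding inner_commute[of "C a"] cov_op_inner by (simp add: mult.commute)

definition sqL2 :: "'g \<Rightarrow> real" where "sqL2 g = (\<integral>x. (norm (evl g x))\<^sup>2 \<partial>qX)"

lemma sqL2_integrable:
  assumes "evl g \<in> borel_measurable borel"
  shows "integrable qX (\<lambda>x. (norm (evl g x))\<^sup>2)"
proof (rule integrable_bounded_qX[where c = "(\<kappa> * norm g)\<^sup>2"])
  show "(\<lambda>x. (norm (evl g x))\<^sup>2) \<in> borel_measurable borel" using assms by measurable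
  show "norm ((norm (evl g x))\<^sup>2) \<le> (\<kappa> * norm g)\<^sup>2" for x
    using order_trans[OF ev_norm_le mult_right_mono[OF feat_bound norm_ge_zero], of g x]
    by (simp add: power_mono)
qed

lemma sqL2_le: 
  assumes "evl g \<in> borel_measurable borel"
  shows "sqL2 g \<le> (\<kappa> * norm g)\<^sup>2"
proof -
  interpret prob_space qX by (rule qX(1))
  have "sqL2 g \<le> (\<integral>x. (\<kappa> * norm g)\<^sup>2 \<partial>qX)"
    unfolding sqL2_def
    using order_trans[OF ev_norm_le mult_right_mono[OF feat_bound norm_ge_zero], of g]
    by (intro integral_mono sqL2_integrable assms power_mono) auto
  then show ?thesis by (simp add: prob_space)
qed

lemma sqL2_diff_le:
  assumes g: "evl g \<in> borel_measurable borel" and h: "evl h \<in> borel_measurable borel"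
  shows "sqL2 (g - h) \<le> 2 * sqL2 g + 2 * sqL2 h"
proof -
  have m: "evl (g - h) \<in> borel_measurable borel" unfolding ev_diff[abs_def] using g h by measurable
  have "(norm (evl (g - h) x))\<^sup>2 \<le> 2 * (norm (evl g x))\<^sup>2 + 2 * (norm (evl h x))\<^sup>2" for x
  proof -
    have "(norm (evl (g - h) x))\<^sup>2 \<le> (norm (evl g x) + norm (evl h x))\<^sup>2"
      unfolding ev_diff by (intro power_mono norm_triangle_ineq4) auto
    then show ?thesis using power2_sum_le order_trans by blast
  qed
  then have "sqL2 (g - h) \<le> (\<integral>x. 2 * (norm (evl g x))\<^sup>2 + 2 * (norm (evl h x))\<^sup>2 \<partial>qX)"
    unfolding sqL2_def using sqL2_integrable[OF g] sqL2_integrable[OF h] sqL2_integrable[OF m]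
    by (intro integral_mono) auto
  also have "\<dots> = 2 * sqL2 g + 2 * sqL2 h"
    unfolding sqL2_def using sqL2_integrable[OF g] sqL2_integrable[OF h] by simp
  finally show ?thesis .
qed

lemma tensor_measurable: "evl (\<Sum>i\<in>I. T (y i) (a i)) \<in> borel_measurable borel"
  unfolding ev_sum[abs_def] ev_tensor by measurable

lemma sqL2_tensor: "sqL2 (\<Sum>i\<in>I. T (y i) (a i)) = (\<Sum>i\<in>I. \<Sum>l\<in>I. (y i \<bullet> y l) * (a i \<bullet> C (a l)))"
proof -
  have int: "integrable qX (\<lambda>x. (a i \<bullet> feat x) * (a l \<bullet> feat x))" for i l
  proof (rule integrable_bounded_qX)
    show "norm ((a i \<bullet> feat x) * (a l \<bullet> feat x)) \<le> norm (a i) * \<kappa> * (norm (a l) * \<kappa>)" for x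
      using mult_mono[OF abs_inner_feat[of "a i" x] abs_inner_feat[of "a l" x]] \<kappa>_nonneg by (simp add: abs_mult)
  qed measurable
  have "(norm (evl (\<Sum>i\<in>I. T (y i) (a i)) x))\<^sup>2
      = (\<Sum>i\<in>I. \<Sum>l\<in>I. (y i \<bullet> y l) * ((a i \<bullet> feat x) * (a l \<bullet> feat x)))" for x
    unfolding ev_sum ev_tensor power2_norm_eq_inner inner_sum_left inner_sum_right
    by (subst sum.swap) (simp add: mult_ac inner_commute)
  then show ?thesis unfolding sqL2_def cov_op_inner
    by (simp add: int integral_sum)
qed

text \<open>As X is the adjoint of A, the function expands into the tensors of \<open>Co e\<close>
  and \<open>A e\<close> over the basis. Gram matrices of finite parts are compared with multiples
  of the identity by the Schur argument, which brings in the Hilbert-Schmidt norm of Co. The factor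
  2 in the last bound pays for passing to the limit.\<close>

lemma bias_element:
  fixes Co :: "'h \<Rightarrow> 'y" and A X :: "'h \<Rightarrow> 'h"
  assumes Co: "bounded_linear Co" and E: "orthonormal_basis E"
    and hs: "(\<lambda>e. (norm (Co e))\<^sup>2) summable_on E"
    and A: "linear A" and A_le: "\<And>v. norm (A v) \<le> M * norm v"
    and A_L2: "\<And>v. A v \<bullet> C (A v) \<le> M2 * (norm v)\<^sup>2"
    and X: "\<And>v w. X v \<bullet> w = v \<bullet> A w" and Xm: "(\<lambda>x. Co (X (feat x))) \<in> borel_measurable borel"
  shows "\<exists>g. evl g = (\<lambda>x. Co (X (feat x))) \<and> (norm g)\<^sup>2 \<le> M\<^sup>2 * (\<Sum>\<^sub>\<infinity>e\<in>E. (norm (Co e))\<^sup>2)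
      \<and> sqL2 g \<le> 2 * (M2 * (\<Sum>\<^sub>\<infinity>e\<in>E. (norm (Co e))\<^sup>2))"
proof -
  have on: "orthonormal E" using E by (rule orthonormal_basis_orthonormal)
  define h2 where "h2 = (\<Sum>\<^sub>\<infinity>e\<in>E. (norm (Co e))\<^sup>2)"
  have h2_ge: "(\<Sum>e\<in>F. (norm (Co e))\<^sup>2) \<le> h2" if "finite F" "F \<subseteq> E" for F
    unfolding h2_def by (rule finite_sum_le_infsum[OF hs that]) auto
  have M2: "0 \<le> M2 * (norm v)\<^sup>2" for v :: 'h
  proof -
    have "0 \<le> A v \<bullet> C (A v)" unfolding cov_op_inner by (intro integral_nonneg_AE) auto
    then show ?thesis using A_L2[of v] by linarith
  qed
  have diag: "(\<Sum>i\<in>F. \<Sum>l\<in>F. c i * c l * (K * (if i = l then 1 else 0))) = K * (norm (\<Sum>e\<in>F. c e *\<^sub>R e))\<^sup>2"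
    if F: "finite F" "F \<subseteq> E" for F c and K :: real
    unfolding orthonormal_sum_norm[OF on F]
    using F by (simp add: sum_distrib_left power2_eq_square if_distrib mult_ac cong: if_cong)
  have diag': "(\<Sum>i\<in>F. \<Sum>l\<in>F. (Co i \<bullet> Co l) * (K * (if i = l then 1 else 0))) = K * (\<Sum>e\<in>F. (norm (Co e))\<^sup>2)"
    if F: "finite F" for F and K :: real
    using F by (simp add: sum_distrib_left power2_norm_eq_inner if_distrib mult_ac cong: if_cong)
  have AS: "(\<Sum>i\<in>F. c i *\<^sub>R A i) = A (\<Sum>e\<in>F. c e *\<^sub>R e)" for F c
    by (simp add: linear_sum[OF A] linear_scale[OF A])
  have Clin: "linear C"
  proof (rule linearI)
    show "C (v + w) = C v + C w" for v w
    proof -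
      have "a \<bullet> C (v + w) = a \<bullet> (C v + C w)" for a
        by (metis cov_op_sym inner_add_left inner_add_right inner_commute)
      then show ?thesis by (metis inner_commute vector_eq_ldot)
    qed
    show "C (c *\<^sub>R v) = c *\<^sub>R C v" for c v
    proof -
      have "a \<bullet> C (c *\<^sub>R v) = a \<bullet> (c *\<^sub>R C v)" for a
        by (metis cov_op_sym inner_scaleR_left inner_scaleR_right inner_commute)
      then show ?thesis by (metis inner_commute vector_eq_ldot)
    qed
  qed
  have norm_F: "(norm (\<Sum>e\<in>F. T (Co e) (A e)))\<^sup>2 \<le> M\<^sup>2 * (\<Sum>e\<in>F. (norm (Co e))\<^sup>2)"
    if F: "finite F" "F \<subseteq> E" for F
    unfolding tensor_sum_norm diag'[OF F(1), symmetric]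
  proof (rule schur_mono[OF F(1)])
    fix c
    have "(\<Sum>i\<in>F. \<Sum>l\<in>F. c i * c l * (A i \<bullet> A l)) = (norm (A (\<Sum>e\<in>F. c e *\<^sub>R e)))\<^sup>2"
      by (subst double_sum_bilinear[of "(\<bullet>)" c A])
         (auto intro: linear_inner_comp[OF linear_id, unfolded id_def] simp: AS power2_norm_eq_inner)
    also have "\<dots> \<le> (M * norm (\<Sum>e\<in>F. c e *\<^sub>R e))\<^sup>2" by (intro power_mono A_le) auto
    finally show "(\<Sum>i\<in>F. \<Sum>l\<in>F. c i * c l * (A i \<bullet> A l)) \<le> (\<Sum>i\<in>F. \<Sum>l\<in>F. c i * c l * (M\<^sup>2 * (if i = l then 1 else 0)))"
      unfolding diag[OF F] by (simp add: power_mult_distrib)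
  qed
  have sq_F: "sqL2 (\<Sum>e\<in>F. T (Co e) (A e)) \<le> M2 * (\<Sum>e\<in>F. (norm (Co e))\<^sup>2)"
    if F: "finite F" "F \<subseteq> E" for F
    unfolding sqL2_tensor diag'[OF F(1), symmetric]
  proof (rule schur_mono[OF F(1)])
    fix c
    have "(\<Sum>i\<in>F. \<Sum>l\<in>F. c i * c l * (A i \<bullet> C (A l))) = A (\<Sum>e\<in>F. c e *\<^sub>R e) \<bullet> C (A (\<Sum>e\<in>F. c e *\<^sub>R e))"
      by (subst double_sum_bilinear[of "\<lambda>v w. v \<bullet> C w" c A])
         (auto intro: linear_inner_comp[OF linear_id, unfolded id_def] linear_inner_comp[OF Clin] simp: AS)
    also have "\<dots> \<le> M2 * (norm (\<Sum>e\<in>F. c e *\<^sub>R e))\<^sup>2" by (rule A_L2)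
    finally show "(\<Sum>i\<in>F. \<Sum>l\<in>F. c i * c l * (A i \<bullet> C (A l))) \<le> (\<Sum>i\<in>F. \<Sum>l\<in>F. c i * c l * (M2 * (if i = l then 1 else 0)))"
      unfolding diag[OF F] .
  qed
  have "(\<lambda>e. T (Co e) (A e)) summable_on E"
  proof (rule summable_on_norm_square_bound)
    show "(\<lambda>e. M\<^sup>2 * (norm (Co e))\<^sup>2) summable_on E" using hs by (rule summable_on_cmult_right)
    show "(norm (\<Sum>e\<in>F. T (Co e) (A e)))\<^sup>2 \<le> (\<Sum>e\<in>F. M\<^sup>2 * (norm (Co e))\<^sup>2)" if "finite F" "F \<subseteq> E" for F
      using norm_F[OF that] by (simp add: sum_distrib_left)
  qed
  then obtain g where g: "((\<lambda>e. T (Co e) (A e)) has_sum g) E" by (auto simp: summable_on_def)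
  have eg: "evl g x = Co (X (feat x))" for x
  proof -
    have "((\<lambda>e. evl (T (Co e) (A e)) x) has_sum evl g x) E"
      by (rule has_sum_bounded_linear[OF ev_bounded_linear g])
    moreover have "((\<lambda>e. Co ((X (feat x) \<bullet> e) *\<^sub>R e)) has_sum Co (X (feat x))) E"
      by (rule has_sum_bounded_linear[OF Co orthonormal_basis_has_sum[OF E]])
    moreover have "evl (T (Co e) (A e)) x = Co ((X (feat x) \<bullet> e) *\<^sub>R e)" for e
      unfolding ev_tensor X linear_scale[OF bounded_linear.linear[OF Co]] by (simp add: inner_commute)
    ultimately show ?thesis using has_sum_unique by (metis (no_types, lifting) has_sum_cong)
  qed
  have lim: "((\<lambda>F. \<Sum>e\<in>F. T (Co e) (A e)) \<longlongrightarrow> g) (finite_subsets_at_top E)"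
    using g by (simp add: has_sum_def)
  have evF: "\<forall>\<^sub>F F in finite_subsets_at_top E. finite F \<and> F \<subseteq> E"
    by (rule eventually_finite_subsets_at_top_weakI) auto
  have ng: "(norm g)\<^sup>2 \<le> M\<^sup>2 * h2"
  proof (rule tendsto_upperbound[OF tendsto_power[OF tendsto_norm[OF lim], of 2]])
    show "\<forall>\<^sub>F F in finite_subsets_at_top E. (norm (\<Sum>e\<in>F. T (Co e) (A e)))\<^sup>2 \<le> M\<^sup>2 * h2"
      using evF
    proof eventually_elim
      case (elim F)
      then show ?case using norm_F[of F] mult_left_mono[OF h2_ge[of F] zero_le_power2[of M]] by linarith
    qed
  qed simp
  have em: "evl g \<in> borel_measurable borel" using Xm unfolding ext[of "evl g", OF eg] .
  \<comment> \<open>Convergence takes place in the norm of the space, which dominates the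
    square-integral norm up to \<kappa>; what remains is a finite partial sum and an arbitrarily
    small rest.\<close>
  have sqg: "sqL2 g \<le> 2 * (M2 * h2)"
  proof (rule field_le_epsilon)
    fix \<epsilon> :: real assume \<epsilon>: "\<epsilon> > 0"
    have "((\<lambda>F. 2 * (\<kappa> * norm (g - (\<Sum>e\<in>F. T (Co e) (A e))))\<^sup>2) \<longlongrightarrow> 2 * (\<kappa> * norm (g - g))\<^sup>2) (finite_subsets_at_top E)"
      by (intro tendsto_intros lim)
    then have "\<forall>\<^sub>F F in finite_subsets_at_top E. 2 * (\<kappa> * norm (g - (\<Sum>e\<in>F. T (Co e) (A e))))\<^sup>2 < \<epsilon>"
      using \<epsilon> by (intro order_tendstoD) auto
    then have "\<forall>\<^sub>F F in finite_subsets_at_top E. finite F \<and> F \<subseteq> E \<and> 2 * (\<kappa> * norm (g - (\<Sum>e\<in>F. T (Co e) (A e))))\<^sup>2 < \<epsilon>"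
      using evF by eventually_elim auto
    then obtain F where F: "finite F" "F \<subseteq> E" "2 * (\<kappa> * norm (g - (\<Sum>e\<in>F. T (Co e) (A e))))\<^sup>2 < \<epsilon>"
      using eventually_happens'[OF finite_subsets_at_top_neq_bot] by blast
    define gF where "gF = (\<Sum>e\<in>F. T (Co e) (A e))"
    have mF: "evl gF \<in> borel_measurable borel" unfolding gF_def by (rule tensor_measurable)
    have mD: "evl (gF - g) \<in> borel_measurable borel"
      unfolding ev_diff[abs_def] using mF em by measurable
    have "sqL2 g = sqL2 (gF - (gF - g))" by simp
    also have "\<dots> \<le> 2 * sqL2 gF + 2 * sqL2 (gF - g)" by (rule sqL2_diff_le[OF mF mD])
    also have "\<dots> \<le> 2 * (M2 * (\<Sum>e\<in>F. (norm (Co e))\<^sup>2)) + \<epsilon>"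
      using sq_F[OF F(1,2)] sqL2_le[OF mD] F(3) unfolding gF_def by (simp add: norm_minus_commute)
    \<comment> \<open>The sign of M2 is known only when a unit vector exists, hence the separate
      case of an empty basis.\<close>
    also have "M2 * (\<Sum>e\<in>F. (norm (Co e))\<^sup>2) \<le> M2 * h2"
    proof (cases "E = {}")
      case True
      then show ?thesis using F by (simp add: h2_def)
    next
      case False
      then obtain e where "e \<in> E" by blast
      then have "0 \<le> M2" using M2[of e] on by (simp add: orthonormal_def)
      then show ?thesis using h2_ge[OF F(1,2)] by (rule mult_left_mono[rotated])
    qed
    finally show "sqL2 g \<le> 2 * (M2 * h2) + \<epsilon>" by simp
  qed
  show ?thesis using eg ng sqg unfolding h2_def by (intro exI[of _ g]) auto
qed

end

section \<open>Noise under a spectral filter\<close>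

context two_ops
begin

text \<open>On the eigenvalues, the hypotheses bound \<open>g\<^sup>2\<close> and
  \<open>g\<^sup>2 * (s + lam)\<close> by a constant times \<open>1 / (s + lam)\<close>; at 0 the
  filter vanishes. In the second claim C is first replaced by \<open>w\<^sup>2 * (Ch + lam)\<close>.
  The Schur argument carries both to vector noise, so one form in the plain resolvent controls every
  filter.\<close>

lemma noise_forms:
  fixes a :: "'i \<Rightarrow> 'a" and y :: "'i \<Rightarrow> 'y::real_inner"
  assumes I: "finite I" and g0: "g 0 = 0" and c: "0 \<le> c" "0 \<le> c'"
    and g1: "\<And>u. u \<in> U \<Longrightarrow> (g (\<sigma> u))\<^sup>2 * (\<sigma> u + lam) \<le> c"
    and g2: "\<And>u. u \<in> U \<Longrightarrow> (g (\<sigma> u) * (\<sigma> u + lam))\<^sup>2 \<le> c'"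
    and lam': "0 \<le> lam'"
  shows "(\<Sum>i\<in>I. \<Sum>l\<in>I. (y i \<bullet> y l) * (F g (a i) \<bullet> F g (a l)))
      \<le> c * (\<Sum>i\<in>I. \<Sum>l\<in>I. (y i \<bullet> y l) * (F (\<lambda>s. 1 / (s + lam)) (a i) \<bullet> a l))"
    and "(\<Sum>i\<in>I. \<Sum>l\<in>I. (y i \<bullet> y l) * (F g (a i) \<bullet> C (F g (a l))))
      \<le> w\<^sup>2 * c' * (\<Sum>i\<in>I. \<Sum>l\<in>I. (y i \<bullet> y l) * (F (\<lambda>s. 1 / (s + lam)) (a i) \<bullet> a l))"
proof -
  let ?R = "F (\<lambda>s. 1 / (s + lam))"
  have lins: "linear (\<lambda>v. F h v \<bullet> F h' w)" "linear (\<lambda>w. F h v \<bullet> F h' w)" "linear (\<lambda>w. F h v \<bullet> w)"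
    "linear (\<lambda>v. F h v \<bullet> z)" "linear (\<lambda>w. F h v \<bullet> C (F h w))" for h h' v w z
    by (auto simp: linear_iff spec_fun_add spec_fun_scale inner_add_left inner_add_right C_add C_scale)
  have R: "(\<Sum>i\<in>I. \<Sum>l\<in>I. e i * e l * (k * (?R (a i) \<bullet> a l))) = k * (?R (\<Sum>i\<in>I. e i *\<^sub>R a i) \<bullet> (\<Sum>i\<in>I. e i *\<^sub>R a i))" for e k
  proof -
    have "(\<Sum>i\<in>I. \<Sum>l\<in>I. e i * e l * (k * (?R (a i) \<bullet> a l))) = k * (\<Sum>i\<in>I. \<Sum>l\<in>I. e i * e l * (?R (a i) \<bullet> a l))"
      by (simp add: sum_distrib_left mult_ac)
    then show ?thesis by (subst (asm) double_sum_bilinear[of "\<lambda>v w. ?R v \<bullet> w"]) (auto intro: lins)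
  qed
  have pos: "0 < \<sigma> u + lam" if "u \<in> U" for u using \<sigma>_pos[OF that] lam by simp
  have "(\<Sum>i\<in>I. \<Sum>l\<in>I. (y i \<bullet> y l) * (F g (a i) \<bullet> F g (a l)))
      \<le> (\<Sum>i\<in>I. \<Sum>l\<in>I. (y i \<bullet> y l) * (c * (?R (a i) \<bullet> a l)))"
  proof (rule schur_mono[OF I])
    fix e
    define v where "v = (\<Sum>i\<in>I. e i *\<^sub>R a i)"
    have "(\<Sum>i\<in>I. \<Sum>l\<in>I. e i * e l * (F g (a i) \<bullet> F g (a l))) = (norm (F g v))\<^sup>2"
      by (subst double_sum_bilinear[of "\<lambda>v w. F g v \<bullet> F g w"]) (auto intro: lins simp: v_def power2_norm_eq_inner)
    also have "\<dots> \<le> F (\<lambda>s. c * (1 / (s + lam))) v \<bullet> v"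
      unfolding spec_fun_norm
    proof (rule spec_fun_mono)
      fix u assume u: "u \<in> U"
      show "(g (\<sigma> u))\<^sup>2 \<le> c * (1 / (\<sigma> u + lam))" using g1[OF u] pos[OF u] by (simp add: pos_le_divide_eq)
    qed (use g0 c lam in simp)
    also have "\<dots> = c * (?R v \<bullet> v)" by (simp only: spec_fun_scale_fun inner_scaleR_left)
    finally show "(\<Sum>i\<in>I. \<Sum>l\<in>I. e i * e l * (F g (a i) \<bullet> F g (a l)))
        \<le> (\<Sum>i\<in>I. \<Sum>l\<in>I. e i * e l * (c * (?R (a i) \<bullet> a l)))" unfolding R v_def .
  qed
  then show "(\<Sum>i\<in>I. \<Sum>l\<in>I. (y i \<bullet> y l) * (F g (a i) \<bullet> F g (a l)))
      \<le> c * (\<Sum>i\<in>I. \<Sum>l\<in>I. (y i \<bullet> y l) * (?R (a i) \<bullet> a l))"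
    by (simp add: sum_distrib_left mult_ac)
  have "(\<Sum>i\<in>I. \<Sum>l\<in>I. (y i \<bullet> y l) * (F g (a i) \<bullet> C (F g (a l))))
      \<le> (\<Sum>i\<in>I. \<Sum>l\<in>I. (y i \<bullet> y l) * (w\<^sup>2 * c' * (?R (a i) \<bullet> a l)))"
  proof (rule schur_mono[OF I])
    fix e
    define v where "v = (\<Sum>i\<in>I. e i *\<^sub>R a i)"
    have "(\<Sum>i\<in>I. \<Sum>l\<in>I. e i * e l * (F g (a i) \<bullet> C (F g (a l)))) = F g v \<bullet> C (F g v)"
      unfolding v_def
      by (subst double_sum_bilinear[of "\<lambda>v w. F g v \<bullet> C (F g w)"])
         (auto simp: linear_iff spec_fun_add spec_fun_scale inner_add_left inner_add_right C_add C_scale)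
    also have "\<dots> \<le> w\<^sup>2 * (F g v \<bullet> Ch (F g v) + lam * (norm (F g v))\<^sup>2)"
      using compare[of "F g v"] lam' mult_nonneg_nonneg[OF lam' zero_le_power2[of "norm (F g v)"]] by linarith
    also have "F g v \<bullet> Ch (F g v) + lam * (norm (F g v))\<^sup>2 = F (\<lambda>s. (g s)\<^sup>2 * (s + lam)) v \<bullet> v"
    proof -
      have 1: "F g v \<bullet> Ch (F g v) = F (\<lambda>s. g s * (s * g s)) v \<bullet> v"
        unfolding Ch spec_fun_mult by (metis inner_commute spec_fun_mult spec_fun_sym)
      have "F (\<lambda>s. (g s)\<^sup>2 * (s + lam)) v = F (\<lambda>s. g s * (s * g s) + lam * (g s)\<^sup>2) v"
        by (rule spec_fun_cong) (auto simp: power2_eq_square algebra_simps)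
      then show ?thesis unfolding 1 spec_fun_norm
        by (simp only: spec_fun_plus_fun spec_fun_scale_fun inner_add_left inner_scaleR_left)
    qed
    also have "F (\<lambda>s. (g s)\<^sup>2 * (s + lam)) v \<bullet> v \<le> F (\<lambda>s. c' * (1 / (s + lam))) v \<bullet> v"
    proof (rule spec_fun_mono)
      fix u assume u: "u \<in> U"
      show "(g (\<sigma> u))\<^sup>2 * (\<sigma> u + lam) \<le> c' * (1 / (\<sigma> u + lam))"
        using g2[OF u] pos[OF u] by (simp add: pos_le_divide_eq power2_eq_square mult_ac)
    qed (use g0 c lam in simp)
    also have "\<dots> = c' * (?R v \<bullet> v)" by (simp only: spec_fun_scale_fun inner_scaleR_left)
    finally show "(\<Sum>i\<in>I. \<Sum>l\<in>I. e i * e l * (F g (a i) \<bullet> C (F g (a l))))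
        \<le> (\<Sum>i\<in>I. \<Sum>l\<in>I. e i * e l * (w\<^sup>2 * c' * (?R (a i) \<bullet> a l)))" unfolding R v_def
      by (simp add: mult_left_mono mult.assoc)
  qed
  then show "(\<Sum>i\<in>I. \<Sum>l\<in>I. (y i \<bullet> y l) * (F g (a i) \<bullet> C (F g (a l))))
      \<le> w\<^sup>2 * c' * (\<Sum>i\<in>I. \<Sum>l\<in>I. (y i \<bullet> y l) * (?R (a i) \<bullet> a l))"
    by (simp add: sum_distrib_left mult_ac)
qed

end

section \<open>Exponential moments\<close>

text \<open>Exponential Markov inequality with the moment taken on G only, so that a moment bound
  valid merely on that event is enough.\<close>

lemma cosh_markov:
  assumes M: "prob_space M" and W: "W \<in> borel_measurable M" and G: "G \<in> sets M"
    and mgf: "(\<integral>\<^sup>+z. indicator G z * ennreal (cosh (W z)) \<partial>M) \<le> ennreal (exp x)"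
  shows "measure M {z\<in>G. t \<le> W z} \<le> 2 * exp (x - t)"
proof -
  interpret prob_space M by (rule M)
  have meas: "(\<lambda>z. ennreal (2 * cosh (W z)) * indicator G z) \<in> borel_measurable M"
    unfolding cosh_field_def using W G by measurable
  have sub: "{z\<in>G. t \<le> W z} \<subseteq> {z\<in>G. 1 \<le> ennreal (exp (- t)) * ennreal (2 * cosh (W z))}"
  proof safe
    fix z assume "t \<le> W z"
    then have "exp t \<le> 2 * cosh (W z)" using exp_le_two_cosh[of "W z"] by (meson exp_le_cancel_iff order_trans)
    then have "exp (- t) * exp t \<le> exp (- t) * (2 * cosh (W z))" by (intro mult_left_mono) auto
    then have "1 \<le> exp (- t) * (2 * cosh (W z))" by (simp add: exp_minus)
    then show "1 \<le> ennreal (exp (- t)) * ennreal (2 * cosh (W z))"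
      by (simp add: ennreal_mult'[symmetric])
  qed
  have "G \<subseteq> space M" using G by (rule sets.sets_into_space)
  have m2: "{z\<in>G. 1 \<le> ennreal (exp (- t)) * ennreal (2 * cosh (W z))} \<in> sets M"
  proof -
    have "{z\<in>space M. 1 \<le> ennreal (exp (- t)) * ennreal (2 * cosh (W z))} \<in> sets M"
      unfolding cosh_field_def using W by measurable
    then have "{z\<in>space M. 1 \<le> ennreal (exp (- t)) * ennreal (2 * cosh (W z))} \<inter> G \<in> sets M" using G by blast
    moreover have "{z\<in>space M. 1 \<le> ennreal (exp (- t)) * ennreal (2 * cosh (W z))} \<inter> G
      = {z\<in>G. 1 \<le> ennreal (exp (- t)) * ennreal (2 * cosh (W z))}" using \<open>G \<subseteq> space M\<close> by blast
    ultimately show ?thesis by simp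
  qed
  have "emeasure M {z\<in>G. t \<le> W z} \<le> emeasure M {z\<in>G. 1 \<le> ennreal (exp (- t)) * ennreal (2 * cosh (W z))}"
    by (rule emeasure_mono[OF sub m2])
  also have "\<dots> \<le> ennreal (exp (- t)) * (\<integral>\<^sup>+z. ennreal (2 * cosh (W z)) * indicator G z \<partial>M)"
    by (rule nn_integral_Markov_inequality[OF meas G])
  also have "(\<integral>\<^sup>+z. ennreal (2 * cosh (W z)) * indicator G z \<partial>M) = 2 * (\<integral>\<^sup>+z. indicator G z * ennreal (cosh (W z)) \<partial>M)"
  proof (subst nn_integral_cmult[symmetric])
    show "(\<lambda>z. indicator G z * ennreal (cosh (W z))) \<in> borel_measurable M"
      unfolding cosh_field_def using W G by measurable
  qed (auto intro!: nn_integral_cong simp: ennreal_mult mult_ac)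
  also have "ennreal (exp (- t)) * (2 * (\<integral>\<^sup>+z. indicator G z * ennreal (cosh (W z)) \<partial>M))
      \<le> ennreal (exp (- t)) * (2 * ennreal (exp x))"
    by (intro mult_left_mono mgf) auto
  also have "\<dots> = ennreal (2 * exp (x - t))"
  proof -
    have "2 * ennreal (exp x) = ennreal (2 * exp x)" by (simp add: ennreal_mult)
    then have "ennreal (exp (- t)) * (2 * ennreal (exp x)) = ennreal (exp (- t) * (2 * exp x))"
      by (simp add: ennreal_mult'[symmetric])
    also have "exp (- t) * (2 * exp x) = 2 * exp (x - t)" by (simp add: exp_diff exp_minus field_simps)
    finally show ?thesis .
  qed
  finally have le: "emeasure M {z\<in>G. t \<le> W z} \<le> ennreal (2 * exp (x - t))" .
  then show ?thesis unfolding measure_def by (intro enn2real_leI) auto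
qed

lemma measurable_PiM_coordinate:
  assumes "V \<in> measurable p N" "i \<in> I"
  shows "(\<lambda>z. V (z i)) \<in> measurable (PiM I (\<lambda>_. p)) N"
proof -
  have "(\<lambda>z. z i) \<in> measurable (PiM I (\<lambda>_. p)) p"
    using measurable_component_singleton[OF assms(2), of "\<lambda>_. p"] by simp
  then show ?thesis using assms(1) by (rule measurable_compose)
qed

text \<open>Induction step for moments under the product measure: a single coordinate is integrated
  out with all others frozen.\<close>

lemma PiM_nn_integral_step:
  fixes p :: "'z measure" and i :: 'i
  assumes p: "prob_space p" and I: "finite I" "i \<in> I"
    and f: "f \<in> borel_measurable (PiM I (\<lambda>_. p))" "f' \<in> borel_measurable (PiM I (\<lambda>_. p))"
    and le: "\<And>z. z \<in> space (PiM (I - {i}) (\<lambda>_. p)) \<Longrightarrow> (\<integral>\<^sup>+\<zeta>. f (z(i := \<zeta>)) \<partial>p) \<le> (\<integral>\<^sup>+\<zeta>. f' (z(i := \<zeta>)) \<partial>p)"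
  shows "(\<integral>\<^sup>+z. f z \<partial>PiM I (\<lambda>_. p)) \<le> (\<integral>\<^sup>+z. f' z \<partial>PiM I (\<lambda>_. p))"
proof -
  interpret product_sigma_finite "\<lambda>_. p"
    by (rule product_sigma_finite.intro) (rule prob_space_imp_sigma_finite[OF p])
  have ins: "insert i (I - {i}) = I" using I by auto
  have *: "(\<integral>\<^sup>+z. h z \<partial>PiM I (\<lambda>_. p)) = (\<integral>\<^sup>+z. \<integral>\<^sup>+\<zeta>. h (z(i := \<zeta>)) \<partial>p \<partial>PiM (I - {i}) (\<lambda>_. p))"
    if "h \<in> borel_measurable (PiM I (\<lambda>_. p))" for h :: "('i \<Rightarrow> 'z) \<Rightarrow> ennreal"
    using product_nn_integral_insert[of "I - {i}" i h] I that unfolding ins by simp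
  show ?thesis unfolding *[OF f(1)] *[OF f(2)] by (rule nn_integral_mono) (rule le)
qed

text \<open>Here q is the squared norm of the past sum, d that of the new summand and c their inner
  product. The term of \<open>cosh_sqrt_step\<close> linear in c has mean zero, so the past enters
  only through the factor \<open>cosh (sqrt q)\<close>.\<close>

lemma nn_integral_cosh_step:
  fixes c d :: "'z \<Rightarrow> real"
  assumes M: "prob_space M" and q: "0 \<le> q"
    and c: "integrable M c" "(\<integral>z. c z \<partial>M) = 0" and e: "integrable M e"
    and d: "AE z in M. 0 \<le> d z" and cs: "AE z in M. \<bar>c z\<bar> \<le> sqrt q * sqrt (d z)"
    and ed: "AE z in M. 2 * cosh (sqrt (d z)) - 1 \<le> e z"
  shows "(\<integral>\<^sup>+z. ennreal (cosh (sqrt (q + 2 * c z + d z))) \<partial>M) \<le> ennreal (cosh (sqrt q) * (\<integral>z. e z \<partial>M))"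
proof -
  let ?h = "\<lambda>z. cosh (sqrt q) * e z + sinh (sqrt q) / sqrt q * c z"
  have ae: "AE z in M. cosh (sqrt (q + 2 * c z + d z)) \<le> ?h z"
    using d cs ed
  proof eventually_elim
    case (elim z)
    have "cosh (sqrt (q + 2 * c z + d z)) \<le> cosh (sqrt q) * (2 * cosh (sqrt (d z)) - 1) + sinh (sqrt q) / sqrt q * c z"
      using cosh_sqrt_step[of "sqrt q" "sqrt (d z)" "c z"] elim q by simp
    also have "cosh (sqrt q) * (2 * cosh (sqrt (d z)) - 1) \<le> cosh (sqrt q) * e z"
      using elim by (intro mult_left_mono) auto
    finally show ?case by simp
  qed
  have int: "integrable M ?h" using c e by auto
  have "(\<integral>\<^sup>+z. ennreal (cosh (sqrt (q + 2 * c z + d z))) \<partial>M) \<le> (\<integral>\<^sup>+z. ennreal (?h z) \<partial>M)"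
    using ae by (intro nn_integral_mono_AE) (auto elim: eventually_mono intro: ennreal_leI)
  also have "\<dots> = ennreal (\<integral>z. ?h z \<partial>M)"
    using ae by (intro nn_integral_eq_integral int) (auto elim!: eventually_mono intro: order_trans[OF cosh_real_nonneg])
  also have "(\<integral>z. ?h z \<partial>M) = cosh (sqrt q) * (\<integral>z. e z \<partial>M)" using c e by simp
  finally show ?thesis .
qed

text \<open>Each summand is a finite family, viewed as one vector of the direct sum over J; in the
  application these are columns of an operator and the norm is Hilbert-Schmidt. As summands have
  norm at most 1, a step multiplies the moment by at most \<open>1 + 2 * v\<close>, hence by at most
  \<open>exp (2 * v)\<close>.\<close>

lemma bernstein_mgf:
  fixes p :: "'z measure" and V :: "'z \<Rightarrow> 'j \<Rightarrow> 'h::{real_inner,banach,second_countable_topology}"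
  assumes p: "prob_space p" and J: "finite J"
    and V: "\<And>j. j \<in> J \<Longrightarrow> (\<lambda>\<zeta>. V \<zeta> j) \<in> borel_measurable p"
    and V1: "\<And>\<zeta>. (\<Sum>j\<in>J. (norm (V \<zeta> j))\<^sup>2) \<le> 1"
    and V0: "\<And>j a. j \<in> J \<Longrightarrow> (\<integral>\<zeta>. a \<bullet> V \<zeta> j \<partial>p) = 0"
    and v: "(\<integral>\<zeta>. (\<Sum>j\<in>J. (norm (V \<zeta> j))\<^sup>2) \<partial>p) \<le> v"
    and mn: "m \<le> n"
  shows "(\<integral>\<^sup>+z. ennreal (cosh (sqrt (\<Sum>j\<in>J. (norm (\<Sum>i<m. V (z i) j))\<^sup>2))) \<partial>PiM {..<n} (\<lambda>_. p)) \<le> ennreal (exp (2 * v * real m))"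
  using mn
proof (induction m)
  case 0
  interpret P: prob_space "PiM {..<n} (\<lambda>_. p)" by (rule prob_space_PiM) (rule p)
  show ?case by (simp add: P.emeasure_space_1)
next
  case (Suc m)
  interpret p: prob_space p by (rule p)
  let ?Pi = "PiM {..<n} (\<lambda>_. p)"
  define Q where "Q k z = (\<Sum>j\<in>J. (norm (\<Sum>i<k. V (z i) j))\<^sup>2)" for k and z :: "nat \<Rightarrow> 'z"
  have Qm: "Q k \<in> borel_measurable ?Pi" if "k \<le> n" for k
  proof -
    have "(\<lambda>z. V (z i) j) \<in> borel_measurable ?Pi" if "i < k" "j \<in> J" for i j
      using V[OF that(2)] that(1) \<open>k \<le> n\<close> by (intro measurable_PiM_coordinate) auto
    then show ?thesis unfolding Q_def
      by (intro borel_measurable_sum borel_measurable_power borel_measurable_norm) auto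
  qed
  have Q0: "0 \<le> Q k z" for k z by (auto simp: Q_def intro: sum_nonneg)
  define D where "D \<zeta> = (\<Sum>j\<in>J. (norm (V \<zeta> j))\<^sup>2)" for \<zeta>
  have Dm: "D \<in> borel_measurable p" unfolding D_def using V by measurable
  have D0: "0 \<le> D \<zeta>" for \<zeta> by (auto simp: D_def intro: sum_nonneg)
  have D1: "D \<zeta> \<le> 1" for \<zeta> using V1 by (simp add: D_def)
  have Di: "integrable p D"
    using Dm D0 D1 by (intro p.integrable_const_bound[of _ 1]) auto
  have m: "m < n" using Suc by simp
  have "(\<integral>\<^sup>+z. ennreal (cosh (sqrt (Q (Suc m) z))) \<partial>?Pi) \<le> (\<integral>\<^sup>+z. ennreal (cosh (sqrt (Q m z)) * exp (2 * v)) \<partial>?Pi)"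
  proof (rule PiM_nn_integral_step[OF p finite_lessThan, of m])
    show "m \<in> {..<n}" using m by simp
    show "(\<lambda>z. ennreal (cosh (sqrt (Q (Suc m) z)))) \<in> borel_measurable ?Pi"
      unfolding cosh_field_def using Qm[OF Suc_leI[OF m]] by measurable
    show "(\<lambda>z. ennreal (cosh (sqrt (Q m z)) * exp (2 * v))) \<in> borel_measurable ?Pi"
      unfolding cosh_field_def using Qm[OF less_imp_le[OF m]] by measurable
  next
    fix z :: "nat \<Rightarrow> 'z"
    define a where "a j = (\<Sum>i<m. V (z i) j)" for j
    define c where "c \<zeta> = (\<Sum>j\<in>J. a j \<bullet> V \<zeta> j)" for \<zeta>
    have Qm_upd: "Q m (z(m := \<zeta>)) = Q m z" for \<zeta> by (simp add: Q_def)
    have Qz: "Q m z = (\<Sum>j\<in>J. (norm (a j))\<^sup>2)" by (simp add: Q_def a_def)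
    have Q_upd: "Q (Suc m) (z(m := \<zeta>)) = Q m z + 2 * c \<zeta> + D \<zeta>" for \<zeta>
    proof -
      have "Q (Suc m) (z(m := \<zeta>)) = (\<Sum>j\<in>J. (norm (a j + V \<zeta> j))\<^sup>2)"
        by (simp add: Q_def a_def)
      also have "\<dots> = (\<Sum>j\<in>J. (norm (a j))\<^sup>2 + 2 * (a j \<bullet> V \<zeta> j) + (norm (V \<zeta> j))\<^sup>2)"
        by (intro sum.cong refl) (simp add: power2_norm_eq_inner inner_add_left inner_add_right inner_commute)
      finally show ?thesis by (simp add: Qz c_def D_def sum.distrib sum_distrib_left)
    qed
    have cs: "\<bar>c \<zeta>\<bar> \<le> sqrt (Q m z) * sqrt (D \<zeta>)" for \<zeta>
    proof -
      have "\<bar>c \<zeta>\<bar> \<le> (\<Sum>j\<in>J. \<bar>norm (a j)\<bar> * \<bar>norm (V \<zeta> j)\<bar>)"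
        unfolding c_def using Cauchy_Schwarz_ineq2 by (intro order_trans[OF sum_abs] sum_mono) simp
      also have "\<dots> \<le> L2_set (\<lambda>j. norm (a j)) J * L2_set (\<lambda>j. norm (V \<zeta> j)) J" by (rule L2_set_mult_ineq)
      finally show ?thesis by (simp add: L2_set_def Qz D_def)
    qed
    have ci: "integrable p (\<lambda>\<zeta>. a j \<bullet> V \<zeta> j)" if j: "j \<in> J" for j
    proof (rule p.integrable_const_bound[of _ "norm (a j)"])
      have "(norm (V \<zeta> j))\<^sup>2 \<le> 1" for \<zeta>
        using member_le_sum[OF j, of "\<lambda>j. (norm (V \<zeta> j))\<^sup>2"] J V1[of \<zeta>] by simp
      then have "norm (V \<zeta> j) \<le> 1" for \<zeta> by (simp add: power_le_one_iff)
      then have "norm (a j \<bullet> V \<zeta> j) \<le> norm (a j)" for \<zeta>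
        using Cauchy_Schwarz_ineq2[of "a j" "V \<zeta> j"] mult_left_mono[of "norm (V \<zeta> j)" 1 "norm (a j)"] by fastforce
      then show "AE \<zeta> in p. norm (a j \<bullet> V \<zeta> j) \<le> norm (a j)" by simp
    qed (use V[OF j] in measurable)
    have "(\<integral>\<^sup>+\<zeta>. ennreal (cosh (sqrt (Q (Suc m) (z(m := \<zeta>))))) \<partial>p) \<le> ennreal (cosh (sqrt (Q m z)) * (\<integral>\<zeta>. 1 + 2 * D \<zeta> \<partial>p))"
      unfolding Q_upd
    proof (rule nn_integral_cosh_step[OF p Q0])
      show "integrable p c" unfolding c_def using ci by (intro Bochner_Integration.integrable_sum)
      show "(\<integral>\<zeta>. c \<zeta> \<partial>p) = 0" unfolding c_def using ci V0 by (simp add: Bochner_Integration.integral_sum)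
      show "integrable p (\<lambda>\<zeta>. 1 + 2 * D \<zeta>)" using Di by simp
      show "AE \<zeta> in p. 2 * cosh (sqrt (D \<zeta>)) - 1 \<le> 1 + 2 * D \<zeta>"
      proof (rule AE_I2)
        fix \<zeta>
        have "cosh (sqrt (D \<zeta>)) \<le> 1 + (sqrt (D \<zeta>))\<^sup>2" using D0[of \<zeta>] D1[of \<zeta>] by (intro cosh_le_one_plus_square) auto
        then show "2 * cosh (sqrt (D \<zeta>)) - 1 \<le> 1 + 2 * D \<zeta>" using D0[of \<zeta>] by simp
      qed
    qed (use cs D0 in auto)
    also have "\<dots> \<le> ennreal (cosh (sqrt (Q m z)) * exp (2 * v))"
    proof (intro ennreal_leI mult_left_mono)
      have "(\<integral>\<zeta>. 1 + 2 * D \<zeta> \<partial>p) = 1 + 2 * (\<integral>\<zeta>. D \<zeta> \<partial>p)" using Di by (simp add: p.prob_space)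
      also have "\<dots> \<le> 1 + 2 * v" using v by (simp add: D_def)
      also have "\<dots> \<le> exp (2 * v)" by (rule exp_ge_add_one_self)
      finally show "(\<integral>\<zeta>. 1 + 2 * D \<zeta> \<partial>p) \<le> exp (2 * v)" .
    qed simp
    also have "\<dots> = (\<integral>\<^sup>+\<zeta>. ennreal (cosh (sqrt (Q m (z(m := \<zeta>)))) * exp (2 * v)) \<partial>p)"
      unfolding Qm_upd by (simp add: p.emeasure_space_1)
    finally show "(\<integral>\<^sup>+\<zeta>. ennreal (cosh (sqrt (Q (Suc m) (z(m := \<zeta>))))) \<partial>p)
        \<le> (\<integral>\<^sup>+\<zeta>. ennreal (cosh (sqrt (Q m (z(m := \<zeta>)))) * exp (2 * v)) \<partial>p)" .
  qed
  also have "\<dots> = (\<integral>\<^sup>+z. ennreal (cosh (sqrt (Q m z))) \<partial>?Pi) * ennreal (exp (2 * v))"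
  proof -
    have "(\<lambda>z. ennreal (cosh (sqrt (Q m z)))) \<in> borel_measurable ?Pi"
      unfolding cosh_field_def using Qm[OF less_imp_le[OF m]] by measurable
    then show ?thesis by (simp add: ennreal_mult' nn_integral_multc)
  qed
  also have "\<dots> \<le> ennreal (exp (2 * v * real m)) * ennreal (exp (2 * v))"
    using Suc by (intro mult_right_mono) (auto simp: Q_def)
  also have "\<dots> = ennreal (exp (2 * v * real (Suc m)))"
    by (simp add: ennreal_mult'[symmetric] exp_add[symmetric] algebra_simps)
  finally show ?case by (simp add: Q_def)
qed

text \<open>Chernoff bound with parameter 1, from \<open>exp x \<le> 1 + 2 * x\<close> on the unit
  interval; the variables enter through their mean alone.\<close>

lemma scalar_mgf:
  fixes p :: "'z measure" and Z :: "'z \<Rightarrow> real"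
  assumes p: "prob_space p" and Z: "Z \<in> borel_measurable p" "\<And>\<zeta>. 0 \<le> Z \<zeta>" "\<And>\<zeta>. Z \<zeta> \<le> 1"
    and v: "(\<integral>\<zeta>. Z \<zeta> \<partial>p) \<le> v"
  shows "measure (PiM {..<n} (\<lambda>_. p)) {z \<in> space (PiM {..<n} (\<lambda>_. p)). t \<le> (\<Sum>i<n. Z (z i))} \<le> exp (2 * v * real n - t)"
proof -
  let ?Pi = "PiM {..<n} (\<lambda>_. p)"
  interpret p: prob_space p by (rule p)
  interpret P: prob_space ?Pi by (rule prob_space_PiM) (rule p)
  have Zi: "integrable p Z" using Z by (intro p.integrable_const_bound[of _ 1]) auto
  have meas: "(\<lambda>z. \<Sum>i<m. Z (z i)) \<in> borel_measurable ?Pi" if "m \<le> n" for m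
    using that Z(1) by (intro borel_measurable_sum measurable_PiM_coordinate) auto
  have one: "(\<integral>\<zeta>. exp (Z \<zeta>) \<partial>p) \<le> exp (2 * v)" and ei: "integrable p (\<lambda>\<zeta>. exp (Z \<zeta>))"
  proof -
    show ei: "integrable p (\<lambda>\<zeta>. exp (Z \<zeta>))"
      using Z by (intro p.integrable_const_bound[of _ "exp 1"]) auto
    have pw: "exp x \<le> 1 + 2 * x" if "0 \<le> x" "x \<le> 1" for x :: real
    proof -
      have "exp x \<le> 1 + x + x\<^sup>2" using that by (rule exp_bound)
      also have "x\<^sup>2 \<le> x" using that by (simp add: power2_eq_square mult_left_le)
      finally show ?thesis by simp
    qed
    have "(\<integral>\<zeta>. exp (Z \<zeta>) \<partial>p) \<le> (\<integral>\<zeta>. 1 + 2 * Z \<zeta> \<partial>p)"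
      using Zi ei pw Z by (intro integral_mono) auto
    also have "\<dots> = 1 + 2 * (\<integral>\<zeta>. Z \<zeta> \<partial>p)" using Zi by (simp add: p.prob_space)
    also have "\<dots> \<le> 1 + 2 * v" using v by simp
    also have "\<dots> \<le> exp (2 * v)" by (rule exp_ge_add_one_self)
    finally show "(\<integral>\<zeta>. exp (Z \<zeta>) \<partial>p) \<le> exp (2 * v)" .
  qed
  have mgf: "(\<integral>\<^sup>+z. ennreal (exp (\<Sum>i<m. Z (z i))) \<partial>?Pi) \<le> ennreal (exp (2 * v * real m))" if "m \<le> n" for m
    using that
  proof (induction m)
    case 0
    then show ?case by (simp add: P.emeasure_space_1)
  next
    case (Suc m)
    have "(\<integral>\<^sup>+z. ennreal (exp (\<Sum>i<Suc m. Z (z i))) \<partial>?Pi) \<le> (\<integral>\<^sup>+z. ennreal (exp (\<Sum>i<m. Z (z i)) * exp (2 * v)) \<partial>?Pi)"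
    proof (rule PiM_nn_integral_step[OF p finite_lessThan, of m])
      show "(\<lambda>z. ennreal (exp (\<Sum>i<Suc m. Z (z i)))) \<in> borel_measurable ?Pi"
        using meas[OF Suc.prems] by measurable
      show "(\<lambda>z. ennreal (exp (\<Sum>i<m. Z (z i)) * exp (2 * v))) \<in> borel_measurable ?Pi"
        using meas[OF Suc_leD[OF Suc.prems]] by measurable
      fix z :: "nat \<Rightarrow> 'z"
      define a where "a = exp (\<Sum>i<m. Z (z i))"
      have "(\<integral>\<^sup>+\<zeta>. ennreal (exp (\<Sum>i<Suc m. Z ((z(m := \<zeta>)) i))) \<partial>p) = (\<integral>\<^sup>+\<zeta>. ennreal (a * exp (Z \<zeta>)) \<partial>p)"
        by (simp add: a_def exp_add)
      also have "\<dots> = ennreal (\<integral>\<zeta>. a * exp (Z \<zeta>) \<partial>p)"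
        using ei by (intro nn_integral_eq_integral) (auto simp: a_def)
      also have "\<dots> \<le> ennreal (a * exp (2 * v))"
        using one by (intro ennreal_leI) (simp add: a_def)
      finally show "(\<integral>\<^sup>+\<zeta>. ennreal (exp (\<Sum>i<Suc m. Z ((z(m := \<zeta>)) i))) \<partial>p)
          \<le> (\<integral>\<^sup>+\<zeta>. ennreal (exp (\<Sum>i<m. Z ((z(m := \<zeta>)) i)) * exp (2 * v)) \<partial>p)"
        by (simp add: a_def p.emeasure_space_1)
    qed (use Suc.prems in simp)
    also have "\<dots> = (\<integral>\<^sup>+z. ennreal (exp (\<Sum>i<m. Z (z i))) \<partial>?Pi) * ennreal (exp (2 * v))"
    proof -
      have "(\<lambda>z. ennreal (exp (\<Sum>i<m. Z (z i)))) \<in> borel_measurable ?Pi"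
        using meas[OF Suc_leD[OF Suc.prems]] by measurable
      then show ?thesis by (simp add: ennreal_mult' nn_integral_multc)
    qed
    also have "\<dots> \<le> ennreal (exp (2 * v * real m)) * ennreal (exp (2 * v))"
      using Suc by (intro mult_right_mono) auto
    also have "\<dots> = ennreal (exp (2 * v * real (Suc m)))"
      by (simp add: ennreal_mult'[symmetric] exp_add[symmetric] algebra_simps)
    finally show ?case .
  qed
  define W where "W z = (\<Sum>i<n. Z (z i))" for z
  have Wm: "W \<in> borel_measurable ?Pi" unfolding W_def using meas[of n] by simp
  have "emeasure ?Pi {z \<in> space ?Pi. 1 \<le> ennreal (exp (- t)) * ennreal (exp (W z))}
      \<le> ennreal (exp (- t)) * (\<integral>\<^sup>+z. ennreal (exp (W z)) * indicator (space ?Pi) z \<partial>?Pi)"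
    by (rule nn_integral_Markov_inequality) (use Wm in measurable)
  also have "(\<integral>\<^sup>+z. ennreal (exp (W z)) * indicator (space ?Pi) z \<partial>?Pi) = (\<integral>\<^sup>+z. ennreal (exp (W z)) \<partial>?Pi)"
    by (intro nn_integral_cong) auto
  also have "ennreal (exp (- t)) * (\<integral>\<^sup>+z. ennreal (exp (W z)) \<partial>?Pi) \<le> ennreal (exp (- t)) * ennreal (exp (2 * v * real n))"
    using mgf[of n] by (intro mult_left_mono) (auto simp: W_def)
  also have "\<dots> = ennreal (exp (2 * v * real n - t))"
    by (simp add: ennreal_mult'[symmetric] exp_add[symmetric])
  finally have "emeasure ?Pi {z \<in> space ?Pi. 1 \<le> ennreal (exp (- t)) * ennreal (exp (W z))} \<le> ennreal (exp (2 * v * real n - t))" .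
  moreover have "(1 \<le> ennreal (exp (- t)) * ennreal (exp (W z))) = (t \<le> W z)" for z
  proof -
    have "ennreal (exp (- t)) * ennreal (exp (W z)) = ennreal (exp (W z - t))"
      by (simp add: ennreal_mult'[symmetric] exp_add[symmetric])
    then show ?thesis by (simp add: ennreal_1[symmetric] del: ennreal_1)
  qed
  ultimately have "emeasure ?Pi {z \<in> space ?Pi. t \<le> W z} \<le> ennreal (exp (2 * v * real n - t))" by simp
  then show ?thesis unfolding measure_def W_def by (intro enn2real_leI) auto
qed

section \<open>Integration with respect to the joint law\<close>

context
  fixes M :: "'x::second_countable_topology measure" and P :: "'x \<Rightarrow> 'y::second_countable_topology measure"
  assumes M: "prob_space M" "sets M = sets borel" and P: "P \<in> borel \<rightarrow>\<^sub>M prob_algebra borel"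
begin

lemma joint_law_kernel:
  "(\<lambda>x. P x \<bind> (\<lambda>y. return (borel \<Otimes>\<^sub>M borel) (x, y))) \<in> M \<rightarrow>\<^sub>M subprob_algebra (borel \<Otimes>\<^sub>M borel)"
proof (rule measurable_bind)
  show "P \<in> M \<rightarrow>\<^sub>M subprob_algebra borel"
    using measurable_prob_algebraD[OF P] measurable_cong_sets[OF M(2) refl] by blast
  have "(\<lambda>x. (fst x, snd x)) \<in> M \<Otimes>\<^sub>M borel \<rightarrow>\<^sub>M (borel :: 'x measure) \<Otimes>\<^sub>M (borel :: 'y measure)"
    by (intro measurable_Pair measurable_snd) (metis M(2) measurable_cong_sets measurable_fst)
  from measurable_compose[OF this return_measurable]
  show "(\<lambda>x. return (borel \<Otimes>\<^sub>M borel) (fst x, snd x)) \<in> M \<Otimes>\<^sub>M (borel :: 'y measure) \<rightarrow>\<^sub>M subprob_algebra (borel \<Otimes>\<^sub>M borel)" .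
qed

lemma kernel_props: "prob_space (P x)" "sets (P x) = sets borel" "space (P x) = UNIV"
proof -
  have "P x \<in> space (prob_algebra borel)" using measurable_space[OF P, of x] by simp
  then show "prob_space (P x)" "sets (P x) = sets borel" by (auto simp: space_prob_algebra)
  then show "space (P x) = UNIV" using sets_eq_imp_space_eq[of "P x" borel] by simp
qed

lemma measurable_kernel: "f \<in> borel_measurable borel \<Longrightarrow> f \<in> borel_measurable (P x)"
  using measurable_cong_sets[OF kernel_props(2) refl] by blast

lemma sets_joint_law: "sets (joint_law M P) = sets (borel \<Otimes>\<^sub>M borel)"
  unfolding joint_law_def
  by (rule sets_bind[OF sets_kernel[OF joint_law_kernel] prob_space.not_empty[OF M(1)]])

lemma space_joint_law: "space (joint_law M P) = UNIV"
  using sets_eq_imp_space_eq[OF sets_joint_law] by (simp add: space_pair_measure)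

lemma joint_law_nn_integral:
  assumes f: "f \<in> borel_measurable (borel \<Otimes>\<^sub>M borel)"
  shows "(\<integral>\<^sup>+z. f z \<partial>joint_law M P) = (\<integral>\<^sup>+x. \<integral>\<^sup>+y. f (x, y) \<partial>P x \<partial>M)"
proof -
  have inner: "(\<integral>\<^sup>+z. f z \<partial>(P x \<bind> (\<lambda>y. return (borel \<Otimes>\<^sub>M borel) (x, y)))) = (\<integral>\<^sup>+y. f (x, y) \<partial>P x)" for x
  proof -
    have "(\<lambda>y. return (borel \<Otimes>\<^sub>M borel) (x, y)) \<in> P x \<rightarrow>\<^sub>M subprob_algebra (borel \<Otimes>\<^sub>M borel)"
      by (rule measurable_compose[OF _ return_measurable])
         (metis kernel_props(2) measurable_Pair1' measurable_cong_sets space_borel UNIV_I)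
    from nn_integral_bind[OF f this] show ?thesis
      using f by (simp add: nn_integral_return space_pair_measure)
  qed
  show ?thesis unfolding joint_law_def nn_integral_bind[OF f joint_law_kernel] inner ..
qed

lemma joint_law_prob_space: "prob_space (joint_law M P)"
proof
  interpret M: prob_space M by (rule M)
  have "emeasure (joint_law M P) (space (joint_law M P)) = (\<integral>\<^sup>+z. 1 \<partial>joint_law M P)" by simp
  also have "\<dots> = (\<integral>\<^sup>+x. \<integral>\<^sup>+y. 1 \<partial>P x \<partial>M)" by (rule joint_law_nn_integral) simp
  also have "\<dots> = 1" using prob_space.emeasure_space_1[OF kernel_props(1)] M.emeasure_space_1 by simp
  finally show "emeasure (joint_law M P) (space (joint_law M P)) = 1" .
qed

lemma joint_law_AE:
  assumes Q: "Measurable.pred (borel \<Otimes>\<^sub>M borel) Q"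
  shows "(AE z in joint_law M P. Q z) \<longleftrightarrow> (AE x in M. AE y in P x. Q (x, y))"
proof -
  have "(AE z in joint_law M P. Q z) \<longleftrightarrow> (AE x in M. AE z in P x \<bind> (\<lambda>y. return (borel \<Otimes>\<^sub>M borel) (x, y)). Q z)"
    unfolding joint_law_def by (rule AE_bind[OF joint_law_kernel Q])
  also have "\<dots> \<longleftrightarrow> (AE x in M. AE y in P x. Q (x, y))"
  proof -
    have "(AE z in P x \<bind> (\<lambda>y. return (borel \<Otimes>\<^sub>M borel) (x, y)). Q z) \<longleftrightarrow> (AE y in P x. Q (x, y))" for x
    proof -
      have "(\<lambda>y. return (borel \<Otimes>\<^sub>M borel) (x, y)) \<in> P x \<rightarrow>\<^sub>M subprob_algebra (borel \<Otimes>\<^sub>M borel)"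
        by (rule measurable_compose[OF _ return_measurable])
           (metis kernel_props(2) measurable_Pair1' measurable_cong_sets space_borel UNIV_I)
      from AE_bind[OF this Q] show ?thesis
        using Q by (simp add: AE_return space_pair_measure)
    qed
    then show ?thesis by simp
  qed
  finally show ?thesis .
qed

lemma joint_law_integral_fst:
  fixes h :: "'x \<Rightarrow> 'b::{banach,second_countable_topology}"
  assumes h: "h \<in> borel_measurable borel"
  shows "(\<integral>z. h (fst z) \<partial>joint_law M P) = (\<integral>x. h x \<partial>M)"
proof -
  have d: "distr (joint_law M P) borel fst = M"
  proof (rule measure_eqI)
    show "sets (distr (joint_law M P) borel fst) = sets M" using M by simp
    fix A assume "A \<in> sets (distr (joint_law M P) borel fst)"
    then have A: "A \<in> sets borel" by simp
    have fm: "fst \<in> measurable (joint_law M P) borel"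
      by (metis measurable_cong_sets measurable_fst sets_joint_law)
    have "emeasure (distr (joint_law M P) borel fst) A = (\<integral>\<^sup>+z. indicator A z \<partial>distr (joint_law M P) borel fst)"
      using A by simp
    also have "\<dots> = (\<integral>\<^sup>+z. indicator A (fst z) \<partial>joint_law M P)"
      using A by (subst nn_integral_distr[OF fm]) auto
    also have "\<dots> = (\<integral>\<^sup>+x. \<integral>\<^sup>+y. indicator A x \<partial>P x \<partial>M)"
      using A by (subst joint_law_nn_integral) auto
    also have "\<dots> = (\<integral>\<^sup>+x. indicator A x \<partial>M)"
      using prob_space.emeasure_space_1[OF kernel_props(1)] by simp
    also have "\<dots> = emeasure M A" using A M by simp
    finally show "emeasure (distr (joint_law M P) borel fst) A = emeasure M A" .
  qed
  have fm: "fst \<in> measurable (joint_law M P) borel"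
    by (metis measurable_cong_sets measurable_fst sets_joint_law)
  have "(\<integral>x. h x \<partial>M) = (\<integral>x. h x \<partial>distr (joint_law M P) borel fst)" by (simp add: d)
  also have "\<dots> = (\<integral>z. h (fst z) \<partial>joint_law M P)" by (rule integral_distr[OF fm h])
  finally show ?thesis by simp
qed

end

section \<open>Exponential moments of quadratic forms given the inputs\<close>

lemma quadratic_cauchy_schwarz:
  fixes q c d :: real
  assumes "\<And>t. 0 \<le> q + 2 * t * c + t\<^sup>2 * d" "0 \<le> q" "0 \<le> d"
  shows "\<bar>c\<bar> \<le> sqrt q * sqrt d"
proof -
  have "c\<^sup>2 \<le> q * d"
  proof (cases "d = 0")
    case True
    have "c = 0"
    proof (rule ccontr)
      assume c: "c \<noteq> 0"
      have "0 \<le> q + 2 * (- (q + 1) / (2 * c)) * c" using assms(1)[of "- (q + 1) / (2 * c)"] True by simp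
      moreover have "2 * (- (q + 1) / (2 * c)) * c = - (q + 1)" using c by simp
      ultimately show False by linarith
    qed
    then show ?thesis using True by simp
  next
    case False
    then have d: "0 < d" using assms by simp
    have "0 \<le> d * (q + 2 * (- c / d) * c + (- c / d)\<^sup>2 * d)" using assms(1)[of "- c / d"] d by (intro mult_nonneg_nonneg) auto
    also have "\<dots> = q * d - c\<^sup>2" using d by (simp add: power2_eq_square field_simps)
    finally show ?thesis by simp
  qed
  then have "sqrt (c\<^sup>2) \<le> sqrt (q * d)" by (rule real_sqrt_le_mono)
  then show ?thesis by (simp add: real_sqrt_mult)
qed

text \<open>
  Hoeffding's bound for the noise conditionally on the inputs: \<open>\<Gamma>\<close> may depend on all inputs, and
  only the outputs are integrated out, one at a time.
\<close>

lemma conditional_hoeffding_mgf: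
  fixes M :: "'x::second_countable_topology measure"
    and P :: "'x \<Rightarrow> 'y::{real_inner,banach,second_countable_topology} measure"
    and r :: "'x \<Rightarrow> 'y" and \<Gamma> :: "nat \<Rightarrow> nat \<Rightarrow> (nat \<Rightarrow> 'x \<times> 'y) \<Rightarrow> real"
  assumes M: "prob_space M" "sets M = sets borel" and P: "P \<in> borel \<rightarrow>\<^sub>M prob_algebra borel"
    and r: "r \<in> borel_measurable borel"
    and noise: "AE x in M. (AE y in P x. norm (y - r x) \<le> B) \<and> (\<forall>a. (\<integral>y. a \<bullet> (y - r x) \<partial>P x) = 0)"
    and \<Gamma>_meas: "\<And>i l. i < n \<Longrightarrow> l < n \<Longrightarrow> \<Gamma> i l \<in> borel_measurable (PiM {..<n} (\<lambda>_. joint_law M P))"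
    and \<Gamma>_inputs: "\<And>i l z z'. (\<And>k. k < n \<Longrightarrow> fst (z k) = fst (z' k)) \<Longrightarrow> \<Gamma> i l z = \<Gamma> i l z'"
    and \<Gamma>_sym: "\<And>i l z. \<Gamma> i l z = \<Gamma> l i z"
    and \<Gamma>_psd: "\<And>z c. 0 \<le> (\<Sum>i<n. \<Sum>l<n. c i * c l * \<Gamma> i l z)"
    and G: "G \<in> sets (PiM {..<n} (\<lambda>_. joint_law M P))"
    and G_inputs: "\<And>z z'. (\<And>k. k < n \<Longrightarrow> fst (z k) = fst (z' k)) \<Longrightarrow> z \<in> space (PiM {..<n} (\<lambda>_. joint_law M P)) \<Longrightarrow>
       z' \<in> space (PiM {..<n} (\<lambda>_. joint_law M P)) \<Longrightarrow> z \<in> G \<longleftrightarrow> z' \<in> G"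
    and trace: "\<And>z. z \<in> G \<Longrightarrow> (\<Sum>i<n. \<Gamma> i i z) \<le> v"
    and v: "0 \<le> v"
  shows "(\<integral>\<^sup>+z. indicator G z * ennreal (cosh (sqrt (\<Sum>i<n. \<Sum>l<n.
      ((snd (z i) - r (fst (z i))) \<bullet> (snd (z l) - r (fst (z l)))) * \<Gamma> i l z))) \<partial>PiM {..<n} (\<lambda>_. joint_law M P))
    \<le> ennreal (exp (B\<^sup>2 * v))"
proof -
  let ?p = "joint_law M P"
  let ?Pi = "PiM {..<n} (\<lambda>_. ?p)"
  have p: "prob_space ?p" by (rule joint_law_prob_space[OF M P])
  interpret P: prob_space ?Pi by (rule prob_space_PiM) (rule p)
  have sets_p: "sets ?p = sets (borel \<Otimes>\<^sub>M borel)" by (rule sets_joint_law[OF M P])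
  have space_p: "space ?p = UNIV" by (rule space_joint_law[OF M P])
  define eps where "eps \<zeta> = snd \<zeta> - r (fst \<zeta>)" for \<zeta> :: "'x \<times> 'y"
  have eps_m: "eps \<in> borel_measurable ?p"
    unfolding eps_def measurable_cong_sets[OF sets_p refl]
    using measurable_compose[OF measurable_fst r] by (intro borel_measurable_diff measurable_snd)
  define Q where "Q m z = (\<Sum>i<m. \<Sum>l<m. (eps (z i) \<bullet> eps (z l)) * \<Gamma> i l z)" for m and z :: "nat \<Rightarrow> 'x \<times> 'y"
  have Q_meas: "Q m \<in> borel_measurable ?Pi" if "m \<le> n" for m
    unfolding Q_def using that
    by (intro borel_measurable_sum borel_measurable_times borel_measurable_inner \<Gamma>_meas
        measurable_PiM_coordinate[OF eps_m]) auto
  have psd: "0 \<le> (\<Sum>i<m. \<Sum>l<m. (y i \<bullet> y l) * \<Gamma> i l z)" if m: "m \<le> n" for m z and y :: "nat \<Rightarrow> 'y"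
  proof (rule schur_nonneg)
    fix c :: "nat \<Rightarrow> real"
    define c' where "c' i = (if i < m then c i else 0)" for i
    have "(\<Sum>i<n. \<Sum>l<n. c' i * c' l * \<Gamma> i l z) = (\<Sum>i<m. \<Sum>l<m. c' i * c' l * \<Gamma> i l z)"
      using m by (intro sum.mono_neutral_cong_right) (auto simp: c'_def intro!: sum.mono_neutral_right)
    also have "\<dots> = (\<Sum>i<m. \<Sum>l<m. c i * c l * \<Gamma> i l z)" by (intro sum.cong refl) (simp add: c'_def)
    finally show "0 \<le> (\<Sum>i<m. \<Sum>l<m. c i * c l * \<Gamma> i l z)" using \<Gamma>_psd[of c' z] by simp
  qed simp
  have Q0: "0 \<le> Q m z" if "m \<le> n" for m z unfolding Q_def using psd[OF that, of "\<lambda>i. eps (z i)" z] .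
  have diag0: "0 \<le> \<Gamma> m m z" if "m < n" for m z
  proof -
    define c :: "nat \<Rightarrow> real" where "c i = (if i = m then 1 else 0)" for i
    have "c i * c l * \<Gamma> i l z = (if l = m then c i * \<Gamma> i m z else 0)" for i l by (simp add: c_def)
    moreover have "c i * \<Gamma> i m z = (if i = m then \<Gamma> m m z else 0)" for i by (simp add: c_def)
    ultimately show ?thesis using \<Gamma>_psd[of c z] that by simp
  qed
  \<comment> \<open>The budget of the outputs not yet integrated: integrating output m moves its
    exponent from the cosh factor into W. At m = 0 the budget is the whole trace, bounded on G by v;
    at m = n nothing is left of it.\<close>
  define W where "W m z = B\<^sup>2 * (\<Sum>i=m..<n. \<Gamma> i i z)" for m z
  have W_meas: "W m \<in> borel_measurable ?Pi" for m
    unfolding W_def by (intro borel_measurable_times borel_measurable_sum borel_measurable_const \<Gamma>_meas) auto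
  define Fm where "Fm m z = indicator G z * ennreal (exp (W m z) * cosh (sqrt (Q m z)))" for m z
  have F_meas: "Fm m \<in> borel_measurable ?Pi" if "m \<le> n" for m
    unfolding Fm_def cosh_field_def using G W_meas[of m] Q_meas[OF that] by measurable
  have "(\<integral>\<^sup>+z. Fm m z \<partial>?Pi) \<le> ennreal (exp (B\<^sup>2 * v))" if "m \<le> n" for m
    using that
  proof (induction m)
    case 0
    have "(\<integral>\<^sup>+z. Fm 0 z \<partial>?Pi) \<le> (\<integral>\<^sup>+z. ennreal (exp (B\<^sup>2 * v)) \<partial>?Pi)"
    proof (rule nn_integral_mono)
      fix z
      show "Fm 0 z \<le> ennreal (exp (B\<^sup>2 * v))"
        using trace[of z] by (auto simp: Fm_def Q_def W_def atLeast0LessThan indicator_def intro!: ennreal_leI mult_left_mono)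
    qed
    then show ?case by (simp add: P.emeasure_space_1)
  next
    case (Suc m)
    then have m: "m < n" by simp
    have "(\<integral>\<^sup>+z. Fm (Suc m) z \<partial>?Pi) \<le> (\<integral>\<^sup>+z. Fm m z \<partial>?Pi)"
    proof (rule PiM_nn_integral_step[OF p finite_lessThan, of m])
      show "Fm (Suc m) \<in> borel_measurable ?Pi" "Fm m \<in> borel_measurable ?Pi" using F_meas m by auto
      fix z :: "nat \<Rightarrow> 'x \<times> 'y" assume z: "z \<in> space (PiM ({..<n} - {m}) (\<lambda>_. ?p))"
      have upd_space: "z(m := \<zeta>) \<in> space ?Pi" for \<zeta>
        using z m by (auto simp: space_PiM space_p PiE_def extensional_def)
      have sec: "(\<lambda>\<zeta>. Fm k (z(m := \<zeta>))) \<in> borel_measurable (borel \<Otimes>\<^sub>M borel)" if "k \<le> n" for k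
      proof -
        have ins: "insert m ({..<n} - {m}) = {..<n}" using m by auto
        have "(\<lambda>\<zeta>. z(m := \<zeta>)) \<in> measurable ?p ?Pi"
          using measurable_fun_upd[of "{..<n}" "{..<n} - {m}" m "\<lambda>_. z" ?p "\<lambda>_. ?p" "\<lambda>\<zeta>. \<zeta>"] ins z by auto
        then have "(\<lambda>\<zeta>. Fm k (z(m := \<zeta>))) \<in> borel_measurable ?p" using F_meas[OF that] by (rule measurable_compose)
        then show ?thesis using measurable_cong_sets[OF sets_p refl] by blast
      qed
      have "AE x in M. (\<integral>\<^sup>+y. Fm (Suc m) (z(m := (x, y))) \<partial>P x) \<le> (\<integral>\<^sup>+y. Fm m (z(m := (x, y))) \<partial>P x)"
        using noise
      proof eventually_elim
        case (elim x)
        interpret Px: prob_space "P x" by (rule kernel_props(1)[OF M P])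
        \<comment> \<open>A fixed output in place of y, as a representative of the inputs: \<Gamma>,
          G and W do not see the outputs, and the form over the first m samples does not see the
          output of sample m.\<close>
        define z0 where "z0 = z(m := (x, r x))"
        have inp: "\<Gamma> i l (z(m := (x, y))) = \<Gamma> i l z0" for i l y by (rule \<Gamma>_inputs) (simp add: z0_def)
        have Ginp: "indicator G (z(m := (x, y))) = (indicator G z0 :: ennreal)" for y
          using G_inputs[of "z(m := (x, y))" z0] upd_space unfolding z0_def by (auto simp: indicator_def)
        have Winp: "W k (z(m := (x, y))) = W k z0" for k y by (simp add: W_def inp)
        have Qinp: "Q m (z(m := (x, y))) = Q m z0" for y by (simp add: Q_def inp) (simp add: z0_def)
        define q where "q = Q m z0"
        define \<gamma> where "\<gamma> = \<Gamma> m m z0"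
        define b where "b = (\<Sum>i<m. \<Gamma> i m z0 *\<^sub>R eps (z0 i))"
        have q0: "0 \<le> q" using Q0[of m z0] m by (simp add: q_def)
        have g0: "0 \<le> \<gamma>" using diag0[OF m] by (simp add: \<gamma>_def)
        have Q_e: "(\<Sum>i<Suc m. \<Sum>l<Suc m. (((\<lambda>i. eps (z0 i))(m := e)) i \<bullet> ((\<lambda>i. eps (z0 i))(m := e)) l) * \<Gamma> i l z0)
            = q + 2 * (b \<bullet> e) + \<gamma> * (norm e)\<^sup>2" for e
        proof -
          have s1: "(\<Sum>i<m. (eps (z0 i) \<bullet> e) * \<Gamma> i m z0) = b \<bullet> e"
            by (simp add: b_def inner_sum_left mult.commute)
          have s2: "(\<Sum>l<m. (e \<bullet> eps (z0 l)) * \<Gamma> m l z0) = b \<bullet> e"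
            unfolding s1[symmetric] by (intro sum.cong refl) (simp add: inner_commute \<Gamma>_sym[of m])
          have "(\<Sum>i<Suc m. \<Sum>l<Suc m. (((\<lambda>i. eps (z0 i))(m := e)) i \<bullet> ((\<lambda>i. eps (z0 i))(m := e)) l) * \<Gamma> i l z0)
            = (\<Sum>i<m. (\<Sum>l<m. (eps (z0 i) \<bullet> eps (z0 l)) * \<Gamma> i l z0) + (eps (z0 i) \<bullet> e) * \<Gamma> i m z0)
              + ((\<Sum>l<m. (e \<bullet> eps (z0 l)) * \<Gamma> m l z0) + (e \<bullet> e) * \<Gamma> m m z0)"
            by simp
          also have "\<dots> = q + 2 * (b \<bullet> e) + \<gamma> * (norm e)\<^sup>2"
            unfolding sum.distrib s1 s2 by (simp add: q_def Q_def \<gamma>_def power2_norm_eq_inner)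
          finally show ?thesis .
        qed
        \<comment> \<open>The form stays nonnegative when the last entry is
          \<open>t *\<^sub>R e\<close> for every t; the discriminant of this quadratic inequality is
          the Cauchy-Schwarz bound.\<close>
        have cs: "\<bar>b \<bullet> e\<bar> \<le> sqrt q * sqrt (\<gamma> * (norm e)\<^sup>2)" for e
        proof (rule quadratic_cauchy_schwarz[OF _ q0])
          fix t
          show "0 \<le> q + 2 * t * (b \<bullet> e) + t\<^sup>2 * (\<gamma> * (norm e)\<^sup>2)"
            using psd[of "Suc m" "(\<lambda>i. eps (z0 i))(m := t *\<^sub>R e)" z0] m unfolding Q_e
            by (simp add: power_mult_distrib mult_ac)
        qed (use g0 in simp)
        have QS: "Q (Suc m) (z(m := (x, y))) = q + 2 * (b \<bullet> (y - r x)) + \<gamma> * (norm (y - r x))\<^sup>2" for y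
        proof -
          have "Q (Suc m) (z(m := (x, y))) = (\<Sum>i<Suc m. \<Sum>l<Suc m.
            (((\<lambda>i. eps (z0 i))(m := y - r x)) i \<bullet> ((\<lambda>i. eps (z0 i))(m := y - r x)) l) * \<Gamma> i l z0)"
            unfolding Q_def inp by (intro sum.cong refl) (auto simp: z0_def eps_def)
          then show ?thesis unfolding Q_e .
        qed
        have ym: "(\<lambda>y. b \<bullet> (y - r x)) \<in> borel_measurable (P x)"
          by (rule measurable_kernel[OF M P]) measurable
        have main: "(\<integral>\<^sup>+y. ennreal (cosh (sqrt (q + 2 * (b \<bullet> (y - r x)) + \<gamma> * (norm (y - r x))\<^sup>2))) \<partial>P x)
            \<le> ennreal (cosh (sqrt q) * (\<integral>y. exp (B\<^sup>2 * \<gamma>) \<partial>P x))"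
        proof (rule nn_integral_cosh_step[OF Px.prob_space_axioms q0])
          show "integrable (P x) (\<lambda>y. b \<bullet> (y - r x))"
          proof (rule Px.integrable_const_bound[OF _ ym, of "norm b * B"])
            show "AE y in P x. norm (b \<bullet> (y - r x)) \<le> norm b * B"
              using conjunct1[OF elim]
            proof eventually_elim
              case (elim y)
              then show ?case using Cauchy_Schwarz_ineq2[of b "y - r x"] mult_left_mono[OF elim norm_ge_zero[of b]] by simp
            qed
          qed
          show "(\<integral>y. b \<bullet> (y - r x) \<partial>P x) = 0" using elim by blast
          show "AE y in P x. 2 * cosh (sqrt (\<gamma> * (norm (y - r x))\<^sup>2)) - 1 \<le> exp (B\<^sup>2 * \<gamma>)"
            using conjunct1[OF elim]
          proof eventually_elim
            case (elim y)
            have "2 * cosh (sqrt (\<gamma> * (norm (y - r x))\<^sup>2)) - 1 \<le> exp ((sqrt (\<gamma> * (norm (y - r x))\<^sup>2))\<^sup>2)"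
              by (rule two_cosh_minus_one_le_exp)
            also have "(sqrt (\<gamma> * (norm (y - r x))\<^sup>2))\<^sup>2 = \<gamma> * (norm (y - r x))\<^sup>2" using g0 by simp
            also have "\<gamma> * (norm (y - r x))\<^sup>2 \<le> \<gamma> * B\<^sup>2" using g0 elim by (intro mult_left_mono power_mono) auto
            finally show ?case by (simp add: mult.commute)
          qed
        qed (use cs g0 in auto)
        have WS: "W m z0 = B\<^sup>2 * \<gamma> + W (Suc m) z0"
          using m by (simp add: W_def \<gamma>_def sum.atLeast_Suc_lessThan algebra_simps)
        have hm: "(\<lambda>y. ennreal (cosh (sqrt (q + 2 * (b \<bullet> (y - r x)) + \<gamma> * (norm (y - r x))\<^sup>2)))) \<in> borel_measurable (P x)"
          by (rule measurable_kernel[OF M P]) (unfold cosh_field_def, measurable)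
        have "(\<integral>\<^sup>+y. Fm (Suc m) (z(m := (x, y))) \<partial>P x)
            = (\<integral>\<^sup>+y. (indicator G z0 * ennreal (exp (W (Suc m) z0))) *
                ennreal (cosh (sqrt (q + 2 * (b \<bullet> (y - r x)) + \<gamma> * (norm (y - r x))\<^sup>2))) \<partial>P x)"
          unfolding Fm_def Ginp Winp QS by (intro nn_integral_cong) (simp add: ennreal_mult' mult.assoc)
        also have "\<dots> = (indicator G z0 * ennreal (exp (W (Suc m) z0))) *
            (\<integral>\<^sup>+y. ennreal (cosh (sqrt (q + 2 * (b \<bullet> (y - r x)) + \<gamma> * (norm (y - r x))\<^sup>2))) \<partial>P x)"
          by (rule nn_integral_cmult[OF hm])
        also have "\<dots> \<le> (indicator G z0 * ennreal (exp (W (Suc m) z0))) * ennreal (cosh (sqrt q) * exp (B\<^sup>2 * \<gamma>))"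
          using main by (intro mult_left_mono) (simp_all add: Px.prob_space)
        also have "\<dots> = Fm m z0"
          unfolding Fm_def WS exp_add q_def[symmetric] by (simp add: ennreal_mult' mult.assoc mult.commute mult.left_commute)
        also have "\<dots> = (\<integral>\<^sup>+y. Fm m (z(m := (x, y))) \<partial>P x)"
        proof -
          have "Fm m (z(m := (x, y))) = Fm m z0" for y unfolding Fm_def Ginp Winp Qinp ..
          then show ?thesis by (simp add: Px.emeasure_space_1)
        qed
        finally show ?case .
      qed
      then show "(\<integral>\<^sup>+\<zeta>. Fm (Suc m) (z(m := \<zeta>)) \<partial>?p) \<le> (\<integral>\<^sup>+\<zeta>. Fm m (z(m := \<zeta>)) \<partial>?p)"
        unfolding joint_law_nn_integral[OF M P sec[OF Suc_leI[OF m]]] joint_law_nn_integral[OF M P sec[OF less_imp_le[OF m]]]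
        by (rule nn_integral_mono_AE)
    qed (use m in simp)
    then show ?case using Suc by simp
  qed
  from this[of n] show ?thesis by (simp add: Fm_def W_def Q_def eps_def)
qed

text \<open>Integral test in difference form: the mean value theorem compares the summand with an
  increment of \<open>x powr (1 - r)\<close>, so that sums telescope.\<close>

lemma powr_neg_Suc_le:
  fixes r :: real
  assumes "1 < r" "1 \<le> J"
  shows "real (Suc J) powr (- r) \<le> (real J powr (1 - r) - real (Suc J) powr (1 - r)) / (r - 1)"
proof -
  have "\<exists>z. real J < z \<and> z < real (Suc J) \<and>
      real (Suc J) powr (1 - r) - real J powr (1 - r) = (real (Suc J) - real J) * ((1 - r) * z powr (1 - r - 1))"
  proof (rule MVT2)
    fix x assume "real J \<le> x" "x \<le> real (Suc J)"
    then have "0 < x" using assms by linarith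
    then show "((\<lambda>x. x powr (1 - r)) has_real_derivative (1 - r) * x powr (1 - r - 1)) (at x)"
      by (rule has_real_derivative_powr)
  qed simp
  then obtain z where z: "real J < z" "z < real (Suc J)"
    "real (Suc J) powr (1 - r) - real J powr (1 - r) = (1 - r) * z powr (- r)" by auto
  have "real (Suc J) powr (- r) \<le> z powr (- r)"
    using z assms by (intro powr_mono2') auto
  then have "(r - 1) * real (Suc J) powr (- r) \<le> (r - 1) * z powr (- r)" using assms by (intro mult_left_mono) auto
  also have "\<dots> = real J powr (1 - r) - real (Suc J) powr (1 - r)" using z(3) by (simp add: algebra_simps)
  finally show ?thesis using assms by (simp add: pos_le_divide_eq mult.commute)
qed

lemma sum_powr_neg_tail_le:
  fixes r :: real
  assumes r: "1 < r" and m: "1 \<le> m"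
  shows "(\<Sum>j=m..<J. real (Suc j) powr (- r)) \<le> real m powr (1 - r) / (r - 1)"
proof (cases "m \<le> J")
  case True
  have "(\<Sum>j=m..<J. real (Suc j) powr (- r)) \<le> (real m powr (1 - r) - real J powr (1 - r)) / (r - 1)"
    using True
  proof (induction J rule: dec_induct)
    case (step J)
    then have "(\<Sum>j=m..<Suc J. real (Suc j) powr (- r))
        \<le> (real m powr (1 - r) - real J powr (1 - r)) / (r - 1) + (real J powr (1 - r) - real (Suc J) powr (1 - r)) / (r - 1)"
      using powr_neg_Suc_le[OF r, of J] m by simp
    then show ?case by (simp add: add_divide_distrib[symmetric])
  qed simp
  also have "\<dots> \<le> real m powr (1 - r) / (r - 1)" using r by (intro divide_right_mono) auto
  finally show ?thesis .
qed (use r in simp)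

section \<open>Relative deviation in the eigenbasis\<close>

context diagonal_op
begin

lemma bessel_f: "(\<Sum>j<J. (v \<bullet> f j)\<^sup>2) \<le> (norm v)\<^sup>2"
  using has_sum_mono2[OF has_sum_finite[of "{..<J}"] parseval[of v]] by simp

lemma f_partial_norm: "(\<lambda>J. (norm v)\<^sup>2 - (\<Sum>j<J. (v \<bullet> f j)\<^sup>2)) \<longlonglongrightarrow> 0"
proof -
  have "(\<lambda>j. (v \<bullet> f j)\<^sup>2) sums (norm v)\<^sup>2" using parseval[of v] by (rule has_sum_imp_sums)
  then have "(\<lambda>J. \<Sum>j<J. (v \<bullet> f j)\<^sup>2) \<longlonglongrightarrow> (norm v)\<^sup>2" by (simp add: sums_def)
  then show ?thesis using tendsto_diff[OF tendsto_const[of "(norm v)\<^sup>2"]] by fastforce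
qed

text \<open>The sums bounded by \<open>B\<^sup>2\<close> are partial sums of the squared
  Hilbert-Schmidt norm of \<open>Ch - C\<close> composed with the inverse square root of
  \<open>C + lam'\<close>. Inserting \<open>sqrt (\<mu> j + lam')\<close> and its reciprocal in
  coordinate j and applying Cauchy-Schwarz gives the bilinear bound.\<close>

lemma deviation_from_coordinates:
  assumes Ch_sym: "\<And>v w. Ch v \<bullet> w = v \<bullet> Ch w" and lam': "0 < lam'" and B: "0 \<le> B"
    and S: "\<And>J. (\<Sum>j<J. (norm (Ch (f j) - \<mu> j *\<^sub>R f j))\<^sup>2 / (\<mu> j + lam')) \<le> B\<^sup>2"
  shows "\<bar>a \<bullet> (Ch x - C x)\<bar> \<le> B * sqrt (a \<bullet> C a + lam' * (norm a)\<^sup>2) * norm x"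
proof -
  have "(\<lambda>j. (a \<bullet> f j) * ((Ch x - C x) \<bullet> f j)) sums (a \<bullet> (Ch x - C x))"
    using parseval_inner[of a "Ch x - C x"] by (rule has_sum_imp_sums)
  then have lim: "(\<lambda>J. \<bar>\<Sum>j<J. (a \<bullet> f j) * ((Ch x - C x) \<bullet> f j)\<bar>) \<longlonglongrightarrow> \<bar>a \<bullet> (Ch x - C x)\<bar>"
    unfolding sums_def by (rule tendsto_rabs)
  have le: "\<bar>\<Sum>j<J. (a \<bullet> f j) * ((Ch x - C x) \<bullet> f j)\<bar> \<le> B * sqrt (a \<bullet> C a + lam' * (norm a)\<^sup>2) * norm x" for J
  proof -
    define d where "d j = Ch (f j) - \<mu> j *\<^sub>R f j" for j
    have pos: "0 < \<mu> j + lam'" for j using \<mu>_pos[of j] lam' by simp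
    have dx: "(Ch x - C x) \<bullet> f j = x \<bullet> d j" for j
      by (simp add: d_def inner_diff_left inner_diff_right Ch_sym C_f)
    have "\<bar>\<Sum>j<J. (a \<bullet> f j) * ((Ch x - C x) \<bullet> f j)\<bar>
        \<le> (\<Sum>j<J. \<bar>sqrt (\<mu> j + lam') * (a \<bullet> f j)\<bar> * \<bar>norm (d j) / sqrt (\<mu> j + lam') * norm x\<bar>)"
    proof (rule order_trans[OF sum_abs sum_mono])
      fix j
      have "\<bar>(a \<bullet> f j) * ((Ch x - C x) \<bullet> f j)\<bar> \<le> \<bar>a \<bullet> f j\<bar> * (norm (d j) * norm x)"
        unfolding abs_mult dx using Cauchy_Schwarz_ineq2[of x "d j"] by (intro mult_left_mono) (auto simp: mult.commute)
      also have "\<dots> = \<bar>sqrt (\<mu> j + lam') * (a \<bullet> f j)\<bar> * \<bar>norm (d j) / sqrt (\<mu> j + lam') * norm x\<bar>"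
        using pos[of j] by (simp add: abs_mult)
      finally show "\<bar>(a \<bullet> f j) * ((Ch x - C x) \<bullet> f j)\<bar>
          \<le> \<bar>sqrt (\<mu> j + lam') * (a \<bullet> f j)\<bar> * \<bar>norm (d j) / sqrt (\<mu> j + lam') * norm x\<bar>" .
    qed
    also have "\<dots> \<le> L2_set (\<lambda>j. sqrt (\<mu> j + lam') * (a \<bullet> f j)) {..<J} * L2_set (\<lambda>j. norm (d j) / sqrt (\<mu> j + lam') * norm x) {..<J}"
      by (rule L2_set_mult_ineq)
    also have "\<dots> \<le> sqrt (a \<bullet> C a + lam' * (norm a)\<^sup>2) * (B * norm x)"
    proof (rule mult_mono)
      have "(\<Sum>j<J. (sqrt (\<mu> j + lam') * (a \<bullet> f j))\<^sup>2) = (\<Sum>j<J. \<mu> j * (a \<bullet> f j)\<^sup>2) + lam' * (\<Sum>j<J. (a \<bullet> f j)\<^sup>2)"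
        using less_imp_le[OF pos] by (simp add: power_mult_distrib algebra_simps sum.distrib sum_distrib_left)
      also have "\<dots> \<le> a \<bullet> C a + lam' * (norm a)\<^sup>2"
      proof (intro add_mono mult_left_mono bessel_f)
        show "(\<Sum>j<J. \<mu> j * (a \<bullet> f j)\<^sup>2) \<le> a \<bullet> C a"
          using has_sum_mono2[OF has_sum_finite[of "{..<J}"] C_quadratic[of a]] less_imp_le[OF \<mu>_pos] by simp
      qed (use lam' in simp)
      finally show "L2_set (\<lambda>j. sqrt (\<mu> j + lam') * (a \<bullet> f j)) {..<J} \<le> sqrt (a \<bullet> C a + lam' * (norm a)\<^sup>2)"
        unfolding L2_set_def by (rule real_sqrt_le_mono)
      have "(\<Sum>j<J. (norm (d j) / sqrt (\<mu> j + lam') * norm x)\<^sup>2) = (\<Sum>j<J. (norm (d j))\<^sup>2 / (\<mu> j + lam')) * (norm x)\<^sup>2"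
        using less_imp_le[OF pos] by (simp add: power_mult_distrib power_divide sum_distrib_right)
      also have "\<dots> \<le> B\<^sup>2 * (norm x)\<^sup>2" using S[of J] by (intro mult_right_mono) (auto simp: d_def)
      finally have "L2_set (\<lambda>j. norm (d j) / sqrt (\<mu> j + lam') * norm x) {..<J} \<le> sqrt ((B * norm x)\<^sup>2)"
        unfolding L2_set_def power_mult_distrib by (rule real_sqrt_le_mono)
      then show "L2_set (\<lambda>j. norm (d j) / sqrt (\<mu> j + lam') * norm x) {..<J} \<le> B * norm x" using B by simp
    qed (use C_psd[of a] lam' in \<open>auto simp: L2_set_nonneg\<close>)
    finally show ?thesis by (simp add: mult_ac)
  qed
  show ?thesis by (rule LIMSEQ_le_const2[OF lim]) (use le in blast)
qed

text \<open>The operator comparison follows from the deviation bound by solving a quadratic inequality.\<close>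

lemma comparison_from_deviation:
  assumes lam: "0 < lam" "lam \<le> lam'" and B: "0 \<le> B" and psd: "0 \<le> a \<bullet> Ch a"
    and dev: "\<bar>a \<bullet> (Ch a - C a)\<bar> \<le> B * sqrt (a \<bullet> C a + lam' * (norm a)\<^sup>2) * norm a"
  shows "a \<bullet> C a + lam' * (norm a)\<^sup>2 \<le> (sqrt (lam' / lam) + B / sqrt lam)\<^sup>2 * (a \<bullet> Ch a + lam * (norm a)\<^sup>2)"
proof -
  define X where "X = sqrt (a \<bullet> C a + lam' * (norm a)\<^sup>2)"
  define Y where "Y = sqrt (a \<bullet> Ch a + lam * (norm a)\<^sup>2)"
  have l: "0 < lam'" using lam by simp
  have X: "0 \<le> X" "X\<^sup>2 = a \<bullet> C a + lam' * (norm a)\<^sup>2" using C_psd[of a] l by (auto simp: X_def)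
  have Y: "0 \<le> Y" "Y\<^sup>2 = a \<bullet> Ch a + lam * (norm a)\<^sup>2" using psd lam by (auto simp: Y_def)
  have na: "sqrt lam * norm a \<le> Y"
  proof -
    have "sqrt lam * norm a = sqrt (lam * (norm a)\<^sup>2)" by (simp add: real_sqrt_mult)
    also have "\<dots> \<le> Y" unfolding Y_def using psd by simp
    finally show ?thesis .
  qed
  have "X\<^sup>2 = a \<bullet> Ch a + lam' * (norm a)\<^sup>2 - a \<bullet> (Ch a - C a)" by (simp add: X inner_diff_right)
  also have "\<dots> \<le> a \<bullet> Ch a + lam' * (norm a)\<^sup>2 + B * X * norm a" using dev by (simp add: X_def)
  also have "\<dots> \<le> (lam' / lam) * Y\<^sup>2 + (B / sqrt lam) * X * Y"
  proof (rule add_mono)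
    have "a \<bullet> Ch a \<le> (lam' / lam) * (a \<bullet> Ch a)" using lam psd by (intro mult_le_cancel_right1[THEN iffD2]) auto
    then show "a \<bullet> Ch a + lam' * (norm a)\<^sup>2 \<le> (lam' / lam) * Y\<^sup>2" unfolding Y using lam by (simp add: distrib_left)
    have "norm a \<le> Y / sqrt lam" using na lam by (simp add: pos_le_divide_eq mult.commute)
    then have "B * X * norm a \<le> B * X * (Y / sqrt lam)" using B X by (intro mult_left_mono) auto
    then show "B * X * norm a \<le> (B / sqrt lam) * X * Y" by (simp add: mult_ac)
  qed
  finally have q: "X\<^sup>2 \<le> (sqrt (lam' / lam) * Y)\<^sup>2 + (B / sqrt lam * Y) * X"
    using lam l by (simp add: power_mult_distrib mult_ac)
  have "X \<le> sqrt (lam' / lam) * Y + B / sqrt lam * Y"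
  proof (rule ccontr)
    assume n: "\<not> X \<le> sqrt (lam' / lam) * Y + B / sqrt lam * Y"
    define u where "u = sqrt (lam' / lam) * Y"
    define w where "w = B / sqrt lam * Y"
    have uw: "0 \<le> u" "0 \<le> w" "u + w < X" using Y B lam l n by (auto simp: u_def w_def)
    have "u * u \<le> u * X" using uw by (intro mult_left_mono) auto
    moreover have "0 < X * (X - (u + w))" using uw by (intro mult_pos_pos) auto
    moreover have "X * X \<le> u * u + w * X" using q by (simp add: u_def w_def power2_eq_square)
    ultimately show False by (simp add: algebra_simps)
  qed
  then have "X\<^sup>2 \<le> ((sqrt (lam' / lam) + B / sqrt lam) * Y)\<^sup>2"
    using X by (intro power_mono) (auto simp: distrib_right)
  then show ?thesis unfolding X Y power_mult_distrib .
qed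

end

section \<open>Monotonicity and approximation of resolvents\<close>

text \<open>Inversion reverses the operator order. With x and y the two resolvents at v, expand the
  nonnegative form of the smaller operator plus t at \<open>y - x\<close>: the mixed terms give
  \<open>- 2 * (x \<bullet> v)\<close>, and the order hypothesis bounds the term in x alone by
  \<open>x \<bullet> v\<close>.\<close>

lemma (in orthonormal_family) resolvent_antimono:
  assumes "orthonormal_family U'" and t: "0 < t"
    and pos: "\<And>u. u \<in> U \<Longrightarrow> 0 < \<sigma> u" "\<And>u. u \<in> U' \<Longrightarrow> 0 < \<sigma>' u"
    and le: "\<And>v. spec_fun U' \<sigma>' (\<lambda>s. s) v \<bullet> v \<le> F (\<lambda>s. s) v \<bullet> v"
  shows "F (\<lambda>s. 1 / (s + t)) v \<bullet> v \<le> spec_fun U' \<sigma>' (\<lambda>s. 1 / (s + t)) v \<bullet> v"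
proof -
  interpret V: orthonormal_family U' \<sigma>' by (rule assms(1))
  define R where "R = F (\<lambda>s. 1 / (s + t))"
  define R' where "R' = V.F (\<lambda>s. 1 / (s + t))"
  have R: "F (\<lambda>s. s) (R w) + t *\<^sub>R R w = w" for w
  proof -
    have "F (\<lambda>s. s) (R w) + t *\<^sub>R R w = F (\<lambda>s. s * (1 / (s + t)) + t * (1 / (s + t))) w"
      unfolding R_def spec_fun_mult by (simp only: spec_fun_plus_fun spec_fun_scale_fun)
    also have "\<dots> = F (\<lambda>s. 1) w"
    proof (rule spec_fun_cong)
      fix u assume "u \<in> U"
      then have "\<sigma> u + t \<noteq> 0" using pos t by (metis add_pos_pos less_irrefl)
      then show "\<sigma> u * (1 / (\<sigma> u + t)) + t * (1 / (\<sigma> u + t)) = 1" unfolding distrib_right[symmetric] by simp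
    qed (use t in simp)
    finally show ?thesis by (simp add: spec_fun_one)
  qed
  have R': "V.F (\<lambda>s. s) (R' w) + t *\<^sub>R R' w = w" for w
  proof -
    have "V.F (\<lambda>s. s) (R' w) + t *\<^sub>R R' w = V.F (\<lambda>s. s * (1 / (s + t)) + t * (1 / (s + t))) w"
      unfolding R'_def V.spec_fun_mult by (simp only: V.spec_fun_plus_fun V.spec_fun_scale_fun)
    also have "\<dots> = V.F (\<lambda>s. 1) w"
    proof (rule V.spec_fun_cong)
      fix u assume "u \<in> U'"
      then have "\<sigma>' u + t \<noteq> 0" using pos t by (metis add_pos_pos less_irrefl)
      then show "\<sigma>' u * (1 / (\<sigma>' u + t)) + t * (1 / (\<sigma>' u + t)) = 1" unfolding distrib_right[symmetric] by simp
    qed (use t in simp)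
    finally show ?thesis by (simp add: V.spec_fun_one)
  qed
  define x y where "x = R v" and "y = R' v"
  have xv: "x \<bullet> v = F (\<lambda>s. s) x \<bullet> x + t * (norm x)\<^sup>2"
    using R[of v] unfolding x_def[symmetric] by (metis inner_add_right inner_commute inner_scaleR_right power2_norm_eq_inner)
  have yv: "y \<bullet> v = V.F (\<lambda>s. s) y \<bullet> y + t * (norm y)\<^sup>2"
    using R'[of v] unfolding y_def[symmetric] by (metis inner_add_right inner_commute inner_scaleR_right power2_norm_eq_inner)
  have xyv: "x \<bullet> v = V.F (\<lambda>s. s) y \<bullet> x + t * (y \<bullet> x)"
    using R'[of v] unfolding y_def[symmetric] by (metis inner_add_right inner_commute inner_scaleR_right)
  have d: "0 \<le> V.F (\<lambda>s. s) (y - x) \<bullet> (y - x) + t * (norm (y - x))\<^sup>2"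
  proof -
    have "0 \<le> V.F (\<lambda>s. s) (y - x) \<bullet> (y - x)" by (rule V.spec_fun_nonneg) (auto intro: less_imp_le pos)
    then show ?thesis using t by simp
  qed
  have "V.F (\<lambda>s. s) (y - x) \<bullet> (y - x) = V.F (\<lambda>s. s) y \<bullet> y - 2 * (V.F (\<lambda>s. s) y \<bullet> x) + V.F (\<lambda>s. s) x \<bullet> x"
    using V.spec_fun_sym[of "\<lambda>s. s" x y]
    by (simp add: V.spec_fun_minus inner_diff_left inner_diff_right inner_commute)
  moreover have "(norm (y - x))\<^sup>2 = (norm y)\<^sup>2 - 2 * (y \<bullet> x) + (norm x)\<^sup>2"
    by (simp add: power2_norm_eq_inner inner_diff_left inner_diff_right inner_commute)
  moreover have "t * ((norm y)\<^sup>2 - 2 * (y \<bullet> x) + (norm x)\<^sup>2) = t * (norm y)\<^sup>2 - 2 * (t * (y \<bullet> x)) + t * (norm x)\<^sup>2"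
    by (simp add: algebra_simps)
  ultimately have "0 \<le> (V.F (\<lambda>s. s) y \<bullet> y + t * (norm y)\<^sup>2) - 2 * (V.F (\<lambda>s. s) y \<bullet> x + t * (y \<bullet> x))
      + (V.F (\<lambda>s. s) x \<bullet> x + t * (norm x)\<^sup>2)"
    using d by simp
  then have "0 \<le> y \<bullet> v - 2 * (x \<bullet> v) + (V.F (\<lambda>s. s) x \<bullet> x + t * (norm x)\<^sup>2)"
    unfolding yv[symmetric] xyv[symmetric] .
  moreover have "V.F (\<lambda>s. s) x \<bullet> x + t * (norm x)\<^sup>2 \<le> x \<bullet> v" unfolding xv using le[of x] by simp
  ultimately have "x \<bullet> v \<le> y \<bullet> v" by simp
  then show ?thesis by (simp add: x_def y_def R_def R'_def inner_commute)
qed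

text \<open>The resolvent as the limit of a Richardson iteration, which makes it measurable in the data.\<close>

lemma (in orthonormal_family) resolvent_iteration:
  assumes t: "0 < t" and pos: "\<And>u. u \<in> U \<Longrightarrow> 0 < \<sigma> u" and le: "\<And>u. u \<in> U \<Longrightarrow> \<sigma> u \<le> \<Lambda>" and \<Lambda>: "0 \<le> \<Lambda>"
    and it: "w 0 = 0" "\<And>k. w (Suc k) = w k + (1 / (\<Lambda> + t)) *\<^sub>R (v - (F (\<lambda>s. s) (w k) + t *\<^sub>R w k))"
  shows "w \<longlonglongrightarrow> F (\<lambda>s. 1 / (s + t)) v"
proof -
  define \<eta> where "\<eta> = 1 / (\<Lambda> + t)"
  \<comment> \<open>Closed form of the iterate, a partial geometric series for the reciprocal of
    \<open>s + t\<close>. The step size keeps \<open>\<eta> * (s + t)\<close> positive and at most 1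
    on the spectrum, which gives convergence.\<close>
  define h where "h k s = (1 - (1 - \<eta> * (s + t)) ^ k) / (s + t)" for k s
  have st: "s + t \<noteq> 0" if "s \<in> insert 0 (\<sigma> ` U)" for s using that pos t by (auto simp: add_pos_pos less_imp_neq[symmetric])
  have w: "w k = F (h k) v" for k
  proof (induction k)
    case 0
    then show ?case by (simp add: it h_def spec_fun_def)
  next
    case (Suc k)
    have "w (Suc k) = F (\<lambda>s. h k s + \<eta> * (1 - (s * h k s + t * h k s))) v"
      unfolding it(2) Suc \<eta>_def[symmetric] spec_fun_mult
      by (simp only: spec_fun_plus_fun spec_fun_scale_fun spec_fun_diff_fun spec_fun_one)
    also have "\<dots> = F (h (Suc k)) v"
    proof (rule spec_fun_cong)
      have e: "h k s + \<eta> * (1 - (s * h k s + t * h k s)) = h (Suc k) s" if "s + t \<noteq> 0" for s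
      proof -
        have 1: "s * h k s + t * h k s = 1 - (1 - \<eta> * (s + t)) ^ k"
          unfolding distrib_right[symmetric] h_def using that by simp
        have "h (Suc k) s - h k s = ((1 - \<eta> * (s + t)) ^ k - (1 - \<eta> * (s + t)) ^ Suc k) / (s + t)"
          by (simp add: h_def diff_divide_distrib[symmetric])
        also have "(1 - \<eta> * (s + t)) ^ k - (1 - \<eta> * (s + t)) ^ Suc k = \<eta> * (s + t) * (1 - \<eta> * (s + t)) ^ k"
          by (simp add: algebra_simps)
        also have "\<dots> / (s + t) = \<eta> * (1 - \<eta> * (s + t)) ^ k" using that by simp
        finally show ?thesis unfolding 1 by simp
      qed
      show "h k (\<sigma> u) + \<eta> * (1 - (\<sigma> u * h k (\<sigma> u) + t * h k (\<sigma> u))) = h (Suc k) (\<sigma> u)" if "u \<in> U" for u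
        using e st that by blast
      show "h k 0 + \<eta> * (1 - (0 * h k 0 + t * h k 0)) = h (Suc k) 0" using e st by blast
    qed
    finally show ?case .
  qed
  have lim: "(\<lambda>k. h k s) \<longlonglongrightarrow> 1 / (s + t)" if s: "s \<in> insert 0 (\<sigma> ` U)" for s
  proof -
    have "0 \<le> s" "s \<le> \<Lambda>" using s pos le \<Lambda> by (auto intro: less_imp_le)
    then have "0 < \<eta> * (s + t)" "\<eta> * (s + t) \<le> 1" using t \<Lambda> by (auto simp: \<eta>_def divide_simps)
    then have "(\<lambda>k. (1 - \<eta> * (s + t)) ^ k) \<longlonglongrightarrow> 0" by (intro LIMSEQ_realpow_zero) auto
    from tendsto_divide[OF tendsto_diff[OF tendsto_const this] tendsto_const st[OF s]]
    have "(\<lambda>k. (1 - (1 - \<eta> * (s + t)) ^ k) / (s + t)) \<longlonglongrightarrow> (1 - 0) / (s + t)" .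
    then show ?thesis by (simp add: h_def)
  qed
  have "(\<lambda>k. F (h k) v) \<longlonglongrightarrow> F (\<lambda>s. 1 / (s + t)) v"
    unfolding spec_fun_def using lim[of 0] by (intro tendsto_intros lim) auto
  then show ?thesis by (simp add: w[abs_def])
qed

section \<open>Samples under covariate shift\<close>

locale covariate_shift = rkhs_population evl feat qX \<kappa> + diagonal_op f \<mu> "cov_op qX feat"
  for evl :: "'g::{real_inner,banach} \<Rightarrow> 'x::second_countable_topology \<Rightarrow> 'y::{real_inner,banach,second_countable_topology}"
    and feat :: "'x \<Rightarrow> 'h::{real_inner,banach,second_countable_topology}" and qX \<kappa> f \<mu> +
  fixes pX :: "'x measure" and P :: "'x \<Rightarrow> 'y measure" and \<beta> :: "'x \<Rightarrow> real" and b M' bb a' :: real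
    and Cstar :: "'h \<Rightarrow> 'y"
  assumes pX: "prob_space pX" "sets pX = sets borel"
    and P: "P \<in> borel \<rightarrow>\<^sub>M prob_algebra borel"
    and \<beta>: "\<beta> \<in> borel_measurable borel" "\<And>x. 0 \<le> \<beta> x" "\<And>x. \<beta> x \<le> b" and b: "0 < b"
    and weight: "qX = density pX (\<lambda>x. ennreal (\<beta> x))"
    and Cstar: "bounded_linear Cstar" and regression: "\<And>x. (\<integral>y. y \<partial>P x) = Cstar (feat x)"
    and M': "0 < M'" "AE xy in joint_law pX P. norm (snd xy) \<le> M'"
    and bb: "1 < bb" and a': "0 < a'" and \<mu>_le: "\<And>j. \<mu> j \<le> a' * real (Suc j) powr (- bb)"
begin

abbreviation p where "p \<equiv> joint_law pX P"

lemma p_prob: "prob_space p"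
  by (rule joint_law_prob_space[OF pX P])

lemma measurable_pX: "h \<in> borel_measurable borel \<Longrightarrow> h \<in> borel_measurable pX"
  using measurable_cong_sets[OF pX(2) refl] by blast

lemma measurable_p_fst: "h \<in> borel_measurable borel \<Longrightarrow> (\<lambda>z. h (fst z)) \<in> borel_measurable p"
  unfolding measurable_cong_sets[OF sets_joint_law[OF pX P] refl] by (rule measurable_compose[OF measurable_fst])

lemma integrable_bounded_pX:
  fixes h :: "'x \<Rightarrow> 'c::{banach,second_countable_topology}"
  assumes "h \<in> borel_measurable borel" "\<And>x. norm (h x) \<le> c"
  shows "integrable pX h"
proof -
  interpret prob_space pX by (rule pX(1))
  show ?thesis using assms by (intro integrable_const_bound[of _ c] measurable_pX) auto
qed

lemma integral_weight:
  fixes h :: "'x \<Rightarrow> real"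
  assumes "h \<in> borel_measurable borel"
  shows "(\<integral>x. \<beta> x * h x \<partial>pX) = (\<integral>x. h x \<partial>qX)"
  unfolding weight using assms \<beta> by (subst integral_density) (auto intro: measurable_pX)

section \<open>Effective dimension of the population covariance\<close>

text \<open>The 2 pays for rounding the cut index up, the quotient for the eigenvalues beyond it;
  \<open>Kn * t powr (- 1 / bb)\<close> then bounds the effective dimension at level t.\<close>

definition Kn :: real where "Kn = 2 + a' / (bb - 1)"

lemma Kn_pos: "0 < Kn"
  using a' bb by (simp add: Kn_def add_pos_nonneg)

text \<open>The index at which the decay \<open>j powr (- bb)\<close> reaches the level t.\<close>

definition mcut :: "real \<Rightarrow> nat" where "mcut t = nat \<lceil>t powr (- 1 / bb)\<rceil>"

text \<open>The integral-test bound for the sum of all eigenvalues from \<open>mcut t\<close>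
  on.\<close>

definition theta :: "real \<Rightarrow> real" where "theta t = a' / (bb - 1) * t powr (1 - 1 / bb)"

context
  fixes t :: real assumes t: "0 < t" "t \<le> 1"
begin

lemma mcut: "1 \<le> mcut t" "t powr (- 1 / bb) \<le> real (mcut t)" "real (mcut t) \<le> 2 * t powr (- 1 / bb)"
proof -
  have "1 \<le> t powr (- 1 / bb)"
    using powr_mono2'[of "- 1 / bb" t 1] t bb by simp
  moreover have "t powr (- 1 / bb) \<le> of_int \<lceil>t powr (- 1 / bb)\<rceil>" by simp
  moreover have "of_int \<lceil>t powr (- 1 / bb)\<rceil> < t powr (- 1 / bb) + 1" by linarith
  moreover have "real (mcut t) = of_int \<lceil>t powr (- 1 / bb)\<rceil>"
    unfolding mcut_def using \<open>1 \<le> t powr (- 1 / bb)\<close> by (simp add: order_trans[OF zero_le_one])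
  ultimately show "t powr (- 1 / bb) \<le> real (mcut t)" "real (mcut t) \<le> 2 * t powr (- 1 / bb)" by linarith+
  then have "1 \<le> real (mcut t)" using \<open>1 \<le> t powr (- 1 / bb)\<close> by linarith
  then show "1 \<le> mcut t" by simp
qed

lemma theta_pos: "0 < theta t"
  using t a' bb by (simp add: theta_def)

lemma theta_div: "theta t / t = a' / (bb - 1) * t powr (- 1 / bb)"
proof -
  have "t powr (1 - 1 / bb) = t * t powr (- 1 / bb)"
    using t powr_add[of t 1 "- 1 / bb"] by (simp add: powr_one)
  then show ?thesis using t by (simp add: theta_def)
qed

lemma tail_le_theta: "(\<Sum>j=mcut t..<J. \<mu> j) \<le> theta t"
proof -
  have "(\<Sum>j=mcut t..<J. \<mu> j) \<le> a' * (\<Sum>j=mcut t..<J. real (Suc j) powr (- bb))"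
    unfolding sum_distrib_left by (intro sum_mono \<mu>_le)
  also have "\<dots> \<le> a' * (real (mcut t) powr (1 - bb) / (bb - 1))"
    using a' by (intro mult_left_mono sum_powr_neg_tail_le bb mcut) auto
  also have "\<dots> \<le> a' * ((t powr (- 1 / bb)) powr (1 - bb) / (bb - 1))"
    using a' bb t mcut by (intro mult_left_mono divide_right_mono powr_mono2') auto
  also have "(t powr (- 1 / bb)) powr (1 - bb) = t powr (1 - 1 / bb)"
  proof -
    have "(- 1 / bb) * (1 - bb) = 1 - 1 / bb" using bb by (simp add: field_simps)
    then show ?thesis by (simp only: powr_powr)
  qed
  finally show ?thesis by (simp add: theta_def)
qed

text \<open>Terms before the cut are at most 1, later ones at most
  \<open>\<mu> j / t\<close>.\<close>

lemma effective_dim_le: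
  assumes t': "t \<le> t'"
  shows "(\<Sum>j<J. \<mu> j / (\<mu> j + t')) \<le> Kn * t powr (- 1 / bb)"
proof -
  have nn: "0 \<le> \<mu> j / (\<mu> j + t')" for j using \<mu>_pos[of j] t t' by simp
  have "(\<Sum>j<J. \<mu> j / (\<mu> j + t')) \<le> (\<Sum>j\<in>{..<mcut t} \<union> {mcut t..<J}. \<mu> j / (\<mu> j + t'))"
    by (intro sum_mono2) (auto simp: nn)
  also have "\<dots> = (\<Sum>j<mcut t. \<mu> j / (\<mu> j + t')) + (\<Sum>j=mcut t..<J. \<mu> j / (\<mu> j + t'))"
    by (intro sum.union_disjoint) auto
  also have "\<dots> \<le> (\<Sum>j<mcut t. 1) + (\<Sum>j=mcut t..<J. \<mu> j / t)"
  proof (intro add_mono sum_mono)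
    fix j
    have "0 < \<mu> j" by (rule \<mu>_pos)
    then show "\<mu> j / (\<mu> j + t') \<le> 1" "\<mu> j / (\<mu> j + t') \<le> \<mu> j / t"
      using t t' by (auto intro!: divide_left_mono mult_pos_pos)
  qed
  also have "\<dots> = real (mcut t) + (\<Sum>j=mcut t..<J. \<mu> j) / t" by (simp add: sum_divide_distrib)
  also have "\<dots> \<le> 2 * t powr (- 1 / bb) + theta t / t"
    using mcut tail_le_theta t by (intro add_mono divide_right_mono) auto
  also have "\<dots> = Kn * t powr (- 1 / bb)" unfolding theta_div Kn_def by (simp add: algebra_simps)
  finally show ?thesis .
qed

end

lemma \<mu>_inner: "(\<integral>x. (feat x \<bullet> f j)\<^sup>2 \<partial>qX) = \<mu> j"
proof -
  have "\<mu> j = f j \<bullet> C (f j)" using C_f[of "f j" j] by (simp add: f_inner inner_commute)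
  also have "\<dots> = (\<integral>x. (feat x \<bullet> f j)\<^sup>2 \<partial>qX)" unfolding cov_op_inner by (simp add: inner_commute power2_eq_square)
  finally show ?thesis by simp
qed

lemma feat_f_measurable [measurable]: "(\<lambda>x. feat x \<bullet> f j) \<in> borel_measurable borel"
  using feat_inner_measurable[of "f j"] by (simp add: inner_commute)

lemma feat_f_integrable: "integrable qX (\<lambda>x. (feat x \<bullet> f j)\<^sup>2)"
proof (rule integrable_bounded_qX[where c = "\<kappa>\<^sup>2"])
  fix x
  have "(feat x \<bullet> f j)\<^sup>2 \<le> (\<Sum>j<Suc j. (feat x \<bullet> f j)\<^sup>2)" by (simp add: sum_nonneg)
  also have "\<dots> \<le> (norm (feat x))\<^sup>2" by (rule bessel_f)
  also have "\<dots> \<le> \<kappa>\<^sup>2" using feat_bound by (intro power_mono) auto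
  finally show "norm ((feat x \<bullet> f j)\<^sup>2) \<le> \<kappa>\<^sup>2" by simp
qed measurable

lemma feat_sq_le: "(norm (feat x))\<^sup>2 \<le> \<kappa>\<^sup>2"
  using feat_bound by (intro power_mono) auto

lemma feat_f_sum_le: "(\<Sum>j<J. (feat x \<bullet> f j)\<^sup>2) \<le> \<kappa>\<^sup>2"
  using bessel_f feat_sq_le order_trans by blast

lemma sum_\<mu>_le: "(\<Sum>j<J. \<mu> j) \<le> \<kappa>\<^sup>2"
proof -
  interpret prob_space qX by (rule qX(1))
  have "(\<Sum>j<J. \<mu> j) = (\<integral>x. (\<Sum>j<J. (feat x \<bullet> f j)\<^sup>2) \<partial>qX)"
    using feat_f_integrable by (simp add: \<mu>_inner[symmetric])
  also have "\<dots> \<le> (\<integral>x. \<kappa>\<^sup>2 \<partial>qX)"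
    using feat_f_integrable feat_f_sum_le by (intro integral_mono) auto
  finally show ?thesis by (simp add: prob_space)
qed

lemma \<mu>_le_\<kappa>: "\<mu> j \<le> \<kappa>\<^sup>2"
  using sum_\<mu>_le[of "Suc j"] sum_nonneg[of "{..<j}" \<mu>] less_imp_le[OF \<mu>_pos] by simp

text \<open>Squared norm of the component of \<open>feat x\<close> outside the span of the first m
  eigenvectors.\<close>

definition tail :: "nat \<Rightarrow> 'x \<Rightarrow> real" where
  "tail m x = (norm (feat x))\<^sup>2 - (\<Sum>j<m. (feat x \<bullet> f j)\<^sup>2)"

lemma tail_bounds: "0 \<le> tail m x" "tail m x \<le> \<kappa>\<^sup>2"
  using bessel_f[where v = "feat x" and J = m] feat_sq_le[of x] sum_nonneg[of "{..<m}" "\<lambda>j. (feat x \<bullet> f j)\<^sup>2"]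
  unfolding tail_def by auto

lemma tail_measurable [measurable]: "tail m \<in> borel_measurable borel"
  unfolding tail_def using feat_measurable by measurable

text \<open>Up to an index J the mean is a finite sum of eigenvalues beyond the cut; the remaining
  mean tends to 0 by dominated convergence.\<close>

lemma tail_integral_le:
  assumes t: "0 < t" "t \<le> 1"
  shows "(\<integral>x. tail (mcut t) x \<partial>qX) \<le> theta t"
proof -
  let ?m = "mcut t"
  have ti: "integrable qX (tail m)" for m
    using tail_bounds by (intro integrable_bounded_qX[of _ "\<kappa>\<^sup>2"]) auto
  have "(\<lambda>J. (\<integral>x. tail J x \<partial>qX)) \<longlonglongrightarrow> (\<integral>x. 0 \<partial>qX)"
  proof (rule integral_dominated_convergence[where w = "\<lambda>_. \<kappa>\<^sup>2"])
    show "AE x in qX. (\<lambda>J. tail J x) \<longlonglongrightarrow> 0" unfolding tail_def using f_partial_norm by simp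
    show "integrable qX (\<lambda>_. \<kappa>\<^sup>2)" by (rule integrable_bounded_qX) auto
  qed (use tail_bounds measurable_qX[OF tail_measurable] in auto)
  then have lim: "(\<lambda>J. theta t + (\<integral>x. tail J x \<partial>qX)) \<longlonglongrightarrow> theta t + 0" by (intro tendsto_intros) simp
  have "(\<integral>x. tail ?m x \<partial>qX) \<le> theta t + 0"
  proof (rule LIMSEQ_le_const[OF lim], intro exI[of _ ?m] allI impI)
    fix J assume J: "?m \<le> J"
    have "tail ?m x = (\<Sum>j=?m..<J. (feat x \<bullet> f j)\<^sup>2) + tail J x" for x
      unfolding tail_def using sum.atLeastLessThan_concat[of 0 ?m J "\<lambda>j. (feat x \<bullet> f j)\<^sup>2"] J
      by (simp add: atLeast0LessThan)
    then have "(\<integral>x. tail ?m x \<partial>qX) = (\<Sum>j=?m..<J. \<mu> j) + (\<integral>x. tail J x \<partial>qX)"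
      using feat_f_integrable ti by (simp add: \<mu>_inner)
    then show "(\<integral>x. tail ?m x \<partial>qX) \<le> theta t + (\<integral>x. tail J x \<partial>qX)" using tail_le_theta[OF t, of J] by simp
  qed
  then show ?thesis by simp
qed

text \<open>Column j of the centered one-sample operator: the weighted rank-one operator minus C,
  applied to \<open>f j\<close>.\<close>

definition xi :: "nat \<Rightarrow> 'x \<Rightarrow> 'h" where
  "xi j x = (\<beta> x * (feat x \<bullet> f j)) *\<^sub>R feat x - \<mu> j *\<^sub>R f j"

lemma xi_measurable [measurable]: "xi j \<in> borel_measurable borel"
  unfolding xi_def using \<beta>(1) feat_measurable by measurable

lemma xi_mean: "(\<integral>x. a \<bullet> xi j x \<partial>pX) = 0"
proof -
  interpret prob_space pX by (rule pX(1))
  have m: "(\<lambda>x. (a \<bullet> feat x) * (f j \<bullet> feat x)) \<in> borel_measurable borel" by measurable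
  have m2: "(\<lambda>x. \<beta> x * ((a \<bullet> feat x) * (f j \<bullet> feat x))) \<in> borel_measurable borel" using \<beta>(1) by measurable
  have int: "integrable pX (\<lambda>x. \<beta> x * ((a \<bullet> feat x) * (f j \<bullet> feat x)))"
  proof (rule integrable_bounded_pX[OF m2])
    show "norm (\<beta> x * ((a \<bullet> feat x) * (f j \<bullet> feat x))) \<le> b * (norm a * \<kappa> * (norm (f j) * \<kappa>))" for x
      unfolding abs_mult real_norm_def using \<beta> b \<kappa>_nonneg abs_inner_feat
      by (intro mult_mono) auto
  qed
  have "a \<bullet> xi j x = \<beta> x * ((a \<bullet> feat x) * (f j \<bullet> feat x)) - \<mu> j * (a \<bullet> f j)" for x
    by (simp add: xi_def inner_diff_right inner_commute mult_ac)
  then have "(\<integral>x. a \<bullet> xi j x \<partial>pX) = (\<integral>x. \<beta> x * ((a \<bullet> feat x) * (f j \<bullet> feat x)) \<partial>pX) - \<mu> j * (a \<bullet> f j)"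
    using int by (simp add: prob_space)
  also have "(\<integral>x. \<beta> x * ((a \<bullet> feat x) * (f j \<bullet> feat x)) \<partial>pX) = a \<bullet> C (f j)"
    unfolding integral_weight[OF m] cov_op_inner ..
  also have "\<dots> = \<mu> j * (a \<bullet> f j)" using C_f[of a j] cov_op_sym[of a "f j"] by simp
  finally show ?thesis by simp
qed

text \<open>One factor \<beta> is bounded by b and the other kept, because as a density it turns
  integrals over pX into integrals over qX.\<close>

lemma xi_norm: "(norm (xi j x))\<^sup>2 \<le> 2 * (b * \<kappa>\<^sup>2 * (\<beta> x * (feat x \<bullet> f j)\<^sup>2)) + 2 * (\<mu> j)\<^sup>2"
proof -
  have "(norm (xi j x))\<^sup>2 \<le> (norm ((\<beta> x * (feat x \<bullet> f j)) *\<^sub>R feat x) + norm (\<mu> j *\<^sub>R f j))\<^sup>2"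
    unfolding xi_def by (intro power_mono norm_triangle_ineq4) auto
  also have "\<dots> \<le> 2 * (norm ((\<beta> x * (feat x \<bullet> f j)) *\<^sub>R feat x))\<^sup>2 + 2 * (norm (\<mu> j *\<^sub>R f j))\<^sup>2"
    by (rule power2_sum_le)
  also have "(norm (\<mu> j *\<^sub>R f j))\<^sup>2 = (\<mu> j)\<^sup>2" using f_inner[of j j] by (simp add: power_mult_distrib power2_norm_eq_inner)
  also have "(norm ((\<beta> x * (feat x \<bullet> f j)) *\<^sub>R feat x))\<^sup>2 = (\<beta> x * (norm (feat x))\<^sup>2) * (\<beta> x * (feat x \<bullet> f j)\<^sup>2)"
    by (simp add: power_mult_distrib power2_eq_square mult_ac)
  also have "\<dots> \<le> (b * \<kappa>\<^sup>2) * (\<beta> x * (feat x \<bullet> f j)\<^sup>2)"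
    using \<beta> b feat_sq_le by (intro mult_right_mono mult_mono) auto
  finally show ?thesis by simp
qed

text \<open>Bounds the Hilbert-Schmidt norm of one centered summand scaled by the inverse square
  root of \<open>C + t\<close>. The added 1 makes positivity immediate for every \<kappa>.\<close>

definition Rbound :: "real \<Rightarrow> real" where "Rbound t = sqrt ((2 * (b\<^sup>2 + 1) * \<kappa>^4 + 1) / t)"

text \<open>Variance constant: the scaled summand has second moment at most
  \<open>Sig * t powr (- 1 / bb)\<close>.\<close>

definition Sig :: real where "Sig = 2 * (b + 1) * \<kappa>\<^sup>2 * Kn"

lemma xi_sum_bound:
  assumes t: "0 < t"
  shows "(\<Sum>j<J. (norm (xi j x))\<^sup>2 / (\<mu> j + t)) \<le> (Rbound t)\<^sup>2"
proof -
  have "(\<Sum>j<J. (norm (xi j x))\<^sup>2 / (\<mu> j + t)) \<le> (\<Sum>j<J. (2 * (b * \<kappa>\<^sup>2 * (b * (feat x \<bullet> f j)\<^sup>2)) + 2 * (\<kappa>\<^sup>2 * \<mu> j)) / t)"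
  proof (rule sum_mono)
    fix j
    have "(norm (xi j x))\<^sup>2 \<le> 2 * (b * \<kappa>\<^sup>2 * (\<beta> x * (feat x \<bullet> f j)\<^sup>2)) + 2 * (\<mu> j)\<^sup>2" by (rule xi_norm)
    also have "\<dots> \<le> 2 * (b * \<kappa>\<^sup>2 * (b * (feat x \<bullet> f j)\<^sup>2)) + 2 * (\<kappa>\<^sup>2 * \<mu> j)"
      unfolding power2_eq_square[of "\<mu> j"] using b \<beta> \<mu>_le_\<kappa> less_imp_le[OF \<mu>_pos]
      by (intro add_mono mult_left_mono mult_right_mono) auto
    finally have le: "(norm (xi j x))\<^sup>2 \<le> 2 * (b * \<kappa>\<^sup>2 * (b * (feat x \<bullet> f j)\<^sup>2)) + 2 * (\<kappa>\<^sup>2 * \<mu> j)" .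
    show "(norm (xi j x))\<^sup>2 / (\<mu> j + t) \<le> (2 * (b * \<kappa>\<^sup>2 * (b * (feat x \<bullet> f j)\<^sup>2)) + 2 * (\<kappa>\<^sup>2 * \<mu> j)) / t"
    proof (rule frac_le[OF _ le])
      show "0 \<le> 2 * (b * \<kappa>\<^sup>2 * (b * (feat x \<bullet> f j)\<^sup>2)) + 2 * (\<kappa>\<^sup>2 * \<mu> j)"
        using b less_imp_le[OF \<mu>_pos[of j]] by (intro add_nonneg_nonneg mult_nonneg_nonneg) auto
    qed (use t \<mu>_pos[of j] in auto)
  qed
  also have "\<dots> = (2 * (b\<^sup>2 * \<kappa>\<^sup>2 * (\<Sum>j<J. (feat x \<bullet> f j)\<^sup>2)) + 2 * (\<kappa>\<^sup>2 * (\<Sum>j<J. \<mu> j))) / t"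
    unfolding sum_divide_distrib[symmetric] sum.distrib sum_distrib_left[symmetric] by (simp add: power2_eq_square mult_ac)
  also have "\<dots> \<le> (2 * (b\<^sup>2 * \<kappa>\<^sup>2 * \<kappa>\<^sup>2) + 2 * (\<kappa>\<^sup>2 * \<kappa>\<^sup>2)) / t"
    using t feat_f_sum_le sum_\<mu>_le by (intro divide_right_mono add_mono mult_left_mono) auto
  also have "\<dots> \<le> (2 * (b\<^sup>2 + 1) * \<kappa>^4 + 1) / t"
    using t by (intro divide_right_mono) (auto simp: algebra_simps power4_eq_xxxx power2_eq_square)
  also have "\<dots> = (Rbound t)\<^sup>2" unfolding Rbound_def using t by (subst real_sqrt_pow2) (auto intro!: divide_nonneg_nonneg add_nonneg_nonneg mult_nonneg_nonneg)
  finally show ?thesis .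
qed

lemma xi_integrable: "integrable pX (\<lambda>x. (norm (xi j x))\<^sup>2)"
proof (rule integrable_bounded_pX)
  show "norm ((norm (xi j x))\<^sup>2) \<le> 2 * (b * \<kappa>\<^sup>2 * (b * \<kappa>\<^sup>2)) + 2 * (\<mu> j)\<^sup>2" for x
  proof -
    have "(feat x \<bullet> f j)\<^sup>2 \<le> (\<Sum>j<Suc j. (feat x \<bullet> f j)\<^sup>2)" by (simp add: sum_nonneg)
    also have "\<dots> \<le> \<kappa>\<^sup>2" by (rule feat_f_sum_le)
    finally have "\<beta> x * (feat x \<bullet> f j)\<^sup>2 \<le> b * \<kappa>\<^sup>2" using \<beta> b by (intro mult_mono) auto
    then have "2 * (b * \<kappa>\<^sup>2 * (\<beta> x * (feat x \<bullet> f j)\<^sup>2)) \<le> 2 * (b * \<kappa>\<^sup>2 * (b * \<kappa>\<^sup>2))" using b by (intro mult_left_mono) auto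
    then show ?thesis using xi_norm[of j x] by simp
  qed
qed measurable

text \<open>Under qX the squared coefficient integrates to \<open>\<mu> j\<close>, so that after
  division by \<open>\<mu> j + t'\<close> the effective dimension remains.\<close>

lemma xi_variance:
  assumes t: "0 < t" "t \<le> 1" "t \<le> t'"
  shows "(\<integral>x. (\<Sum>j<J. (norm (xi j x))\<^sup>2 / (\<mu> j + t')) \<partial>pX) \<le> Sig * t powr (- 1 / bb)"
proof -
  interpret prob_space pX by (rule pX(1))
  have one: "(\<integral>x. (norm (xi j x))\<^sup>2 \<partial>pX) \<le> 2 * (b + 1) * \<kappa>\<^sup>2 * \<mu> j" for j
  proof -
    have m: "(\<lambda>x. (feat x \<bullet> f j)\<^sup>2) \<in> borel_measurable borel" by measurable
    have m2: "(\<lambda>x. \<beta> x * (feat x \<bullet> f j)\<^sup>2) \<in> borel_measurable borel" using \<beta>(1) by measurable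
    have int: "integrable pX (\<lambda>x. \<beta> x * (feat x \<bullet> f j)\<^sup>2)"
    proof (rule integrable_bounded_pX[OF m2])
      show "norm (\<beta> x * (feat x \<bullet> f j)\<^sup>2) \<le> b * \<kappa>\<^sup>2" for x
      proof -
        have "(feat x \<bullet> f j)\<^sup>2 \<le> (\<Sum>j<Suc j. (feat x \<bullet> f j)\<^sup>2)" by (simp add: sum_nonneg)
        also have "\<dots> \<le> \<kappa>\<^sup>2" by (rule feat_f_sum_le)
        finally show ?thesis using \<beta> b by (auto simp: abs_mult intro!: mult_mono)
      qed
    qed
    have "(\<integral>x. (norm (xi j x))\<^sup>2 \<partial>pX) \<le> (\<integral>x. 2 * (b * \<kappa>\<^sup>2 * (\<beta> x * (feat x \<bullet> f j)\<^sup>2)) + 2 * (\<mu> j)\<^sup>2 \<partial>pX)"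
      using int by (intro integral_mono xi_integrable xi_norm) auto
    also have "\<dots> = 2 * (b * \<kappa>\<^sup>2 * \<mu> j) + 2 * (\<mu> j)\<^sup>2"
      using int integral_weight[OF m] by (simp add: prob_space \<mu>_inner)
    also have "\<dots> \<le> 2 * (b * \<kappa>\<^sup>2 * \<mu> j) + 2 * (\<kappa>\<^sup>2 * \<mu> j)"
      unfolding power2_eq_square[of "\<mu> j"] using \<mu>_le_\<kappa> less_imp_le[OF \<mu>_pos] by (intro add_left_mono mult_left_mono mult_right_mono) auto
    finally show ?thesis by (simp add: algebra_simps)
  qed
  have "(\<integral>x. (\<Sum>j<J. (norm (xi j x))\<^sup>2 / (\<mu> j + t')) \<partial>pX) = (\<Sum>j<J. (\<integral>x. (norm (xi j x))\<^sup>2 \<partial>pX) / (\<mu> j + t'))"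
    using xi_integrable by simp
  also have "\<dots> \<le> (\<Sum>j<J. 2 * (b + 1) * \<kappa>\<^sup>2 * \<mu> j / (\<mu> j + t'))"
    using t by (intro sum_mono divide_right_mono one) (simp add: less_imp_le[OF \<mu>_pos] add_nonneg_nonneg)
  also have "\<dots> = 2 * (b + 1) * \<kappa>\<^sup>2 * (\<Sum>j<J. \<mu> j / (\<mu> j + t'))"
    by (simp add: sum_distrib_left)
  also have "\<dots> \<le> 2 * (b + 1) * \<kappa>\<^sup>2 * (Kn * t powr (- 1 / bb))"
    using b by (intro mult_left_mono effective_dim_le t) auto
  finally show ?thesis by (simp add: Sig_def mult_ac)
qed

end

section \<open>Empirical covariance and its resolvent\<close>

lemma emp_cov_eq:
  "emp_cov w feat n z v = (\<Sum>i<n. ((w (fst (z i)) / real n) * (v \<bullet> feat (fst (z i)))) *\<^sub>R feat (fst (z i)))"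
  by (simp add: emp_cov_def tensor_op_def scaleR_sum_right)

lemma emp_cov_inner:
  "emp_cov w feat n z v \<bullet> u = (\<Sum>i<n. (w (fst (z i)) / real n) * ((v \<bullet> feat (fst (z i))) * (u \<bullet> feat (fst (z i)))))"
  unfolding emp_cov_eq inner_sum_left by (simp add: inner_commute mult_ac)

lemma emp_cov_sym: "emp_cov w feat n z v \<bullet> u = v \<bullet> emp_cov w feat n z u"
  unfolding inner_commute[of v] emp_cov_inner by (simp add: mult_ac)

lemma emp_cov_spectral_rep:
  assumes "\<And>x. 0 \<le> w x"
  shows "\<exists>U \<sigma>. spectral_rep (emp_cov w feat n z) U \<sigma>"
  by (rule finite_rank_spectral_rep[of "{..<n}" "\<lambda>i. w (fst (z i)) / real n" _ "\<lambda>i. feat (fst (z i))"])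
     (auto simp: assms emp_cov_eq)

text \<open>Choosing a spectral representation makes the resolvent a function of the operator alone;
  its value is the same for every choice. The chosen family may depend on the sample in a
  non-measurable way, and measurability of the value is recovered from the iteration.\<close>

definition fin_resolvent :: "('a \<Rightarrow> 'a::real_inner) \<Rightarrow> real \<Rightarrow> 'a \<Rightarrow> 'a" where
  "fin_resolvent A t v = (let (U, \<sigma>) = SOME (U, \<sigma>). spectral_rep A U \<sigma> in spec_fun U \<sigma> (\<lambda>s. 1 / (s + t)) v)"

lemma fin_resolvent_obtain:
  assumes "\<exists>U \<sigma>. spectral_rep A U \<sigma>"
  obtains U \<sigma> where "spectral_rep A U \<sigma>" "\<And>t v. fin_resolvent A t v = spec_fun U \<sigma> (\<lambda>s. 1 / (s + t)) v"
proof -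
  define p where "p = (SOME (U, \<sigma>). spectral_rep A U \<sigma>)"
  obtain U \<sigma> where rep: "spectral_rep A U \<sigma>" using assms by blast
  have "case p of (U, \<sigma>) \<Rightarrow> spectral_rep A U \<sigma>"
    unfolding p_def by (rule someI[where x = "(U, \<sigma>)"]) (simp add: rep)
  then have "spectral_rep A (fst p) (snd p)" by (simp add: case_prod_beta)
  moreover have "fin_resolvent A t v = spec_fun (fst p) (snd p) (\<lambda>s. 1 / (s + t)) v" for t v
    unfolding fin_resolvent_def p_def[symmetric] by (simp add: case_prod_beta)
  ultimately show ?thesis by (rule that)
qed

context
  fixes feat :: "'x \<Rightarrow> 'h::real_inner" and w :: "'x \<Rightarrow> real" and n :: nat and z :: "nat \<Rightarrow> 'x \<times> 'y"
    and U :: "'h set" and \<sigma> :: "'h \<Rightarrow> real"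
  assumes w: "\<And>x. 0 \<le> w x" and rep: "spectral_rep (emp_cov w feat n z) U \<sigma>"
begin

lemma emp_cov_eigenvalue: "u \<in> U \<Longrightarrow> (\<Sum>i<n. (w (fst (z i)) / real n) * (feat (fst (z i)) \<bullet> u)\<^sup>2) = \<sigma> u"
proof -
  interpret orthonormal_family U \<sigma> by (rule spectral_rep_family[OF rep])
  assume u: "u \<in> U"
  have "emp_cov w feat n z u \<bullet> u = \<sigma> u"
    using spec_fun_inner_U[OF u, of "\<lambda>s. s" u] spectral_rep_spec_fun[OF rep, of u] orthonormal_inner[OF orthonormal_U u u] by simp
  then show ?thesis unfolding emp_cov_inner by (simp add: power2_eq_square inner_commute)
qed

lemma emp_cov_eigenvalue_le:
  assumes "\<And>x. w x \<le> b" "\<And>x. norm (feat x) \<le> \<kappa>" "u \<in> U" "0 \<le> b"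
  shows "\<sigma> u \<le> b * \<kappa>\<^sup>2"
proof (cases "n = 0")
  case True
  then show ?thesis using emp_cov_eigenvalue[OF assms(3)] assms by simp
next
  case False
  have u: "norm u = 1" using assms(3) spectral_repD(2)[OF rep] by (simp add: orthonormal_def)
  have "\<sigma> u \<le> (\<Sum>i<n. (b / real n) * \<kappa>\<^sup>2)"
    unfolding emp_cov_eigenvalue[OF assms(3), symmetric]
  proof (intro sum_mono mult_mono divide_right_mono assms)
    fix i
    have "\<bar>feat (fst (z i)) \<bullet> u\<bar> \<le> \<kappa>" using Cauchy_Schwarz_ineq2[of "feat (fst (z i))" u] u assms(2)[of "fst (z i)"] by simp
    then show "(feat (fst (z i)) \<bullet> u)\<^sup>2 \<le> \<kappa>\<^sup>2" by (metis abs_ge_zero power2_abs power_mono)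
  qed (use assms w in auto)
  then show ?thesis using False by simp
qed

text \<open>The part q of a sampled feature orthogonal to U lies in the kernel of the empirical
  covariance, whose form is a weighted sum of squares; every summand vanishes at q, in particular
  the one of this sample.\<close>

lemma emp_cov_range:
  assumes i: "i < n"
  shows "w (fst (z i)) * ((norm (feat (fst (z i))))\<^sup>2 - (\<Sum>u\<in>U. (feat (fst (z i)) \<bullet> u)\<^sup>2)) = 0"
proof -
  interpret orthonormal_family U \<sigma> by (rule spectral_rep_family[OF rep])
  define a where "a = feat (fst (z i))"
  define q where "q = a - (\<Sum>u\<in>U. (a \<bullet> u) *\<^sub>R u)"
  have qU: "q \<bullet> u = 0" if "u \<in> U" for u
    using orthonormal_sum_inner[OF orthonormal_U finite_U subset_refl that, of "\<lambda>u. a \<bullet> u"] that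
    by (simp add: q_def inner_diff_left)
  have "emp_cov w feat n z q = 0" unfolding spectral_repD(4)[OF rep] by (simp add: qU)
  then have "(\<Sum>i<n. (w (fst (z i)) / real n) * (q \<bullet> feat (fst (z i)))\<^sup>2) = 0"
    using emp_cov_inner[of w feat n z q q] by (simp add: power2_eq_square)
  then have "(w (fst (z i)) / real n) * (q \<bullet> feat (fst (z i)))\<^sup>2 = 0"
    using i w by (subst (asm) sum_nonneg_eq_0_iff) auto
  then have "w (fst (z i)) = 0 \<or> q \<bullet> a = 0" using i by (auto simp: a_def)
  moreover have "q \<bullet> a = (norm q)\<^sup>2"
  proof -
    have "q \<bullet> (\<Sum>u\<in>U. (a \<bullet> u) *\<^sub>R u) = 0" by (simp add: inner_sum_right qU)
    then have "q \<bullet> a = q \<bullet> (a - (\<Sum>u\<in>U. (a \<bullet> u) *\<^sub>R u))" by (simp add: inner_diff_right)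
    then show ?thesis by (simp add: q_def power2_norm_eq_inner)
  qed
  moreover have "(norm q)\<^sup>2 = (norm a)\<^sup>2 - (\<Sum>u\<in>U. (a \<bullet> u)\<^sup>2)"
    unfolding q_def by (rule bessel_eq[OF orthonormal_U finite_U subset_refl])
  ultimately show ?thesis by (auto simp: a_def)
qed

end

section \<open>Empirical effective dimension and deviation of the covariance\<close>

context covariate_shift
begin

text \<open>For A the empirical covariance, the left side is the trace of A times the inverse of
  \<open>A + t\<close>. Weigh each eigenvector u of A by its squared projection \<open>c u\<close>
  onto the first m eigenvectors of C: the weighted part has trace at most m, the rest at most the
  empirical tail divided by t. This holds for every sample.\<close>

lemma empirical_dimension_le:
  fixes z :: "nat \<Rightarrow> 'x \<times> 'y"
  assumes w: "\<And>x. 0 \<le> w x" and rep: "spectral_rep (emp_cov w feat n z) U \<sigma>" and t: "0 < t"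
  shows "(\<Sum>i<n. (w (fst (z i)) / real n) * (spec_fun U \<sigma> (\<lambda>s. 1 / (s + t)) (feat (fst (z i))) \<bullet> feat (fst (z i))))
    \<le> real m + (\<Sum>i<n. (w (fst (z i)) / real n) * tail m (fst (z i))) / t"
proof -
  interpret V: orthonormal_family U \<sigma> by (rule spectral_rep_family[OF rep])
  let ?\<phi> = "\<lambda>i. feat (fst (z i))" and ?w = "\<lambda>i. w (fst (z i)) / real n"
  have wn: "0 \<le> ?w i" for i using w by simp
  have \<sigma>: "0 < \<sigma> u" if "u \<in> U" for u using spectral_repD(3)[OF rep that] .
  define c where "c u = (\<Sum>j<m. (u \<bullet> f j)\<^sup>2)" for u
  have c: "0 \<le> c u" "c u \<le> 1" if "u \<in> U" for u
    using that V.orthonormal_U bessel_f[where v = u and J = m] by (auto simp: c_def sum_nonneg orthonormal_def)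
  \<comment> \<open>The resolvent acts on the complement of U by \<open>1 / t\<close>, but sampled
    features of nonzero weight have no component there.\<close>
  have "(\<Sum>i<n. ?w i * (V.F (\<lambda>s. 1 / (s + t)) (?\<phi> i) \<bullet> ?\<phi> i)) = (\<Sum>i<n. ?w i * (\<Sum>u\<in>U. 1 / (\<sigma> u + t) * (?\<phi> i \<bullet> u)\<^sup>2))"
  proof (intro sum.cong refl)
    fix i assume "i \<in> {..<n}"
    then have "?w i * ((norm (?\<phi> i))\<^sup>2 - (\<Sum>u\<in>U. (?\<phi> i \<bullet> u)\<^sup>2)) = 0"
      using emp_cov_range[OF w rep, of i] by auto
    then have "?w i * (?\<phi> i \<bullet> ?\<phi> i - (\<Sum>u\<in>U. (?\<phi> i \<bullet> u) * (?\<phi> i \<bullet> u))) = 0"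
      unfolding power2_norm_eq_inner unfolding power2_eq_square .
    then have "?w i * (1 / t * (?\<phi> i \<bullet> ?\<phi> i - (\<Sum>u\<in>U. (?\<phi> i \<bullet> u) * (?\<phi> i \<bullet> u)))) = 0"
      by auto
    then show "?w i * (V.F (\<lambda>s. 1 / (s + t)) (?\<phi> i) \<bullet> ?\<phi> i) = ?w i * (\<Sum>u\<in>U. 1 / (\<sigma> u + t) * (?\<phi> i \<bullet> u)\<^sup>2)"
      unfolding V.spec_fun_inner distrib_left by (simp add: power2_eq_square mult.assoc)
  qed
  also have "\<dots> = (\<Sum>u\<in>U. (\<Sum>i<n. ?w i * (?\<phi> i \<bullet> u)\<^sup>2) / (\<sigma> u + t))"
    unfolding sum_distrib_left sum_divide_distrib by (subst sum.swap) (simp add: mult_ac)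
  also have "\<dots> = (\<Sum>u\<in>U. \<sigma> u / (\<sigma> u + t))"
    by (intro sum.cong refl) (simp only: emp_cov_eigenvalue[OF w rep])
  also have "\<dots> \<le> (\<Sum>u\<in>U. c u + \<sigma> u * (1 - c u) / t)"
  proof (rule sum_mono)
    fix u assume u: "u \<in> U"
    have "\<sigma> u / (\<sigma> u + t) = c u * (\<sigma> u / (\<sigma> u + t)) + (1 - c u) * (\<sigma> u / (\<sigma> u + t))" by (simp only: distrib_right[symmetric]) simp
    also have "\<dots> \<le> c u * 1 + (1 - c u) * (\<sigma> u / t)"
      using c[OF u] \<sigma>[OF u] t by (intro add_mono mult_left_mono) (auto intro!: divide_left_mono mult_pos_pos)
    finally show "\<sigma> u / (\<sigma> u + t) \<le> c u + \<sigma> u * (1 - c u) / t" by (simp add: mult.commute)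
  qed
  also have "\<dots> = (\<Sum>u\<in>U. c u) + (\<Sum>u\<in>U. \<sigma> u * (1 - c u)) / t"
    by (simp add: sum.distrib sum_divide_distrib)
  also have "(\<Sum>u\<in>U. c u) \<le> real m"
  proof -
    have "(\<Sum>u\<in>U. c u) = (\<Sum>j<m. \<Sum>u\<in>U. (f j \<bullet> u)\<^sup>2)"
      unfolding c_def by (subst sum.swap) (simp add: inner_commute)
    also have "\<dots> \<le> (\<Sum>j<m. 1)"
    proof (rule sum_mono)
      fix j
      have "(\<Sum>u\<in>U. (f j \<bullet> u)\<^sup>2) \<le> (norm (f j))\<^sup>2" by (rule bessel[OF V.orthonormal_U V.finite_U subset_refl])
      then show "(\<Sum>u\<in>U. (f j \<bullet> u)\<^sup>2) \<le> 1" using f_inner[of j j] by (simp add: power2_norm_eq_inner)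
    qed
    finally show ?thesis by simp
  qed
  also have "(\<Sum>u\<in>U. \<sigma> u * (1 - c u)) \<le> (\<Sum>i<n. ?w i * tail m (fst (z i)))"
  proof -
    have s1: "(\<Sum>u\<in>U. \<sigma> u) = (\<Sum>i<n. ?w i * (\<Sum>u\<in>U. (?\<phi> i \<bullet> u)\<^sup>2))"
    proof -
      have "(\<Sum>u\<in>U. \<sigma> u) = (\<Sum>u\<in>U. \<Sum>i<n. ?w i * (?\<phi> i \<bullet> u)\<^sup>2)"
        by (intro sum.cong refl) (simp only: emp_cov_eigenvalue[OF w rep])
      then show ?thesis unfolding sum_distrib_left by (subst sum.swap) simp
    qed
    have s2: "(\<Sum>u\<in>U. \<sigma> u * c u) = (\<Sum>i<n. ?w i * (\<Sum>j<m. (?\<phi> i \<bullet> f j)\<^sup>2))"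
    proof -
      have e: "(\<Sum>u\<in>U. \<sigma> u * (u \<bullet> f j)\<^sup>2) = (\<Sum>i<n. ?w i * (?\<phi> i \<bullet> f j)\<^sup>2)" for j
      proof -
        have "(\<Sum>u\<in>U. \<sigma> u * (u \<bullet> f j)\<^sup>2) = emp_cov w feat n z (f j) \<bullet> f j"
          unfolding spectral_repD(4)[OF rep] inner_sum_left
          by (intro sum.cong refl) (simp add: power2_eq_square inner_commute)
        then show ?thesis unfolding emp_cov_inner by (simp add: power2_eq_square inner_commute)
      qed
      have "(\<Sum>u\<in>U. \<sigma> u * c u) = (\<Sum>j<m. \<Sum>u\<in>U. \<sigma> u * (u \<bullet> f j)\<^sup>2)"
        unfolding c_def sum_distrib_left by (rule sum.swap)
      also have "\<dots> = (\<Sum>i<n. ?w i * (\<Sum>j<m. (?\<phi> i \<bullet> f j)\<^sup>2))"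
        unfolding e sum_distrib_left by (rule sum.swap)
      finally show ?thesis .
    qed
    have "(\<Sum>u\<in>U. \<sigma> u * (1 - c u)) = (\<Sum>u\<in>U. \<sigma> u) - (\<Sum>u\<in>U. \<sigma> u * c u)"
      by (simp add: right_diff_distrib sum_subtractf)
    also have "\<dots> = (\<Sum>i<n. ?w i * ((\<Sum>u\<in>U. (?\<phi> i \<bullet> u)\<^sup>2) - (\<Sum>j<m. (?\<phi> i \<bullet> f j)\<^sup>2)))"
      unfolding s1 s2 by (simp add: right_diff_distrib sum_subtractf)
    also have "\<dots> \<le> (\<Sum>i<n. ?w i * tail m (fst (z i)))"
      unfolding tail_def
      using bessel[OF V.orthonormal_U V.finite_U subset_refl] wn by (intro sum_mono mult_left_mono) (auto simp: diff_right_mono)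
    finally show ?thesis .
  qed
  finally show ?thesis using t by (auto simp: divide_right_mono)
qed

text \<open>The columns \<open>xi j\<close> divided by \<open>sqrt (\<mu> j + t')\<close> form the
  vector to which the Bernstein moment applies. For finitely many columns the probability bound does
  not depend on J; the events decrease in J, so their intersection keeps it.\<close>

lemma deviation_event:
  assumes n: "0 < n" and t: "0 < t" "t \<le> 1" "t \<le> t'" and L: "0 < L"
  defines "B \<equiv> 4 * (L * Rbound t' + sqrt (real n * (Sig * t powr (- 1 / bb)) * L)) / real n"
  shows "\<exists>A\<in>sets (PiM {..<n} (\<lambda>_. p)). 1 - 2 * exp (- 2 * L) \<le> measure (PiM {..<n} (\<lambda>_. p)) A \<and>
    (\<forall>z\<in>A. \<forall>J. (\<Sum>j<J. (norm (emp_cov \<beta> feat n z (f j) - \<mu> j *\<^sub>R f j))\<^sup>2 / (\<mu> j + t')) \<le> B\<^sup>2)"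
proof -
  let ?Pi = "PiM {..<n} (\<lambda>_. p)"
  interpret Pi: prob_space ?Pi by (rule prob_space_PiM) (rule p_prob)
  have t'0: "0 < t'" using t by simp
  have bpos: "0 < \<mu> j + t'" for j using \<mu>_pos[of j] t'0 by simp
  define sg where "sg = Sig * t powr (- 1 / bb)"
  have sg0: "0 \<le> sg" using Kn_pos b by (auto simp: sg_def Sig_def)
  define y where "y = real n * sg / L"
  have y0: "0 \<le> y" using sg0 L by (simp add: y_def)
  have R0: "0 < Rbound t'"
  proof -
    have "0 \<le> 2 * (b\<^sup>2 + 1) * \<kappa>^4" by (intro mult_nonneg_nonneg add_nonneg_nonneg) auto
    then have "0 < 2 * (b\<^sup>2 + 1) * \<kappa>^4 + 1" by linarith
    then show ?thesis unfolding Rbound_def using t'0 by (intro real_sqrt_gt_zero divide_pos_pos)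
  qed
  \<comment> \<open>This scale makes each summand at most 1 in norm and the total variance
    \<open>n * s\<^sup>2 * sg\<close> at most L, both at once.\<close>
  define s where "s = 1 / (Rbound t' + sqrt y)"
  have s0: "0 < s" using R0 y0 by (simp add: s_def add_pos_nonneg)
  have sR: "s\<^sup>2 * (Rbound t')\<^sup>2 \<le> 1"
  proof -
    have "s * Rbound t' \<le> 1" using R0 y0 by (simp add: s_def divide_simps add_pos_nonneg)
    then show ?thesis using s0 R0 by (simp add: power_mult_distrib[symmetric] power_le_one)
  qed
  have sy: "s\<^sup>2 * y \<le> 1"
  proof -
    have "s * sqrt y \<le> 1" using R0 y0 by (simp add: s_def divide_simps add_pos_nonneg)
    then have "(s * sqrt y)\<^sup>2 \<le> 1" using s0 y0 by (intro power_le_one) auto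
    then show ?thesis using y0 by (simp add: power_mult_distrib)
  qed
  define V where "V \<zeta> j = (s / sqrt (\<mu> j + t')) *\<^sub>R xi j (fst \<zeta>)" for \<zeta> :: "'x \<times> 'y" and j
  have V_norm: "(norm (V \<zeta> j))\<^sup>2 = s\<^sup>2 * ((norm (xi j (fst \<zeta>)))\<^sup>2 / (\<mu> j + t'))" for \<zeta> j
    using bpos[of j] s0 by (simp add: V_def power_mult_distrib power_divide)
  define S where "S J z = (\<Sum>j<J. (norm (emp_cov \<beta> feat n z (f j) - \<mu> j *\<^sub>R f j))\<^sup>2 / (\<mu> j + t'))" for J and z :: "nat \<Rightarrow> 'x \<times> 'y"
  define W where "W J z = sqrt (\<Sum>j<J. (norm (\<Sum>i<n. V (z i) j))\<^sup>2)" for J z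
  have WS: "W J z = s * real n * sqrt (S J z)" for J z
  proof -
    have "(\<Sum>i<n. V (z i) j) = (s * real n / sqrt (\<mu> j + t')) *\<^sub>R (emp_cov \<beta> feat n z (f j) - \<mu> j *\<^sub>R f j)" for j
    proof -
      have "(\<Sum>i<n. xi j (fst (z i))) = real n *\<^sub>R (emp_cov \<beta> feat n z (f j) - \<mu> j *\<^sub>R f j)"
        using n by (simp add: xi_def sum_subtractf emp_cov_eq scaleR_diff_right scaleR_sum_right inner_commute sum_constant_scaleR)
      then show ?thesis by (simp add: V_def scaleR_sum_right[symmetric])
    qed
    then have "(\<Sum>j<J. (norm (\<Sum>i<n. V (z i) j))\<^sup>2) = (\<Sum>j<J. (s * real n)\<^sup>2 * ((norm (emp_cov \<beta> feat n z (f j) - \<mu> j *\<^sub>R f j))\<^sup>2 / (\<mu> j + t')))"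
      using less_imp_le[OF bpos] by (intro sum.cong refl) (simp add: power_mult_distrib power_divide)
    then show ?thesis unfolding W_def S_def sum_distrib_left[symmetric]
      using s0 by (simp add: real_sqrt_mult)
  qed
  have V_meas: "(\<lambda>\<zeta>. V \<zeta> j) \<in> borel_measurable p" for j
    unfolding V_def by (rule measurable_p_fst) measurable
  have W_meas: "W J \<in> borel_measurable ?Pi" for J
  proof -
    have "(\<lambda>z. \<Sum>i<n. V (z i) j) \<in> borel_measurable ?Pi" for j
      by (intro borel_measurable_sum measurable_PiM_coordinate[OF V_meas])
    then show ?thesis unfolding W_def by measurable
  qed
  \<comment> \<open>The exponential moment is at most \<open>exp (2 * L)\<close>, so the level
    \<open>4 * L\<close> leaves \<open>2 * exp (- 2 * L)\<close>.\<close>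
  have tailW: "measure ?Pi {z \<in> space ?Pi. 4 * L \<le> W J z} \<le> 2 * exp (- 2 * L)" for J
  proof -
    have mgf: "(\<integral>\<^sup>+z. ennreal (cosh (W J z)) \<partial>?Pi) \<le> ennreal (exp (2 * (s\<^sup>2 * sg) * real n))"
      unfolding W_def
    proof (rule bernstein_mgf[OF p_prob finite_lessThan])
      show "(\<lambda>\<zeta>. V \<zeta> j) \<in> borel_measurable p" for j by (rule V_meas)
      show "(\<Sum>j<J. (norm (V \<zeta> j))\<^sup>2) \<le> 1" for \<zeta>
        using mult_left_mono[OF xi_sum_bound[OF t'0, of "fst \<zeta>" J] zero_le_power2[of s]] sR
        unfolding V_norm sum_distrib_left by simp
      show "(\<integral>\<zeta>. a \<bullet> V \<zeta> j \<partial>p) = 0" for j a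
      proof -
        have "(\<integral>\<zeta>. a \<bullet> V \<zeta> j \<partial>p) = (\<integral>\<zeta>. (\<lambda>x. (s / sqrt (\<mu> j + t')) * (a \<bullet> xi j x)) (fst \<zeta>) \<partial>p)"
          by (simp add: V_def)
        also have "\<dots> = (\<integral>x. (s / sqrt (\<mu> j + t')) * (a \<bullet> xi j x) \<partial>pX)"
          by (rule joint_law_integral_fst[OF pX P]) measurable
        finally show ?thesis by (simp add: xi_mean)
      qed
      have "(\<integral>\<zeta>. (\<Sum>j<J. (norm (V \<zeta> j))\<^sup>2) \<partial>p) = (\<integral>\<zeta>. (\<lambda>x. s\<^sup>2 * (\<Sum>j<J. (norm (xi j x))\<^sup>2 / (\<mu> j + t'))) (fst \<zeta>) \<partial>p)"
        by (simp add: V_norm sum_distrib_left)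
      also have "\<dots> = (\<integral>x. s\<^sup>2 * (\<Sum>j<J. (norm (xi j x))\<^sup>2 / (\<mu> j + t')) \<partial>pX)"
        by (rule joint_law_integral_fst[OF pX P]) measurable
      also have "\<dots> \<le> s\<^sup>2 * sg"
        unfolding integral_mult_right_zero sg_def by (intro mult_left_mono xi_variance t) auto
      finally show "(\<integral>\<zeta>. (\<Sum>j<J. (norm (V \<zeta> j))\<^sup>2) \<partial>p) \<le> s\<^sup>2 * sg" .
    qed simp
    have "2 * (s\<^sup>2 * sg) * real n \<le> 2 * L"
    proof -
      have "s\<^sup>2 * sg * real n = s\<^sup>2 * y * L" using L by (simp add: y_def)
      also have "\<dots> \<le> 1 * L" using sy L by (intro mult_right_mono) auto
      finally show ?thesis by simp
    qed
    then have "(\<integral>\<^sup>+z. ennreal (cosh (W J z)) \<partial>?Pi) \<le> ennreal (exp (2 * L))"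
      using mgf by (elim order_trans) (auto intro!: ennreal_leI)
    then have "(\<integral>\<^sup>+z. indicator (space ?Pi) z * ennreal (cosh (W J z)) \<partial>?Pi) \<le> ennreal (exp (2 * L))"
      by (subst nn_integral_cong[where v = "\<lambda>z. ennreal (cosh (W J z))"]) auto
    from cosh_markov[OF Pi.prob_space_axioms W_meas sets.top this, of "4 * L"] show ?thesis by simp
  qed
  define A where "A J = {z \<in> space ?Pi. W J z < 4 * L}" for J
  have A_sets: "A J \<in> sets ?Pi" for J unfolding A_def using W_meas[of J] by measurable
  have A_prob: "1 - 2 * exp (- 2 * L) \<le> measure ?Pi (A J)" for J
  proof -
    have "space ?Pi - A J = {z \<in> space ?Pi. 4 * L \<le> W J z}" by (auto simp: A_def)
    then show ?thesis using Pi.prob_compl[OF A_sets[of J]] tailW[of J] by simp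
  qed
  have S_mono: "S J z \<le> S (Suc J) z" for J z using less_imp_le[OF bpos] by (simp add: S_def)
  have A_dec: "decseq A"
  proof (rule decseq_SucI, rule subsetI)
    fix J z assume "z \<in> A (Suc J)"
    moreover have "W J z \<le> W (Suc J) z" unfolding WS using s0 S_mono by (intro mult_left_mono) auto
    ultimately show "z \<in> A J" by (auto simp: A_def)
  qed
  have "(\<lambda>J. measure ?Pi (A J)) \<longlonglongrightarrow> measure ?Pi (\<Inter>J. A J)"
    by (rule Pi.finite_Lim_measure_decseq) (use A_sets A_dec in auto)
  then have "1 - 2 * exp (- 2 * L) \<le> measure ?Pi (\<Inter>J. A J)"
    by (rule LIMSEQ_le_const) (use A_prob in blast)
  moreover have "(\<Inter>J. A J) \<in> sets ?Pi" using A_sets by (intro sets.countable_INT) auto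
  moreover have "S J z \<le> B\<^sup>2" if z: "z \<in> (\<Inter>J. A J)" for z J
  proof -
    have "s * real n * sqrt (S J z) < 4 * L" using z unfolding WS[symmetric] by (auto simp: A_def)
    then have "sqrt (S J z) \<le> 4 * L / (s * real n)" using s0 n by (simp add: pos_le_divide_eq mult_ac)
    also have "\<dots> = 4 * (L * Rbound t' + L * sqrt y) / real n"
      using s0 by (simp add: s_def field_simps)
    also have "L * sqrt y = sqrt (real n * sg * L)"
    proof -
      have "L * sqrt y = sqrt (L\<^sup>2 * y)" using L by (simp add: real_sqrt_mult)
      also have "L\<^sup>2 * y = real n * sg * L" using L by (simp add: y_def power2_eq_square)
      finally show ?thesis .
    qed
    finally have "sqrt (S J z) \<le> B" by (simp add: B_def sg_def)
    moreover have S0: "0 \<le> S J z" unfolding S_def using less_imp_le[OF bpos] by (intro sum_nonneg divide_nonneg_nonneg) auto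
    ultimately have "(sqrt (S J z))\<^sup>2 \<le> B\<^sup>2" by (intro power_mono) auto
    then show ?thesis using S0 by simp
  qed
  ultimately show ?thesis unfolding S_def by (intro bexI[of _ "\<Inter>J. A J"]) auto
qed

end

section \<open>Noise and its quadratic form\<close>

context covariate_shift
begin

lemma AE_output: "AE x in pX. AE y in P x. norm y \<le> M'"
proof -
  have "Measurable.pred (borel \<Otimes>\<^sub>M borel) (\<lambda>xy :: 'x \<times> 'y. norm (snd xy) \<le> M')" by measurable
  from joint_law_AE[OF pX P this] M'(2) show ?thesis by simp
qed

lemma integrable_output:
  assumes "AE y in P x. norm y \<le> M'"
  shows "integrable (P x) (\<lambda>y. y)" "norm (Cstar (feat x)) \<le> M'"
proof -
  interpret prob_space "P x" by (rule kernel_props(1)[OF pX P])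
  have m: "(\<lambda>y. y) \<in> borel_measurable (P x)" by (rule measurable_kernel[OF pX P]) simp
  show int: "integrable (P x) (\<lambda>y. y)" by (rule integrable_const_bound[OF assms m])
  have "norm (Cstar (feat x)) \<le> (\<integral>y. norm y \<partial>P x)"
    unfolding regression[symmetric] by (rule integral_norm_bound)
  also have "\<dots> \<le> (\<integral>y. M' \<partial>P x)" using int assms by (intro integral_mono_AE) auto
  finally show "norm (Cstar (feat x)) \<le> M'" by (simp add: prob_space)
qed

lemma Cstar_feat_measurable: "(\<lambda>x. Cstar (feat x)) \<in> borel_measurable borel"
  using borel_measurable_continuous_on[OF linear_continuous_on[OF Cstar] feat_measurable] by simp

lemma AE_noise: "AE x in pX. (AE y in P x. norm (y - Cstar (feat x)) \<le> 2 * M') \<and>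
    (\<forall>a. (\<integral>y. a \<bullet> (y - Cstar (feat x)) \<partial>P x) = 0)"
  using AE_output
proof eventually_elim
  case (elim x)
  interpret prob_space "P x" by (rule kernel_props(1)[OF pX P])
  note int = integrable_output(1)[OF elim] and le = integrable_output(2)[OF elim]
  have "AE y in P x. norm (y - Cstar (feat x)) \<le> 2 * M'"
    using elim
  proof eventually_elim
    case (elim y)
    then show ?case using norm_triangle_ineq4[of y "Cstar (feat x)"] le by simp
  qed
  moreover have "(\<integral>y. a \<bullet> (y - Cstar (feat x)) \<partial>P x) = 0" for a
  proof -
    have "(\<integral>y. a \<bullet> (y - Cstar (feat x)) \<partial>P x) = a \<bullet> (\<integral>y. y - Cstar (feat x) \<partial>P x)"
      using int by (subst integral_inner_right) auto
    also have "(\<integral>y. y - Cstar (feat x) \<partial>P x) = 0"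
      using int by (simp add: prob_space regression)
    finally show ?thesis by simp
  qed
  ultimately show ?case by blast
qed

definition noise :: "'x \<times> 'y \<Rightarrow> 'y" where "noise \<zeta> = snd \<zeta> - Cstar (feat (fst \<zeta>))"

lemma AE_noise_sample:
  fixes n :: nat
  shows "AE z in PiM {..<n} (\<lambda>_. p). \<forall>i<n. norm (noise (z i)) \<le> 2 * M'"
proof -
  have m: "noise \<in> borel_measurable (borel \<Otimes>\<^sub>M borel)"
    unfolding noise_def using measurable_compose[OF measurable_fst Cstar_feat_measurable]
    by (intro borel_measurable_diff measurable_snd)
  have "Measurable.pred (borel \<Otimes>\<^sub>M borel) (\<lambda>\<zeta>. norm (noise \<zeta>) \<le> 2 * M')" using m by measurable
  from joint_law_AE[OF pX P this] have "AE \<zeta> in p. norm (noise \<zeta>) \<le> 2 * M'"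
    using AE_noise by (simp add: noise_def)
  then have "AE z in PiM {..<n} (\<lambda>_. p). norm (noise (z i)) \<le> 2 * M'" if "i < n" for i
    using that p_prob by (intro AE_PiM_component) auto
  then have "AE z in PiM {..<n} (\<lambda>_. p). \<forall>i\<in>{..<n}. norm (noise (z i)) \<le> 2 * M'"
    by (intro AE_finite_allI) auto
  then show ?thesis unfolding Ball_def lessThan_iff .
qed

text \<open>Each iterate is built from the inputs by sums, products and inner products, and the
  resolvent is the pointwise limit. The number \<open>b * \<kappa>\<^sup>2\<close> bounds the
  empirical eigenvalues of every sample, so one step size serves all of them.\<close>

lemma fin_resolvent_measurable:
  fixes w :: "'x \<Rightarrow> real"
  assumes w: "w \<in> borel_measurable borel" "\<And>x. 0 \<le> w x" "\<And>x. w x \<le> b" and t: "0 < t" and i: "i < n"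
  shows "(\<lambda>z. fin_resolvent (emp_cov w feat n z) t (feat (fst (z i)))) \<in> borel_measurable (PiM {..<n} (\<lambda>_. p))"
proof -
  let ?Pi = "PiM {..<n} (\<lambda>_. p)"
  define it where "it k z = rec_nat 0 (\<lambda>_ v. v + (1 / (b * \<kappa>\<^sup>2 + t)) *\<^sub>R (feat (fst (z i)) - (emp_cov w feat n z v + t *\<^sub>R v))) k"
    for k and z :: "nat \<Rightarrow> 'x \<times> 'y"
  have it0: "it 0 z = 0" and itS: "it (Suc k) z = it k z + (1 / (b * \<kappa>\<^sup>2 + t)) *\<^sub>R (feat (fst (z i)) - (emp_cov w feat n z (it k z) + t *\<^sub>R it k z))"
    for k z by (simp_all add: it_def)
  have f_m: "(\<lambda>z. feat (fst (z l))) \<in> borel_measurable ?Pi" if "l < n" for l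
    using that by (intro measurable_PiM_coordinate[OF measurable_p_fst[OF feat_measurable]]) auto
  have w_m: "(\<lambda>z. w (fst (z l))) \<in> borel_measurable ?Pi" if "l < n" for l
    using that by (intro measurable_PiM_coordinate[OF measurable_p_fst[OF w(1)]]) auto
  have it_m: "it k \<in> borel_measurable ?Pi" for k
  proof (induction k)
    case 0
    then show ?case by (simp add: it0)
  next
    case (Suc k)
    have "(\<lambda>z. emp_cov w feat n z (it k z)) \<in> borel_measurable ?Pi"
      unfolding emp_cov_eq using f_m w_m Suc
      by (intro borel_measurable_sum borel_measurable_scaleR borel_measurable_times borel_measurable_divide borel_measurable_inner) auto
    then show ?case unfolding itS using f_m[OF i] Suc by measurable
  qed
  show ?thesis
  proof (rule borel_measurable_LIMSEQ_metric[OF it_m])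
    fix z :: "nat \<Rightarrow> 'x \<times> 'y"
    obtain U \<sigma> where rep: "spectral_rep (emp_cov w feat n z) U \<sigma>"
      and res: "\<And>t v. fin_resolvent (emp_cov w feat n z) t v = spec_fun U \<sigma> (\<lambda>s. 1 / (s + t)) v"
      using fin_resolvent_obtain[OF emp_cov_spectral_rep[where w = w and feat = feat and n = n and z = z, OF w(2)]] by blast
    interpret orthonormal_family U \<sigma> by (rule spectral_rep_family[OF rep])
    show "(\<lambda>k. it k z) \<longlonglongrightarrow> fin_resolvent (emp_cov w feat n z) t (feat (fst (z i)))"
      unfolding res
    proof (rule resolvent_iteration[OF t, where \<Lambda> = "b * \<kappa>\<^sup>2"])
      show "0 < \<sigma> u" if "u \<in> U" for u using spectral_repD(3)[OF rep that] .
      show "\<sigma> u \<le> b * \<kappa>\<^sup>2" if "u \<in> U" for u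
        using emp_cov_eigenvalue_le[OF w(2) rep w(3) feat_bound that] b by simp
      show "it (Suc k) z = it k z + (1 / (b * \<kappa>\<^sup>2 + t)) *\<^sub>R (feat (fst (z i)) - (F (\<lambda>s. s) (it k z) + t *\<^sub>R it k z))" for k
        unfolding itS spectral_rep_spec_fun[OF rep, symmetric] ..
    qed (use b in \<open>simp_all add: it0\<close>)
  qed
qed

text \<open>For R a resolvent this is the squared Hilbert-Schmidt norm of the noise operator
  composed with the square root of R. The weight is a parameter because truncated weights are
  inserted as well.\<close>

definition noise_form :: "('x \<Rightarrow> real) \<Rightarrow> (('h \<Rightarrow> 'h)) \<Rightarrow> nat \<Rightarrow> (nat \<Rightarrow> 'x \<times> 'y) \<Rightarrow> real" where
  "noise_form w R n z = (\<Sum>i<n. \<Sum>l<n. (noise (z i) \<bullet> noise (z l)) *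
     ((w (fst (z i)) / real n) * (w (fst (z l)) / real n) * (R (feat (fst (z i))) \<bullet> feat (fst (z l)))))"

text \<open>
  Inputs with a large component outside the leading eigenspaces are rare: there are only \<open>O(L)\<close> of them,
  and their noise is bounded deterministically.
\<close>

lemma noise_form_split:
  fixes z :: "nat \<Rightarrow> 'x \<times> 'y"
  assumes n: "0 < n" and t: "0 < t" and w: "\<And>x. 0 \<le> w x" "\<And>x. w x = \<beta> x \<or> w x = 0"
    and rep: "spectral_rep (emp_cov \<beta> feat n z) U \<sigma>" and rep': "spectral_rep (emp_cov w feat n z) U' \<sigma>'"
    and noise_le: "\<And>i. i < n \<Longrightarrow> norm (noise (z i)) \<le> 2 * M'"
    and bad: "real (card {i. i < n \<and> w (fst (z i)) \<noteq> \<beta> (fst (z i))}) \<le> K"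
  shows "noise_form \<beta> (spec_fun U \<sigma> (\<lambda>s. 1 / (s + t))) n z
    \<le> 2 * noise_form w (spec_fun U' \<sigma>' (\<lambda>s. 1 / (s + t))) n z + 8 * b * M'\<^sup>2 * K / real n"
proof -
  interpret V: orthonormal_family U \<sigma> by (rule spectral_rep_family[OF rep])
  interpret W: orthonormal_family U' \<sigma>' by (rule spectral_rep_family[OF rep'])
  let ?R = "V.F (\<lambda>s. 1 / (s + t))" and ?R' = "W.F (\<lambda>s. 1 / (s + t))"
  let ?\<phi> = "\<lambda>i. feat (fst (z i))" and ?e = "\<lambda>i. noise (z i)"
  have \<sigma>: "0 < \<sigma> u" if "u \<in> U" for u using spectral_repD(3)[OF rep that] .
  have \<sigma>': "0 < \<sigma>' u" if "u \<in> U'" for u using spectral_repD(3)[OF rep' that] .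
  define v where "v x = \<beta> x - w x" for x
  have v: "0 \<le> v x" "v x \<le> \<beta> x" for x using w(1)[of x] w(2)[of x] \<beta>(2)[of x] by (auto simp: v_def)
  have lin: "linear (\<lambda>u. ?R a \<bullet> u)" "linear (\<lambda>a. ?R a \<bullet> u)" "linear (\<lambda>u. ?R' a \<bullet> u)" "linear (\<lambda>a. ?R' a \<bullet> u)" for a u
    by (auto simp: linear_iff V.spec_fun_add V.spec_fun_scale W.spec_fun_add W.spec_fun_scale inner_add_left inner_add_right)
  have Rpos: "0 \<le> ?R a \<bullet> a" for a using \<sigma> t by (intro V.spec_fun_nonneg) (auto intro!: add_nonneg_nonneg intro: less_imp_le)
  have form: "(\<Sum>i<n. \<Sum>l<n. c i * c l * ((k (fst (z i)) / real n) * (k (fst (z l)) / real n) * (?R (?\<phi> i) \<bullet> ?\<phi> l)))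
      = ?R (\<Sum>i<n. (c i * (k (fst (z i)) / real n)) *\<^sub>R ?\<phi> i) \<bullet> (\<Sum>i<n. (c i * (k (fst (z i)) / real n)) *\<^sub>R ?\<phi> i)" for c k
    using double_sum_bilinear[of "\<lambda>a u. ?R a \<bullet> u" "\<lambda>i. c i * (k (fst (z i)) / real n)" ?\<phi> "{..<n}"] lin
    by (simp add: mult_ac)
  have form': "(\<Sum>i<n. \<Sum>l<n. c i * c l * ((k (fst (z i)) / real n) * (k (fst (z l)) / real n) * (?R' (?\<phi> i) \<bullet> ?\<phi> l)))
      = ?R' (\<Sum>i<n. (c i * (k (fst (z i)) / real n)) *\<^sub>R ?\<phi> i) \<bullet> (\<Sum>i<n. (c i * (k (fst (z i)) / real n)) *\<^sub>R ?\<phi> i)" for c k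
    using double_sum_bilinear[of "\<lambda>a u. ?R' a \<bullet> u" "\<lambda>i. c i * (k (fst (z i)) / real n)" ?\<phi> "{..<n}"] lin
    by (simp add: mult_ac)
  \<comment> \<open>As \<beta> is w plus v, the form at a sum is at most twice the sum of the forms;
    the Schur argument passes this to vector noise.\<close>
  have split: "noise_form \<beta> ?R n z \<le> 2 * noise_form w ?R n z + 2 * noise_form v ?R n z"
  proof -
    have "noise_form \<beta> ?R n z \<le> (\<Sum>i<n. \<Sum>l<n. (?e i \<bullet> ?e l) *
        (2 * ((w (fst (z i)) / real n) * (w (fst (z l)) / real n) * (?R (?\<phi> i) \<bullet> ?\<phi> l))
         + 2 * ((v (fst (z i)) / real n) * (v (fst (z l)) / real n) * (?R (?\<phi> i) \<bullet> ?\<phi> l))))"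
      unfolding noise_form_def
    proof (rule schur_mono)
      fix c
      define a where "a k = (\<Sum>i<n. (c i * (k (fst (z i)) / real n)) *\<^sub>R ?\<phi> i)" for k :: "'x \<Rightarrow> real"
      have ab: "a \<beta> = a w + a v"
        by (simp add: a_def v_def sum.distrib[symmetric] scaleR_add_left[symmetric] distrib_left[symmetric] add_divide_distrib[symmetric])
      have "0 \<le> ?R (a w - a v) \<bullet> (a w - a v)" by (rule Rpos)
      then have "?R (a \<beta>) \<bullet> a \<beta> \<le> 2 * (?R (a w) \<bullet> a w) + 2 * (?R (a v) \<bullet> a v)"
        unfolding ab V.spec_fun_add V.spec_fun_minus by (simp add: inner_add_left inner_add_right inner_diff_left inner_diff_right)
      then have "(\<Sum>i<n. \<Sum>l<n. c i * c l * ((\<beta> (fst (z i)) / real n) * (\<beta> (fst (z l)) / real n) * (?R (?\<phi> i) \<bullet> ?\<phi> l)))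
        \<le> 2 * (\<Sum>i<n. \<Sum>l<n. c i * c l * ((w (fst (z i)) / real n) * (w (fst (z l)) / real n) * (?R (?\<phi> i) \<bullet> ?\<phi> l)))
        + 2 * (\<Sum>i<n. \<Sum>l<n. c i * c l * ((v (fst (z i)) / real n) * (v (fst (z l)) / real n) * (?R (?\<phi> i) \<bullet> ?\<phi> l)))"
        unfolding form a_def[symmetric] .
      also have "\<dots> = (\<Sum>i<n. \<Sum>l<n. c i * c l * (2 * ((w (fst (z i)) / real n) * (w (fst (z l)) / real n) * (?R (?\<phi> i) \<bullet> ?\<phi> l))
         + 2 * ((v (fst (z i)) / real n) * (v (fst (z l)) / real n) * (?R (?\<phi> i) \<bullet> ?\<phi> l))))"
        unfolding sum_distrib_left sum.distrib[symmetric] by (intro sum.cong refl) (simp only: distrib_left mult.left_commute[of 2])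
      finally show "(\<Sum>i<n. \<Sum>l<n. c i * c l * ((\<beta> (fst (z i)) / real n) * (\<beta> (fst (z l)) / real n) * (?R (?\<phi> i) \<bullet> ?\<phi> l)))
        \<le> (\<Sum>i<n. \<Sum>l<n. c i * c l * (2 * ((w (fst (z i)) / real n) * (w (fst (z l)) / real n) * (?R (?\<phi> i) \<bullet> ?\<phi> l))
         + 2 * ((v (fst (z i)) / real n) * (v (fst (z l)) / real n) * (?R (?\<phi> i) \<bullet> ?\<phi> l))))" .
    qed simp
    also have "\<dots> = 2 * noise_form w ?R n z + 2 * noise_form v ?R n z"
      unfolding noise_form_def sum_distrib_left sum.distrib[symmetric] by (intro sum.cong refl) (simp only: distrib_left mult.left_commute[of 2])
    finally show ?thesis .
  qed
  \<comment> \<open>Truncating the weight lowers the empirical covariance as a form and therefore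
    raises its resolvent.\<close>
  have good: "noise_form w ?R n z \<le> noise_form w ?R' n z"
    unfolding noise_form_def
  proof (rule schur_mono)
    fix c
    show "(\<Sum>i<n. \<Sum>l<n. c i * c l * ((w (fst (z i)) / real n) * (w (fst (z l)) / real n) * (?R (?\<phi> i) \<bullet> ?\<phi> l)))
      \<le> (\<Sum>i<n. \<Sum>l<n. c i * c l * ((w (fst (z i)) / real n) * (w (fst (z l)) / real n) * (?R' (?\<phi> i) \<bullet> ?\<phi> l)))"
      unfolding form form'
    proof (rule V.resolvent_antimono[OF _ t \<sigma> \<sigma>'])
      show "orthonormal_family U'" by (rule spectral_rep_family[OF rep'])
      fix a
      show "W.F (\<lambda>s. s) a \<bullet> a \<le> V.F (\<lambda>s. s) a \<bullet> a"
        unfolding spectral_rep_spec_fun[OF rep, symmetric] spectral_rep_spec_fun[OF rep', symmetric] emp_cov_inner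
        using w \<beta>(2) by (intro sum_mono mult_right_mono divide_right_mono) (auto, metis order_refl)
    qed
  qed simp
  \<comment> \<open>Each weight is split into two square roots, one for the noise and one for the
    feature. The Gram matrix of the rescaled features under the resolvent is at most the identity,
    since their covariance is dominated by the full empirical one.\<close>
  have badf: "noise_form v ?R n z \<le> 4 * b * M'\<^sup>2 * K / real n"
  proof -
    let ?y = "\<lambda>i. sqrt (v (fst (z i)) / real n) *\<^sub>R ?e i" and ?\<psi> = "\<lambda>i. sqrt (v (fst (z i)) / real n) *\<^sub>R ?\<phi> i"
    have sq: "sqrt (v (fst (z i)) / real n) * sqrt (v (fst (z i)) / real n) = v (fst (z i)) / real n" for i
      using v by simp
    have "noise_form v ?R n z = (\<Sum>i<n. \<Sum>l<n. (?y i \<bullet> ?y l) * (?R (?\<psi> i) \<bullet> ?\<psi> l))"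
      unfolding noise_form_def
    proof (intro sum.cong refl)
      fix i l
      have "(?y i \<bullet> ?y l) * (?R (?\<psi> i) \<bullet> ?\<psi> l) = (?e i \<bullet> ?e l) * ((sqrt (v (fst (z i)) / real n) * sqrt (v (fst (z i)) / real n))
          * (sqrt (v (fst (z l)) / real n) * sqrt (v (fst (z l)) / real n)) * (?R (?\<phi> i) \<bullet> ?\<phi> l))"
        unfolding V.spec_fun_scale by (simp only: inner_scaleR_left inner_scaleR_right mult_ac)
      then show "(?e i \<bullet> ?e l) * ((v (fst (z i)) / real n) * (v (fst (z l)) / real n) * (?R (?\<phi> i) \<bullet> ?\<phi> l))
          = (?y i \<bullet> ?y l) * (?R (?\<psi> i) \<bullet> ?\<psi> l)" unfolding sq by simp
    qed
    also have "\<dots> \<le> (\<Sum>i<n. \<Sum>l<n. (?y i \<bullet> ?y l) * (if i = l then 1 else 0))"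
    proof (rule schur_mono)
      fix c :: "nat \<Rightarrow> real"
      define a where "a = (\<Sum>i<n. c i *\<^sub>R ?\<psi> i)"
      define u where "u = ?R a"
      define X where "X = ?R a \<bullet> a"
      have X0: "0 \<le> X" unfolding X_def by (rule Rpos)
      have e1: "(\<Sum>i<n. \<Sum>l<n. c i * c l * (?R (?\<psi> i) \<bullet> ?\<psi> l)) = X"
        unfolding X_def a_def using lin by (intro double_sum_bilinear[of "\<lambda>a u. ?R a \<bullet> u"])
      have e2: "(\<Sum>i<n. \<Sum>l<n. c i * c l * (if i = l then 1 else 0)) = (\<Sum>i<n. (c i)\<^sup>2)"
        by (simp add: if_distrib power2_eq_square cong: if_cong)
      have "X = (\<Sum>i<n. c i * (u \<bullet> ?\<psi> i))" by (simp add: X_def u_def a_def inner_sum_right mult.assoc)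
      also have "\<dots> \<le> (\<Sum>i<n. \<bar>c i\<bar> * \<bar>u \<bullet> ?\<psi> i\<bar>)" by (intro sum_mono) (metis abs_ge_self abs_mult)
      also have "\<dots> \<le> L2_set c {..<n} * L2_set (\<lambda>i. u \<bullet> ?\<psi> i) {..<n}" by (rule L2_set_mult_ineq)
      also have "\<dots> \<le> sqrt (\<Sum>i<n. (c i)\<^sup>2) * sqrt X"
        unfolding L2_set_def
      proof (intro mult_left_mono real_sqrt_le_mono)
        have "(\<Sum>i<n. (u \<bullet> ?\<psi> i)\<^sup>2) = (\<Sum>i<n. (v (fst (z i)) / real n) * ((u \<bullet> ?\<phi> i) * (u \<bullet> ?\<phi> i)))"
        proof (intro sum.cong refl)
          fix i
          have "(u \<bullet> ?\<psi> i)\<^sup>2 = sqrt (v (fst (z i)) / real n) * sqrt (v (fst (z i)) / real n) * ((u \<bullet> ?\<phi> i) * (u \<bullet> ?\<phi> i))"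
            by (simp only: inner_scaleR_right power2_eq_square mult_ac)
          then show "(u \<bullet> ?\<psi> i)\<^sup>2 = (v (fst (z i)) / real n) * ((u \<bullet> ?\<phi> i) * (u \<bullet> ?\<phi> i))" unfolding sq .
        qed
        also have "\<dots> \<le> (\<Sum>i<n. (\<beta> (fst (z i)) / real n) * ((u \<bullet> ?\<phi> i) * (u \<bullet> ?\<phi> i)))"
          using v by (intro sum_mono mult_right_mono divide_right_mono) auto
        also have "\<dots> = V.F (\<lambda>s. s) u \<bullet> u" unfolding spectral_rep_spec_fun[OF rep, symmetric] emp_cov_inner ..
        also have "\<dots> = V.F (\<lambda>s. 1 / (s + t) * (s * (1 / (s + t)))) a \<bullet> a"
          unfolding u_def V.spec_fun_sym[of "\<lambda>s. 1 / (s + t)" _ a, symmetric] V.spec_fun_mult ..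
        also have "\<dots> \<le> V.F (\<lambda>s. 1 / (s + t)) a \<bullet> a"
        proof (rule V.spec_fun_mono)
          fix u assume "u \<in> U"
          then have "\<sigma> u / (\<sigma> u + t) \<le> 1" "0 < \<sigma> u + t" using \<sigma>[of u] t by auto
          then show "1 / (\<sigma> u + t) * (\<sigma> u * (1 / (\<sigma> u + t))) \<le> 1 / (\<sigma> u + t)"
            by (intro mult_left_le) auto
        qed (use t in simp)
        finally show "(\<Sum>i<n. (u \<bullet> ?\<psi> i)\<^sup>2) \<le> X" by (simp add: X_def)
      qed (simp add: sum_nonneg)
      finally have "sqrt X * sqrt X \<le> sqrt (\<Sum>i<n. (c i)\<^sup>2) * sqrt X" using X0 by simp
      then have "sqrt X \<le> sqrt (\<Sum>i<n. (c i)\<^sup>2)"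
        using X0 mult_right_le_imp_le[of "sqrt X" "sqrt X"] by (cases "X = 0") (auto simp: sum_nonneg simp del: real_sqrt_mult_self)
      then have "X \<le> (\<Sum>i<n. (c i)\<^sup>2)" by simp
      then show "(\<Sum>i<n. \<Sum>l<n. c i * c l * (?R (?\<psi> i) \<bullet> ?\<psi> l)) \<le> (\<Sum>i<n. \<Sum>l<n. c i * c l * (if i = l then 1 else 0))"
        unfolding e1 e2 .
    qed simp
    also have "\<dots> = (\<Sum>i<n. v (fst (z i)) / real n * (?e i \<bullet> ?e i))"
    proof (intro sum.cong refl)
      fix i assume "i \<in> {..<n}"
      then have "(\<Sum>l<n. (?y i \<bullet> ?y l) * (if i = l then 1 else 0)) = ?y i \<bullet> ?y i"
        by (simp add: if_distrib[of "\<lambda>x. _ * x"] cong: if_cong)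
      also have "\<dots> = sqrt (v (fst (z i)) / real n) * sqrt (v (fst (z i)) / real n) * (?e i \<bullet> ?e i)"
        by (simp only: inner_scaleR_left inner_scaleR_right mult_ac)
      finally show "(\<Sum>l<n. (?y i \<bullet> ?y l) * (if i = l then 1 else 0)) = v (fst (z i)) / real n * (?e i \<bullet> ?e i)" unfolding sq .
    qed
    also have "\<dots> \<le> (\<Sum>i<n. if w (fst (z i)) \<noteq> \<beta> (fst (z i)) then b / real n * (2 * M')\<^sup>2 else 0)"
    proof (rule sum_mono)
      fix i assume i: "i \<in> {..<n}"
      have "?e i \<bullet> ?e i \<le> (2 * M')\<^sup>2"
        unfolding power2_norm_eq_inner[symmetric] using noise_le[of i] i by (intro power_mono) auto
      then show "v (fst (z i)) / real n * (?e i \<bullet> ?e i) \<le> (if w (fst (z i)) \<noteq> \<beta> (fst (z i)) then b / real n * (2 * M')\<^sup>2 else 0)"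
        using order_trans[OF v(2) \<beta>(3)] v(1) b by (auto simp: v_def intro!: mult_mono divide_right_mono)
    qed
    also have "\<dots> = real (card {i. i < n \<and> w (fst (z i)) \<noteq> \<beta> (fst (z i))}) * (b / real n * (2 * M')\<^sup>2)"
    proof -
      have "{..<n} \<inter> {i. w (fst (z i)) \<noteq> \<beta> (fst (z i))} = {i. i < n \<and> w (fst (z i)) \<noteq> \<beta> (fst (z i))}" by auto
      then show ?thesis by (simp add: sum.If_cases)
    qed
    also have "\<dots> \<le> K * (b / real n * (2 * M')\<^sup>2)" using bad b by (intro mult_right_mono) auto
    finally show ?thesis by (simp add: power_mult_distrib mult_ac)
  qed
  show ?thesis using split good badf by simp
qed

end

section \<open>Probability of a small noise form\<close>

context covariate_shift
begin

text \<open>\<open>512 = 2 * 64 * 4\<close> comes from the truncated form, and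
  \<open>32 = 8 * 4\<close> from the at most 4 L removed inputs.\<close>

definition Kno :: real where "Kno = b * M'\<^sup>2 * (512 * Kn + 32)"

text \<open>The tail of a single input is small only on average, so the trace bound needs
  truncation: inputs with \<open>\<beta> x * tail m x\<close> above \<tau> get weight 0. The one
  event G bounds both the empirical tail of the remaining inputs and the number of removed ones.
  Given the inputs, the Hoeffding moment applies to the truncated form.\<close>

lemma noise_event:
  assumes n: "0 < n" and t: "0 < t" "t \<le> 1" and L: "0 < L"
  shows "\<exists>A\<in>sets (PiM {..<n} (\<lambda>_. p)). 1 - (exp (- 2 * L) + 2 * exp (- 3 * L)) \<le> measure (PiM {..<n} (\<lambda>_. p)) A \<and>
    (\<forall>z\<in>A. \<forall>U \<sigma>. spectral_rep (emp_cov \<beta> feat n z) U \<sigma> \<longrightarrow>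
      noise_form \<beta> (spec_fun U \<sigma> (\<lambda>s. 1 / (s + t))) n z \<le> Kno * L * t powr (- 1 / bb) / real n)"
proof -
  let ?Pi = "PiM {..<n} (\<lambda>_. p)"
  interpret Pi: prob_space ?Pi by (rule prob_space_PiM) (rule p_prob)
  define m where "m = mcut t"
  \<comment> \<open>At this level the truncated sum Sz has mean at most L, while its bound 4 L on G
    turns into an empirical tail of at most \<open>4 * theta t\<close>.\<close>
  define \<tau> where "\<tau> = real n * theta t / L"
  have \<tau>: "0 < \<tau>" using n L theta_pos[OF t] by (simp add: \<tau>_def)
  define Zx where "Zx x = min (\<beta> x * tail m x) \<tau> / \<tau>" for x
  have bt: "0 \<le> \<beta> x * tail m x" for x using \<beta>(2) tail_bounds(1) by simp
  have Zx: "0 \<le> Zx x" "Zx x \<le> 1" for x using bt[of x] \<tau> by (auto simp: Zx_def)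
  have Zx_m: "Zx \<in> borel_measurable borel" unfolding Zx_def using \<beta>(1) by measurable
  define Sz where "Sz z = (\<Sum>i<n. Zx (fst (z i)))" for z :: "nat \<Rightarrow> 'x \<times> 'y"
  have Zx_mean: "(\<integral>\<zeta>. Zx (fst \<zeta>) \<partial>p) \<le> L / real n"
  proof -
    have bm: "(\<lambda>x. \<beta> x * tail m x) \<in> borel_measurable borel" using \<beta>(1) by measurable
    have int: "integrable pX (\<lambda>x. \<beta> x * tail m x)"
      using \<beta> b tail_bounds by (intro integrable_bounded_pX[OF bm, of "b * \<kappa>\<^sup>2"]) (auto simp: abs_mult intro!: mult_mono)
    have "(\<integral>\<zeta>. Zx (fst \<zeta>) \<partial>p) = (\<integral>x. Zx x \<partial>pX)" by (rule joint_law_integral_fst[OF pX P Zx_m])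
    also have "\<dots> \<le> (\<integral>x. \<beta> x * tail m x / \<tau> \<partial>pX)"
    proof (rule integral_mono)
      show "integrable pX Zx" by (rule integrable_bounded_pX[OF Zx_m, of 1]) (use Zx in auto)
      show "integrable pX (\<lambda>x. \<beta> x * tail m x / \<tau>)" using int by simp
      show "Zx x \<le> \<beta> x * tail m x / \<tau>" for x using \<tau> unfolding Zx_def by (intro divide_right_mono) auto
    qed
    also have "\<dots> = (\<integral>x. tail m x \<partial>qX) / \<tau>" using integral_weight[OF tail_measurable[of m]] by simp
    also have "\<dots> \<le> theta t / \<tau>" using tail_integral_le[OF t] \<tau> by (intro divide_right_mono) (auto simp: m_def)
    also have "\<dots> = L / real n" using n L theta_pos[OF t] by (simp add: \<tau>_def)
    finally show ?thesis .
  qed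
  have Sz_m: "Sz \<in> borel_measurable ?Pi"
    unfolding Sz_def by (intro borel_measurable_sum measurable_PiM_coordinate[OF measurable_p_fst[OF Zx_m]])
  have PS: "measure ?Pi {z \<in> space ?Pi. 4 * L \<le> Sz z} \<le> exp (- 2 * L)"
  proof -
    have "measure ?Pi {z \<in> space ?Pi. 4 * L \<le> (\<Sum>i<n. Zx (fst (z i)))} \<le> exp (2 * (L / real n) * real n - 4 * L)"
      by (rule scalar_mgf[OF p_prob measurable_p_fst[OF Zx_m] Zx Zx_mean])
    then show ?thesis using n by (simp add: Sz_def)
  qed
  define G where "G = {z \<in> space ?Pi. Sz z < 4 * L}"
  have G: "G \<in> sets ?Pi" unfolding G_def using Sz_m by measurable
  define w where "w x = (if \<beta> x * tail m x \<le> \<tau> then \<beta> x else 0)" for x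
  have w: "0 \<le> w x" "w x \<le> b" "w x = \<beta> x \<or> w x = 0" for x using \<beta> b by (auto simp: w_def)
  have w_m: "w \<in> borel_measurable borel" unfolding w_def using \<beta>(1) by measurable
  define R where "R z = fin_resolvent (emp_cov w feat n z) t" for z :: "nat \<Rightarrow> 'x \<times> 'y"
  have Rrep: "\<exists>U \<sigma>. spectral_rep (emp_cov w feat n z) U \<sigma> \<and> (\<forall>v. R z v = spec_fun U \<sigma> (\<lambda>s. 1 / (s + t)) v)" for z
    using fin_resolvent_obtain[OF emp_cov_spectral_rep[where w = w and feat = feat and n = n and z = z, OF w(1)]]
    unfolding R_def by metis
  define V0 where "V0 = b / real n * (real m + 4 * theta t / t)"
  have V0: "0 < V0" using b n t theta_pos[OF t] by (simp add: V0_def add_nonneg_pos)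
  \<comment> \<open>Scales the form so that the Hoeffding exponent
    \<open>(2 * M')\<^sup>2 * (s2 * V0)\<close> equals L.\<close>
  define s2 where "s2 = L / ((2 * M')\<^sup>2 * V0)"
  have s2: "0 < s2" using L V0 M' by (simp add: s2_def)
  define \<Gamma> where "\<Gamma> i l z = (if i < n \<and> l < n then s2 * ((w (fst (z i)) / real n) * (w (fst (z l)) / real n) * (R z (feat (fst (z i))) \<bullet> feat (fst (z l)))) else 0)"
    for i l and z :: "nat \<Rightarrow> 'x \<times> 'y"
  have \<Gamma>_form: "(\<Sum>i<n. \<Sum>l<n. q i l * \<Gamma> i l z) = s2 * (\<Sum>i<n. \<Sum>l<n. q i l * ((w (fst (z i)) / real n) * (w (fst (z l)) / real n) * (R z (feat (fst (z i))) \<bullet> feat (fst (z l)))))"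
    for q :: "nat \<Rightarrow> nat \<Rightarrow> real" and z :: "nat \<Rightarrow> 'x \<times> 'y"
    unfolding sum_distrib_left by (intro sum.cong refl) (simp add: \<Gamma>_def mult_ac)
  define W where "W z = sqrt (\<Sum>i<n. \<Sum>l<n. (noise (z i) \<bullet> noise (z l)) * \<Gamma> i l z)" for z
  have feat_z: "(\<lambda>z. feat (fst (z i))) \<in> borel_measurable ?Pi" if "i < n" for i
    using that by (intro measurable_PiM_coordinate[OF measurable_p_fst[OF feat_measurable]]) auto
  have w_z: "(\<lambda>z. w (fst (z i))) \<in> borel_measurable ?Pi" if "i < n" for i
    using that by (intro measurable_PiM_coordinate[OF measurable_p_fst[OF w_m]]) auto
  have \<Gamma>_m: "\<Gamma> i l \<in> borel_measurable ?Pi" if "i < n" "l < n" for i l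
  proof -
    have 1: "(\<lambda>z. R z (feat (fst (z i)))) \<in> borel_measurable ?Pi"
      unfolding R_def by (rule fin_resolvent_measurable[OF w_m w(1,2) t(1) that(1)])
    show ?thesis unfolding \<Gamma>_def using that 1 feat_z[OF that(2)] w_z[OF that(1)] w_z[OF that(2)] by simp
  qed
  have noise_m: "noise \<in> borel_measurable p"
    unfolding noise_def measurable_cong_sets[OF sets_joint_law[OF pX P] refl]
    using measurable_compose[OF measurable_fst Cstar_feat_measurable] by (intro borel_measurable_diff measurable_snd)
  have noise_z: "(\<lambda>z. noise (z i)) \<in> borel_measurable ?Pi" if "i < n" for i
    using that by (intro measurable_PiM_coordinate[OF noise_m]) auto
  have W_m: "W \<in> borel_measurable ?Pi"
  proof -
    have "(\<lambda>z. \<Sum>i<n. \<Sum>l<n. (noise (z i) \<bullet> noise (z l)) * \<Gamma> i l z) \<in> borel_measurable ?Pi"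
      using noise_z \<Gamma>_m by (intro borel_measurable_sum borel_measurable_times borel_measurable_inner) auto
    then show ?thesis unfolding W_def by measurable
  qed
  have mgf: "(\<integral>\<^sup>+z. indicator G z * ennreal (cosh (W z)) \<partial>?Pi) \<le> ennreal (exp ((2 * M')\<^sup>2 * (s2 * V0)))"
    unfolding W_def noise_def
  proof (rule conditional_hoeffding_mgf[OF pX P Cstar_feat_measurable AE_noise \<Gamma>_m])
    fix i l and z z' :: "nat \<Rightarrow> 'x \<times> 'y"
    assume eq: "\<And>k. k < n \<Longrightarrow> fst (z k) = fst (z' k)"
    have "emp_cov w feat n z = emp_cov w feat n z'"
      by (rule ext) (simp add: emp_cov_def eq)
    then show "\<Gamma> i l z = \<Gamma> i l z'" by (simp add: \<Gamma>_def R_def eq)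
  next
    fix i l and z :: "nat \<Rightarrow> 'x \<times> 'y"
    obtain U \<sigma> where rep: "spectral_rep (emp_cov w feat n z) U \<sigma>" and Rz: "\<And>v. R z v = spec_fun U \<sigma> (\<lambda>s. 1 / (s + t)) v"
      using Rrep by blast
    interpret V: orthonormal_family U \<sigma> by (rule spectral_rep_family[OF rep])
    have "R z u \<bullet> v = R z v \<bullet> u" for u v unfolding Rz V.spec_fun_sym[of _ u v] by (rule inner_commute)
    then show "\<Gamma> i l z = \<Gamma> l i z" by (simp add: \<Gamma>_def mult_ac)
  next
    fix z :: "nat \<Rightarrow> 'x \<times> 'y" and c :: "nat \<Rightarrow> real"
    obtain U \<sigma> where rep: "spectral_rep (emp_cov w feat n z) U \<sigma>" and Rz: "\<And>v. R z v = spec_fun U \<sigma> (\<lambda>s. 1 / (s + t)) v"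
      using Rrep by blast
    interpret V: orthonormal_family U \<sigma> by (rule spectral_rep_family[OF rep])
    define a where "a = (\<Sum>i<n. (c i * (w (fst (z i)) / real n)) *\<^sub>R feat (fst (z i)))"
    have lin: "linear (\<lambda>v. R z u \<bullet> v)" "linear (\<lambda>u. R z u \<bullet> v)" for u v
      by (auto simp: Rz linear_iff V.spec_fun_add V.spec_fun_scale inner_add_left inner_add_right)
    have "(\<Sum>i<n. \<Sum>l<n. c i * c l * ((w (fst (z i)) / real n) * (w (fst (z l)) / real n) * (R z (feat (fst (z i))) \<bullet> feat (fst (z l)))))
        = R z a \<bullet> a"
      using double_sum_bilinear[of "\<lambda>u v. R z u \<bullet> v" "\<lambda>i. c i * (w (fst (z i)) / real n)" "\<lambda>i. feat (fst (z i))" "{..<n}"] lin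
      by (simp add: a_def mult_ac)
    moreover have "0 \<le> R z a \<bullet> a"
      unfolding Rz using t spectral_repD(3)[OF rep] by (intro V.spec_fun_nonneg) (simp_all add: add_nonneg_nonneg less_imp_le)
    ultimately show "0 \<le> (\<Sum>i<n. \<Sum>l<n. c i * c l * \<Gamma> i l z)"
      unfolding \<Gamma>_form[of "\<lambda>i l. c i * c l"] using s2 by simp
  next
    show "G \<in> sets ?Pi" by (rule G)
    fix z z' :: "nat \<Rightarrow> 'x \<times> 'y"
    assume eq: "\<And>k. k < n \<Longrightarrow> fst (z k) = fst (z' k)" and sp: "z \<in> space ?Pi" "z' \<in> space ?Pi"
    have "Sz z = Sz z'" unfolding Sz_def by (intro sum.cong refl) (simp add: eq)
    then show "z \<in> G \<longleftrightarrow> z' \<in> G" using sp by (simp add: G_def)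
  next
    fix z assume z: "z \<in> G"
    obtain U \<sigma> where rep: "spectral_rep (emp_cov w feat n z) U \<sigma>" and Rz: "\<And>v. R z v = spec_fun U \<sigma> (\<lambda>s. 1 / (s + t)) v"
      using Rrep by blast
    interpret V: orthonormal_family U \<sigma> by (rule spectral_rep_family[OF rep])
    have Rpos: "0 \<le> R z a \<bullet> a" for a
      unfolding Rz using t spectral_repD(3)[OF rep] by (intro V.spec_fun_nonneg) (simp_all add: add_nonneg_nonneg less_imp_le)
    have "(\<Sum>i<n. \<Gamma> i i z) = (\<Sum>i<n. s2 * ((w (fst (z i)) / real n) * ((w (fst (z i)) / real n) * (R z (feat (fst (z i))) \<bullet> feat (fst (z i))))))"
      by (intro sum.cong refl) (simp add: \<Gamma>_def)
    also have "\<dots> \<le> (\<Sum>i<n. s2 * ((b / real n) * ((w (fst (z i)) / real n) * (R z (feat (fst (z i))) \<bullet> feat (fst (z i))))))"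
      using w s2 Rpos by (intro sum_mono mult_left_mono mult_right_mono divide_right_mono mult_nonneg_nonneg) auto
    also have "\<dots> = s2 * (b / real n) * (\<Sum>i<n. (w (fst (z i)) / real n) * (R z (feat (fst (z i))) \<bullet> feat (fst (z i))))"
      by (simp add: sum_distrib_left mult.assoc)
    also have "\<dots> \<le> s2 * (b / real n) * (real m + (\<Sum>i<n. (w (fst (z i)) / real n) * tail m (fst (z i))) / t)"
      unfolding Rz using s2 b by (intro mult_left_mono empirical_dimension_le w(1) rep t) auto
    also have "\<dots> \<le> s2 * (b / real n) * (real m + 4 * theta t / t)"
    proof -
      have "(\<Sum>i<n. (w (fst (z i)) / real n) * tail m (fst (z i))) \<le> (\<Sum>i<n. \<tau> / real n * Zx (fst (z i)))"
      proof (rule sum_mono)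
        fix i
        have "w (fst (z i)) * tail m (fst (z i)) \<le> \<tau> * Zx (fst (z i))"
          using bt[of "fst (z i)"] \<tau> by (auto simp: w_def Zx_def)
        then show "(w (fst (z i)) / real n) * tail m (fst (z i)) \<le> \<tau> / real n * Zx (fst (z i))"
          using divide_right_mono[of _ _ "real n"] by fastforce
      qed
      also have "\<dots> = \<tau> / real n * Sz z" by (simp add: Sz_def sum_distrib_left)
      also have "\<dots> \<le> \<tau> / real n * (4 * L)" using z \<tau> by (intro mult_left_mono) (auto simp: G_def)
      also have "\<dots> = 4 * theta t" using n L by (simp add: \<tau>_def)
      finally have "(\<Sum>i<n. (w (fst (z i)) / real n) * tail m (fst (z i))) / t \<le> 4 * theta t / t" using t by (intro divide_right_mono) auto
      then show ?thesis using s2 b by (intro mult_left_mono add_left_mono) auto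
    qed
    finally show "(\<Sum>i<n. \<Gamma> i i z) \<le> s2 * V0" by (simp add: V0_def mult.assoc)
  next
    show "0 \<le> s2 * V0" using s2 V0 by simp
  qed
  have "(2 * M')\<^sup>2 * (s2 * V0) = L" using V0 M' by (simp add: s2_def)
  then have mgf': "(\<integral>\<^sup>+z. indicator G z * ennreal (cosh (W z)) \<partial>?Pi) \<le> ennreal (exp L)" using mgf by simp
  have PW: "measure ?Pi {z\<in>G. 4 * L \<le> W z} \<le> 2 * exp (- 3 * L)"
    using cosh_markov[OF Pi.prob_space_axioms W_m G mgf', of "4 * L"] by simp
  define E where "E = {z \<in> space ?Pi. \<forall>i\<in>{..<n}. norm (noise (z i)) \<le> 2 * M'}"
  have E: "E \<in> sets ?Pi"
  proof -
    have "{z \<in> space ?Pi. norm (noise (z i)) \<le> 2 * M'} \<in> sets ?Pi" if "i < n" for i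
      using noise_z[OF that] by measurable
    then show ?thesis unfolding E_def by (intro sets.sets_Collect_finite_All) auto
  qed
  have PE: "measure ?Pi E = 1"
    using AE_noise_sample[of n] by (intro Pi.prob_eq_1[THEN iffD2] E) (auto simp: E_def elim!: eventually_mono)
  define A where "A = {z\<in>G. W z < 4 * L} \<inter> E"
  have GW: "{z\<in>G. 4 * L \<le> W z} \<in> sets ?Pi" "{z\<in>G. W z < 4 * L} \<in> sets ?Pi"
  proof -
    have 1: "{z\<in>space ?Pi. 4 * L \<le> W z} \<in> sets ?Pi" "{z\<in>space ?Pi. W z < 4 * L} \<in> sets ?Pi" using W_m by measurable
    have "G \<subseteq> space ?Pi" by (auto simp: G_def)
    then have "{z\<in>G. 4 * L \<le> W z} = G \<inter> {z\<in>space ?Pi. 4 * L \<le> W z}" "{z\<in>G. W z < 4 * L} = G \<inter> {z\<in>space ?Pi. W z < 4 * L}" by auto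
    then show "{z\<in>G. 4 * L \<le> W z} \<in> sets ?Pi" "{z\<in>G. W z < 4 * L} \<in> sets ?Pi" using 1 G by auto
  qed
  have A: "A \<in> sets ?Pi" unfolding A_def using GW E by blast
  have "space ?Pi - A \<subseteq> {z \<in> space ?Pi. 4 * L \<le> Sz z} \<union> {z\<in>G. 4 * L \<le> W z} \<union> (space ?Pi - E)"
    by (auto simp: A_def G_def)
  then have "measure ?Pi (space ?Pi - A) \<le> measure ?Pi ({z \<in> space ?Pi. 4 * L \<le> Sz z} \<union> {z\<in>G. 4 * L \<le> W z} \<union> (space ?Pi - E))"
    using Sz_m GW E by (intro Pi.finite_measure_mono) auto
  also have "\<dots> \<le> measure ?Pi {z \<in> space ?Pi. 4 * L \<le> Sz z} + measure ?Pi {z\<in>G. 4 * L \<le> W z} + measure ?Pi (space ?Pi - E)"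
    using Sz_m GW E by (intro order_trans[OF measure_Un_le add_right_mono[OF measure_Un_le]]) auto
  also have "\<dots> \<le> exp (- 2 * L) + 2 * exp (- 3 * L)"
    using PS PW Pi.prob_compl[OF E] PE by simp
  finally have PA: "1 - (exp (- 2 * L) + 2 * exp (- 3 * L)) \<le> measure ?Pi A" using Pi.prob_compl[OF A] by simp
  have "noise_form \<beta> (spec_fun U \<sigma> (\<lambda>s. 1 / (s + t))) n z \<le> Kno * L * t powr (- 1 / bb) / real n"
    if z: "z \<in> A" and rep: "spectral_rep (emp_cov \<beta> feat n z) U \<sigma>" for z U \<sigma>
  proof -
    obtain U' \<sigma>' where rep': "spectral_rep (emp_cov w feat n z) U' \<sigma>'" and Rz: "\<And>v. R z v = spec_fun U' \<sigma>' (\<lambda>s. 1 / (s + t)) v"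
      using Rrep by blast
    have Reta: "R z = spec_fun U' \<sigma>' (\<lambda>s. 1 / (s + t))" using Rz by blast
    have W2: "W z = sqrt (s2 * noise_form w (R z) n z)"
      unfolding W_def \<Gamma>_form noise_form_def ..
    have "sqrt (s2 * noise_form w (R z) n z) < 4 * L" using z W2 by (simp add: A_def)
    then have "s2 * noise_form w (R z) n z \<le> (4 * L)\<^sup>2" using sqrt_le_D less_imp_le by blast
    then have "noise_form w (R z) n z \<le> 16 * L\<^sup>2 / s2" using s2 by (simp add: pos_le_divide_eq power_mult_distrib mult.commute)
    also have "16 * L\<^sup>2 / s2 = 64 * L * M'\<^sup>2 * V0" using L V0 M' by (simp add: s2_def power2_eq_square field_simps)
    also have "\<dots> \<le> 64 * L * M'\<^sup>2 * (4 * b * Kn * t powr (- 1 / bb) / real n)"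
    proof (rule mult_left_mono)
      have "real m + 4 * theta t / t \<le> 2 * t powr (- 1 / bb) + 4 * (a' / (bb - 1) * t powr (- 1 / bb))"
        using mcut(3)[OF t] theta_div[OF t] by (simp add: m_def)
      also have "\<dots> \<le> 4 * Kn * t powr (- 1 / bb)" by (simp add: Kn_def algebra_simps)
      finally have "b / real n * (real m + 4 * theta t / t) \<le> b / real n * (4 * Kn * t powr (- 1 / bb))"
        using b by (intro mult_left_mono) auto
      then show "V0 \<le> 4 * b * Kn * t powr (- 1 / bb) / real n" by (simp add: V0_def mult_ac)
    qed (use L in simp)
    finally have Q: "noise_form w (R z) n z \<le> 64 * L * M'\<^sup>2 * (4 * b * Kn * t powr (- 1 / bb) / real n)" .
    \<comment> \<open>Every removed input contributes a full 1 to Sz, which is below 4 L on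
      G.\<close>
    have bad: "real (card {i. i < n \<and> w (fst (z i)) \<noteq> \<beta> (fst (z i))}) \<le> 4 * L"
    proof -
      have "real (card {i. i < n \<and> w (fst (z i)) \<noteq> \<beta> (fst (z i))}) = (\<Sum>i\<in>{i. i < n \<and> w (fst (z i)) \<noteq> \<beta> (fst (z i))}. 1)" by simp
      also have "\<dots> \<le> (\<Sum>i\<in>{i. i < n \<and> w (fst (z i)) \<noteq> \<beta> (fst (z i))}. Zx (fst (z i)))"
        using \<tau> by (intro sum_mono) (auto simp: w_def Zx_def split: if_splits)
      also have "\<dots> \<le> Sz z" unfolding Sz_def using Zx by (intro sum_mono2) auto
      also have "\<dots> \<le> 4 * L" using z by (simp add: A_def G_def)
      finally show ?thesis .
    qed
    have "noise_form \<beta> (spec_fun U \<sigma> (\<lambda>s. 1 / (s + t))) n z \<le> 2 * noise_form w (R z) n z + 8 * b * M'\<^sup>2 * (4 * L) / real n"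
      unfolding Reta using z by (intro noise_form_split n t w rep rep' bad) (auto simp: A_def E_def)
    also have "\<dots> \<le> 2 * (64 * L * M'\<^sup>2 * (4 * b * Kn * t powr (- 1 / bb) / real n)) + 8 * b * M'\<^sup>2 * (4 * L) * t powr (- 1 / bb) / real n"
    proof (intro add_mono mult_left_mono Q divide_right_mono)
      have "1 \<le> t powr (- 1 / bb)" using powr_mono2'[of "- 1 / bb" t 1] t bb by simp
      then show "8 * b * M'\<^sup>2 * (4 * L) \<le> 8 * b * M'\<^sup>2 * (4 * L) * t powr (- 1 / bb)"
        using b L mult_left_mono[of 1 "t powr (- 1 / bb)" "8 * b * M'\<^sup>2 * (4 * L)"] by simp
    qed auto
    also have "\<dots> = Kno * L * t powr (- 1 / bb) / real n"
      using n by (simp add: Kno_def field_simps)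
    finally show ?thesis .
  qed
  then show ?thesis using A PA by blast
qed

end

section \<open>Combined sample event and decomposition of the error\<close>

context covariate_shift
begin

text \<open>Collects the sup-norm and the variance constant of the deviation bound; the 4 is the
  level chosen in the tail estimate.\<close>

definition KB :: real where "KB = 4 * (sqrt (2 * (b\<^sup>2 + 1) * \<kappa>^4 + 1) + sqrt Sig)"

lemma Sig_nonneg: "0 \<le> Sig"
  using Kn_pos b by (simp add: Sig_def)

lemma KB_nonneg: "0 \<le> KB"
  using Sig_nonneg by (simp add: KB_def)

text \<open>Rewrites both events in terms of t, ph and L: the relation between n and t turns
  \<open>t powr (- 1 / bb) / n\<close> into \<open>t * ph\<^sup>2\<close>, the balance of effective
  dimension and sample size.\<close>

lemma sample_event:
  assumes n: "0 < n" and t: "0 < t" "t \<le> 1" and ph: "0 < ph" and \<delta>: "0 < \<delta>" "\<delta> < 1"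
    and nt: "1 / real n = t powr (1 + 1 / bb) * ph\<^sup>2" and L_def: "L = ln (2 / \<delta>)"
  defines "B \<equiv> KB * (sqrt t * (ph * sqrt L))" and "w \<equiv> (1 + KB) * (1 + ph * sqrt L)"
  shows "\<exists>A\<in>sets (PiM {..<n} (\<lambda>_. p)). 1 - \<delta> \<le> measure (PiM {..<n} (\<lambda>_. p)) A \<and>
    (\<forall>z\<in>A. \<forall>U \<sigma>. spectral_rep (emp_cov \<beta> feat n z) U \<sigma> \<longrightarrow>
      two_ops f \<mu> C U \<sigma> (emp_cov \<beta> feat n z) t (t + L / real n) B w \<and>
      noise_form \<beta> (spec_fun U \<sigma> (\<lambda>s. 1 / (s + t))) n z \<le> Kno * L * t * ph\<^sup>2)"
proof -
  let ?Pi = "PiM {..<n} (\<lambda>_. p)"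
  interpret Pi: prob_space ?Pi by (rule prob_space_PiM) (rule p_prob)
  define t' where "t' = t + L / real n"
  have L: "0 < L" using \<delta> by (simp add: L_def)
  have t': "t < t'" "0 < t'" using L n t by (auto simp: t'_def add_pos_pos)
  have nt1: "t powr (- 1 / bb) / real n = t * ph\<^sup>2"
  proof -
    have "t powr (- 1 / bb) / real n = t powr (- 1 / bb) * (1 / real n)" by simp
    also have "\<dots> = (t powr (- 1 / bb) * t powr (1 + 1 / bb)) * ph\<^sup>2" by (simp only: nt mult.assoc)
    also have "t powr (- 1 / bb) * t powr (1 + 1 / bb) = t" using t by (simp add: powr_add[symmetric])
    finally show ?thesis .
  qed
  have nt2: "1 / real n \<le> t * ph\<^sup>2"
  proof -
    have "t powr (1 + 1 / bb) \<le> t powr 1" using t bb by (intro powr_mono') auto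
    then show ?thesis unfolding nt using t by (intro mult_right_mono) auto
  qed
  have Ln: "L / real n \<le> t * (ph * sqrt L)\<^sup>2"
    using mult_left_mono[OF nt2, of L] L by (simp add: power_mult_distrib mult_ac)
  have phL: "0 \<le> ph * sqrt L" using ph L by simp
  define B0 where "B0 = 4 * (L * Rbound t' + sqrt (real n * (Sig * t powr (- 1 / bb)) * L)) / real n"
  have B0_nonneg: "0 \<le> B0" using L t' Sig_nonneg by (simp add: B0_def Rbound_def)
  have B0_le: "B0 \<le> B"
  proof -
    let ?R0 = "2 * (b\<^sup>2 + 1) * \<kappa>^4 + 1"
    \<comment> \<open>The summand \<open>L / n\<close> of t' serves this step: the sup-norm part of
      the deviation is at most of order \<open>sqrt (L / n)\<close>, however large L is compared
      with n.\<close>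
    have "L / real n / sqrt t' \<le> sqrt (L / real n)"
    proof -
      have "L / real n = sqrt (L / real n) * sqrt (L / real n)" using L by simp
      also have "\<dots> \<le> sqrt (L / real n) * sqrt t'" using L t by (intro mult_left_mono) (auto simp: t'_def)
      finally show ?thesis by (subst pos_divide_le_eq) (use t' in auto)
    qed
    also have "\<dots> \<le> sqrt (t * (ph * sqrt L)\<^sup>2)" using Ln by simp
    also have "\<dots> = sqrt t * (ph * sqrt L)" using phL by (simp add: real_sqrt_mult)
    finally have a: "L / real n / sqrt t' \<le> sqrt t * (ph * sqrt L)" .
    have "L * Rbound t' / real n = sqrt ?R0 * (L / real n / sqrt t')" by (simp add: Rbound_def real_sqrt_divide mult_ac)
    also have "\<dots> \<le> sqrt ?R0 * (sqrt t * (ph * sqrt L))" by (intro mult_left_mono a) auto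
    finally have 1: "L * Rbound t' / real n \<le> sqrt ?R0 * (sqrt t * (ph * sqrt L))" .
    have "sqrt (real n * (Sig * t powr (- 1 / bb)) * L) / real n
        = sqrt (real n * (Sig * t powr (- 1 / bb)) * L / (real n)\<^sup>2)" by (simp add: real_sqrt_divide)
    also have "real n * (Sig * t powr (- 1 / bb)) * L / (real n)\<^sup>2 = Sig * L * (t powr (- 1 / bb) / real n)"
      using n by (simp add: power2_eq_square)
    also have "\<dots> = Sig * (t * (ph * sqrt L)\<^sup>2)" unfolding nt1 using L by (simp add: power_mult_distrib mult_ac)
    also have "sqrt \<dots> = sqrt Sig * (sqrt t * (ph * sqrt L))" using phL by (simp add: real_sqrt_mult)
    finally have 2: "sqrt (real n * (Sig * t powr (- 1 / bb)) * L) / real n = sqrt Sig * (sqrt t * (ph * sqrt L))" .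
    have "B0 = 4 * (L * Rbound t' / real n + sqrt (real n * (Sig * t powr (- 1 / bb)) * L) / real n)"
      by (simp add: B0_def add_divide_distrib)
    also have "\<dots> \<le> 4 * (sqrt ?R0 * (sqrt t * (ph * sqrt L)) + sqrt Sig * (sqrt t * (ph * sqrt L)))"
      unfolding 2 using 1 by simp
    also have "\<dots> = B" by (simp add: B_def KB_def algebra_simps)
    finally show ?thesis .
  qed
  have B: "0 \<le> B" using KB_nonneg phL t by (simp add: B_def)
  have w: "sqrt (t' / t) + B / sqrt t \<le> w"
  proof -
    have "t' / t = 1 + (L / real n) / t" using t by (simp add: t'_def add_divide_distrib)
    also have "\<dots> \<le> 1 + (ph * sqrt L)\<^sup>2" by (intro add_left_mono, subst pos_divide_le_eq) (use t Ln in \<open>simp_all add: mult.commute\<close>)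
    also have "\<dots> \<le> (1 + ph * sqrt L)\<^sup>2" using phL by (simp add: power2_sum)
    finally have "sqrt (t' / t) \<le> 1 + ph * sqrt L" using phL by (intro real_le_lsqrt) auto
    moreover have "B / sqrt t = KB * (ph * sqrt L)" using t by (simp add: B_def)
    ultimately show ?thesis using KB_nonneg by (simp add: w_def algebra_simps)
  qed
  obtain A1 where A1: "A1 \<in> sets ?Pi" "1 - 2 * exp (- 2 * L) \<le> measure ?Pi A1"
    "\<And>z J. z \<in> A1 \<Longrightarrow> (\<Sum>j<J. (norm (emp_cov \<beta> feat n z (f j) - \<mu> j *\<^sub>R f j))\<^sup>2 / (\<mu> j + t')) \<le> B0\<^sup>2"
    using deviation_event[OF n t less_imp_le[OF t'(1)] L] unfolding B0_def by blast
  obtain A2 where A2: "A2 \<in> sets ?Pi" "1 - (exp (- 2 * L) + 2 * exp (- 3 * L)) \<le> measure ?Pi A2"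
    "\<And>z U \<sigma>. z \<in> A2 \<Longrightarrow> spectral_rep (emp_cov \<beta> feat n z) U \<sigma> \<Longrightarrow>
      noise_form \<beta> (spec_fun U \<sigma> (\<lambda>s. 1 / (s + t))) n z \<le> Kno * L * t powr (- 1 / bb) / real n"
    using noise_event[OF n t L] by blast
  have "1 - \<delta> \<le> measure ?Pi (A1 \<inter> A2)"
  proof -
    \<comment> \<open>The failure probabilities add up to
      \<open>3 * \<delta>\<^sup>2 / 4 + \<delta> ^ 3 / 4\<close>, which is at most \<delta>.\<close>
    have "exp (- L) = \<delta> / 2" using \<delta> by (simp add: L_def exp_minus inverse_eq_divide)
    moreover have "exp (- 2 * L) = exp (- L) ^ 2" "exp (- 3 * L) = exp (- L) ^ 3"
      by (simp_all add: exp_of_nat_mult[symmetric])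
    ultimately have "exp (- 2 * L) = (\<delta> / 2) ^ 2" "exp (- 3 * L) = (\<delta> / 2) ^ 3" by (simp_all only:)
    then have e: "exp (- 2 * L) = \<delta>\<^sup>2 / 4" "exp (- 3 * L) = \<delta> ^ 3 / 8" by (simp_all add: power_divide)
    have "\<delta>\<^sup>2 \<le> \<delta>" "\<delta> ^ 3 \<le> \<delta>" using \<delta> by (simp_all add: power_le_one_iff power2_eq_square mult_left_le power3_eq_cube mult_le_one mult.assoc)
    then have d: "2 * exp (- 2 * L) + (exp (- 2 * L) + 2 * exp (- 3 * L)) \<le> \<delta>" unfolding e by simp
    have "1 - measure ?Pi (A1 \<inter> A2) = measure ?Pi (space ?Pi - A1 \<inter> A2)"
      using Pi.prob_compl[of "A1 \<inter> A2"] A1(1) A2(1) by simp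
    also have "\<dots> = measure ?Pi ((space ?Pi - A1) \<union> (space ?Pi - A2))" by (simp add: Diff_Int)
    also have "\<dots> \<le> measure ?Pi (space ?Pi - A1) + measure ?Pi (space ?Pi - A2)"
      using A1(1) A2(1) by (intro measure_Un_le) auto
    also have "\<dots> = (1 - measure ?Pi A1) + (1 - measure ?Pi A2)"
      using Pi.prob_compl[OF A1(1)] Pi.prob_compl[OF A2(1)] by simp
    finally show ?thesis using d A1(2) A2(2) by simp
  qed
  moreover have "two_ops f \<mu> C U \<sigma> (emp_cov \<beta> feat n z) t t' B w"
    if z: "z \<in> A1" and rep: "spectral_rep (emp_cov \<beta> feat n z) U \<sigma>" for z U \<sigma>
  proof -
    interpret V: orthonormal_family U \<sigma> by (rule spectral_rep_family[OF rep])
    have psd: "0 \<le> a \<bullet> emp_cov \<beta> feat n z a" for a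
      unfolding emp_cov_sym[symmetric] emp_cov_inner
      using \<beta>(2) by (intro sum_nonneg mult_nonneg_nonneg[OF _ zero_le_square] divide_nonneg_nonneg) auto
    have "(\<Sum>j<J. (norm (emp_cov \<beta> feat n z (f j) - \<mu> j *\<^sub>R f j))\<^sup>2 / (\<mu> j + t')) \<le> B\<^sup>2" for J
      using A1(3)[OF z, of J] power_mono[OF B0_le B0_nonneg, of 2] by linarith
    from deviation_from_coordinates[OF emp_cov_sym t'(2) B this]
    have dev: "\<bar>a \<bullet> (emp_cov \<beta> feat n z x - C x)\<bar> \<le> B * sqrt (a \<bullet> C a + t' * (norm a)\<^sup>2) * norm x" for a x .
    have cmp: "a \<bullet> C a + t' * (norm a)\<^sup>2 \<le> w\<^sup>2 * (a \<bullet> emp_cov \<beta> feat n z a + t * (norm a)\<^sup>2)" for a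
    proof -
      have "a \<bullet> C a + t' * (norm a)\<^sup>2 \<le> (sqrt (t' / t) + B / sqrt t)\<^sup>2 * (a \<bullet> emp_cov \<beta> feat n z a + t * (norm a)\<^sup>2)"
        using t' by (intro comparison_from_deviation t B psd dev) auto
      also have "\<dots> \<le> w\<^sup>2 * (a \<bullet> emp_cov \<beta> feat n z a + t * (norm a)\<^sup>2)"
        using w t t' B psd[of a] by (intro mult_right_mono power_mono) auto
      finally show ?thesis .
    qed
    have "0 \<le> w" using KB_nonneg phL by (simp add: w_def)
    then show ?thesis
      using dev cmp t B spectral_rep_spec_fun[OF rep] spectral_repD(3)[OF rep] by unfold_locales auto
  qed
  moreover have "noise_form \<beta> (spec_fun U \<sigma> (\<lambda>s. 1 / (s + t))) n z \<le> Kno * L * t * ph\<^sup>2"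
    if "z \<in> A2" and "spectral_rep (emp_cov \<beta> feat n z) U \<sigma>" for z U \<sigma>
  proof -
    have "Kno * L * t powr (- 1 / bb) / real n = Kno * L * (t powr (- 1 / bb) / real n)" by simp
    then show ?thesis using A2(3)[OF that] by (simp only: nt1 mult.assoc)
  qed
  ultimately show ?thesis using A1(1) A2(1) unfolding t'_def by blast
qed

text \<open>The bounds of the family do not control the filter at 0, and its value there drops out:
  the residual at 0 is 1 in any case, and the weighted inner products of sampled features with the
  kernel of the empirical covariance vanish. The filter may thus be set to 0 at 0.\<close>

lemma error_decomposition:
  fixes gl :: "real \<Rightarrow> real"
  assumes rep: "spectral_rep (emp_cov \<beta> feat n z) U \<sigma>"
  defines "gz \<equiv> \<lambda>s. if s = 0 then 0 else gl s"
  shows "Cstar (feat x) - emp_cross_cov \<beta> feat n z (fun_calc gl (emp_cov \<beta> feat n z) (feat x))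
    = Cstar (spec_fun U \<sigma> (\<lambda>s. 1 - s * gl s) (feat x))
      - (\<Sum>i<n. ((\<beta> (fst (z i)) / real n) * (spec_fun U \<sigma> gz (feat (fst (z i))) \<bullet> feat x)) *\<^sub>R noise (z i))"
proof -
  interpret V: orthonormal_family U \<sigma> by (rule spectral_rep_family[OF rep])
  let ?w = "\<lambda>i. \<beta> (fst (z i)) / real n" and ?\<phi> = "\<lambda>i. feat (fst (z i))"
  define v where "v = V.F gl (feat x)"
  define h where "h = v - V.F gz (feat x)"
  have lin: "linear Cstar" using Cstar by (rule bounded_linear.linear)
  have "emp_cross_cov \<beta> feat n z v = (\<Sum>i<n. (?w i * (v \<bullet> ?\<phi> i)) *\<^sub>R snd (z i))"
    by (simp add: emp_cross_cov_def tensor_op_def scaleR_sum_right)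
  also have "\<dots> = (\<Sum>i<n. (?w i * (v \<bullet> ?\<phi> i)) *\<^sub>R Cstar (?\<phi> i)) + (\<Sum>i<n. (?w i * (v \<bullet> ?\<phi> i)) *\<^sub>R noise (z i))"
    by (simp add: noise_def sum.distrib[symmetric] scaleR_add_right[symmetric])
  also have "(\<Sum>i<n. (?w i * (v \<bullet> ?\<phi> i)) *\<^sub>R Cstar (?\<phi> i)) = Cstar (emp_cov \<beta> feat n z v)"
    unfolding emp_cov_eq linear_sum[OF lin] linear_scale[OF lin] ..
  finally have e1: "emp_cross_cov \<beta> feat n z v = Cstar (emp_cov \<beta> feat n z v) + (\<Sum>i<n. (?w i * (v \<bullet> ?\<phi> i)) *\<^sub>R noise (z i))" .
  have "V.F (\<lambda>s. 1 - s * gl s) (feat x) = feat x - emp_cov \<beta> feat n z v"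
    unfolding spectral_rep_spec_fun[OF rep] v_def V.spec_fun_mult V.spec_fun_diff_fun V.spec_fun_one ..
  then have e2: "Cstar (feat x) - Cstar (emp_cov \<beta> feat n z v) = Cstar (V.F (\<lambda>s. 1 - s * gl s) (feat x))"
    by (simp add: linear_diff[OF lin])
  have h: "h = V.F (\<lambda>s. gl s - gz s) (feat x)" by (simp add: h_def v_def V.spec_fun_diff_fun)
  have "emp_cov \<beta> feat n z h = V.F (\<lambda>s. 0) (feat x)"
    unfolding spectral_rep_spec_fun[OF rep] h V.spec_fun_mult by (rule V.spec_fun_cong) (auto simp: gz_def)
  then have "emp_cov \<beta> feat n z h \<bullet> h = 0" by (simp add: spec_fun_def)
  then have "(\<Sum>i<n. ?w i * ((h \<bullet> ?\<phi> i) * (h \<bullet> ?\<phi> i))) = 0" unfolding emp_cov_inner .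
  then have "\<forall>i\<in>{..<n}. ?w i * ((h \<bullet> ?\<phi> i) * (h \<bullet> ?\<phi> i)) = 0"
    using \<beta>(2) by (subst (asm) sum_nonneg_eq_0_iff) auto
  then have h0: "?w i * (h \<bullet> ?\<phi> i) = 0" if "i < n" for i using that by auto
  have "?w i * (v \<bullet> ?\<phi> i) = ?w i * (V.F gz (?\<phi> i) \<bullet> feat x)" if "i < n" for i
  proof -
    have "v = h + V.F gz (feat x)" by (simp add: h_def)
    then have "?w i * (v \<bullet> ?\<phi> i) = ?w i * (h \<bullet> ?\<phi> i) + ?w i * (V.F gz (feat x) \<bullet> ?\<phi> i)"
      by (simp only: inner_add_left distrib_left)
    also have "V.F gz (feat x) \<bullet> ?\<phi> i = V.F gz (?\<phi> i) \<bullet> feat x" unfolding V.spec_fun_sym[of gz "feat x"] by (rule inner_commute)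
    finally show ?thesis unfolding h0[OF that] by simp
  qed
  then have "(\<Sum>i<n. (?w i * (v \<bullet> ?\<phi> i)) *\<^sub>R noise (z i)) = (\<Sum>i<n. (?w i * (V.F gz (?\<phi> i) \<bullet> feat x)) *\<^sub>R noise (z i))"
    by (intro sum.cong refl) simp
  then show ?thesis
    unfolding fun_calc_spectral_rep[OF rep] v_def[symmetric] e1 e2[symmetric] by simp
qed

text \<open>The bias comes from \<open>bias_element\<close>, with \<phi>(C) followed by the
  empirical residual as A; the noise is a finite sum of tensors. Both bounds are for one and the
  same element e, so the two norms of the error are treated together.\<close>

lemma error_element:
  fixes gl :: "real \<Rightarrow> real" and Co :: "'h \<Rightarrow> 'y"
  assumes rep: "spectral_rep (emp_cov \<beta> feat n z) U \<sigma>"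
    and ops: "two_ops f \<mu> C U \<sigma> (emp_cov \<beta> feat n z) t t' B w" and t': "0 \<le> t'"
    and source: "Cstar = Co \<circ> fun_calc \<phi> C" and \<phi>H: "\<And>j. \<bar>\<phi> (\<mu> j)\<bar> \<le> H"
    and Co: "bounded_linear Co" and E: "orthonormal_basis E" "(\<lambda>e. (norm (Co e))\<^sup>2) summable_on E"
    and M: "0 \<le> M" "\<And>v. norm (spec_fun U \<sigma> (\<lambda>s. 1 - s * gl s) (fun_calc \<phi> C v)) \<le> M * norm v"
    and M2: "\<And>v. spec_fun U \<sigma> (\<lambda>s. 1 - s * gl s) (fun_calc \<phi> C v) \<bullet>
        C (spec_fun U \<sigma> (\<lambda>s. 1 - s * gl s) (fun_calc \<phi> C v)) \<le> M2 * (norm v)\<^sup>2"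
    and c: "0 \<le> c" "\<And>u. u \<in> U \<Longrightarrow> (gl (\<sigma> u))\<^sup>2 * (\<sigma> u + t) \<le> c"
    and c': "0 \<le> c'" "\<And>u. u \<in> U \<Longrightarrow> (gl (\<sigma> u) * (\<sigma> u + t))\<^sup>2 \<le> c'"
    and N: "noise_form \<beta> (spec_fun U \<sigma> (\<lambda>s. 1 / (s + t))) n z \<le> N"
  shows "\<exists>e. evl e = (\<lambda>x. Cstar (feat x) - emp_cross_cov \<beta> feat n z (fun_calc gl (emp_cov \<beta> feat n z) (feat x)))
    \<and> evl e \<in> borel_measurable borel
    \<and> norm e \<le> M * sqrt (\<Sum>\<^sub>\<infinity>e\<in>E. (norm (Co e))\<^sup>2) + sqrt (c * N)
    \<and> sqL2 e \<le> 4 * (M2 * (\<Sum>\<^sub>\<infinity>e\<in>E. (norm (Co e))\<^sup>2)) + 2 * (w\<^sup>2 * c' * N)"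
proof -
  interpret V: two_ops f \<mu> C U \<sigma> "emp_cov \<beta> feat n z" t t' B w by (rule ops)
  let ?w = "\<lambda>i. \<beta> (fst (z i)) / real n" and ?\<phi> = "\<lambda>i. feat (fst (z i))"
  define r where "r s = 1 - s * gl s" for s
  define gz where "gz s = (if s = 0 then 0 else gl s)" for s
  define h2 where "h2 = (\<Sum>\<^sub>\<infinity>e\<in>E. (norm (Co e))\<^sup>2)"
  have h2: "0 \<le> h2" unfolding h2_def by (intro infsum_nonneg) auto
  note calc = diag_linear[of \<phi> H, OF \<phi>H]
  have A: "linear (\<lambda>v. V.F r (fun_calc \<phi> C v))"
    by (intro linearI) (simp_all add: calc V.spec_fun_add V.spec_fun_scale)
  have X: "fun_calc \<phi> C (V.F r v) \<bullet> u = v \<bullet> V.F r (fun_calc \<phi> C u)" for v u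
    unfolding diag_sym[of \<phi> H, OF \<phi>H] V.spec_fun_sym ..
  have Fm: "(\<lambda>x. V.F r (feat x)) \<in> borel_measurable borel"
    unfolding spec_fun_def using feat_measurable by measurable
  have Xm: "(\<lambda>x. Co (fun_calc \<phi> C (V.F r (feat x)))) \<in> borel_measurable borel"
    using borel_measurable_continuous_on[OF linear_continuous_on[OF Cstar] Fm] by (simp add: source o_def)
  obtain g1 where g1: "evl g1 = (\<lambda>x. Co (fun_calc \<phi> C (V.F r (feat x))))" "(norm g1)\<^sup>2 \<le> M\<^sup>2 * h2" "sqL2 g1 \<le> 2 * (M2 * h2)"
    using bias_element[OF Co E A _ _ X Xm, of M M2] M(2) M2 unfolding h2_def r_def by blast
  define g2 where "g2 = (\<Sum>i<n. T (noise (z i)) (?w i *\<^sub>R V.F gz (?\<phi> i)))"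
  have nf: "(\<Sum>i<n. \<Sum>l<n. (noise (z i) \<bullet> noise (z l)) * (V.F (\<lambda>s. 1 / (s + t)) (?w i *\<^sub>R ?\<phi> i) \<bullet> (?w l *\<^sub>R ?\<phi> l)))
      = noise_form \<beta> (V.F (\<lambda>s. 1 / (s + t))) n z"
    unfolding noise_form_def V.spec_fun_scale by (intro sum.cong refl) (simp only: inner_scaleR_left inner_scaleR_right mult_ac)
  have gz1: "(gz (\<sigma> u))\<^sup>2 * (\<sigma> u + t) \<le> c" "(gz (\<sigma> u) * (\<sigma> u + t))\<^sup>2 \<le> c'" if "u \<in> U" for u
    using V.\<sigma>_pos[OF that] c(2)[OF that] c'(2)[OF that] by (simp_all add: gz_def)
  note nfs = V.noise_forms[of "{..<n}" gz c c' "\<lambda>i. noise (z i)" "\<lambda>i. ?w i *\<^sub>R ?\<phi> i", OF _ _ c(1) c'(1) gz1 t', unfolded nf]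
  have n1: "(norm g2)\<^sup>2 \<le> c * N"
    unfolding g2_def tensor_sum_norm V.spec_fun_scale[symmetric]
    by (rule order_trans[OF nfs(1) mult_left_mono[OF N c(1)]]) (auto simp: gz_def)
  have n2: "sqL2 g2 \<le> w\<^sup>2 * c' * N"
    unfolding g2_def sqL2_tensor V.spec_fun_scale[symmetric]
    by (rule order_trans[OF nfs(2) mult_left_mono[OF N]]) (auto simp: gz_def c')
  have m: "evl g1 \<in> borel_measurable borel" "evl g2 \<in> borel_measurable borel"
    using Xm tensor_measurable by (simp_all add: g1 g2_def)
  have ev: "evl (g1 - g2) = (\<lambda>x. Cstar (feat x) - emp_cross_cov \<beta> feat n z (fun_calc gl (emp_cov \<beta> feat n z) (feat x)))"
    unfolding error_decomposition[OF rep] fun_eq_iff ev_diff g1(1)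
    by (simp add: g2_def ev_sum ev_tensor source r_def[abs_def] gz_def[abs_def] mult_ac)
  have "evl (g1 - g2) = (\<lambda>x. evl g1 x - evl g2 x)" by (simp add: fun_eq_iff ev_diff)
  then have "evl (g1 - g2) \<in> borel_measurable borel" using m by simp
  moreover have "norm (g1 - g2) \<le> M * sqrt h2 + sqrt (c * N)"
  proof -
    have "norm g1 \<le> M * sqrt h2"
      using real_le_rsqrt[OF g1(2)] M(1) by (simp add: real_sqrt_mult)
    moreover have "norm g2 \<le> sqrt (c * N)" using real_le_rsqrt[OF n1] .
    ultimately show ?thesis using norm_triangle_ineq4[of g1 g2] by linarith
  qed
  moreover have "sqL2 (g1 - g2) \<le> 4 * (M2 * h2) + 2 * (w\<^sup>2 * c' * N)"
    using sqL2_diff_le[OF m] g1(3) n2 by linarith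
  ultimately show ?thesis using ev unfolding h2_def by blast
qed

end

section \<open>Rates\<close>

text \<open>The form of C is replaced by \<open>w\<^sup>2 * (Ch + lam)\<close>, whose square root
  commutes with the filter and is absorbed as \<open>sqrt ((s + lam) / lam)\<close>. The
  square-integral norm is thereby reduced to a norm bound for a modified residual.\<close>

lemma (in two_ops) residual_L2:
  assumes "0 \<le> lam'"
  shows "F r v \<bullet> C (F r v) \<le> w\<^sup>2 * lam * (norm (F (\<lambda>s. r s * sqrt ((s + lam) / lam)) v))\<^sup>2"
proof -
  have "F r v \<bullet> Ch (F r v) = F (\<lambda>s. r s * (s * r s)) v \<bullet> v"
    unfolding Ch spec_fun_mult spec_fun_sym[of r v] inner_commute[of v] by simp
  moreover have "lam * (norm (F r v))\<^sup>2 = F (\<lambda>s. lam * (r s)\<^sup>2) v \<bullet> v"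
    by (simp add: spec_fun_norm spec_fun_scale_fun)
  ultimately have "F r v \<bullet> Ch (F r v) + lam * (norm (F r v))\<^sup>2 = F (\<lambda>s. r s * (s * r s) + lam * (r s)\<^sup>2) v \<bullet> v"
    by (simp add: spec_fun_plus_fun inner_add_left)
  also have "F (\<lambda>s. r s * (s * r s) + lam * (r s)\<^sup>2) v = F (\<lambda>s. lam * (r s * sqrt ((s + lam) / lam))\<^sup>2) v"
  proof (rule spec_fun_cong)
    fix u assume "u \<in> U"
    then have "0 \<le> (\<sigma> u + lam) / lam" using \<sigma>_pos[of u] lam by simp
    then show "r (\<sigma> u) * (\<sigma> u * r (\<sigma> u)) + lam * (r (\<sigma> u))\<^sup>2 = lam * (r (\<sigma> u) * sqrt ((\<sigma> u + lam) / lam))\<^sup>2"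
      using lam by (simp add: power_mult_distrib) (simp add: power2_eq_square field_simps)
  qed (use lam in simp)
  also have "\<dots> \<bullet> v = lam * (norm (F (\<lambda>s. r s * sqrt ((s + lam) / lam)) v))\<^sup>2"
    unfolding spec_fun_norm spec_fun_scale_fun by simp
  finally have e: "F r v \<bullet> Ch (F r v) + lam * (norm (F r v))\<^sup>2 = lam * (norm (F (\<lambda>s. r s * sqrt ((s + lam) / lam)) v))\<^sup>2" .
  have "F r v \<bullet> C (F r v) \<le> F r v \<bullet> C (F r v) + lam' * (norm (F r v))\<^sup>2" using assms by simp
  also have "\<dots> \<le> w\<^sup>2 * (lam * (norm (F (\<lambda>s. r s * sqrt ((s + lam) / lam)) v))\<^sup>2)"
    unfolding e[symmetric] by (rule compare)
  finally show ?thesis by (simp add: mult.assoc)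
qed

text \<open>The covering condition speaks of \<sigma> between t and S. Below t monotonicity
  suffices; above S, where population eigenvalues may lie, the bound at S is enlarged by a fixed
  ratio.\<close>

lemma covers_growth:
  fixes \<psi> :: "real \<Rightarrow> real"
  assumes cov: "covers S \<nu> \<psi>" and S: "0 < S" and \<nu>: "0 < \<nu>"
    and pos: "\<And>x. 0 < x \<Longrightarrow> 0 < \<psi> x" and mono: "\<And>x y. 0 < x \<Longrightarrow> x \<le> y \<Longrightarrow> \<psi> x \<le> \<psi> y"
  shows "\<exists>K\<ge>1. \<forall>t \<sigma>. 0 < t \<and> t \<le> S \<and> 0 < \<sigma> \<and> \<sigma> \<le> R \<longrightarrow> \<psi> \<sigma> \<le> K * \<psi> t * max 1 ((\<sigma> / t) powr \<nu>)"
proof -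
  obtain c where c: "0 < c" "\<And>t. 0 < t \<Longrightarrow> t \<le> S \<Longrightarrow> c * (t powr \<nu> / \<psi> t) \<le> (INF \<sigma>\<in>{t..S}. \<sigma> powr \<nu> / \<psi> \<sigma>)"
    using cov unfolding covers_def by auto
  have inner: "\<psi> \<sigma> \<le> \<psi> t / c * (\<sigma> / t) powr \<nu>" if t: "0 < t" "t \<le> \<sigma>" "\<sigma> \<le> S" for t \<sigma>
  proof -
    have p: "0 < \<psi> t" "0 < \<psi> \<sigma>" "0 < t powr \<nu>" using t pos by auto
    have "bdd_below ((\<lambda>\<sigma>. \<sigma> powr \<nu> / \<psi> \<sigma>) ` {t..S})"
    proof (rule bdd_belowI2[where m = 0])
      fix x assume "x \<in> {t..S}"
      then have "0 < x" using t by simp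
      then show "0 \<le> x powr \<nu> / \<psi> x" using pos[of x] by simp
    qed
    then have INF_le: "(INF \<sigma>\<in>{t..S}. \<sigma> powr \<nu> / \<psi> \<sigma>) \<le> \<sigma> powr \<nu> / \<psi> \<sigma>" using t by (intro cINF_lower) auto
    have "c * (t powr \<nu> / \<psi> t) \<le> (INF \<sigma>\<in>{t..S}. \<sigma> powr \<nu> / \<psi> \<sigma>)" by (rule c(2)) (use t in auto)
    also note INF_le
    finally have "c * t powr \<nu> / \<psi> t \<le> \<sigma> powr \<nu> / \<psi> \<sigma>" by simp
    then have "c * t powr \<nu> / \<psi> t * \<psi> \<sigma> \<le> \<sigma> powr \<nu>" using p by (simp only: pos_le_divide_eq)
    then have "c * t powr \<nu> * \<psi> \<sigma> / \<psi> t \<le> \<sigma> powr \<nu>" by simp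
    then have "c * t powr \<nu> * \<psi> \<sigma> \<le> \<sigma> powr \<nu> * \<psi> t" using p by (simp only: pos_divide_le_eq)
    then have "\<psi> \<sigma> * (c * t powr \<nu>) \<le> \<sigma> powr \<nu> * \<psi> t" by (simp only: mult_ac)
    then have "\<psi> \<sigma> \<le> \<sigma> powr \<nu> * \<psi> t / (c * t powr \<nu>)" using p c by (subst pos_le_divide_eq) auto
    also have "\<dots> = \<psi> t / c * (\<sigma> / t) powr \<nu>" using t by (simp add: powr_divide)
    finally show ?thesis .
  qed
  \<comment> \<open>One summand for each of the three ranges of \<sigma>, all independent of
    t.\<close>
  define K where "K = 1 + 1 / c + \<bar>\<psi> R\<bar> / \<psi> S / c"
  have pS: "0 < \<psi> S" using pos S by simp
  have K: "1 \<le> K" "1 / c \<le> K" "\<bar>\<psi> R\<bar> / \<psi> S / c \<le> K" using c pS by (simp_all add: K_def)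
  have "\<psi> \<sigma> \<le> K * \<psi> t * max 1 ((\<sigma> / t) powr \<nu>)" if t: "0 < t" "t \<le> S" and \<sigma>: "0 < \<sigma>" "\<sigma> \<le> R" for t \<sigma>
  proof -
    have p: "0 < \<psi> t" using pos t by simp
    have m: "1 \<le> max 1 ((\<sigma> / t) powr \<nu>)" by simp
    consider "\<sigma> \<le> t" | "t \<le> \<sigma>" "\<sigma> \<le> S" | "S < \<sigma>" by linarith
    then show ?thesis
    proof cases
      case 1
      have "\<psi> \<sigma> \<le> 1 * \<psi> t * 1" using mono[OF \<sigma>(1) 1] by simp
      also have "\<dots> \<le> K * \<psi> t * max 1 ((\<sigma> / t) powr \<nu>)" using K p m by (intro mult_mono) auto
      finally show ?thesis .
    next
      case 2
      have "\<psi> \<sigma> \<le> 1 / c * \<psi> t * (\<sigma> / t) powr \<nu>" using inner[OF t(1) 2] by simp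
      also have "\<dots> \<le> K * \<psi> t * max 1 ((\<sigma> / t) powr \<nu>)" using K p c by (intro mult_mono) auto
      finally show ?thesis .
    next
      case 3
      have "\<psi> \<sigma> \<le> \<psi> R" using mono \<sigma> by simp
      then have "\<psi> \<sigma> \<le> \<bar>\<psi> R\<bar> / \<psi> S * \<psi> S" using pS by simp
      also have "\<dots> \<le> \<bar>\<psi> R\<bar> / \<psi> S * (\<psi> t / c * (S / t) powr \<nu>)"
        using inner[OF t order_refl] pS by (intro mult_left_mono) auto
      also have "\<dots> = \<bar>\<psi> R\<bar> / \<psi> S / c * \<psi> t * (S / t) powr \<nu>" by simp
      also have "\<dots> \<le> K * \<psi> t * max 1 ((\<sigma> / t) powr \<nu>)"
      proof (intro mult_mono K order_refl)
        have "(S / t) powr \<nu> \<le> (\<sigma> / t) powr \<nu>" using 3 S t \<nu> by (intro powr_mono2) (auto intro: divide_right_mono)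
        then show "(S / t) powr \<nu> \<le> max 1 ((\<sigma> / t) powr \<nu>)" by simp
      qed (use K p in auto)
      finally show ?thesis .
    qed
  qed
  then show ?thesis using K(1) by blast
qed

lemma bias_const_nonneg: "0 < \<nu> \<Longrightarrow> 0 \<le> bias_const \<nu>"
  using powr_mono2'[of "- \<nu>" 1 4] by (simp add: bias_const_def)

section \<open>Bounds on a good sample\<close>

locale spectral_regularization = covariate_shift evl feat qX \<kappa> f \<mu> pX P \<beta> b M' bb a' Cstar
  for evl :: "'g::{real_inner,banach} \<Rightarrow> 'x::second_countable_topology \<Rightarrow> 'y::{real_inner,banach,second_countable_topology}"
    and feat :: "'x \<Rightarrow> 'h::{real_inner,banach,second_countable_topology}"
    and qX \<kappa> f \<mu> pX P \<beta> b M' bb a' Cstar +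
  fixes Co :: "'h \<Rightarrow> 'y" and \<phi> :: "real \<Rightarrow> real" and E :: "'h set" and S :: real
    and g :: "real \<Rightarrow> real \<Rightarrow> real" and Bg Dg \<gamma> :: real
  assumes source: "Cstar = Co \<circ> fun_calc \<phi> (cov_op qX feat)" and Co: "bounded_linear Co"
    and E: "orthonormal_basis E" "(\<lambda>e. (norm (Co e))\<^sup>2) summable_on E"
    and index: "index_function \<phi>" and family: "regularization_family S g Bg Dg \<gamma>" and S: "0 < S"
begin

abbreviation err where
  "err n z t x \<equiv> Cstar (feat x) - emp_cross_cov \<beta> feat n z (fun_calc (g t) (emp_cov \<beta> feat n z) (feat x))"

definition h2 :: real where "h2 = (\<Sum>\<^sub>\<infinity>e\<in>E. (norm (Co e))\<^sup>2)"

definition H :: real where "H = \<phi> (\<kappa>\<^sup>2)"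

lemma h2_nonneg: "0 \<le> h2"
  unfolding h2_def by (intro infsum_nonneg) auto

lemma \<phi>_mono: "0 \<le> x \<Longrightarrow> x \<le> y \<Longrightarrow> \<phi> x \<le> \<phi> y"
  using index unfolding index_function_def by (cases "x = y") (auto simp: strict_mono_on_def less_imp_le)

lemma \<phi>_pos: "0 < x \<Longrightarrow> 0 < \<phi> x"
  using index unfolding index_function_def by (metis atLeast_iff order_refl strict_mono_onD less_imp_le)

lemma \<phi>H: "\<bar>\<phi> (\<mu> j)\<bar> \<le> H"
  using \<phi>_pos[OF \<mu>_pos[of j]] \<phi>_mono[of "\<mu> j" "\<kappa>\<^sup>2"] \<mu>_pos[of j] \<mu>_le_\<kappa>[of j] by (simp add: H_def)

lemma C_le: "v \<bullet> C v \<le> \<kappa>\<^sup>2 * (norm v)\<^sup>2"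
  by (rule has_sum_mono[OF C_quadratic has_sum_cmult_right[OF parseval, of "\<kappa>\<^sup>2"]]) (simp add: mult_right_mono \<mu>_le_\<kappa>)

lemma H_nonneg: "0 \<le> H"
  using order_trans[OF abs_ge_zero \<phi>H] .

lemma Kno_nonneg: "0 \<le> Kno"
  using b Kn_pos by (simp add: Kno_def)

text \<open>Combines the uniform bound \<gamma> with the qualification. Taking \<Gamma> at least 1
  makes it also a bound for the residual at 0, which is 1.\<close>

lemma residual_bound:
  assumes "qualification_at_least S g \<nu>"
  shows "\<exists>\<Gamma>\<ge>1. \<forall>t\<in>{0<..S}. \<forall>\<sigma>\<in>{0<..S}. \<bar>1 - \<sigma> * g t \<sigma>\<bar> \<le> \<Gamma> * min 1 ((t / \<sigma>) powr \<nu>)"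
proof -
  obtain \<gamma>\<nu> where q: "\<And>t \<sigma>. t \<in> {0<..S} \<Longrightarrow> \<sigma> \<in> {0<..S} \<Longrightarrow> \<bar>1 - \<sigma> * g t \<sigma>\<bar> * \<sigma> powr \<nu> \<le> \<gamma>\<nu> * t powr \<nu>"
    using assms unfolding qualification_at_least_def by blast
  define \<Gamma> where "\<Gamma> = max 1 (max \<gamma> \<gamma>\<nu>)"
  have "\<bar>1 - \<sigma> * g t \<sigma>\<bar> \<le> \<Gamma> * min 1 ((t / \<sigma>) powr \<nu>)" if t: "t \<in> {0<..S}" and \<sigma>: "\<sigma> \<in> {0<..S}" for t \<sigma>
  proof -
    have "\<bar>1 - \<sigma> * g t \<sigma>\<bar> \<le> \<gamma>" using family t \<sigma> unfolding regularization_family_def by blast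
    then have 1: "\<bar>1 - \<sigma> * g t \<sigma>\<bar> \<le> \<Gamma>" by (simp add: \<Gamma>_def)
    have "\<bar>1 - \<sigma> * g t \<sigma>\<bar> * \<sigma> powr \<nu> \<le> \<Gamma> * t powr \<nu>"
      by (rule order_trans[OF q[OF t \<sigma>]]) (simp add: \<Gamma>_def mult_right_mono)
    then have "\<bar>1 - \<sigma> * g t \<sigma>\<bar> \<le> \<Gamma> * (t / \<sigma>) powr \<nu>" using t \<sigma> by (simp add: powr_divide pos_le_divide_eq)
    then show ?thesis using 1 by (simp add: min_def)
  qed
  moreover have "1 \<le> \<Gamma>" by (simp add: \<Gamma>_def)
  ultimately show ?thesis by blast
qed

text \<open>Collects what a sample has to satisfy, without reference to the filter g. The pair U,
  \<sigma> is exposed so that one spectral representation serves all estimates.\<close>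

definition good :: "nat \<Rightarrow> (nat \<Rightarrow> 'x \<times> 'y) \<Rightarrow> real \<Rightarrow> real \<Rightarrow> 'h set \<Rightarrow> ('h \<Rightarrow> real) \<Rightarrow> bool" where
  "good n z t L U \<sigma> \<longleftrightarrow> spectral_rep (emp_cov \<beta> feat n z) U \<sigma> \<and> (\<forall>u\<in>U. \<sigma> u \<le> S) \<and>
     two_ops f \<mu> C U \<sigma> (emp_cov \<beta> feat n z) t (t + L / real n) (KB * (sqrt t * (\<phi> t * sqrt L))) ((1 + KB) * (1 + \<phi> t * sqrt L)) \<and>
     noise_form \<beta> (spec_fun U \<sigma> (\<lambda>s. 1 / (s + t))) n z \<le> Kno * L * t * (\<phi> t)\<^sup>2"

text \<open>The spectrum condition holds almost surely, but the set where it holds need not be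
  measurable; a null set containing all exceptions is removed.\<close>

lemma good_event:
  assumes n: "0 < n" and t: "0 < t" "t \<le> 1" and \<delta>: "0 < \<delta>" "\<delta> < 1"
    and nt: "Psi bb \<phi> t = real n powr (- 1 / 2)"
    and spec: "AE z in PiM {..<n} (\<lambda>_. p). spectrum (emp_cov \<beta> feat n z) \<subseteq> {0..S}"
  shows "\<exists>A\<in>sets (PiM {..<n} (\<lambda>_. p)). 1 - \<delta> \<le> measure (PiM {..<n} (\<lambda>_. p)) A \<and>
    (\<forall>z\<in>A. \<exists>U \<sigma>. good n z t (ln (2 / \<delta>)) U \<sigma>)"
proof -
  let ?Pi = "PiM {..<n} (\<lambda>_. p)"
  have "(real n powr (- 1 / 2))\<^sup>2 = real n powr (- 1 / 2 + - 1 / 2)" by (simp only: power2_eq_square powr_add)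
  then have "1 / real n = (real n powr (- 1 / 2))\<^sup>2" using n by (simp add: powr_minus_divide)
  also have "\<dots> = t powr (1 + 1 / bb) * (\<phi> t)\<^sup>2"
  proof -
    have "(t powr (1 / 2 + 1 / (2 * bb)))\<^sup>2 = t powr (1 + 1 / bb)"
      using t by (simp add: powr_power algebra_simps)
    then show ?thesis unfolding nt[symmetric] Psi_def by (simp add: power_mult_distrib)
  qed
  finally have nt': "1 / real n = t powr (1 + 1 / bb) * (\<phi> t)\<^sup>2" .
  obtain A where A: "A \<in> sets ?Pi" "1 - \<delta> \<le> measure ?Pi A"
    "\<And>z U \<sigma>. z \<in> A \<Longrightarrow> spectral_rep (emp_cov \<beta> feat n z) U \<sigma> \<Longrightarrow>
      two_ops f \<mu> C U \<sigma> (emp_cov \<beta> feat n z) t (t + ln (2 / \<delta>) / real n) (KB * (sqrt t * (\<phi> t * sqrt (ln (2 / \<delta>)))))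
        ((1 + KB) * (1 + \<phi> t * sqrt (ln (2 / \<delta>)))) \<and>
      noise_form \<beta> (spec_fun U \<sigma> (\<lambda>s. 1 / (s + t))) n z \<le> Kno * ln (2 / \<delta>) * t * (\<phi> t)\<^sup>2"
    using sample_event[OF n t \<phi>_pos[OF t(1)] \<delta> nt' refl] by blast
  obtain N where N: "{z \<in> space ?Pi. \<not> spectrum (emp_cov \<beta> feat n z) \<subseteq> {0..S}} \<subseteq> N" "N \<in> null_sets ?Pi"
    using spec by (auto elim!: AE_E intro: that simp: null_sets_def)
  have "\<exists>U \<sigma>. good n z t (ln (2 / \<delta>)) U \<sigma>" if z: "z \<in> A - N" for z
  proof -
    obtain U \<sigma> where rep: "spectral_rep (emp_cov \<beta> feat n z) U \<sigma>"
      using emp_cov_spectral_rep[where w = \<beta> and feat = feat and n = n and z = z, OF \<beta>(2)] by blast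
    have "z \<in> space ?Pi" using z sets.sets_into_space[OF A(1)] by blast
    then have "spectrum (emp_cov \<beta> feat n z) \<subseteq> {0..S}" using z N by blast
    then have "\<forall>u\<in>U. \<sigma> u \<le> S" using spectral_rep_in_spectrum[OF rep] by (meson atLeastAtMost_iff subsetD)
    then show ?thesis unfolding good_def using rep A(3)[OF _ rep] z by blast
  qed
  moreover have "A - N \<in> sets ?Pi" using A N by auto
  moreover have "measure ?Pi (A - N) = measure ?Pi A" using A(1) N(2) by (rule measure_Diff_null_set)
  ultimately show ?thesis using A(2) by (intro bexI[of _ "A - N"]) auto
qed

context
  fixes n z t L U \<sigma>
  assumes good: "good n z t L U \<sigma>" and n: "0 < n" and t: "0 < t" "t \<le> 1" "t \<le> S" and L: "1 / 2 \<le> L"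
begin

lemma good_rep: "spectral_rep (emp_cov \<beta> feat n z) U \<sigma>"
  using good by (simp add: good_def)

interpretation V: two_ops f \<mu> C U \<sigma> "emp_cov \<beta> feat n z" t "t + L / real n" "KB * (sqrt t * (\<phi> t * sqrt L))" "(1 + KB) * (1 + \<phi> t * sqrt L)"
  using good by (simp add: good_def)

lemma good_\<sigma>: "u \<in> U \<Longrightarrow> \<sigma> u \<in> {0<..S}"
  using good V.\<sigma>_pos by (simp add: good_def)

text \<open>With L at least 1/2, lower powers of L are absorbed into higher ones, so that the final
  bound carries the single factor L.\<close>

lemma L_facts: "0 < L" "sqrt L \<le> 2 * L" "L \<le> 2 * L\<^sup>2"
proof -
  show L0: "0 < L" using L by simp
  have "1 * L \<le> 2 * L * L" using L by (intro mult_right_mono) auto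
  then show 2: "L \<le> 2 * L\<^sup>2" by (simp add: power2_eq_square)
  show "sqrt L \<le> 2 * L" using L0 2 by (intro real_le_lsqrt) (auto simp: power_mult_distrib)
qed

lemma \<phi>t: "0 < \<phi> t" "\<phi> t \<le> \<phi> 1"
  using \<phi>_pos \<phi>_mono t by auto

text \<open>Up to constants, the product of the comparison constant and the relative deviation. It
  is linear in \<open>\<phi> t * L\<close> because \<open>\<phi> t\<close> is at most
  \<open>\<phi> 1\<close>.\<close>

lemma eps_le: "(1 + \<phi> t * sqrt L) * (\<phi> t * sqrt L) \<le> (2 + \<phi> 1) * (\<phi> t * L)"
proof -
  have "\<phi> t * (\<phi> t * L) \<le> \<phi> 1 * (\<phi> t * L)" using \<phi>t L_facts by (intro mult_right_mono) auto
  moreover have "\<phi> t * sqrt L \<le> 2 * (\<phi> t * L)"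
    using mult_left_mono[OF L_facts(2), of "\<phi> t"] \<phi>t by simp
  moreover have "(1 + \<phi> t * sqrt L) * (\<phi> t * sqrt L) = \<phi> t * sqrt L + \<phi> t * (\<phi> t * (sqrt L * sqrt L))"
    by (simp only: algebra_simps)
  moreover have "sqrt L * sqrt L = L" using L_facts by simp
  ultimately show ?thesis unfolding distrib_right[of 2 "\<phi> 1"] by simp
qed

lemma good_bias:
  assumes \<nu>: "0 < \<nu>" and K: "1 \<le> K" and \<Gamma>: "0 \<le> \<Gamma>"
    and growth: "\<And>j. \<phi> (\<mu> j) \<le> K * \<phi> t * max 1 ((\<mu> j / t) powr \<nu>)"
    and r: "\<And>u. u \<in> U \<Longrightarrow> \<bar>r (\<sigma> u)\<bar> \<le> \<Gamma> * min 1 ((t / \<sigma> u) powr \<nu>)" and r0: "\<bar>r 0\<bar> \<le> \<Gamma>"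
  shows "norm (V.F r (fun_calc \<phi> C v)) \<le> \<Gamma> * bias_const \<nu> * (2 * K + KB * (1 + KB) * (2 + \<phi> 1) * H) * (\<phi> t * L) * norm v"
proof -
  let ?e = "\<phi> t * sqrt L"
  have KP: "0 \<le> K * \<phi> t" using K \<phi>t by simp
  have "norm (V.F r (fun_calc \<phi> C v)) \<le> \<Gamma> * bias_const \<nu> * (K * \<phi> t + ((1 + KB) * (1 + ?e)) * (KB * (sqrt t * ?e)) / sqrt t * H) * norm v"
    using growth \<phi>_pos[OF \<mu>_pos] by (intro V.bias_bound \<nu> KP \<Gamma> \<phi>H r r0) (auto simp: abs_of_pos)
  also have "\<dots> \<le> \<Gamma> * bias_const \<nu> * ((2 * K + KB * (1 + KB) * (2 + \<phi> 1) * H) * (\<phi> t * L)) * norm v"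
  proof (intro mult_right_mono mult_left_mono)
    have "((1 + KB) * (1 + ?e)) * (KB * (sqrt t * ?e)) / sqrt t * H = KB * (1 + KB) * H * ((1 + ?e) * ?e)"
      using t by simp
    also have "\<dots> \<le> KB * (1 + KB) * H * ((2 + \<phi> 1) * (\<phi> t * L))"
      using KB_nonneg H_nonneg by (intro mult_left_mono eps_le) auto
    finally have 1: "((1 + KB) * (1 + ?e)) * (KB * (sqrt t * ?e)) / sqrt t * H \<le> KB * (1 + KB) * H * ((2 + \<phi> 1) * (\<phi> t * L))" .
    have "K * \<phi> t * 1 \<le> K * \<phi> t * (2 * L)" using KP L by (intro mult_left_mono) auto
    then show "K * \<phi> t + ((1 + KB) * (1 + ?e)) * (KB * (sqrt t * ?e)) / sqrt t * H \<le> (2 * K + KB * (1 + KB) * (2 + \<phi> 1) * H) * (\<phi> t * L)"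
      using 1 by (simp add: algebra_simps)
  qed (use \<Gamma> bias_const_nonneg[OF \<nu>] in auto)
  finally show ?thesis by (simp add: mult_ac)
qed

text \<open>Adding two bounds of the family shows that the absolute value of g times
  \<open>\<sigma> u + t\<close> is at most \<open>Bg + Dg\<close>; both claims are products of such
  bounds.\<close>

lemma good_filter:
  assumes "u \<in> U"
  shows "(g t (\<sigma> u))\<^sup>2 * (\<sigma> u + t) \<le> Bg * (Bg + Dg) / t" "(g t (\<sigma> u) * (\<sigma> u + t))\<^sup>2 \<le> (Bg + Dg)\<^sup>2"
proof -
  have fam: "\<bar>\<sigma> u * g t (\<sigma> u)\<bar> \<le> Dg" "\<bar>g t (\<sigma> u)\<bar> \<le> Bg / t" "0 < Bg" "0 < Dg"
    using family good_\<sigma>[OF assms] t unfolding regularization_family_def by auto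
  have \<sigma>: "0 < \<sigma> u" using V.\<sigma>_pos[OF assms] .
  have "\<bar>g t (\<sigma> u)\<bar> * t \<le> Bg" using fam(2) t by (simp add: pos_le_divide_eq)
  then have a: "\<bar>g t (\<sigma> u)\<bar> * (\<sigma> u + t) \<le> Bg + Dg" using fam(1) \<sigma> by (simp add: abs_mult algebra_simps)
  have "(g t (\<sigma> u))\<^sup>2 * (\<sigma> u + t) = \<bar>g t (\<sigma> u)\<bar> * (\<bar>g t (\<sigma> u)\<bar> * (\<sigma> u + t))"
    by (simp add: power2_eq_square mult.assoc[symmetric])
  also have "\<dots> \<le> Bg / t * (Bg + Dg)" using a fam t \<sigma> by (intro mult_mono) auto
  finally show "(g t (\<sigma> u))\<^sup>2 * (\<sigma> u + t) \<le> Bg * (Bg + Dg) / t" by simp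
  have "\<bar>g t (\<sigma> u) * (\<sigma> u + t)\<bar> \<le> Bg + Dg" using a \<sigma> t by (simp add: abs_mult)
  then show "(g t (\<sigma> u) * (\<sigma> u + t))\<^sup>2 \<le> (Bg + Dg)\<^sup>2" by (rule power2_le_iff_abs_le[THEN iffD2, rotated]) (use fam in simp)
qed

lemma good_error_element:
  assumes M: "0 \<le> M" "\<And>v. norm (V.F (\<lambda>s. 1 - s * g t s) (fun_calc \<phi> C v)) \<le> M * norm v"
    and M2: "\<And>v. V.F (\<lambda>s. 1 - s * g t s) (fun_calc \<phi> C v) \<bullet> C (V.F (\<lambda>s. 1 - s * g t s) (fun_calc \<phi> C v)) \<le> M2 * (norm v)\<^sup>2"
  shows "\<exists>e. evl e = err n z t \<and> evl e \<in> borel_measurable borel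
    \<and> norm e \<le> M * sqrt h2 + 2 * sqrt (Bg * (Bg + Dg) * Kno) * (\<phi> t * L)
    \<and> sqL2 e \<le> 4 * (M2 * h2) + 2 * ((1 + KB)\<^sup>2 * (Bg + Dg)\<^sup>2 * Kno * (2 + \<phi> 1)\<^sup>2) * (t * (\<phi> t * L)\<^sup>2)"
proof -
  let ?N = "Kno * L * t * (\<phi> t)\<^sup>2" and ?w = "(1 + KB) * (1 + \<phi> t * sqrt L)"
  have N: "noise_form \<beta> (V.F (\<lambda>s. 1 / (s + t))) n z \<le> ?N" using good by (simp add: good_def)
  have BD: "0 < Bg" "0 < Dg" using family by (auto simp: regularization_family_def)
  have ops: "two_ops f \<mu> C U \<sigma> (emp_cov \<beta> feat n z) t (t + L / real n) (KB * (sqrt t * (\<phi> t * sqrt L))) ?w"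
    using good by (simp add: good_def)
  have t': "0 \<le> t + L / real n" using t L_facts by simp
  have c: "0 \<le> Bg * (Bg + Dg) / t" using BD t by simp
  obtain e where e: "evl e = err n z t" "evl e \<in> borel_measurable borel"
      "norm e \<le> M * sqrt h2 + sqrt (Bg * (Bg + Dg) / t * ?N)" "sqL2 e \<le> 4 * (M2 * h2) + 2 * (?w\<^sup>2 * (Bg + Dg)\<^sup>2 * ?N)"
    using error_element[OF good_rep ops t' source \<phi>H Co E M M2 c good_filter(1) zero_le_power2 good_filter(2) N]
    unfolding h2_def by blast
  have "Bg * (Bg + Dg) / t * ?N = Bg * (Bg + Dg) * Kno * (L * (\<phi> t)\<^sup>2)" using t by simp
  then have "sqrt (Bg * (Bg + Dg) / t * ?N) = sqrt (Bg * (Bg + Dg) * Kno) * (sqrt L * \<phi> t)"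
    using \<phi>t by (simp only: real_sqrt_mult real_sqrt_abs abs_of_pos)
  also have "\<dots> \<le> sqrt (Bg * (Bg + Dg) * Kno) * (2 * L * \<phi> t)"
    using \<phi>t L_facts BD Kno_nonneg by (intro mult_left_mono mult_right_mono) auto
  finally have 1: "sqrt (Bg * (Bg + Dg) / t * ?N) \<le> 2 * sqrt (Bg * (Bg + Dg) * Kno) * (\<phi> t * L)" by (simp add: mult_ac)
  have "?w\<^sup>2 * (Bg + Dg)\<^sup>2 * ?N = (1 + KB)\<^sup>2 * (Bg + Dg)\<^sup>2 * Kno * t * ((1 + \<phi> t * sqrt L) * (\<phi> t * sqrt L))\<^sup>2"
    using L_facts by (simp add: power_mult_distrib mult_ac)
  also have "\<dots> \<le> (1 + KB)\<^sup>2 * (Bg + Dg)\<^sup>2 * Kno * t * ((2 + \<phi> 1) * (\<phi> t * L))\<^sup>2"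
    using \<phi>t L_facts t Kno_nonneg by (intro mult_left_mono power_mono eps_le) auto
  also have "\<dots> = (1 + KB)\<^sup>2 * (Bg + Dg)\<^sup>2 * Kno * (2 + \<phi> 1)\<^sup>2 * (t * (\<phi> t * L)\<^sup>2)" by (simp add: power_mult_distrib mult_ac)
  finally have 2: "?w\<^sup>2 * (Bg + Dg)\<^sup>2 * ?N \<le> \<dots>" .
  have "norm e \<le> M * sqrt h2 + 2 * sqrt (Bg * (Bg + Dg) * Kno) * (\<phi> t * L)" using e(3) 1 by linarith
  moreover have "sqL2 e \<le> 4 * (M2 * h2) + 2 * ((1 + KB)\<^sup>2 * (Bg + Dg)\<^sup>2 * Kno * (2 + \<phi> 1)\<^sup>2) * (t * (\<phi> t * L)\<^sup>2)"
    using e(4) 2 by linarith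
  ultimately show ?thesis using e(1,2) by blast
qed

end

end

lemma ln_two_div_ge: "0 < \<delta> \<Longrightarrow> \<delta> < 1 \<Longrightarrow> 1 / 2 \<le> ln (2 / \<delta>)"
  for \<delta> :: real
proof -
  assume \<delta>: "0 < \<delta>" "\<delta> < 1"
  have "1 / 2 \<le> ln (2::real)" using ln_2_less_1 ln_add_one_self_le_self2[of "-1/2"] by (simp add: ln_div)
  also have "ln 2 \<le> ln (2 / \<delta>)" using \<delta> by (subst ln_le_cancel_iff) (auto simp: pos_le_divide_eq)
  finally show ?thesis .
qed

section \<open>Convergence rates in both norms\<close>

context spectral_regularization
begin

text \<open>Growth of \<phi> and decay of the residual carry the same exponent \<nu>, as the dyadic
  comparison requires. The growth is taken up to \<open>\<kappa>\<^sup>2\<close>, the bound for the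
  eigenvalues of C, which may exceed S.\<close>

lemma rate_norm:
  assumes cov: "covers S \<nu> \<phi>" and qual: "qualification_at_least S g \<nu>"
  shows "\<exists>c1>0. \<forall>n \<delta> t. 0 < n \<and> \<delta> \<in> {0<..<1} \<and> t \<in> {0<..1} \<and> t \<le> S \<and> Psi bb \<phi> t = real n powr (- 1 / 2) \<and>
      (AE z in PiM {..<n} (\<lambda>_. p). spectrum (emp_cov \<beta> feat n z) \<subseteq> {0..S}) \<longrightarrow>
      (\<exists>A\<in>sets (PiM {..<n} (\<lambda>_. p)). 1 - \<delta> \<le> measure (PiM {..<n} (\<lambda>_. p)) A \<and>
        (\<forall>z\<in>A. \<exists>e. evl e = err n z t \<and> norm e \<le> c1 * \<phi> t * ln (2 / \<delta>)))"
proof -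
  have \<nu>: "0 < \<nu>" using qual by (simp add: qualification_at_least_def)
  obtain \<Gamma> where \<Gamma>: "1 \<le> \<Gamma>" "\<And>t \<sigma>. t \<in> {0<..S} \<Longrightarrow> \<sigma> \<in> {0<..S} \<Longrightarrow> \<bar>1 - \<sigma> * g t \<sigma>\<bar> \<le> \<Gamma> * min 1 ((t / \<sigma>) powr \<nu>)"
    using residual_bound[OF qual] by blast
  obtain K where K: "1 \<le> K" "\<And>t \<sigma>. 0 < t \<Longrightarrow> t \<le> S \<Longrightarrow> 0 < \<sigma> \<Longrightarrow> \<sigma> \<le> \<kappa>\<^sup>2 \<Longrightarrow> \<phi> \<sigma> \<le> K * \<phi> t * max 1 ((\<sigma> / t) powr \<nu>)"
    using covers_growth[OF cov S \<nu> \<phi>_pos \<phi>_mono, of "\<kappa>\<^sup>2"] by (meson less_imp_le)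
  define m where "m = \<Gamma> * bias_const \<nu> * (2 * K + KB * (1 + KB) * (2 + \<phi> 1) * H)"
  define c1 where "c1 = m * sqrt h2 + 2 * sqrt (Bg * (Bg + Dg) * Kno) + 1"
  have BD: "0 < Bg" "0 < Dg" using family by (auto simp: regularization_family_def)
  have m: "0 \<le> m" unfolding m_def using \<Gamma>(1) K(1) bias_const_nonneg[OF \<nu>] KB_nonneg H_nonneg \<phi>_pos[of 1] by simp
  have "0 < c1" unfolding c1_def using m BD Kno_nonneg h2_nonneg
    by (intro add_nonneg_pos add_nonneg_nonneg mult_nonneg_nonneg) auto
  moreover have "\<exists>A\<in>sets (PiM {..<n} (\<lambda>_. p)). 1 - \<delta> \<le> measure (PiM {..<n} (\<lambda>_. p)) A \<and>
        (\<forall>z\<in>A. \<exists>e. evl e = err n z t \<and> norm e \<le> c1 * \<phi> t * ln (2 / \<delta>))"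
    if h: "0 < n" "\<delta> \<in> {0<..<1}" "t \<in> {0<..1}" "t \<le> S" "Psi bb \<phi> t = real n powr (- 1 / 2)"
      "AE z in PiM {..<n} (\<lambda>_. p). spectrum (emp_cov \<beta> feat n z) \<subseteq> {0..S}" for n \<delta> t
  proof -
    define L where "L = ln (2 / \<delta>)"
    have t: "0 < t" "t \<le> 1" and \<delta>: "0 < \<delta>" "\<delta> < 1" using h by auto
    have L: "1 / 2 \<le> L" unfolding L_def by (rule ln_two_div_ge[OF \<delta>])
    have pL: "0 \<le> \<phi> t * L" using \<phi>_pos[OF t(1)] L by simp
    have "\<exists>e. evl e = err n z t \<and> norm e \<le> c1 * \<phi> t * L" if good: "good n z t L U \<sigma>" for z U \<sigma>
    proof -
      note \<sigma> = good_\<sigma>[OF good h(1) t h(4) L]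
      let ?A = "\<lambda>v. spec_fun U \<sigma> (\<lambda>s. 1 - s * g t s) (fun_calc \<phi> C v)"
      have M: "norm (?A v) \<le> m * (\<phi> t * L) * norm v" for v
        unfolding m_def
      proof (rule good_bias[OF good h(1) t h(4) L \<nu> K(1)])
        show "\<phi> (\<mu> j) \<le> K * \<phi> t * max 1 ((\<mu> j / t) powr \<nu>)" for j by (rule K(2)[OF t(1) h(4) \<mu>_pos \<mu>_le_\<kappa>])
        show "\<bar>1 - \<sigma> u * g t (\<sigma> u)\<bar> \<le> \<Gamma> * min 1 ((t / \<sigma> u) powr \<nu>)" if "u \<in> U" for u
          using \<Gamma>(2)[OF _ \<sigma>[OF that]] t h(4) by simp
      qed (use \<Gamma> in auto)
      have M2: "?A v \<bullet> C (?A v) \<le> (\<kappa>\<^sup>2 * (m * (\<phi> t * L))\<^sup>2) * (norm v)\<^sup>2" for v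
      proof -
        have "?A v \<bullet> C (?A v) \<le> \<kappa>\<^sup>2 * (norm (?A v))\<^sup>2" by (rule C_le)
        also have "\<dots> \<le> \<kappa>\<^sup>2 * (m * (\<phi> t * L) * norm v)\<^sup>2" by (intro mult_left_mono power_mono M) auto
        finally show ?thesis by (simp add: power_mult_distrib mult_ac)
      qed
      obtain e where e: "evl e = err n z t" "norm e \<le> m * (\<phi> t * L) * sqrt h2 + 2 * sqrt (Bg * (Bg + Dg) * Kno) * (\<phi> t * L)"
        using good_error_element[OF good h(1) t h(4) L _ M M2] m pL by auto
      have "norm e \<le> c1 * \<phi> t * L" using e(2) pL by (simp add: c1_def algebra_simps)
      then show ?thesis using e(1) by blast
    qed
    then show ?thesis using good_event[OF h(1) t \<delta> h(5,6)] unfolding L_def by meson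
  qed
  ultimately show ?thesis by blast
qed

text \<open>Covering \<open>\<phi>(t) \<surd>t\<close> forces \<open>\<nu> > 1/2\<close>: otherwise \<open>\<phi>\<close> would be bounded below near \<open>0\<close>.\<close>

lemma covers_sqrt:
  assumes cov: "covers S \<nu> (\<lambda>t. \<phi> t * sqrt t)" and \<nu>: "0 < \<nu>"
  shows "1 / 2 < \<nu>"
    and "\<exists>K\<ge>1. \<forall>t. 0 < t \<and> t \<le> S \<longrightarrow> (\<forall>j. \<phi> (\<mu> j) \<le> K * \<phi> t * max 1 ((\<mu> j / t) powr (\<nu> - 1 / 2)))"
proof -
  have pos: "0 < \<phi> x * sqrt x" if "0 < x" for x using \<phi>_pos[OF that] that by simp
  have mono: "\<phi> x * sqrt x \<le> \<phi> y * sqrt y" if "0 < x" "x \<le> y" for x y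
    using \<phi>_mono[of x y] \<phi>_pos[of x] \<phi>_pos[of y] that by (intro mult_mono) auto
  note growth = covers_growth[OF cov S \<nu> pos mono]
  show half: "1 / 2 < \<nu>"
  proof (rule ccontr)
    assume "\<not> 1 / 2 < \<nu>"
    then have \<nu>2: "\<nu> \<le> 1 / 2" by simp
    obtain K where K: "1 \<le> K" "\<And>t. 0 < t \<Longrightarrow> t \<le> S \<Longrightarrow> \<phi> S * sqrt S \<le> K * (\<phi> t * sqrt t) * max 1 ((S / t) powr \<nu>)"
      using growth[of S] S by blast
    \<comment> \<open>With \<nu> at most 1/2 the factor \<open>(S / t) powr \<nu>\<close> is at most
      \<open>sqrt S / sqrt t\<close>, which cancels the square root of t.\<close>
    have low: "\<phi> S / K \<le> \<phi> t" if t: "0 < t" "t \<le> S" for t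
    proof -
      have 1: "1 \<le> S / t" using t by simp
      have "max 1 ((S / t) powr \<nu>) = (S / t) powr \<nu>" using ge_one_powr_ge_zero[OF 1, of \<nu>] \<nu> by simp
      also have "\<dots> \<le> (S / t) powr (1 / 2)" using 1 \<nu>2 by (intro powr_mono) auto
      also have "\<dots> = sqrt S / sqrt t" using S t by (simp add: powr_half_sqrt real_sqrt_divide)
      finally have "K * (\<phi> t * sqrt t) * max 1 ((S / t) powr \<nu>) \<le> K * (\<phi> t * sqrt t) * (sqrt S / sqrt t)"
        using K(1) pos[OF t(1)] by (intro mult_left_mono) auto
      moreover have "K * (\<phi> t * sqrt t) * (sqrt S / sqrt t) = K * \<phi> t * sqrt S" using t by simp
      ultimately have "\<phi> S * sqrt S \<le> K * \<phi> t * sqrt S" using K(2)[OF t] by linarith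
      then show ?thesis using S K(1) by (simp add: pos_divide_le_eq mult.commute)
    qed
    have "\<phi> S / K > 0" using \<phi>_pos[OF S] K(1) by simp
    moreover have "continuous (at 0 within {0..}) \<phi>" "\<phi> 0 = 0"
      using index by (auto simp: index_function_def continuous_on_eq_continuous_within)
    ultimately obtain d where d: "0 < d" "\<And>x. 0 \<le> x \<Longrightarrow> x < d \<Longrightarrow> \<bar>\<phi> x\<bar> < \<phi> S / K"
      unfolding continuous_within_eps_delta by (force simp: dist_real_def)
    have "\<bar>\<phi> (min (d / 2) S)\<bar> < \<phi> S / K" using d S by (intro d(2)) (auto simp: min_def)
    moreover have "\<phi> S / K \<le> \<phi> (min (d / 2) S)" using d S by (intro low) auto
    ultimately show False by linarith
  qed
  obtain K where K: "1 \<le> K" "\<And>t \<sigma>. 0 < t \<Longrightarrow> t \<le> S \<Longrightarrow> 0 < \<sigma> \<Longrightarrow> \<sigma> \<le> \<kappa>\<^sup>2 \<Longrightarrow>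
      \<phi> \<sigma> * sqrt \<sigma> \<le> K * (\<phi> t * sqrt t) * max 1 ((\<sigma> / t) powr \<nu>)"
    using growth[of "\<kappa>\<^sup>2"] by meson
  have "\<phi> (\<mu> j) \<le> K * \<phi> t * max 1 ((\<mu> j / t) powr (\<nu> - 1 / 2))" if t: "0 < t" "t \<le> S" for t j
  proof (cases "\<mu> j \<le> t")
    case True
    have "\<phi> (\<mu> j) \<le> 1 * \<phi> t * 1" using \<phi>_mono[OF _ True] \<mu>_pos[of j] by simp
    also have "\<dots> \<le> K * \<phi> t * max 1 ((\<mu> j / t) powr (\<nu> - 1 / 2))" using K(1) \<phi>_pos[OF t(1)] by (intro mult_mono) auto
    finally show ?thesis .
  next
    case False
    then have 1: "1 \<le> \<mu> j / t" and m: "0 < \<mu> j" using t by auto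
    have "max 1 ((\<mu> j / t) powr \<nu>) = (\<mu> j / t) powr (1 / 2 + (\<nu> - 1 / 2))" using ge_one_powr_ge_zero[OF 1, of \<nu>] \<nu> by simp
    also have "\<dots> = sqrt (\<mu> j) / sqrt t * (\<mu> j / t) powr (\<nu> - 1 / 2)"
      unfolding powr_add using t m by (simp add: powr_half_sqrt real_sqrt_divide)
    finally have "\<phi> (\<mu> j) * sqrt (\<mu> j) \<le> K * (\<phi> t * sqrt t) * (sqrt (\<mu> j) / sqrt t * (\<mu> j / t) powr (\<nu> - 1 / 2))"
      using K(2)[OF t m \<mu>_le_\<kappa>] by simp
    also have "\<dots> = K * \<phi> t * (\<mu> j / t) powr (\<nu> - 1 / 2) * sqrt (\<mu> j)" using t by simp
    finally have "\<phi> (\<mu> j) \<le> K * \<phi> t * (\<mu> j / t) powr (\<nu> - 1 / 2)" using m by (simp only: mult_le_cancel_right) auto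
    also have "\<dots> \<le> K * \<phi> t * max 1 ((\<mu> j / t) powr (\<nu> - 1 / 2))" using K(1) \<phi>_pos[OF t(1)] by (intro mult_left_mono) auto
    finally show ?thesis .
  qed
  then show "\<exists>K\<ge>1. \<forall>t. 0 < t \<and> t \<le> S \<longrightarrow> (\<forall>j. \<phi> (\<mu> j) \<le> K * \<phi> t * max 1 ((\<mu> j / t) powr (\<nu> - 1 / 2)))"
    using K(1) by blast
qed

text \<open>Absorbing \<open>sqrt ((s + t) / t)\<close> into the residual costs half a power of the
  qualification. Covering \<open>\<phi> t * sqrt t\<close> gives back the same half: growth of
  \<phi> and decay of the modified residual are matched with exponent
  \<open>\<nu> - 1 / 2\<close>.\<close>

lemma rate_L2:
  assumes cov: "covers S \<nu> (\<lambda>t. \<phi> t * sqrt t)" and qual: "qualification_at_least S g \<nu>"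
  shows "\<exists>c2>0. \<forall>n \<delta> t. 0 < n \<and> \<delta> \<in> {0<..<1} \<and> t \<in> {0<..1} \<and> t \<le> S \<and> Psi bb \<phi> t = real n powr (- 1 / 2) \<and>
      (AE z in PiM {..<n} (\<lambda>_. p). spectrum (emp_cov \<beta> feat n z) \<subseteq> {0..S}) \<longrightarrow>
      (\<exists>A\<in>sets (PiM {..<n} (\<lambda>_. p)). 1 - \<delta> \<le> measure (PiM {..<n} (\<lambda>_. p)) A \<and>
        (\<forall>z\<in>A. \<exists>e. evl e = err n z t \<and> evl e \<in> borel_measurable borel \<and> sqrt (sqL2 e) \<le> c2 * sqrt t * \<phi> t * ln (2 / \<delta>)))"
proof -
  have \<nu>: "0 < \<nu>" using qual by (simp add: qualification_at_least_def)
  obtain \<Gamma> where \<Gamma>: "1 \<le> \<Gamma>" "\<And>t \<sigma>. t \<in> {0<..S} \<Longrightarrow> \<sigma> \<in> {0<..S} \<Longrightarrow> \<bar>1 - \<sigma> * g t \<sigma>\<bar> \<le> \<Gamma> * min 1 ((t / \<sigma>) powr \<nu>)"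
    using residual_bound[OF qual] by blast
  have \<nu>2: "0 < \<nu> - 1 / 2" using covers_sqrt(1)[OF cov \<nu>] by simp
  obtain K where K: "1 \<le> K" "\<And>t j. 0 < t \<Longrightarrow> t \<le> S \<Longrightarrow> \<phi> (\<mu> j) \<le> K * \<phi> t * max 1 ((\<mu> j / t) powr (\<nu> - 1 / 2))"
    using covers_sqrt(2)[OF cov \<nu>] by blast
  \<comment> \<open>The \<open>sqrt 2\<close> bounds \<open>sqrt ((s + t) / t)\<close> by a multiple
    of the larger of 1 and \<open>sqrt (s / t)\<close>.\<close>
  define G where "G = sqrt 2 * \<Gamma>"
  define m where "m = G * bias_const (\<nu> - 1 / 2) * (2 * K + KB * (1 + KB) * (2 + \<phi> 1) * H)"
  define mc where "mc = 4 * (1 + KB)\<^sup>2 * (m\<^sup>2 + 2 * (G * H)\<^sup>2)"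
  define nc where "nc = (1 + KB)\<^sup>2 * (Bg + Dg)\<^sup>2 * Kno * (2 + \<phi> 1)\<^sup>2"
  define c2 where "c2 = sqrt (4 * mc * h2 + 2 * nc) + 1"
  have G1: "1 \<le> G" using \<Gamma>(1) mult_mono[of 1 "sqrt 2" 1 \<Gamma>] by (simp add: G_def)
  have m: "0 \<le> m" unfolding m_def using G1 K(1) bias_const_nonneg[OF \<nu>2] KB_nonneg H_nonneg \<phi>_pos[of 1] by simp
  have mc: "0 \<le> mc" and nc: "0 \<le> nc" using Kno_nonneg by (simp_all add: mc_def nc_def)
  have c2: "0 < c2" "4 * mc * h2 + 2 * nc \<le> c2\<^sup>2"
    using mc nc h2_nonneg by (auto simp: c2_def add_nonneg_pos power2_sum)
  have "\<exists>A\<in>sets (PiM {..<n} (\<lambda>_. p)). 1 - \<delta> \<le> measure (PiM {..<n} (\<lambda>_. p)) A \<and>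
        (\<forall>z\<in>A. \<exists>e. evl e = err n z t \<and> evl e \<in> borel_measurable borel \<and> sqrt (sqL2 e) \<le> c2 * sqrt t * \<phi> t * ln (2 / \<delta>))"
    if h: "0 < n" "\<delta> \<in> {0<..<1}" "t \<in> {0<..1}" "t \<le> S" "Psi bb \<phi> t = real n powr (- 1 / 2)"
      "AE z in PiM {..<n} (\<lambda>_. p). spectrum (emp_cov \<beta> feat n z) \<subseteq> {0..S}" for n \<delta> t
  proof -
    define L where "L = ln (2 / \<delta>)"
    have t: "0 < t" "t \<le> 1" and \<delta>: "0 < \<delta>" "\<delta> < 1" using h by auto
    have L: "1 / 2 \<le> L" unfolding L_def by (rule ln_two_div_ge[OF \<delta>])
    have ph: "0 < \<phi> t" using \<phi>_pos[OF t(1)] .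
    have pL: "0 \<le> \<phi> t * L" using ph L by simp
    let ?d = "\<phi> t * sqrt L" and ?q = "\<phi> t * L"
    have "\<exists>e. evl e = err n z t \<and> evl e \<in> borel_measurable borel \<and> sqrt (sqL2 e) \<le> c2 * sqrt t * \<phi> t * L"
      if good: "good n z t L U \<sigma>" for z U \<sigma>
    proof -
      interpret V: two_ops f \<mu> C U \<sigma> "emp_cov \<beta> feat n z" t "t + L / real n" "KB * (sqrt t * ?d)" "(1 + KB) * (1 + ?d)"
        using good by (simp add: good_def)
      note \<sigma> = good_\<sigma>[OF good h(1) t h(4) L]
      let ?A = "\<lambda>v. spec_fun U \<sigma> (\<lambda>s. 1 - s * g t s) (fun_calc \<phi> C v)"
      define r where "r s = (1 - s * g t s) * sqrt ((s + t) / t)" for s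
      have r: "\<bar>r (\<sigma> u)\<bar> \<le> G * min 1 ((t / \<sigma> u) powr (\<nu> - 1 / 2))" if u: "u \<in> U" for u
      proof -
        have s: "0 < \<sigma> u" using V.\<sigma>_pos[OF u] .
        have ra: "\<bar>r (\<sigma> u)\<bar> = \<bar>1 - \<sigma> u * g t (\<sigma> u)\<bar> * sqrt ((\<sigma> u + t) / t)"
          using s t by (simp add: r_def abs_mult)
        have G2: "\<bar>1 - \<sigma> u * g t (\<sigma> u)\<bar> \<le> \<Gamma> * min 1 ((t / \<sigma> u) powr \<nu>)" using \<Gamma>(2)[OF _ \<sigma>[OF u]] t h(4) by simp
        show ?thesis
        proof (cases "\<sigma> u \<le> t")
          case True
          have 1: "1 \<le> t / \<sigma> u" using True s by simp
          have "\<bar>1 - \<sigma> u * g t (\<sigma> u)\<bar> \<le> \<Gamma> * 1" by (rule order_trans[OF G2]) (use \<Gamma>(1) in \<open>intro mult_left_mono, auto\<close>)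
          moreover have "sqrt ((\<sigma> u + t) / t) \<le> sqrt 2" using True t by (simp add: pos_divide_le_eq)
          ultimately have "\<bar>r (\<sigma> u)\<bar> \<le> \<Gamma> * 1 * sqrt 2" unfolding ra using \<Gamma>(1) s t by (intro mult_mono) auto
          moreover have "min 1 ((t / \<sigma> u) powr (\<nu> - 1 / 2)) = 1" using ge_one_powr_ge_zero[OF 1, of "\<nu> - 1 / 2"] \<nu>2 by simp
          ultimately show ?thesis by (simp add: G_def mult.commute)
        next
          case False
          have 1: "t / \<sigma> u \<le> 1" using False s by simp
          have "\<bar>1 - \<sigma> u * g t (\<sigma> u)\<bar> \<le> \<Gamma> * (t / \<sigma> u) powr \<nu>" by (rule order_trans[OF G2]) (use \<Gamma>(1) in \<open>intro mult_left_mono, auto\<close>)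
          moreover have "sqrt ((\<sigma> u + t) / t) \<le> sqrt (2 * (\<sigma> u / t))" using False t by (intro real_sqrt_le_mono) (simp add: divide_right_mono)
          ultimately have "\<bar>r (\<sigma> u)\<bar> \<le> \<Gamma> * (t / \<sigma> u) powr \<nu> * sqrt (2 * (\<sigma> u / t))" unfolding ra using \<Gamma>(1) s t by (intro mult_mono) auto
          also have "\<dots> = G * ((t / \<sigma> u) powr \<nu> * sqrt (\<sigma> u / t))" by (simp only: real_sqrt_mult G_def mult_ac)
          also have "sqrt (\<sigma> u / t) = (t / \<sigma> u) powr (- 1 / 2)" using s t
            by (simp add: powr_minus_divide powr_half_sqrt real_sqrt_divide)
          also have "(t / \<sigma> u) powr \<nu> * (t / \<sigma> u) powr (- 1 / 2) = (t / \<sigma> u) powr (\<nu> - 1 / 2)"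
            by (simp add: powr_add[symmetric])
          also have "(t / \<sigma> u) powr (\<nu> - 1 / 2) = min 1 ((t / \<sigma> u) powr (\<nu> - 1 / 2))"
            using powr_le1[of "\<nu> - 1 / 2" "t / \<sigma> u"] 1 s t \<nu>2 by simp
          finally show ?thesis .
        qed
      qed
      have r0: "\<bar>r 0\<bar> \<le> G" using G1 t by (simp add: r_def)
      have small: "norm (V.F r (fun_calc \<phi> C v)) \<le> m * ?q * norm v" for v
        unfolding m_def by (rule good_bias[OF good h(1) t h(4) L \<nu>2 K(1) _ K(2)[OF t(1) h(4)] r r0]) (use G1 in simp)
      have large: "norm (V.F r (fun_calc \<phi> C v)) \<le> G * H * norm v" for v
      proof -
        have "norm (V.F r (fun_calc \<phi> C v)) \<le> G * norm (fun_calc \<phi> C v)"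
          proof (rule V.spec_fun_norm_le[where h = r])
          show "\<bar>r (\<sigma> u)\<bar> \<le> G" if "u \<in> U" for u
            using order_trans[OF r[OF that] mult_left_mono[of _ 1 G]] G1 by simp
        qed (rule r0)
        also have "\<dots> \<le> G * (H * norm v)" using G1 by (intro mult_left_mono diag_norm_le[of \<phi>] \<phi>H) auto
        finally show ?thesis by simp
      qed
      have resid: "?A v \<bullet> C (?A v) \<le> ((1 + KB) * (1 + ?d))\<^sup>2 * t * (norm (V.F r (fun_calc \<phi> C v)))\<^sup>2" for v
        unfolding r_def by (rule V.residual_L2) (use t L in simp)
      have d0: "0 \<le> ?d" using ph L by simp
      have M2: "?A v \<bullet> C (?A v) \<le> (mc * (t * ?q\<^sup>2)) * (norm v)\<^sup>2" for v
      proof -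
        have P: "0 \<le> t * ?q\<^sup>2 * (norm v)\<^sup>2" using t by simp
        \<comment> \<open>The comparison constant enters squared beside the bias. If
          \<open>\<phi> t * sqrt L\<close> is at most 1, it is bounded and the sharp bias estimate
          is used. Otherwise the crude one is enough: the square of \<open>\<phi> t * sqrt L\<close>
          already supplies \<open>(\<phi> t)\<^sup>2 * L\<close>, at most twice
          \<open>(\<phi> t * L)\<^sup>2\<close>.\<close>
        show ?thesis
        proof (cases "?d \<le> 1")
          case True
          have "?A v \<bullet> C (?A v) \<le> ((1 + KB) * 2)\<^sup>2 * t * (m * ?q * norm v)\<^sup>2"
            by (rule order_trans[OF resid]) (use True t KB_nonneg d0 small in \<open>intro mult_mono power_mono, auto\<close>)
          also have "\<dots> = 4 * (1 + KB)\<^sup>2 * m\<^sup>2 * (t * ?q\<^sup>2 * (norm v)\<^sup>2)" by (simp add: power_mult_distrib mult_ac del: distrib_left_numeral distrib_right_numeral)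
          also have "\<dots> \<le> mc * (t * ?q\<^sup>2 * (norm v)\<^sup>2)" using P
            by (intro mult_right_mono) (auto simp: mc_def distrib_left)
          finally show ?thesis by (simp add: mult_ac)
        next
          case False
          then have w2: "1 + ?d \<le> 2 * ?d" by linarith
          have "?A v \<bullet> C (?A v) \<le> ((1 + KB) * (2 * ?d))\<^sup>2 * t * (G * H * norm v)\<^sup>2"
            by (rule order_trans[OF resid]) (intro mult_mono power_mono w2 large order_refl, use t KB_nonneg d0 in auto)
          also have "\<dots> = 4 * (1 + KB)\<^sup>2 * (G * H)\<^sup>2 * (t * (norm v)\<^sup>2 * ((\<phi> t)\<^sup>2 * L))" using L by (simp add: power_mult_distrib mult_ac del: distrib_left_numeral distrib_right_numeral)
          also have "\<dots> \<le> 4 * (1 + KB)\<^sup>2 * (G * H)\<^sup>2 * (t * (norm v)\<^sup>2 * ((\<phi> t)\<^sup>2 * (2 * L\<^sup>2)))"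
            by (intro mult_left_mono L_facts(3)[OF good h(1) t h(4) L]) (use t in auto)
          also have "\<dots> = 4 * (1 + KB)\<^sup>2 * (2 * (G * H)\<^sup>2) * (t * ?q\<^sup>2 * (norm v)\<^sup>2)" by (simp add: power_mult_distrib mult_ac del: distrib_left_numeral distrib_right_numeral)
          also have "\<dots> \<le> mc * (t * ?q\<^sup>2 * (norm v)\<^sup>2)" using P
            by (intro mult_right_mono) (auto simp: mc_def distrib_left)
          finally show ?thesis by (simp add: mult_ac)
        qed
      qed
      have M: "norm (?A v) \<le> G * H * norm v" for v
      proof -
        have "\<bar>1 - \<sigma> u * g t (\<sigma> u)\<bar> \<le> G" if u: "u \<in> U" for u
        proof -
          have "\<bar>1 - \<sigma> u * g t (\<sigma> u)\<bar> * 1 \<le> \<bar>r (\<sigma> u)\<bar>"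
            unfolding r_def abs_mult using V.\<sigma>_pos[OF u] t by (intro mult_left_mono) auto
          also have "\<dots> \<le> G * 1" using order_trans[OF r[OF u] mult_left_mono[of _ 1 G]] G1 by simp
          finally show ?thesis by simp
        qed
        then have "norm (?A v) \<le> G * norm (fun_calc \<phi> C v)" by (rule V.spec_fun_norm_le) (use G1 in simp_all)
        also have "\<dots> \<le> G * (H * norm v)" using G1 by (intro mult_left_mono diag_norm_le[of \<phi>] \<phi>H) auto
        finally show ?thesis by simp
      qed
      obtain e where e: "evl e = err n z t" "evl e \<in> borel_measurable borel"
          "sqL2 e \<le> 4 * (mc * (t * ?q\<^sup>2) * h2) + 2 * nc * (t * ?q\<^sup>2)"
        using good_error_element[OF good h(1) t h(4) L _ M M2] G1 H_nonneg unfolding nc_def by auto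
      have "sqL2 e \<le> (4 * mc * h2 + 2 * nc) * (t * ?q\<^sup>2)" using e(3) by (simp add: algebra_simps)
      also have "\<dots> \<le> c2\<^sup>2 * (t * ?q\<^sup>2)" using c2(2) t by (intro mult_right_mono) auto
      also have "\<dots> = (c2 * sqrt t * ?q)\<^sup>2" using t by (simp add: power_mult_distrib)
      finally have "sqrt (sqL2 e) \<le> c2 * sqrt t * ?q" using c2(1) t pL by (intro real_le_lsqrt) auto
      then show ?thesis using e by (auto simp: mult.assoc)
    qed
    then show ?thesis using good_event[OF h(1) t \<delta> h(5,6)] unfolding L_def by meson
  qed
  then show ?thesis using c2(1) by blast
qed

end

section \<open>From the stated hypotheses to the sample setting\<close>

text \<open>Measurability of the kernel sections passes to the span of the features and, by density
  and limits, to every functional; the feature map is then the pointwise limit of its basis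
  expansions.\<close>

lemma feat_borel_measurable:
  fixes feat :: "'x::topological_space \<Rightarrow> 'h::{real_inner,banach,second_countable_topology}" and f :: "nat \<Rightarrow> 'h"
  assumes f: "inj f" "orthonormal_basis (range f)" and total: "\<And>v. (\<And>x. v \<bullet> feat x = 0) \<Longrightarrow> v = 0"
    and sections: "\<And>t. (\<lambda>x. feat t \<bullet> feat x) \<in> borel_measurable borel"
  shows "feat \<in> borel_measurable borel"
proof -
  interpret D: diagonal_op f "\<lambda>_. 1" "\<lambda>v. v" by unfold_locales (use f in auto)
  let ?S = "{a. (\<lambda>x. a \<bullet> feat x) \<in> borel_measurable borel}"
  have "subspace ?S" by (auto simp: subspace_def inner_add_left intro!: borel_measurable_add borel_measurable_times)
  then have span: "span (range feat) \<subseteq> ?S" using sections by (intro span_minimal) auto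
  have "closure (span (range feat)) = UNIV" using total by (intro dense_span_if_orthogonal_trivial) auto
  then have inner: "(\<lambda>x. a \<bullet> feat x) \<in> borel_measurable borel" for a
  proof -
    obtain X where X: "\<And>i. X i \<in> span (range feat)" "X \<longlonglongrightarrow> a"
      using \<open>closure (span (range feat)) = UNIV\<close> closure_sequential[of a "span (range feat)"] by auto
    show ?thesis
    proof (rule borel_measurable_LIMSEQ_metric)
      show "(\<lambda>x. X i \<bullet> feat x) \<in> borel_measurable borel" for i using span X(1) by blast
      show "(\<lambda>i. X i \<bullet> feat x) \<longlonglongrightarrow> a \<bullet> feat x" for x by (intro tendsto_inner X(2) tendsto_const)
    qed
  qed
  show ?thesis
  proof (rule borel_measurable_LIMSEQ_metric)
    show "(\<lambda>x. \<Sum>j<J. (f j \<bullet> feat x) *\<^sub>R f j) \<in> borel_measurable borel" for J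
      using inner by (intro borel_measurable_sum borel_measurable_scaleR) auto
    show "(\<lambda>J. \<Sum>j<J. (f j \<bullet> feat x) *\<^sub>R f j) \<longlonglongrightarrow> feat x" for x
      using has_sum_imp_sums[OF D.f_expand[of "feat x"]] by (simp add: sums_def inner_commute)
  qed
qed

text \<open>Continuity, the value 0 at 0 and unbounded growth give surjectivity onto the half line
  by the intermediate value theorem; strict monotonicity gives injectivity.\<close>

lemma Psi_Psi_inv:
  assumes \<phi>: "index_function \<phi>" and bb: "1 < bb" and y: "0 \<le> y"
  shows "Psi bb \<phi> (Psi_inv bb \<phi> y) = y"
proof -
  let ?e = "1 / 2 + 1 / (2 * bb)"
  have e: "1 / 2 \<le> ?e" using bb by simp
  then have e0: "0 < ?e" by linarith
  have mono: "\<phi> u < \<phi> v" if "0 \<le> u" "u < v" for u v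
    using \<phi> that by (auto simp: index_function_def strict_mono_on_def)
  have \<phi>0: "\<phi> 0 = 0" "continuous_on {0..} \<phi>" using \<phi> by (auto simp: index_function_def)
  have nonneg: "0 \<le> \<phi> u" if "0 \<le> u" for u using mono[of 0 u] \<phi>0 that by (cases "u = 0") auto
  have strict: "Psi bb \<phi> u < Psi bb \<phi> v" if "0 \<le> u" "u < v" for u v
    unfolding Psi_def using powr_less_mono2[OF e0 that] mono[OF that] nonneg[OF that(1)]
    by (intro mult_strict_mono') auto
  then have inj: "inj_on (Psi bb \<phi>) {0..}"
    by (intro linorder_inj_onI) (fastforce dest: strict)+
  have cont: "continuous_on {0..} (Psi bb \<phi>)"
    unfolding Psi_def[abs_def] using e0 \<phi>0
    by (intro continuous_on_mult continuous_on_powr' continuous_on_id continuous_on_const) auto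
  have \<phi>1: "0 < \<phi> 1" using mono[of 0 1] \<phi>0 by simp
  \<comment> \<open>Large enough because the exponent in Psi is at least 1/2, so that Psi at x is at
    least \<open>sqrt x * \<phi> 1\<close>.\<close>
  define x where "x = max 1 ((y / \<phi> 1)\<^sup>2)"
  have x: "1 \<le> x" "(y / \<phi> 1)\<^sup>2 \<le> x" by (auto simp: x_def)
  have "y / \<phi> 1 \<le> sqrt x" using x(2) by (rule real_le_rsqrt)
  also have "\<dots> = x powr (1 / 2)" using x(1) by (simp add: powr_half_sqrt)
  also have "\<dots> \<le> x powr ?e" using e x(1) by (rule powr_mono)
  finally have "y \<le> x powr ?e * \<phi> 1" using \<phi>1 by (simp only: pos_divide_le_eq)
  also have "\<dots> \<le> Psi bb \<phi> x"
    unfolding Psi_def using mono[of 1 x] x(1) by (cases "x = 1") (auto intro!: mult_left_mono)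
  finally have "\<exists>u\<ge>0. u \<le> x \<and> Psi bb \<phi> u = y"
    using y x(1) cont by (intro IVT') (auto simp: Psi_def \<phi>0 intro: continuous_on_subset)
  then have "y \<in> Psi bb \<phi> ` {0..}" by auto
  then show ?thesis unfolding Psi_inv_def by (rule f_the_inv_into_f[OF inj])
qed

text \<open>The constants are fixed before n, \<delta> and lam. High probability is expressed by a
  measurable set contained in the good samples, since for an arbitrary filter the set of good
  samples may fail to be measurable. Membership of the error in the range of \<open>evG\<close> and
  in the square-integrable functions is part of the claim, because the two norms are meaningful only
  there.\<close>

theorem theorem18:
  fixes k :: "'x::{second_countable_topology, t2_space} \<Rightarrow> 'x \<Rightarrow> real"
    and evH :: "'h::{real_inner, banach, second_countable_topology} \<Rightarrow> 'x \<Rightarrow> real"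
    and feat :: "'x \<Rightarrow> 'h"
    and evG :: "'g::{real_inner, banach} \<Rightarrow> 'x \<Rightarrow> 'y::{real_inner, banach, second_countable_topology}"
    and p q :: "('x \<times> 'y) measure"
    and pX qX :: "'x measure"
    and P :: "'x \<Rightarrow> 'y measure"
    and \<beta> :: "'x \<Rightarrow> real"
    and Cstar Co :: "'h \<Rightarrow> 'y"
    and \<phi> :: "real \<Rightarrow> real"
    and \<mu> :: "nat \<Rightarrow> real" and f :: "nat \<Rightarrow> 'h"
    and g :: "real \<Rightarrow> real \<Rightarrow> real"
    and \<kappa> b M' bb s B D \<gamma> \<nu> :: real
  assumes locally_compact_X: "locally compact (UNIV :: 'x set)"
    and infinite_dim_Y: "\<nexists>S :: 'y set. finite S \<and> span S = UNIV"
    and rkhs_H: "scalar_rkhs k evH feat"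
    and kernel_measurable: "\<And>x. k x \<in> borel_measurable borel"
    and rkhs_G: "vector_rkhs (\<lambda>x t y. k x t *\<^sub>R y) evG"
    and pX: "prob_space pX" "sets pX = sets borel"
    and qX: "prob_space qX" "sets qX = sets borel"
    and cond_law: "P \<in> borel \<rightarrow>\<^sub>M prob_algebra borel"
    and p: "p = joint_law pX P"
    and q: "q = joint_law qX P"
    and family: "regularization_family s g B D \<gamma>"
    and qualification: "qualification s g \<nu>"
    and kernel_bounded: "\<And>x. k x x \<le> \<kappa>\<^sup>2"
    and weight_measurable: "\<beta> \<in> borel_measurable borel"
    and weight: "qX = density pX (\<lambda>x. ennreal (\<beta> x))"
    and weight_bounded: "\<And>x. 0 \<le> \<beta> x" "\<And>x. \<beta> x \<le> b" "0 < b"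
    and output_bounded: "0 < M'" "AE xy in p. norm (snd xy) \<le> M'"
    and source: "\<And>x. regression_fun P x = Cstar (feat x)"
      "Cstar = Co \<circ> fun_calc \<phi> (cov_op qX feat)" "hilbert_schmidt Co" "index_function \<phi>"
    and eigenpairs: "\<And>i. 0 < \<mu> i" "\<And>i. cov_op qX feat (f i) = \<mu> i *\<^sub>R f i"
    and eigenbasis: "inj f" "orthonormal_basis (range f)"
    and eigenvalue_decay: "1 < bb"
      "\<exists>a>0. \<exists>a'>0. \<forall>i. a * real (Suc i) powr (- bb) \<le> \<mu> i \<and> \<mu> i \<le> a' * real (Suc i) powr (- bb)"
  shows
    "(covers s \<nu> \<phi> \<longrightarrow>
       (\<exists>c1>0. \<forall>n \<delta> lam. 0 < n \<and> \<delta> \<in> {0<..<1} \<and> lam \<in> {0<..1} \<and> lam \<le> s \<and>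
          lam = Psi_inv bb \<phi> (real n powr (- 1 / 2)) \<and>
          (AE z in (\<Pi>\<^sub>M i\<in>{..<n}. p). spectrum (emp_cov \<beta> feat n z) \<subseteq> {0..s}) \<longrightarrow>
          (\<exists>A \<in> sets (\<Pi>\<^sub>M i\<in>{..<n}. p). measure (\<Pi>\<^sub>M i\<in>{..<n}. p) A \<ge> 1 - \<delta> \<and>
             (\<forall>z\<in>A. (\<lambda>x. regression_fun P x - estimator \<beta> feat g n z lam x) \<in> range evG \<and>
                rkhs_norm evG (\<lambda>x. regression_fun P x - estimator \<beta> feat g n z lam x)
                  \<le> c1 * \<phi> (Psi_inv bb \<phi> (real n powr (- 1 / 2))) * ln (2 / \<delta>))))) \<and>
     (covers s \<nu> (\<lambda>t. \<phi> t * sqrt t) \<longrightarrow>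
       (\<exists>c2>0. \<forall>n \<delta> lam. 0 < n \<and> \<delta> \<in> {0<..<1} \<and> lam \<in> {0<..1} \<and> lam \<le> s \<and>
          lam = Psi_inv bb \<phi> (real n powr (- 1 / 2)) \<and>
          (AE z in (\<Pi>\<^sub>M i\<in>{..<n}. p). spectrum (emp_cov \<beta> feat n z) \<subseteq> {0..s}) \<longrightarrow>
          (\<exists>A \<in> sets (\<Pi>\<^sub>M i\<in>{..<n}. p). measure (\<Pi>\<^sub>M i\<in>{..<n}. p) A \<ge> 1 - \<delta> \<and>
             (\<forall>z\<in>A. (\<lambda>x. regression_fun P x - estimator \<beta> feat g n z lam x) \<in> L2_functions qX \<and>
                L2_norm qX (\<lambda>x. regression_fun P x - estimator \<beta> feat g n z lam x)
                  \<le> c2 * (Psi_inv bb \<phi> (real n powr (- 1 / 2))) powr (1 / 2)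
                       * \<phi> (Psi_inv bb \<phi> (real n powr (- 1 / 2))) * ln (2 / \<delta>)))))"
proof (cases "0 < s")
  case False
  \<comment> \<open>Without a positive s there is no admissible lam, and any constant will
    do.\<close>
  have "\<not> (lam \<in> {0<..1} \<and> lam \<le> s)" for lam :: real using False by simp
  then show ?thesis by (intro conjI impI exI[of _ 1]) auto
next
  case s: True
  have ev: "evH h x = h \<bullet> feat x" "evH (feat x) = k x" "inj evH" for h x
    using rkhs_H by (auto simp: scalar_rkhs_def)
  have k: "k x t = feat x \<bullet> feat t" for x t
    using ev(1)[of "feat x" t] ev(2)[of x] by simp
  have total: "v = 0" if "\<And>x. v \<bullet> feat x = 0" for v
    using that by (intro injD[OF ev(3)]) (simp add: fun_eq_iff ev(1))
  have feat_m: "feat \<in> borel_measurable borel"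
    proof (rule feat_borel_measurable[OF eigenbasis])
    show "v = 0" if "\<And>x. v \<bullet> feat x = 0" for v using that by (rule total)
    show "(\<lambda>x. feat t \<bullet> feat x) \<in> borel_measurable borel" for t
      unfolding k[symmetric] by (rule kernel_measurable)
  qed
  \<comment> \<open>The absolute value appears because the kernel bound leaves the sign of \<kappa>
    open.\<close>
  have feat_le: "norm (feat x) \<le> \<bar>\<kappa>\<bar>" for x
    by (rule power2_le_imp_le) (use kernel_bounded[of x] in \<open>simp_all add: k power2_norm_eq_inner\<close>)
  have rkhs_G': "vector_rkhs (\<lambda>x t y. (feat x \<bullet> feat t) *\<^sub>R y) evG"
    using rkhs_G by (simp add: k)
  interpret Q: rkhs_population evG feat qX "\<bar>\<kappa>\<bar>"
  proof (intro rkhs_population.intro tensor_rkhs.intro rkhs_population_axioms.intro)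
    show "v = 0" if "\<And>x. v \<bullet> feat x = 0" for v using that by (rule total)
  qed (fact rkhs_G' qX feat_m feat_le)+
  interpret D: diagonal_op f \<mu> "cov_op qX feat"
  proof
    show "cov_op qX feat w \<bullet> f j = \<mu> j * (w \<bullet> f j)" for w j
      unfolding Q.cov_op_sym[symmetric] eigenpairs(2) by simp
  qed (fact eigenbasis eigenpairs)+
  obtain a' where a': "0 < a'" "\<And>i. \<mu> i \<le> a' * real (Suc i) powr (- bb)"
    using eigenvalue_decay(2) by blast
  \<comment> \<open>A bound for \<phi> on the eigenvalues makes \<phi>(C) a bounded operator, and
    hence Cstar bounded, which the sample setting requires.\<close>
  have \<phi>_bound: "\<bar>\<phi> (\<mu> j)\<bar> \<le> \<phi> a'" for j
  proof -
    have "real (Suc j) powr (- bb) \<le> 1" using powr_mono2'[of "- bb" 1 "real (Suc j)"] eigenvalue_decay(1) by simp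
    then have "a' * real (Suc j) powr (- bb) \<le> a' * 1" using a'(1) by (intro mult_left_mono) auto
    then have "\<mu> j \<le> a'" using a'(2)[of j] by linarith
    moreover have "\<phi> u \<le> \<phi> v" if "0 \<le> u" "u \<le> v" for u v
      using source(4) that by (cases "u = v") (auto simp: index_function_def strict_mono_on_def less_imp_le)
    ultimately have "\<phi> (\<mu> j) \<le> \<phi> a'" "\<phi> 0 \<le> \<phi> (\<mu> j)" using eigenpairs(1)[of j] by auto
    then show ?thesis using source(4) by (simp add: index_function_def)
  qed
  have calc: "bounded_linear (fun_calc \<phi> (cov_op qX feat))"
    using D.diag_norm_le[of \<phi>, OF \<phi>_bound] D.diag_linear[of \<phi>, OF \<phi>_bound]
    by (intro bounded_linear_intro[where K = "\<phi> a'"]) (auto simp: mult.commute)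
  obtain E where Co: "bounded_linear Co" "orthonormal_basis E" "(\<lambda>e. (norm (Co e))\<^sup>2) summable_on E"
    using source(3) unfolding hilbert_schmidt_def by blast
  have Cstar: "bounded_linear Cstar"
    unfolding source(2) comp_def by (rule bounded_linear_compose[OF Co(1) calc])
  have regr: "(\<integral>y. y \<partial>P x) = Cstar (feat x)" for x using source(1)[of x] by (simp add: regression_fun_def)
  have pj: "joint_law pX P = p" by (rule p[symmetric])
  have out: "AE xy in joint_law pX P. norm (snd xy) \<le> M'" unfolding pj by (rule output_bounded(2))
  interpret R: spectral_regularization evG feat qX "\<bar>\<kappa>\<bar>" f \<mu> pX P \<beta> b M' bb a' Cstar Co \<phi> E s g B D \<gamma>
    by (intro spectral_regularization.intro covariate_shift.intro covariate_shift_axioms.intro spectral_regularization_axioms.intro)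
      (fact Q.rkhs_population_axioms D.diagonal_op_axioms pX cond_law weight_measurable weight_bounded weight Cstar regr output_bounded(1) out
        eigenvalue_decay(1) a' source(2) Co source(4) family s)+
  have err: "(\<lambda>x. regression_fun P x - estimator \<beta> feat g n z lam x) = R.err n z lam" for n z lam
    by (simp add: source(1) estimator_def)
  have Psi: "Psi bb \<phi> (Psi_inv bb \<phi> (real n powr (- 1 / 2))) = real n powr (- 1 / 2)" for n
    by (rule Psi_Psi_inv[OF source(4) eigenvalue_decay(1)]) simp
  have qual: "qualification_at_least s g \<nu>" using qualification by (simp add: qualification_def)
  show ?thesis
  proof (intro conjI impI, goal_cases)
    case 1
    obtain c1 where c1: "0 < c1" "\<And>n (\<delta>::real) t. 0 < n \<and> \<delta> \<in> {0<..<1} \<and> t \<in> {0<..1} \<and> t \<le> s \<and> Psi bb \<phi> t = real n powr (- 1 / 2) \<and>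
      (AE z in PiM {..<n} (\<lambda>_. p). spectrum (emp_cov \<beta> feat n z) \<subseteq> {0..s}) \<Longrightarrow>
      \<exists>A\<in>sets (PiM {..<n} (\<lambda>_. p)). 1 - \<delta> \<le> measure (PiM {..<n} (\<lambda>_. p)) A \<and>
        (\<forall>z\<in>A. \<exists>e. evG e = R.err n z t \<and> norm e \<le> c1 * \<phi> t * ln (2 / \<delta>))"
      using R.rate_norm[OF 1 qual, unfolded pj] by blast
    show ?case
    proof (intro exI[of _ c1] conjI allI impI c1(1), elim conjE)
      fix n :: nat and \<delta> lam :: real
      assume h: "0 < n" "\<delta> \<in> {0<..<1}" "lam \<in> {0<..1}" "lam \<le> s" "lam = Psi_inv bb \<phi> (real n powr (- 1 / 2))"
        "AE z in PiM {..<n} (\<lambda>_. p). spectrum (emp_cov \<beta> feat n z) \<subseteq> {0..s}"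
      obtain A where A: "A \<in> sets (PiM {..<n} (\<lambda>_. p))" "1 - \<delta> \<le> measure (PiM {..<n} (\<lambda>_. p)) A"
        "\<And>z. z \<in> A \<Longrightarrow> \<exists>e. evG e = R.err n z lam \<and> norm e \<le> c1 * \<phi> lam * ln (2 / \<delta>)"
        using c1(2)[of n \<delta> lam] h Psi[of n] by blast
      have "R.err n z lam \<in> range evG \<and> rkhs_norm evG (R.err n z lam) \<le> c1 * \<phi> lam * ln (2 / \<delta>)" if z: "z \<in> A" for z
      proof -
        obtain e where e: "evG e = R.err n z lam" "norm e \<le> c1 * \<phi> lam * ln (2 / \<delta>)" using A(3)[OF z] by blast
        have "rkhs_norm evG (evG e) = norm e" by (simp add: rkhs_norm_def the_inv_f_f Q.ev_inj)
        then show ?thesis using e(2) unfolding e(1)[symmetric] by simp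
      qed
      then show "\<exists>A\<in>sets (PiM {..<n} (\<lambda>i. p)). 1 - \<delta> \<le> measure (PiM {..<n} (\<lambda>i. p)) A \<and>
             (\<forall>z\<in>A. (\<lambda>x. regression_fun P x - estimator \<beta> feat g n z lam x) \<in> range evG \<and>
                rkhs_norm evG (\<lambda>x. regression_fun P x - estimator \<beta> feat g n z lam x)
                  \<le> c1 * \<phi> (Psi_inv bb \<phi> (real n powr (- 1 / 2))) * ln (2 / \<delta>))"
        unfolding err h(5)[symmetric] using A(1,2) by blast
    qed
  next
    case 2
    obtain c2 where c2: "0 < c2" "\<And>n (\<delta>::real) t. 0 < n \<and> \<delta> \<in> {0<..<1} \<and> t \<in> {0<..1} \<and> t \<le> s \<and> Psi bb \<phi> t = real n powr (- 1 / 2) \<and>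
      (AE z in PiM {..<n} (\<lambda>_. p). spectrum (emp_cov \<beta> feat n z) \<subseteq> {0..s}) \<Longrightarrow>
      \<exists>A\<in>sets (PiM {..<n} (\<lambda>_. p)). 1 - \<delta> \<le> measure (PiM {..<n} (\<lambda>_. p)) A \<and>
        (\<forall>z\<in>A. \<exists>e. evG e = R.err n z t \<and> evG e \<in> borel_measurable borel \<and> sqrt (Q.sqL2 e) \<le> c2 * sqrt t * \<phi> t * ln (2 / \<delta>))"
      using R.rate_L2[OF 2 qual, unfolded pj] by blast
    show ?case
    proof (intro exI[of _ c2] conjI allI impI c2(1), elim conjE)
      fix n :: nat and \<delta> lam :: real
      assume h: "0 < n" "\<delta> \<in> {0<..<1}" "lam \<in> {0<..1}" "lam \<le> s" "lam = Psi_inv bb \<phi> (real n powr (- 1 / 2))"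
        "AE z in PiM {..<n} (\<lambda>_. p). spectrum (emp_cov \<beta> feat n z) \<subseteq> {0..s}"
      obtain A where A: "A \<in> sets (PiM {..<n} (\<lambda>_. p))" "1 - \<delta> \<le> measure (PiM {..<n} (\<lambda>_. p)) A"
        "\<And>z. z \<in> A \<Longrightarrow> \<exists>e. evG e = R.err n z lam \<and> evG e \<in> borel_measurable borel \<and> sqrt (Q.sqL2 e) \<le> c2 * sqrt lam * \<phi> lam * ln (2 / \<delta>)"
        using c2(2)[of n \<delta> lam] h Psi[of n] by blast
      have "R.err n z lam \<in> L2_functions qX \<and> L2_norm qX (R.err n z lam) \<le> c2 * lam powr (1 / 2) * \<phi> lam * ln (2 / \<delta>)" if z: "z \<in> A" for z
      proof -
        obtain e where e: "evG e = R.err n z lam" "evG e \<in> borel_measurable borel" "sqrt (Q.sqL2 e) \<le> c2 * sqrt lam * \<phi> lam * ln (2 / \<delta>)"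
          using A(3)[OF z] by blast
        have "L2_norm qX (evG e) = sqrt (Q.sqL2 e)" by (simp add: L2_norm_def Q.sqL2_def)
        moreover have "evG e \<in> L2_functions qX"
          using Q.measurable_qX[OF e(2)] Q.sqL2_integrable[OF e(2)] by (simp add: L2_functions_def)
        ultimately show ?thesis using e(3) h(3) unfolding e(1)[symmetric] by (simp add: powr_half_sqrt)
      qed
      then show "\<exists>A\<in>sets (PiM {..<n} (\<lambda>i. p)). 1 - \<delta> \<le> measure (PiM {..<n} (\<lambda>i. p)) A \<and>
             (\<forall>z\<in>A. (\<lambda>x. regression_fun P x - estimator \<beta> feat g n z lam x) \<in> L2_functions qX \<and>
                L2_norm qX (\<lambda>x. regression_fun P x - estimator \<beta> feat g n z lam x)
                  \<le> c2 * (Psi_inv bb \<phi> (real n powr (- 1 / 2))) powr (1 / 2)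
                       * \<phi> (Psi_inv bb \<phi> (real n powr (- 1 / 2))) * ln (2 / \<delta>))"
        unfolding err h(5)[symmetric] using A(1,2) by blast
    qed
  qed
qed

end
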